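(* Fix $d\ge2$ and suppose $f,g\in\mathcal{C}^{1+}$. Then $(f,h_f)\sim_T(g,h_g)$ if and only if $D^{*}(f)=D^{*}(g)$. Furthermore, for $\Pi,\Pi'\in\mathcal{T}\mathcal{C}^{1+}$, $d_{\mathcal{T}}(\Pi,\Pi')=0$ if and only if $\Pi=\Pi'$.
   Context: $T$ is the unit circle. A circle endomorphism is an orientation-preserving covering map $f:T\to T$ of degree $d\ge2$ with $f(1)=1$; its lift is the homeomorphism $F:\mathbb{R}\to\mathbb{R}$ with $F(0)=0$, $F(x+1)=F(x)+d$ and $e^{2\pi i F(x)}=f(e^{2\pi i x})$. $f$ is $C^{1+\alpha}$ ($0<\alpha\le1$) if $F'$ is $\alpha$-Hölder, and expanding if $(F^n)'(x)\ge C\lambda^n$ for all $x\in\mathbb R$, $n\ge1$, for some $C>0,\lambda>1$. $\mathcal{C}^{1+}$ is the space of all circle endomorphisms of degree $d$ that are $C^{1+\alpha}$ expanding for some $0<\alpha\le1$. Let $q_d(z)=z^d$. For $f\in\mathcal{C}^{1+}$, $h_f$ is the (unique) orientation-preserving homeomorphism of $T$ with $h_f(1)=1$ and $f\circ h_f=h_f\circ q_d$; it is quasisymmetric. The pair $(f,h_f)$ is a marked $C^{1+}$ circle endomorphism. $(f,h_f)\sim_T(g,h_g)$ means that $h_f\circ h_g^{-1}$ is a $C^1$-diffeomorphism of $T$. $\mathcal{T}\mathcal{C}^{1+}$ is the set of equivalence classes $[(f,h_f)]$. For a quasisymmetric orientation-preserving homeomorphism $h$ of $T$, its boundary dilatation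 is $B_h=\inf\frac{1+k}{1-k}$, the infimum over all quasiconformal extensions $\tilde h$ of $h$ to neighborhoods $U$ of $T$ in $\mathbb{C}$, where $k=\|\tilde h_{\bar z}/\tilde h_z\|_{\infty,U}$. For $\Pi=[(f,h_f)]$, $\Pi'=[(g,h_g)]$ put $d_{\mathcal{T}}(\Pi,\Pi')=\frac12\log B_{h_f\circ h_g^{-1}}$. Dual derivative: for a word $w_n=i_0\cdots i_{n-1}$ in digits $\{0,\dots,d-1\}$ let $I_{w_n}=F^{-n}([m,m+1])\subset[0,1]$, $m=i_{n-1}+i_{n-2}d+\cdots+i_0d^{n-1}$. $\Sigma^{*}$ is the space of left-infinite sequences $w^{*}=\cdots j_{n-1}\cdots j_1j_0$ with digits in $\{0,\dots,d-1\}$. The dual derivative is $D^{*}(f)(w^{*})=\lim_{n\to\infty}|I_{v_{n-1}}|/|I_{w_n}|$, where $w_n=j_{n-1}\cdots j_1j_0$ and $v_{n-1}=j_{n-1}\cdots j_1$ read left to right as words; the limit exists for all $w^*$ when $f\in\mathcal{C}^{1+}$. *)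

theory Defs
  imports "HOL-Analysis.Analysis"
begin

abbreviation circle :: "complex set" where
  "circle \<equiv> sphere 0 1"

definition circle_lift :: "int \<Rightarrow> (complex \<Rightarrow> complex) \<Rightarrow> (real \<Rightarrow> real) \<Rightarrow> bool" where
  "circle_lift d f F \<longleftrightarrow>
     (\<exists>G. homeomorphism UNIV UNIV F G) \<and>
     (\<forall>x. F (x + 1) = F x + of_int d) \<and>
     (\<forall>x. f (cis (2 * pi * x)) = cis (2 * pi * F x))"

text \<open>
  Self-maps of the circle are functions that are extensional on the circle, so that equality
  of functions is equality of circle maps.  A lift in the above sense is a homeomorphism of the
  line, and for \<open>d \<ge> 1\<close> the equation \<open>F (x + 1) = F x + d\<close> makes it increasing; its
  existence therefore says that the map preserves orientation and has degree \<open>d\<close>.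
\<close>

definition circle_endomorphism :: "nat \<Rightarrow> (complex \<Rightarrow> complex) \<Rightarrow> bool" where
  "circle_endomorphism d f \<longleftrightarrow>
     f \<in> extensional circle \<and> covering_space circle f circle \<and> f 1 = 1 \<and>
     (\<exists>F. circle_lift (int d) f F)"

definition lift_of :: "nat \<Rightarrow> (complex \<Rightarrow> complex) \<Rightarrow> real \<Rightarrow> real" where
  "lift_of d f = (THE F. circle_lift (int d) f F \<and> F 0 = 0)"

definition C1_Holder :: "real \<Rightarrow> (real \<Rightarrow> real) \<Rightarrow> bool" where
  "C1_Holder \<alpha> F \<longleftrightarrow>
     (\<forall>x. F differentiable at x) \<and>
     (\<exists>L. \<forall>x y. \<bar>deriv F x - deriv F y\<bar> \<le> L * \<bar>x - y\<bar> powr \<alpha>)"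

definition expanding :: "(real \<Rightarrow> real) \<Rightarrow> bool" where
  "expanding F \<longleftrightarrow>
     (\<exists>C r. C > 0 \<and> r > 1 \<and> (\<forall>n\<ge>1. \<forall>x. deriv (F ^^ n) x \<ge> C * r ^ n))"

definition C1plus :: "nat \<Rightarrow> (complex \<Rightarrow> complex) set" where
  "C1plus d = {f. circle_endomorphism d f \<and>
     (\<exists>\<alpha>. 0 < \<alpha> \<and> \<alpha> \<le> 1 \<and> C1_Holder \<alpha> (lift_of d f)) \<and> expanding (lift_of d f)}"

definition oriented_circle_homeo :: "(complex \<Rightarrow> complex) \<Rightarrow> bool" where
  "oriented_circle_homeo h \<longleftrightarrow>
     h \<in> extensional circle \<and> (\<exists>k. homeomorphism circle circle h k) \<and>
     (\<exists>H. circle_lift 1 h H)"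

definition marking :: "nat \<Rightarrow> (complex \<Rightarrow> complex) \<Rightarrow> complex \<Rightarrow> complex" where
  "marking d f =
     (THE h. oriented_circle_homeo h \<and> h 1 = 1 \<and> (\<forall>z\<in>circle. f (h z) = h (z ^ d)))"

type_synonym marked_map = "(complex \<Rightarrow> complex) \<times> (complex \<Rightarrow> complex)"

definition marked_maps :: "nat \<Rightarrow> marked_map set" where
  "marked_maps d = {(f, marking d f) | f. f \<in> C1plus d}"

definition C1_circle_map :: "(complex \<Rightarrow> complex) \<Rightarrow> bool" where
  "C1_circle_map \<phi> \<longleftrightarrow>
     \<phi> ` circle \<subseteq> circle \<and> (\<lambda>x. \<phi> (cis (2 * pi * x))) C1_differentiable_on UNIV"

definition C1_circle_diffeo :: "(complex \<Rightarrow> complex) \<Rightarrow> bool" where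
  "C1_circle_diffeo \<phi> \<longleftrightarrow>
     bij_betw \<phi> circle circle \<and> C1_circle_map \<phi> \<and> C1_circle_map (inv_into circle \<phi>)"

definition transition :: "marked_map \<Rightarrow> marked_map \<Rightarrow> complex \<Rightarrow> complex" where
  "transition p q = compose circle (snd p) (inv_into circle (snd q))"

definition teich_equiv :: "marked_map \<Rightarrow> marked_map \<Rightarrow> bool" where
  "teich_equiv p q \<longleftrightarrow> C1_circle_diffeo (transition p q)"

definition TC1plus :: "nat \<Rightarrow> marked_map set set" where
  "TC1plus d =
     marked_maps d // {(p, q). p \<in> marked_maps d \<and> q \<in> marked_maps d \<and> teich_equiv p q}"

definition abs_cont_on :: "real \<Rightarrow> real \<Rightarrow> (real \<Rightarrow> complex) \<Rightarrow> bool" where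
  "abs_cont_on a b u \<longleftrightarrow>
     (\<forall>\<epsilon>>0. \<exists>\<delta>>0. \<forall>D. D division_of \<Union>D \<and> \<Union>D \<subseteq> {a..b} \<and>
        (\<Sum>K\<in>D. Sup K - Inf K) < \<delta> \<longrightarrow> (\<Sum>K\<in>D. norm (u (Sup K) - u (Inf K))) < \<epsilon>)"

definition ACL_on :: "complex set \<Rightarrow> (complex \<Rightarrow> complex) \<Rightarrow> bool" where
  "ACL_on U h \<longleftrightarrow>
     (\<forall>a b c e. a < b \<and> c < e \<and> cbox (Complex a c) (Complex b e) \<subseteq> U \<longrightarrow>
        (AE y in lborel. y \<in> {c..e} \<longrightarrow> abs_cont_on a b (\<lambda>x. h (Complex x y))) \<and>
        (AE x in lborel. x \<in> {a..b} \<longrightarrow> abs_cont_on c e (\<lambda>y. h (Complex x y))))"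

definition partial_x :: "(complex \<Rightarrow> complex) \<Rightarrow> complex \<Rightarrow> complex" where
  "partial_x h z = vector_derivative (\<lambda>t. h (z + of_real t)) (at 0)"

definition partial_y :: "(complex \<Rightarrow> complex) \<Rightarrow> complex \<Rightarrow> complex" where
  "partial_y h z = vector_derivative (\<lambda>t. h (z + \<i> * of_real t)) (at 0)"

definition d_z :: "(complex \<Rightarrow> complex) \<Rightarrow> complex \<Rightarrow> complex" where
  "d_z h z = (partial_x h z - \<i> * partial_y h z) / 2"

definition d_zbar :: "(complex \<Rightarrow> complex) \<Rightarrow> complex \<Rightarrow> complex" where
  "d_zbar h z = (partial_x h z + \<i> * partial_y h z) / 2"

text \<open>
  The essential bounds of \<open>d_zbar h / d_z h\<close> are written without the quotient, because division
  by zero would hide points with \<open>d_z h z = 0 \<noteq> d_zbar h z\<close>.  The partial derivatives exist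
  almost everywhere on \<open>U\<close> when \<open>h\<close> is ACL there.
\<close>

definition beltrami_bounds :: "complex set \<Rightarrow> (complex \<Rightarrow> complex) \<Rightarrow> real set" where
  "beltrami_bounds U h =
     {k. 0 \<le> k \<and> (AE z in lborel. z \<in> U \<longrightarrow> norm (d_zbar h z) \<le> k * norm (d_z h z))}"

definition beltrami_norm :: "complex set \<Rightarrow> (complex \<Rightarrow> complex) \<Rightarrow> real" where
  "beltrami_norm U h = Inf (beltrami_bounds U h)"

text \<open>
  Analytic definition of quasiconformality.  Preservation of orientation is not a separate
  clause: an essential bound below 1 makes the Jacobian nonnegative almost everywhere, which
  an orientation-reversing ACL homeomorphism cannot satisfy.
\<close>

definition quasiconformal_on :: "complex set \<Rightarrow> (complex \<Rightarrow> complex) \<Rightarrow> bool" where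
  "quasiconformal_on U h \<longleftrightarrow>
     (\<exists>k. homeomorphism U (h ` U) h k) \<and> ACL_on U h \<and> (\<exists>k\<in>beltrami_bounds U h. k < 1)"

text \<open>
  Taken in the extended reals, so that the infimum over an empty set of extensions is \<open>\<infinity>\<close>;
  for quasisymmetric \<open>h\<close> the value is finite.
\<close>

definition boundary_dilatation :: "(complex \<Rightarrow> complex) \<Rightarrow> ereal" where
  "boundary_dilatation h =
     Inf {ereal ((1 + k) / (1 - k)) | U h' k.
            open U \<and> circle \<subseteq> U \<and> quasiconformal_on U h' \<and> (\<forall>z\<in>circle. h' z = h z) \<and>
            k = beltrami_norm U h'}"

definition half_log :: "ereal \<Rightarrow> ereal" where
  "half_log B = (if B = \<infinity> then \<infinity> else ereal (ln (real_of_ereal B) / 2))"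

text \<open>
  The boundary dilatation of the transition map is unchanged under composition with
  \<open>C\<^sup>1\<close>-diffeomorphisms, so the distance does not depend on the representatives chosen.
\<close>

definition teich_dist :: "marked_map set \<Rightarrow> marked_map set \<Rightarrow> ereal" where
  "teich_dist P Q =
     half_log (boundary_dilatation (transition (SOME p. p \<in> P) (SOME q. q \<in> Q)))"

text \<open>A finite word \<open>i\<^sub>0 \<cdots> i\<^sub>n\<^sub>-\<^sub>1\<close> is the list with \<open>i\<^sub>0\<close> at its head.\<close>

definition word_value :: "nat \<Rightarrow> nat list \<Rightarrow> nat" where
  "word_value d w = (\<Sum>k<length w. w ! k * d ^ (length w - 1 - k))"

definition word_interval :: "nat \<Rightarrow> (complex \<Rightarrow> complex) \<Rightarrow> nat list \<Rightarrow> real set" where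
  "word_interval d f w =
     (lift_of d f ^^ length w) -` {real (word_value d w)..real (word_value d w) + 1}"

text \<open>
  A left-infinite sequence \<open>\<cdots> j\<^sub>1 j\<^sub>0\<close> is the function \<open>k \<mapsto> j\<^sub>k\<close>; \<open>dual_word j m n\<close> is the
  word \<open>j\<^sub>n\<^sub>-\<^sub>1 \<cdots> j\<^sub>m\<close>.
\<close>

definition dual_sequences :: "nat \<Rightarrow> (nat \<Rightarrow> nat) set" where
  "dual_sequences d = {j. \<forall>k. j k < d}"

definition dual_word :: "(nat \<Rightarrow> nat) \<Rightarrow> nat \<Rightarrow> nat \<Rightarrow> nat list" where
  "dual_word j m n = map j (rev [m..<n])"

definition dual_derivative :: "nat \<Rightarrow> (complex \<Rightarrow> complex) \<Rightarrow> (nat \<Rightarrow> nat) \<Rightarrow> real" where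
  "dual_derivative d f =
     (\<lambda>j\<in>dual_sequences d.
        lim (\<lambda>n. measure lborel (word_interval d f (dual_word j 1 n)) /
                 measure lborel (word_interval d f (dual_word j 0 n))))"

end

theory Submission
  imports Defs
begin

text \<open>
  Let \<open>F\<close> be the lift of \<open>f\<close> and \<open>H\<close> the lift of its marking, so that \<open>F (H t) = H (d t)\<close>.  The
  interval of a word of length \<open>n\<close> and value \<open>m\<close> has length \<open>len n m = H ((m + 1) / d ^ n) - H (m / d ^ n)\<close>,
  and bounded distortion makes its ratio to the parent interval converge exponentially fast along
  left-infinite sequences; the limit is the reciprocal of the dual derivative.  If the dual derivatives of
  \<open>f\<close> and \<open>g\<close> agree, the quotients of corresponding lengths therefore converge exponentially fast along
  nested intervals, uniformly and also across neighbours, and the transition map is \<open>C\<^sup>1\<close> with positive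
  derivative.  Conversely, it suffices that these quotients are bounded: they form a martingale, and
  below a word with nearly maximal quotient the ratios of \<open>f\<close> and \<open>g\<close> nearly agree.

  Quotients are bounded for a \<open>C\<^sup>1\<close> transition map.  They are also bounded when the boundary dilatation
  is 1: a quasiconformal extension with dilatation near 1 satisfies at every boundary point a
  one-sided Hoelder estimate with exponent near 1, by a length-area argument, and at the
  periodic points such estimates compare the multipliers of \<open>f\<close> and \<open>g\<close> and hence the lengths.
  In the other direction, a \<open>C\<^sup>1\<close>-diffeomorphism with lift \<open>\<Phi>\<close> is extended, in the coordinate \<open>x + i y\<close> of
  \<open>exp (2 \<pi> i (x + i y))\<close>, by \<open>(\<Phi> (x + y) + \<Phi> (x - y)) / 2 + i (\<Phi> (x + y) - \<Phi> (x - y)) / 2\<close>, whose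
  Beltrami coefficient tends to 0 at the circle.
\<close>

subsection \<open>Absolutely continuous functions\<close>

text \<open>Small dilatation yields, for each exponent below 1, a Hoelder estimate with uncontrolled
  constants. Applied at the scales d^(-nj) around one periodic point with j tending to infinity, it
  sheds the constants; letting the exponent tend to 1 then compares the multipliers exactly. A
  multiplier determines the length of its word interval up to a factor independent of the word, so
  one inequality between multipliers bounds the quotients, and the martingale argument asks for no
  more. The obstacle is that quasiconformality is given analytically: absolute continuity is known
  on almost every horizontal and vertical line, not on the circles on which the length-area method
  is usually run. The estimate is therefore put in dual form: an angular vector field around the
  boundary point is paired with a function composed with the extension, and integration by parts
  uses only the axis-parallel lines of a box. This is what calls for almost everywhere
  differentiability, the fundamental theorem of calculus for absolutely continuous functions, and an
  area inequality on sets where the extension is differentiable.\<close>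

lemma division_real_interval:
  fixes D :: "real set set"
  assumes "D division_of \<Union>D" "\<Union>D \<subseteq> {a..b}" "K \<in> D"
  shows "K = {Inf K..Sup K}" "Inf K \<le> Sup K" "Inf K \<in> {a..b}" "Sup K \<in> {a..b}"
    "measure lborel K = Sup K - Inf K"
proof -
  obtain u v where K: "K = {u..v}" "u \<le> v"
    using division_ofD(3,4)[OF assms(1,3)] by (metis atLeastatMost_empty_iff2 box_real(2) )
  moreover have "K \<subseteq> {a..b}" using assms by auto
  ultimately show "K = {Inf K..Sup K}" "Inf K \<le> Sup K" "Inf K \<in> {a..b}" "Sup K \<in> {a..b}"
    "measure lborel K = Sup K - Inf K"
    by auto
qed

lemma abs_cont_onE:
  assumes "abs_cont_on a b u" "e > 0"
  obtains d where "d > 0" "\<forall>D. D division_of \<Union>D \<and> \<Union>D \<subseteq> {a..b} \<and>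
    (\<Sum>K\<in>D. Sup K - Inf K) < d \<longrightarrow> (\<Sum>K\<in>D. norm (u (Sup K) - u (Inf K))) < e"
  using assms unfolding abs_cont_on_def by auto

text \<open>Summing the estimate over a division leaves a multiple of the variation of
  \<open>u\<close> plus a multiple of the total length, both small. This one criterion covers
  Lipschitz functions, real and imaginary parts, linear perturbations, products with cutoffs and
  compositions with charts.\<close>

lemma abs_cont_on_comparison:
  assumes u: "abs_cont_on a b u" and AB: "A \<ge> 0" "B \<ge> 0"
    and le: "\<And>x y. x \<in> {a..b} \<Longrightarrow> y \<in> {a..b} \<Longrightarrow> norm (v x - v y) \<le> A * norm (u x - u y) + B * \<bar>x - y\<bar>"
  shows "abs_cont_on a b v"
  unfolding abs_cont_on_def
proof (intro allI impI)
  fix e :: real assume e: "e > 0"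
  have eA: "e / (2 * (A + 1)) > 0" using e AB by simp
  obtain d where d: "d > 0" and D0: "\<forall>D. D division_of \<Union>D \<and> \<Union>D \<subseteq> {a..b} \<and>
      (\<Sum>K\<in>D. Sup K - Inf K) < d \<longrightarrow> (\<Sum>K\<in>D. norm (u (Sup K) - u (Inf K))) < e / (2 * (A + 1))"
    using abs_cont_onE[OF u eA] .
  note D = D0[rule_format, OF conjI[OF _ conjI]]
  define d' where "d' = min d (e / (2 * (B + 1)))"
  have "d' > 0" using d e AB by (simp add: d'_def)
  moreover have "(\<Sum>K\<in>D. norm (v (Sup K) - v (Inf K))) < e"
    if div: "D division_of \<Union>D" "\<Union>D \<subseteq> {a..b}" and len: "(\<Sum>K\<in>D. Sup K - Inf K) < d'" for D
  proof -
    have "(\<Sum>K\<in>D. norm (v (Sup K) - v (Inf K)))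
        \<le> (\<Sum>K\<in>D. A * norm (u (Sup K) - u (Inf K)) + B * (Sup K - Inf K))"
    proof (rule sum_mono)
      fix K assume "K \<in> D"
      note K = division_real_interval[OF div this]
      show "norm (v (Sup K) - v (Inf K)) \<le> A * norm (u (Sup K) - u (Inf K)) + B * (Sup K - Inf K)"
        using le[OF K(4,3)] K(2) by simp
    qed
    also have "\<dots> = A * (\<Sum>K\<in>D. norm (u (Sup K) - u (Inf K))) + B * (\<Sum>K\<in>D. Sup K - Inf K)"
      by (simp add: sum.distrib sum_distrib_left)
    also have "\<dots> \<le> A * (e / (2 * (A + 1))) + B * (e / (2 * (B + 1)))"
      using D[OF div] len AB by (intro add_mono mult_left_mono) (auto simp: d'_def less_imp_le)
    also have "A * (e / (2 * (A + 1))) < e / 2" using e AB by (simp add: field_simps)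
    also have "B * (e / (2 * (B + 1))) \<le> e / 2" using e AB by (simp add: field_simps)
    finally show ?thesis by simp
  qed
  ultimately show "\<exists>d>0. \<forall>D. D division_of \<Union>D \<and> \<Union>D \<subseteq> {a..b} \<and> (\<Sum>K\<in>D. Sup K - Inf K) < d
      \<longrightarrow> (\<Sum>K\<in>D. norm (v (Sup K) - v (Inf K))) < e" by blast
qed

lemma Lipschitz_imp_abs_cont_on:
  assumes "B \<ge> 0" "\<And>x y. x \<in> {a..b} \<Longrightarrow> y \<in> {a..b} \<Longrightarrow> norm (v x - v y) \<le> B * \<bar>x - y\<bar>"
  shows "abs_cont_on a b v"
  by (rule abs_cont_on_comparison[of a b "\<lambda>_. 0" 0 B])
    (use assms in \<open>auto simp: abs_cont_on_def intro: exI[of _ 1]\<close>)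

lemma abs_cont_on_imp_continuous_on:
  assumes "abs_cont_on a b u"
  shows "continuous_on {a..b} u"
  unfolding continuous_on_iff
proof (intro ballI allI impI)
  fix x e :: real assume x: "x \<in> {a..b}" and e: "e > 0"
  obtain d where d: "d > 0" and D0: "\<forall>D. D division_of \<Union>D \<and> \<Union>D \<subseteq> {a..b} \<and>
      (\<Sum>K\<in>D. Sup K - Inf K) < d \<longrightarrow> (\<Sum>K\<in>D. norm (u (Sup K) - u (Inf K))) < e"
    using abs_cont_onE[OF assms e] .
  note D = D0[rule_format, OF conjI[OF _ conjI]]
  have "dist (u y) (u x) < e" if y: "y \<in> {a..b}" "dist y x < d" for y
  proof -
    let ?K = "{min x y..max x y}"
    have "{?K} division_of \<Union>{?K}"
      using division_of_self[of "min x y" "max x y"] by simp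
    from D[OF this] x y have "norm (u (max x y) - u (min x y)) < e"
      by (auto simp: dist_real_def)
    then show ?thesis by (auto simp: dist_norm min_def max_def norm_minus_commute split: if_splits)
  qed
  with d show "\<exists>d>0. \<forall>x'\<in>{a..b}. dist x' x < d \<longrightarrow> dist (u x') (u x) < e" by blast
qed

text \<open>Exceptional points are tagged inside an open set so small that absolute continuity bounds
  their total contribution.\<close>

lemma abs_cont_on_has_integral:
  fixes u :: "real \<Rightarrow> complex"
  assumes ab: "a \<le> b" and ac: "abs_cont_on a b u" and N: "negligible N"
    and der: "\<And>x. x \<in> {a..b} - N \<Longrightarrow> (u has_vector_derivative u' x) (at x within {a..b})"
  shows "(u' has_integral (u b - u a)) {a..b}"
proof -
  \<comment> \<open>With the value 0 on \<open>N\<close>, tags in \<open>N\<close> contribute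
    nothing to a Riemann sum, and only the increments of \<open>u\<close> over their intervals have
    to be estimated.\<close>
  define g where "g = (\<lambda>x. if x \<in> N then 0 else u' x)"
  have "(g has_integral (u b - u a)) {a..b}"
  proof (cases "a = b")
    case True
    then show ?thesis by (simp add: has_integral_refl)
  next
    case False
    with ab have ab': "a < b" by simp
    show ?thesis unfolding has_integral_factor_content_real
    proof (intro allI impI)
      fix e :: real assume e: "e > 0"
      define e1 where "e1 = e / 2"
      define e2 where "e2 = e / 2 * (b - a)"
      have e12: "e1 > 0" "e2 > 0" using e ab' by (auto simp: e1_def e2_def)
      obtain d where d: "d > 0" and D0: "\<forall>D. D division_of \<Union>D \<and> \<Union>D \<subseteq> {a..b} \<and>
      (\<Sum>K\<in>D. Sup K - Inf K) < d \<longrightarrow> (\<Sum>K\<in>D. norm (u (Sup K) - u (Inf K))) < e2"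
    using abs_cont_onE[OF ac e12(2)] .
  note D = D0[rule_format, OF conjI[OF _ conjI]]
      obtain T where T: "open T" "N \<subseteq> T" "T - N \<in> lmeasurable" "emeasure lebesgue (T - N) < ennreal d"
        using sets_lebesgue_outer_open[OF negligible_imp_sets[OF N] d] .
      have Tm: "T \<in> lmeasurable"
        using T N by (metis Diff_partition fmeasurable.Un negligible_imp_measurable)
      have Td: "measure lebesgue T < d"
      proof -
        have "measure lebesgue T = measure lebesgue (T - N)"
          using N T by (intro measure_negligible_symdiff[OF Tm, symmetric]) (auto intro: negligible_subset)
        also have "\<dots> < d"
          using T(3,4) d by (simp add: emeasure_eq_measure2 ennreal_less_iff)
        finally show ?thesis .
      qed
      have "\<exists>r>0. (x \<in> N \<longrightarrow> ball x r \<subseteq> T) \<and> (x \<in> {a..b} - N \<longrightarrow>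
          (\<forall>y\<in>{a..b}. norm (y - x) < r \<longrightarrow> norm (u y - u x - (y - x) *\<^sub>R g x) \<le> e1 * norm (y - x)))" for x
      proof (cases "x \<in> N")
        case True
        then show ?thesis using T(1,2) openE by blast
      next
        case xN: False
        show ?thesis
        proof (cases "x \<in> {a..b}")
          case True
          then have "(u has_vector_derivative u' x) (at x within {a..b})" using der xN by auto
          then have "\<exists>r>0. \<forall>y\<in>{a..b}. norm (y - x) < r \<longrightarrow> norm (u y - u x - (y - x) *\<^sub>R u' x) \<le> e1 * norm (y - x)"
            using e12 unfolding has_vector_derivative_def has_derivative_within_alt by blast
          then show ?thesis using xN by (auto simp: g_def)
        qed (use xN in \<open>auto intro: exI[of _ 1]\<close>)
      qed
      then obtain r where r: "\<And>x. 0 < r x" "\<And>x. x \<in> N \<Longrightarrow> ball x (r x) \<subseteq> T"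
        and rd: "\<And>x y. x \<in> {a..b} - N \<Longrightarrow> y \<in> {a..b} \<Longrightarrow> norm (y - x) < r x \<Longrightarrow>
            norm (u y - u x - (y - x) *\<^sub>R g x) \<le> e1 * norm (y - x)"
        by metis
      show "\<exists>\<gamma>. gauge \<gamma> \<and> (\<forall>p. p tagged_division_of {a..b} \<and> \<gamma> fine p \<longrightarrow>
           norm ((\<Sum>(x,K)\<in>p. measure lborel K *\<^sub>R g x) - (u b - u a)) \<le> e * measure lborel {a..b})"
      proof (intro exI conjI allI impI)
        show "gauge (\<lambda>x. ball x (r x))" using r(1) gauge_ball_dependent by blast
        fix p assume "p tagged_division_of {a..b} \<and> (\<lambda>x. ball x (r x)) fine p"
        then have p: "p tagged_division_of {a..b}" and fine: "(\<lambda>x. ball x (r x)) fine p" by auto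
        have finp: "finite p" using p by blast
        define p1 where "p1 = {q \<in> p. fst q \<in> N}"
        define p2 where "p2 = {q \<in> p. fst q \<notin> N}"
        have pp: "p = p1 \<union> p2" "p1 \<inter> p2 = {}" "finite p1" "finite p2"
          using finp by (auto simp: p1_def p2_def)
        have KI: "\<exists>u v. K = {u..v} \<and> u \<le> v \<and> x \<in> K \<and> K \<subseteq> {a..b}" if "(x,K) \<in> p" for x K
          using tagged_division_ofD(2,3,4)[OF p that]
          by (metis atLeastatMost_empty_iff2 box_real(2) empty_iff)
        have sub: "u b - u a = (\<Sum>(x,K)\<in>p. u (Sup K) - u (Inf K))"
          by (rule additive_tagged_division_1[OF ab p, of u, symmetric])
        have "(\<Sum>(x,K)\<in>p. measure lborel K *\<^sub>R g x) - (u b - u a)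
            = (\<Sum>(x,K)\<in>p. measure lborel K *\<^sub>R g x - (u (Sup K) - u (Inf K)))"
          by (simp add: sub sum_subtractf split_def)
        also have "\<dots> = (\<Sum>(x,K)\<in>p1. measure lborel K *\<^sub>R g x - (u (Sup K) - u (Inf K)))
            + (\<Sum>(x,K)\<in>p2. measure lborel K *\<^sub>R g x - (u (Sup K) - u (Inf K)))"
          using pp by (simp add: sum.union_disjoint)
        finally have eq: "(\<Sum>(x,K)\<in>p. measure lborel K *\<^sub>R g x) - (u b - u a) = \<dots>" .
        have "norm (\<Sum>(x,K)\<in>p2. measure lborel K *\<^sub>R g x - (u (Sup K) - u (Inf K)))
            \<le> (\<Sum>(x,K)\<in>p2. e1 * measure lborel K)"
        proof (rule sum_norm_le, clarify)
          fix x K assume xK: "(x,K) \<in> p2"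
          then obtain s t where K: "K = {s..t}" "s \<le> t" "x \<in> K" "K \<subseteq> {a..b}"
            using KI by (force simp: p2_def)
          have "K \<subseteq> ball x (r x)" using fine xK by (auto simp: fine_def p2_def)
          then have "s \<in> ball x (r x)" "t \<in> ball x (r x)" using K(1,2) by auto
          then have st: "norm (s - x) < r x" "norm (t - x) < r x" by (simp_all add: dist_norm norm_minus_commute)
          have x: "x \<in> {a..b} - N" using xK K by (auto simp: p2_def)
          have "norm (measure lborel K *\<^sub>R g x - (u (Sup K) - u (Inf K)))
              = norm ((u s - u x - (s - x) *\<^sub>R g x) - (u t - u x - (t - x) *\<^sub>R g x))"
            using K by (simp add: algebra_simps)
          also have "\<dots> \<le> e1 * norm (s - x) + e1 * norm (t - x)"
            using K by (intro order_trans[OF norm_triangle_ineq4] add_mono rd x st) auto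
          also have "\<dots> = e1 * measure lborel K" using K by (simp add: algebra_simps)
          finally show "norm (measure lborel K *\<^sub>R g x - (u (Sup K) - u (Inf K))) \<le> e1 * measure lborel K" .
        qed
        also have "\<dots> \<le> (\<Sum>(x,K)\<in>p. e1 * measure lborel K)"
          using finp e12 by (intro sum_mono2) (auto simp: p2_def)
        also have "\<dots> = e1 * (b - a)"
          using additive_content_tagged_division[of p a b] p ab
          by (simp add: sum_distrib_left[symmetric] split_def)
        finally have n2: "norm (\<Sum>(x,K)\<in>p2. measure lborel K *\<^sub>R g x - (u (Sup K) - u (Inf K))) \<le> e1 * (b - a)" .
        have p1: "p1 tagged_division_of \<Union>(snd ` p1)"
          using p by (intro tagged_partial_division_of_Union_self[of _ "{a..b}"])
            (auto simp: p1_def tagged_division_of_def intro: tagged_partial_division_subset)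
        define E where "E = snd ` p1"
        have E: "E division_of \<Union>E" using division_of_tagged_division[OF p1] by (simp add: E_def)
        have Eab: "\<Union>E \<subseteq> {a..b}" using KI by (fastforce simp: E_def p1_def)
        have ET: "\<Union>E \<subseteq> T"
          using fine r(2) by (fastforce simp: E_def p1_def fine_def)
        have "(\<Sum>K\<in>E. Sup K - Inf K) = (\<Sum>K\<in>E. measure lborel K)"
          by (intro sum.cong refl) (use division_real_interval[OF E Eab] in auto)
        also have "\<dots> = (\<Sum>K\<in>E. measure lebesgue K)"
          by (intro sum.cong refl measure_completion[symmetric]) (use division_ofD(4)[OF E] in force)
        also have "\<dots> = measure lebesgue (\<Union>E)"
          using content_division[OF E] .
        also have "\<dots> \<le> measure lebesgue T"
          using ET Tm E by (intro measure_mono_fmeasurable) (auto simp: lmeasurable_division fmeasurableD)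
        finally have "(\<Sum>K\<in>E. Sup K - Inf K) < d" using Td by simp
        from D[OF E Eab this] have nE: "(\<Sum>K\<in>E. norm (u (Sup K) - u (Inf K))) < e2" .
        \<comment> \<open>The passage from tagged pairs to intervals requires a summand that
          vanishes on boxes with empty interior. Degenerate intervals satisfy this, and the case
          \<open>K = {}\<close> is set to 0 because \<open>Sup\<close> and \<open>Inf\<close> say
          nothing there.\<close>
        have "norm (\<Sum>(x,K)\<in>p1. measure lborel K *\<^sub>R g x - (u (Sup K) - u (Inf K)))
            \<le> (\<Sum>(x,K)\<in>p1. if K = {} then 0 else norm (u (Sup K) - u (Inf K)))"
        proof (rule sum_norm_le, clarify)
          fix x K assume xK: "(x,K) \<in> p1"
          then have "x \<in> N" "K \<noteq> {}" using KI by (fastforce simp: p1_def)+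
          then show "norm (measure lborel K *\<^sub>R g x - (u (Sup K) - u (Inf K)))
              \<le> (if K = {} then 0 else norm (u (Sup K) - u (Inf K)))"
            by (simp add: g_def norm_minus_commute)
        qed
        also have "\<dots> = (\<Sum>K\<in>E. if K = {} then 0 else norm (u (Sup K) - u (Inf K)))"
          unfolding E_def
          by (rule sum.over_tagged_division_lemma[OF p1]) (auto simp: box_real cbox_interval not_less)
        also have "\<dots> = (\<Sum>K\<in>E. norm (u (Sup K) - u (Inf K)))"
          using division_ofD(3)[OF E] by (intro sum.cong) auto
        finally have n1: "norm (\<Sum>(x,K)\<in>p1. measure lborel K *\<^sub>R g x - (u (Sup K) - u (Inf K))) \<le> e2"
          using nE by simp
        show "norm ((\<Sum>(x,K)\<in>p. measure lborel K *\<^sub>R g x) - (u b - u a)) \<le> e * measure lborel {a..b}"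
          unfolding eq using order_trans[OF norm_triangle_ineq add_mono[OF n1 n2]] ab'
          by (simp add: e1_def e2_def algebra_simps)
      qed
    qed
  qed
  then show ?thesis
    by (rule has_integral_spike[OF N, rotated]) (auto simp: g_def)
qed

section \<open>Almost everywhere differentiability of absolutely continuous functions\<close>

lemma Vitali_finite_intervals:
  fixes S :: "real set"
  assumes S: "S \<in> lmeasurable" and O: "open O'" "S \<subseteq> O'"
    and cov: "\<And>x d. x \<in> S \<Longrightarrow> 0 < d \<Longrightarrow> \<exists>u w. u < w \<and> x \<in> {u..w} \<and> w - u < d \<and> P u w"
    and e: "e > 0"
  shows "\<exists>D. D division_of \<Union>D \<and> \<Union>D \<subseteq> O' \<and> (\<forall>K\<in>D. \<exists>u w. u < w \<and> K = {u..w} \<and> P u w) \<and>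
    measure lebesgue (S - \<Union>D) < e \<and> \<Union>D \<in> lmeasurable"
proof -
  define I where "I = {(u,w). u < w \<and> P u w \<and> {u..w} \<subseteq> O'}"
  \<comment> \<open>Intervals are treated as closed balls around their midpoints, to which the
    Vitali covering theorem applies; the countable disjoint family is then cut down to a finite one
    by continuity of the measure.\<close>
  define c where "c = (\<lambda>(u::real,w). (u + w) / 2)"
  define r where "r = (\<lambda>(u::real,w). (w - u) / 2)"
  have cb: "cball (c (u,w)) (r (u,w)) = {u..w}" for u w
    by (simp add: cball_eq_atLeastAtMost c_def r_def field_simps)
  have 1: "\<exists>i. i \<in> I \<and> x \<in> cball (c i) (r i) \<and> r i < d" if x: "x \<in> S" and d: "0 < d" for x d
  proof -
    obtain \<rho> where \<rho>: "\<rho> > 0" "ball x \<rho> \<subseteq> O'" using O x by (meson openE subsetD)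
    obtain u w where uw: "u < w" "x \<in> {u..w}" "w - u < min d \<rho>" "P u w"
      using cov[OF x, of "min d \<rho>"] d \<rho> by auto
    have "{u..w} \<subseteq> ball x \<rho>" using uw by (auto simp: dist_real_def)
    then have "(u,w) \<in> I" using uw \<rho> by (auto simp: I_def)
    moreover have "r (u,w) < d" using uw by (auto simp: r_def)
    ultimately show ?thesis using cb uw(2) by blast
  qed
  have rpos: "0 < r i" if "i \<in> I" for i using that by (auto simp: I_def r_def)
  obtain C where C: "countable C" "C \<subseteq> I"
    "pairwise (\<lambda>i j. disjnt (cball (c i) (r i)) (cball (c j) (r j))) C"
    "negligible (S - (\<Union>i\<in>C. cball (c i) (r i)))"
    using Vitali_covering_theorem_cballs[of I r S c, OF rpos 1] .
  define F where "F = (\<lambda>i. S \<inter> cball (c i) (r i)) ` C"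
  have Fm: "T \<in> lmeasurable" if "T \<in> F" for T
    using that S by (auto simp: F_def intro!: fmeasurable_Int_fmeasurable)
  have mS: "measure lebesgue (\<Union>F) = measure lebesgue S"
    by (rule measure_negligible_symdiff[OF S])
      (rule negligible_subset[OF C(4)], auto simp: F_def)
  obtain F' where F': "F' \<subseteq> F" "finite F'" "measure lebesgue (\<Union>F) - e < measure lebesgue (\<Union>F')"
  proof (rule measure_countable_Union_approachable[of F e "measure lebesgue S"])
    show "countable F" using C by (simp add: F_def)
    show "measure lebesgue (\<Union>D') \<le> measure lebesgue S" if "D' \<subseteq> F" "finite D'" for D'
      using that Fm S by (intro measure_mono_fmeasurable) (auto simp: F_def intro!: fmeasurableD)
  qed (use e Fm in auto)
  obtain C' where C': "C' \<subseteq> C" "finite C'" "F' = (\<lambda>i. S \<inter> cball (c i) (r i)) ` C'"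
    using finite_subset_image[OF F'(2) F'(1)[unfolded F_def]] by blast
  define D where "D = (\<lambda>i. cball (c i) (r i)) ` C'"
  have Dm: "\<Union>D \<in> lmeasurable" using C'(2) by (auto simp: D_def intro!: fmeasurable.finite_UN)
  have DK: "\<exists>u w. u < w \<and> K = {u..w} \<and> P u w \<and> K \<subseteq> O'" if "K \<in> D" for K
  proof -
    obtain u w where uw: "(u,w) \<in> C'" "K = cball (c (u,w)) (r (u,w))" using \<open>K \<in> D\<close> by (auto simp: D_def)
    then have "(u,w) \<in> I" using C'(1) C(2) by blast
    then show ?thesis using uw(2) unfolding cb by (auto simp: I_def)
  qed
  show ?thesis
  proof (intro exI[of _ D] conjI ballI)
    show D: "D division_of \<Union>D"
      unfolding division_of_def
    proof (intro conjI ballI impI)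
      show "finite D" using C' by (simp add: D_def)
      fix K assume K: "K \<in> D"
      then obtain u w where uw: "u < w" "K = {u..w}" using DK by blast
      then show "K \<noteq> {}" "\<exists>a b. K = cbox a b" by auto
      show "K \<subseteq> \<Union>D" using K by auto
      fix L assume L: "L \<in> D" "K \<noteq> L"
      obtain i j where ij: "i \<in> C'" "j \<in> C'" "K = cball (c i) (r i)" "L = cball (c j) (r j)"
        using K L(1) by (auto simp: D_def)
      then have "i \<noteq> j" using L(2) by auto
      then have "disjnt K L"
        using pairwiseD[OF C(3), of i j] C'(1) ij by auto
      then show "interior K \<inter> interior L = {}"
        using interior_subset unfolding disjnt_def by blast
    qed simp
    show "\<Union>D \<subseteq> O'" using DK by blast
    show "\<exists>u w. u < w \<and> K = {u..w} \<and> P u w" if "K \<in> D" for K using DK[OF that] by blast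
    have "\<Union>F' = S \<inter> \<Union>D" by (auto simp: C' D_def)
    moreover have "measure lebesgue (S - \<Union>D) = measure lebesgue S - measure lebesgue (S \<inter> \<Union>D)"
    proof -
      have "S - \<Union>D = S - S \<inter> \<Union>D" by blast
      moreover have "S \<inter> \<Union>D \<in> sets lebesgue" using S Dm by (auto dest: fmeasurableD)
      ultimately show ?thesis using S by (metis Int_lower1 measurable_measure_Diff)
    qed
    ultimately show "measure lebesgue (S - \<Union>D) < e" using F'(3) mS by simp
    show "\<Union>D \<in> lmeasurable" by (rule Dm)
  qed
qed

lemma sum_division_increments:
  fixes f :: "real \<Rightarrow> 'a::real_normed_vector"
  assumes "a \<le> b" "q division_of {a..b}"
  shows "(\<Sum>K\<in>q. f (Sup K) - f (Inf K)) = f b - f a"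
proof -
  define p where "p = (\<lambda>K. (Inf K, K)) ` q"
  have K: "K = {Inf K..Sup K} \<and> Inf K \<le> Sup K" if "K \<in> q" for K
    using division_real_interval[of q a b K] assms(2) that division_ofD(6)[OF assms(2)] by auto
  have "p tagged_division_of {a..b}"
    unfolding tagged_division_of_def tagged_partial_division_of_def
  proof (intro conjI allI impI)
    show "finite p" using assms by (simp add: p_def division_of_finite)
  next
    fix x L assume xL: "(x,L) \<in> p"
    then have L: "L \<in> q" "x = Inf L" by (auto simp: p_def)
    then show "x \<in> L" using K by (metis atLeastAtMost_iff order_refl)
    show "L \<subseteq> {a..b}" using L division_ofD(2)[OF assms(2)] by blast
    show "\<exists>a b. L = cbox a b" using L division_ofD(4)[OF assms(2)] by blast
  next
    fix x L y M assume xL: "(x,L) \<in> p \<and> (y,M) \<in> p \<and> (x,L) \<noteq> (y,M)"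
    then have "L \<in> q" "M \<in> q" "M \<noteq> L" by (auto simp: p_def)
    then show "interior L \<inter> interior M = {}" using division_ofD(5)[OF assms(2)] by blast
  next
    show "\<Union>{K. \<exists>x. (x,K) \<in> p} = {a..b}" using division_ofD(6)[OF assms(2)] unfolding p_def by blast
  qed
  from additive_tagged_division_1[OF assms(1) this, of f]
  show ?thesis by (simp add: p_def sum.reindex inj_on_def)
qed

lemma sum_lengths_division:
  fixes D :: "real set set"
  assumes "D division_of \<Union>D" "\<Union>D \<subseteq> {a..b}"
  shows "(\<Sum>K\<in>D. Sup K - Inf K) = measure lebesgue (\<Union>D)"
proof -
  have "(\<Sum>K\<in>D. Sup K - Inf K) = (\<Sum>K\<in>D. measure lborel K)"
    by (intro sum.cong refl) (use division_real_interval[OF assms] in auto)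
  also have "\<dots> = (\<Sum>K\<in>D. measure lebesgue K)"
    by (intro sum.cong refl measure_completion[symmetric]) (use division_ofD(4)[OF assms(1)] in force)
  finally show ?thesis using content_division[OF assms(1)] by simp
qed

text \<open>Cover most of \<open>S\<close> by intervals \<open>D1\<close> of increasing increments and, inside them, by intervals
  \<open>D2\<close> of nonpositive increments; the total increment over \<open>D1 - D2\<close> is small by absolute
  continuity, which is impossible unless \<open>S\<close> is negligible.\<close>

lemma abs_cont_on_opposite_increments_negligible:
  fixes w :: "real \<Rightarrow> real"
  assumes ac: "abs_cont_on a b (\<lambda>x. complex_of_real (w x))"
    and S: "S \<in> sets lebesgue" "S \<subseteq> {a<..<b}" and \<eta>: "\<eta> > 0"
    and up: "\<And>x d. x \<in> S \<Longrightarrow> 0 < d \<Longrightarrow> \<exists>s t. s < t \<and> x \<in> {s..t} \<and> t - s < d \<and> w t - w s \<ge> \<eta> * (t - s)"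
    and down: "\<And>x d. x \<in> S \<Longrightarrow> 0 < d \<Longrightarrow> \<exists>s t. s < t \<and> x \<in> {s..t} \<and> t - s < d \<and> w t - w s \<le> 0"
  shows "negligible S"
proof (rule ccontr)
  assume "\<not> negligible S"
  have Sm: "S \<in> lmeasurable"
    using S by (intro bounded_set_imp_lmeasurable) (auto intro: bounded_subset[OF bounded_Ioo[of a b]])
  define m where "m = measure lebesgue S"
  have m: "m > 0" using \<open>\<not> negligible S\<close> Sm negligible_iff_measure0
    unfolding m_def by (metis measure_nonneg less_le)
  define e where "e = \<eta> * m / 4"
  have e: "e > 0" using m \<eta> by (simp add: e_def)
  obtain d where d: "d > 0" and D0: "\<forall>D. D division_of \<Union>D \<and> \<Union>D \<subseteq> {a..b} \<and>
      (\<Sum>K\<in>D. Sup K - Inf K) < d \<longrightarrow> (\<Sum>K\<in>D. norm (complex_of_real (w (Sup K)) - complex_of_real (w (Inf K)))) < e"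
    using abs_cont_onE[OF ac e] .
  have D: "(\<Sum>K\<in>D. \<bar>w (Sup K) - w (Inf K)\<bar>) < e"
    if "D division_of \<Union>D" "\<Union>D \<subseteq> {a..b}" "(\<Sum>K\<in>D. Sup K - Inf K) < d" for D
    using D0[rule_format, of D] that by (simp flip: of_real_diff)
  \<comment> \<open>The gaps that \<open>D2\<close> leaves in \<open>D1\<close> will have total
    length below \<open>3 * d'\<close>, hence below \<open>d\<close>, while \<open>D1\<close> keeps
    at least three quarters of \<open>m\<close>.\<close>
  define d' where "d' = min (d / 4) (m / 4)"
  have d': "d' > 0" "d' \<le> d / 4" "d' \<le> m / 4" using d m by (auto simp: d'_def)
  obtain T where T: "open T" "S \<subseteq> T" "T - S \<in> lmeasurable" "emeasure lebesgue (T - S) < ennreal d'"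
    using sets_lebesgue_outer_open[OF S(1) d'(1)] .
  define U where "U = T \<inter> {a<..<b}"
  have U: "open U" "S \<subseteq> U" "U \<subseteq> {a<..<b}" using T S by (auto simp: U_def)
  have Um: "U \<in> lmeasurable" using U
    by (intro bounded_set_imp_lmeasurable) (auto intro: bounded_subset[OF bounded_Ioo[of a b]])
  have mU: "measure lebesgue U < m + d'"
  proof -
    have "measure lebesgue U \<le> measure lebesgue (S \<union> (T - S))"
      using Sm T Um by (intro measure_mono_fmeasurable fmeasurable.Un) (auto simp: U_def dest: fmeasurableD)
    also have "\<dots> \<le> m + measure lebesgue (T - S)"
      unfolding m_def using Sm T by (intro measure_Un_le) (auto dest: fmeasurableD)
    also have "measure lebesgue (T - S) < d'"
      using T(3,4) d' by (simp add: emeasure_eq_measure2 ennreal_less_iff)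
    finally show ?thesis by simp
  qed
  have "\<exists>D1. D1 division_of \<Union>D1 \<and> \<Union>D1 \<subseteq> U \<and> (\<forall>K\<in>D1. \<exists>s t. s < t \<and> K = {s..t} \<and> w t - w s \<ge> \<eta> * (t - s))
      \<and> measure lebesgue (S - \<Union>D1) < d' \<and> \<Union>D1 \<in> lmeasurable"
    by (rule Vitali_finite_intervals[OF Sm U(1,2) _ d'(1), where P="\<lambda>s t. w t - w s \<ge> \<eta> * (t - s)"])
      (rule up)
  then obtain D1 where D1: "D1 division_of \<Union>D1" "\<Union>D1 \<subseteq> U"
    and D1P: "\<And>K. K \<in> D1 \<Longrightarrow> \<exists>s t. s < t \<and> K = {s..t} \<and> w t - w s \<ge> \<eta> * (t - s)"
    and D1S: "measure lebesgue (S - \<Union>D1) < d'" and D1m: "\<Union>D1 \<in> lmeasurable"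
    by (elim exE conjE) (rule that, auto)
  have D1ab: "\<Union>D1 \<subseteq> {a..b}" using D1 U by force
  have fin1: "finite D1" using D1 by blast
  define V where "V = (\<Union>K\<in>D1. interior K)"
  have V: "open V" by (auto simp: V_def)
  have negV: "negligible (\<Union>D1 - V)"
  proof (rule negligible_subset)
    show "negligible (\<Union>K\<in>D1. frontier K)"
      using fin1 D1P by (intro negligible_Union) (auto intro!: negligible_convex_frontier)
    show "\<Union>D1 - V \<subseteq> (\<Union>K\<in>D1. frontier K)"
      using closure_subset by (fastforce simp: V_def frontier_def)
  qed
  define S2 where "S2 = S \<inter> V"
  have S2m: "S2 \<in> lmeasurable" using Sm V by (auto simp: S2_def intro: fmeasurable_Int_fmeasurable)
  have sl: "S \<in> sets lebesgue" "S2 \<in> sets lebesgue" "\<Union>D1 \<in> sets lebesgue" "V \<in> sets lebesgue"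
    using S(1) S2m D1m V by (auto dest: fmeasurableD)
  have mS2: "measure lebesgue S2 > m - d'"
  proof -
    have "m \<le> measure lebesgue (S2 \<union> ((S - \<Union>D1) \<union> (\<Union>D1 - V)))"
      unfolding m_def using sl(1) S2m fmeasurable.Diff[OF Sm D1m] negligible_imp_measurable[OF negV]
      by (intro measure_mono_fmeasurable fmeasurable.Un) (auto simp: S2_def)
    also have "\<dots> \<le> measure lebesgue S2 + measure lebesgue ((S - \<Union>D1) \<union> (\<Union>D1 - V))"
      using sl by (intro measure_Un_le sets.Un sets.Diff)
    also have "measure lebesgue ((S - \<Union>D1) \<union> (\<Union>D1 - V)) \<le> measure lebesgue (S - \<Union>D1) + measure lebesgue (\<Union>D1 - V)"
      using sl by (intro measure_Un_le sets.Un sets.Diff)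
    finally show ?thesis using D1S negV by (simp add: negligible_imp_measure0)
  qed
  have "\<exists>D2. D2 division_of \<Union>D2 \<and> \<Union>D2 \<subseteq> V \<and> (\<forall>K\<in>D2. \<exists>s t. s < t \<and> K = {s..t} \<and> (w t - w s \<le> 0 \<and> (\<exists>J\<in>D1. {s..t} \<subseteq> J)))
      \<and> measure lebesgue (S2 - \<Union>D2) < d' \<and> \<Union>D2 \<in> lmeasurable"
  proof (rule Vitali_finite_intervals[OF S2m V _ _ d'(1), where P="\<lambda>s t. w t - w s \<le> 0 \<and> (\<exists>J\<in>D1. {s..t} \<subseteq> J)"])
    show "S2 \<subseteq> V" by (auto simp: S2_def)
    fix x r :: real assume x: "x \<in> S2" and r: "0 < r"
    then obtain J where J: "J \<in> D1" "x \<in> interior J" by (auto simp: S2_def V_def)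
    then obtain \<rho> where \<rho>: "\<rho> > 0" "ball x \<rho> \<subseteq> J" by (meson interior_subset open_interior openE subset_trans)
    obtain s t where st: "s < t" "x \<in> {s..t}" "t - s < min r \<rho>" "w t - w s \<le> 0"
      using down[of x "min r \<rho>"] x r \<rho> by (auto simp: S2_def)
    have "{s..t} \<subseteq> ball x \<rho>" using st by (auto simp: dist_real_def)
    then show "\<exists>u wa. u < wa \<and> x \<in> {u..wa} \<and> wa - u < r \<and> w wa - w u \<le> 0 \<and> (\<exists>J\<in>D1. {u..wa} \<subseteq> J)"
      using st \<rho> J by (intro exI[of _ s] exI[of _ t]) auto
  qed
  then obtain D2 where D2: "D2 division_of \<Union>D2" "\<Union>D2 \<subseteq> V"
    and D2P: "\<And>K. K \<in> D2 \<Longrightarrow> \<exists>s t. s < t \<and> K = {s..t} \<and> w t - w s \<le> 0 \<and> (\<exists>J\<in>D1. {s..t} \<subseteq> J)"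
    and D2S: "measure lebesgue (S2 - \<Union>D2) < d'" and D2m: "\<Union>D2 \<in> lmeasurable"
    by (elim exE conjE) (rule that, auto)
  have fin2: "finite D2" using D2 by blast
  have mD2: "measure lebesgue (\<Union>D2) > m - 2 * d'"
  proof -
    have "measure lebesgue S2 \<le> measure lebesgue (\<Union>D2 \<union> (S2 - \<Union>D2))"
      using S2m D2m by (intro measure_mono_fmeasurable fmeasurable.Un fmeasurable.Diff) (auto dest: fmeasurableD)
    also have "\<dots> \<le> measure lebesgue (\<Union>D2) + measure lebesgue (S2 - \<Union>D2)"
      using S2m D2m by (intro measure_Un_le) (auto dest: fmeasurableD)
    finally show ?thesis using mS2 D2S by simp
  qed
  define E where "E = (\<lambda>K. {J \<in> D2. J \<subseteq> K})"
  have "\<exists>q. E K \<subseteq> q \<and> q division_of K" if K: "K \<in> D1" for K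
  proof -
    obtain s t where st: "K = cbox s t" using division_ofD(4)[OF D1(1) K] by blast
    have "E K \<subseteq> D2" by (auto simp: E_def)
    then have "E K division_of \<Union>(E K)" by (rule division_of_subset[OF D2(1)])
    moreover have "\<Union>(E K) \<subseteq> cbox s t" using st by (auto simp: E_def)
    ultimately show ?thesis using partial_division_extend_interval st by metis
  qed
  then obtain q where q: "\<And>K. K \<in> D1 \<Longrightarrow> E K \<subseteq> q K" "\<And>K. K \<in> D1 \<Longrightarrow> q K division_of K" by metis
  define \<Delta> where "\<Delta> = (\<lambda>K. w (Sup K) - w (Inf K))"
  define l where "l = (\<lambda>K::real set. Sup K - Inf K)"
  \<comment> \<open>The gaps left by \<open>D2\<close> inside \<open>K\<close>. Degenerate intervals
    are excluded: they carry no increment, and one of them could lie in two neighbouring intervals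
    \<open>K\<close>, whereas the families \<open>R K\<close> have to be disjoint.\<close>
  define R where "R = (\<lambda>K. {J \<in> q K - E K. interior J \<noteq> {}})"
  have qfin: "finite (q K)" if "K \<in> D1" for K using q(2)[OF that] by blast
  have qJ: "J = {Inf J..Sup J}" "Inf J \<le> Sup J" if "K \<in> D1" "J \<in> q K" for K J
  proof -
    have "q K division_of \<Union>(q K)" "\<Union>(q K) \<subseteq> {a..b}"
      using q(2)[OF that(1)] D1ab that(1) division_ofD(6)[OF q(2)[OF that(1)]] by auto
    from division_real_interval[OF this that(2)] show "J = {Inf J..Sup J}" "Inf J \<le> Sup J" by auto
  qed
  have degen: "Sup J = Inf J" if "K \<in> D1" "J \<in> q K" "interior J = {}" for K J
    using qJ[OF that(1,2)] that(3) by (metis greaterThanLessThan_empty_iff interior_atLeastAtMost_real leD order_le_imp_less_or_eq not_less_iff_gr_or_eq)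
  have split: "(\<Sum>J\<in>q K. f J) = (\<Sum>J\<in>E K. f J) + (\<Sum>J\<in>R K. f J)"
    if K: "K \<in> D1" and f: "\<And>J. Sup J = Inf J \<Longrightarrow> f J = 0" for f :: "real set \<Rightarrow> real" and K
  proof -
    have "(\<Sum>J\<in>q K. f J) = (\<Sum>J\<in>E K. f J) + (\<Sum>J\<in>q K - E K. f J)"
      using q(1)[OF K] qfin[OF K] by (simp add: sum.subset_diff add.commute)
    also have "(\<Sum>J\<in>q K - E K. f J) = (\<Sum>J\<in>R K. f J)"
      using qfin[OF K] by (intro sum.mono_neutral_right) (auto simp: R_def intro: f degen[OF K])
    finally show ?thesis .
  qed
  have \<Delta>K: "\<Delta> K = (\<Sum>J\<in>E K. \<Delta> J) + (\<Sum>J\<in>R K. \<Delta> J)" if K: "K \<in> D1" for K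
  proof -
    obtain s t where st: "s < t" "K = {s..t}" using D1P[OF K] by blast
    have "(\<Sum>J\<in>q K. \<Delta> J) = w t - w s"
      unfolding \<Delta>_def using q(2)[OF K] st by (intro sum_division_increments) auto
    then show ?thesis using split[OF K, of \<Delta>] st by (simp add: \<Delta>_def)
  qed
  have lK: "l K = (\<Sum>J\<in>E K. l J) + (\<Sum>J\<in>R K. l J)" if K: "K \<in> D1" for K
  proof -
    obtain s t where st: "s < t" "K = {s..t}" using D1P[OF K] by blast
    have "(\<Sum>J\<in>q K. l J) = t - s"
      unfolding l_def using q(2)[OF K] st by (intro sum_division_increments[of s t _ "\<lambda>x. x"]) auto
    then show ?thesis using split[OF K, of l] st by (simp add: l_def)
  qed
  define RR where "RR = (\<Union>K\<in>D1. R K)"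
  have Rint: "interior J \<subseteq> interior K" if "K \<in> D1" "J \<in> R K" for J K
    using that division_ofD(2)[OF q(2)[OF that(1)]] by (intro interior_mono) (auto simp: R_def)
  have disjR: "R K \<inter> R L = {}" if "K \<in> D1" "L \<in> D1" "K \<noteq> L" for K L
    using division_ofD(5)[OF D1(1) that] Rint[OF that(1)] Rint[OF that(2)] by (fastforce simp: R_def)
  have sumRR: "(\<Sum>J\<in>RR. f J) = (\<Sum>K\<in>D1. \<Sum>J\<in>R K. f J)" for f :: "real set \<Rightarrow> real"
    unfolding RR_def using fin1 qfin disjR by (intro sum.UNION_disjoint) (auto simp: R_def)
  have RRdiv: "RR division_of \<Union>RR"
    unfolding division_of_def
  proof (intro conjI ballI impI)
    show "finite RR" using fin1 qfin by (auto simp: RR_def R_def)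
    fix J assume J: "J \<in> RR"
    then obtain K where K: "K \<in> D1" "J \<in> R K" by (auto simp: RR_def)
    then have Jq: "J \<in> q K" by (simp add: R_def)
    show "J \<subseteq> \<Union>RR" using J by auto
    show "J \<noteq> {}" "\<exists>a b. J = cbox a b" using division_ofD(3,4)[OF q(2)[OF K(1)] Jq] by auto
    fix L assume L: "L \<in> RR" "J \<noteq> L"
    then obtain K' where K': "K' \<in> D1" "L \<in> R K'" by (auto simp: RR_def)
    show "interior J \<inter> interior L = {}"
    proof (cases "K = K'")
      case True
      then show ?thesis using division_ofD(5)[OF q(2)[OF K(1)] Jq] K' L by (auto simp: R_def)
    next
      case False
      then show ?thesis using division_ofD(5)[OF D1(1) K(1) K'(1)] Rint[OF K] Rint[OF K'] by blast
    qed
  qed simp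
  have RRab: "\<Union>RR \<subseteq> {a..b}"
    using D1ab division_ofD(2)[OF q(2)] by (fastforce simp: RR_def R_def)
  have sumD1: "(\<Sum>K\<in>D1. l K) = measure lebesgue (\<Union>D1)"
    unfolding l_def by (rule sum_lengths_division[OF D1(1) D1ab])
  have D2ab: "\<Union>D2 \<subseteq> {a..b}" using D1ab D2P by fastforce
  have sumE: "(\<Sum>K\<in>D1. \<Sum>J\<in>E K. l J) \<ge> measure lebesgue (\<Union>D2)"
  proof -
    have "J \<in> E K \<Longrightarrow> J \<in> D2" for J K by (simp add: E_def)
    moreover have "\<exists>K\<in>D1. J \<in> E K" if "J \<in> D2" for J using D2P[OF that] that by (auto simp: E_def)
    ultimately have eq: "\<Union>D2 = (\<Union>K\<in>D1. \<Union>(E K))" by blast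
    have "\<Union>(E K) \<in> sets lebesgue" for K
    proof (rule sets.finite_Union)
      show "finite (E K)" using fin2 by (simp add: E_def)
      show "E K \<subseteq> sets lebesgue" using D2P by (fastforce simp: E_def)
    qed
    then have "measure lebesgue (\<Union>D2) \<le> (\<Sum>K\<in>D1. measure lebesgue (\<Union>(E K)))"
      unfolding eq using fin1 by (intro measure_UNION_le)
    also have "\<dots> = (\<Sum>K\<in>D1. \<Sum>J\<in>E K. l J)"
    proof (intro sum.cong refl)
      fix K assume "K \<in> D1"
      have "E K \<subseteq> D2" by (auto simp: E_def)
      then show "measure lebesgue (\<Union>(E K)) = (\<Sum>J\<in>E K. l J)"
        unfolding l_def using D2ab by (intro sum_lengths_division[symmetric] division_of_subset[OF D2(1)]) auto
    qed
    finally show ?thesis .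
  qed
  have "(\<Sum>J\<in>RR. l J) = (\<Sum>K\<in>D1. l K) - (\<Sum>K\<in>D1. \<Sum>J\<in>E K. l J)"
    unfolding sumRR by (simp add: lK sum.distrib)
  also have "\<dots> \<le> measure lebesgue (\<Union>D1) - measure lebesgue (\<Union>D2)"
    using sumD1 sumE by simp
  also have "\<dots> < m + d' - (m - 2 * d')"
  proof -
    have "measure lebesgue (\<Union>D1) \<le> measure lebesgue U"
      using D1 D1m Um by (intro measure_mono_fmeasurable) (auto dest: fmeasurableD)
    then show ?thesis using mU mD2 by simp
  qed
  finally have "(\<Sum>J\<in>RR. l J) < d" using d' by simp
  then have small: "(\<Sum>J\<in>RR. \<bar>\<Delta> J\<bar>) < e" using D[OF RRdiv RRab] by (simp add: l_def \<Delta>_def)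
  have "\<eta> * (m - d') \<le> \<eta> * measure lebesgue (\<Union>D1)"
  proof -
    have "m \<le> measure lebesgue (\<Union>D1 \<union> (S - \<Union>D1))" unfolding m_def
      using Sm D1m by (intro measure_mono_fmeasurable fmeasurable.Un fmeasurable.Diff) (auto dest: fmeasurableD)
    also have "\<dots> \<le> measure lebesgue (\<Union>D1) + measure lebesgue (S - \<Union>D1)"
      using Sm D1m by (intro measure_Un_le) (auto dest: fmeasurableD)
    finally show ?thesis using D1S \<eta> by simp
  qed
  also have "\<dots> = (\<Sum>K\<in>D1. \<eta> * l K)" by (simp add: sumD1[symmetric] sum_distrib_left)
  also have "\<dots> \<le> (\<Sum>K\<in>D1. \<Delta> K)"
    by (rule sum_mono) (use D1P in \<open>fastforce simp: l_def \<Delta>_def\<close>)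
  also have "\<dots> = (\<Sum>K\<in>D1. \<Sum>J\<in>E K. \<Delta> J) + (\<Sum>J\<in>RR. \<Delta> J)"
    unfolding sumRR by (simp add: \<Delta>K sum.distrib)
  also have "\<dots> \<le> 0 + (\<Sum>J\<in>RR. \<bar>\<Delta> J\<bar>)"
    using D2P by (intro add_mono sum_nonpos sum_mono) (fastforce simp: E_def \<Delta>_def)+
  finally have "\<eta> * (m - d') < e" using small by simp
  moreover have "\<eta> * (m - d') \<ge> \<eta> * (m * 3 / 4)" using d' \<eta> by (intro mult_left_mono) auto
  ultimately show False using \<eta> m by (simp add: e_def)
qed

text \<open>Where the difference quotients stay bounded but have no limit, two rational numbers p <
  q separate their lower and upper limits; subtracting a linear function of slope between p and q
  turns this into increments of opposite signs. Where they are unbounded, intervals of large slope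
  would produce a fixed variation over a small total length.\<close>

lemma abs_cont_on_differentiable_real:
  fixes v :: "real \<Rightarrow> real"
  assumes ac: "abs_cont_on a b (\<lambda>x. complex_of_real (v x))"
  shows "\<exists>N. negligible N \<and> (\<forall>x\<in>{a<..<b} - N. v differentiable at x)"
proof (cases "a < b")
  case False
  then show ?thesis by (intro exI[of _ "{}"]) auto
next
  case ab: True
  have cv: "continuous_on {a..b} v"
    using continuous_on_Re[OF abs_cont_on_imp_continuous_on[OF ac]] by simp
  \<comment> \<open>Clamping the argument makes the quotient continuous on the whole line for every
    fixed step, so that the sets below are Borel although the steps range over uncountably many
    values.\<close>
  define c where "c = (\<lambda>x::real. max a (min b x))"
  define Q where "Q = (\<lambda>h x. (v (c (x + h)) - v (c x)) / h)"
  have cvc: "continuous_on UNIV (\<lambda>x. v (c (x + h)))" for h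
    by (rule continuous_on_compose2[OF cv]) (use ab in \<open>auto simp: c_def intro!: continuous_intros\<close>)
  have contQ: "continuous_on UNIV (Q h)" for h
    unfolding Q_def divide_inverse by (intro continuous_intros cvc cvc[of 0, simplified])
  define A where "A = (\<lambda>n::nat. {h::real. h \<noteq> 0 \<and> \<bar>h\<bar> < 1 / Suc n})"
  define Low where "Low = (\<lambda>p. {a<..<b} \<inter> (\<Inter>n. \<Union>h\<in>A n. {x. Q h x < p}))"
  define Upp where "Upp = (\<lambda>q. {a<..<b} \<inter> (\<Inter>n. \<Union>h\<in>A n. {x. Q h x > q}))"
  define Unb where "Unb = {a<..<b} \<inter> (\<Inter>k::nat. \<Inter>n. \<Union>h\<in>A n. {x. \<bar>Q h x\<bar> > k})"
  have setsL: "Low p \<in> sets borel" for p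
    unfolding Low_def by (intro sets.Int sets.countable_INT'' borel_open open_UN ballI open_Collect_less contQ continuous_intros) auto
  have setsU: "Upp p \<in> sets borel" for p
    unfolding Upp_def by (intro sets.Int sets.countable_INT'' borel_open open_UN ballI open_Collect_less contQ continuous_intros) auto
  have setsB: "Unb \<in> sets borel"
    unfolding Unb_def by (intro sets.Int sets.countable_INT'' borel_open open_UN ballI open_Collect_less contQ continuous_intros) auto
  have dest: "\<exists>h. h \<noteq> 0 \<and> \<bar>h\<bar> < d \<and> P h x" if "\<And>n. \<exists>h\<in>A n. P h x" "d > 0" for P x and d :: real
  proof -
    obtain n where "1 / Suc n < d" using \<open>d > 0\<close> nat_approx_posE by (metis )
    then show ?thesis using that(1)[of n] by (force simp: A_def)
  qed
  have ival: "\<exists>s t. s < t \<and> x \<in> {s..t} \<and> {s..t} \<subseteq> {a..b} \<and> t - s < d \<and> v t - v s = Q h x * (t - s)"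
    if "h \<noteq> 0" "\<bar>h\<bar> < min d (min (x - a) (b - x))" for x d h
  proof (cases "h > 0")
    case True
    then have "c (x + h) = x + h" "c x = x" using that by (auto simp: c_def)
    then have "v (x + h) - v x = Q h x * ((x + h) - x)" using True by (simp add: Q_def field_simps)
    then show ?thesis using that True by (intro exI[of _ x] exI[of _ "x + h"]) auto
  next
    case False
    then have h: "h < 0" using that by simp
    then have "c (x + h) = x + h" "c x = x" using that by (auto simp: c_def)
    then have "v x - v (x + h) = Q h x * (x - (x + h))" using h by (simp add: Q_def field_simps)
    then show ?thesis using that h by (intro exI[of _ "x + h"] exI[of _ x]) auto
  qed
  have n1: "negligible (Low p \<inter> Upp q)" if pq: "p < q" for p q
  proof -
    define m where "m = (p + q) / 2"
    define w where "w = (\<lambda>x. v x - m * x)"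
    show ?thesis
    proof (rule abs_cont_on_opposite_increments_negligible[of a b w _ "q - m"])
      show "abs_cont_on a b (\<lambda>x. complex_of_real (w x))"
      proof (rule abs_cont_on_comparison[OF ac, of 1 "\<bar>m\<bar>"])
        fix x y
        have "\<bar>w x - w y\<bar> \<le> \<bar>v x - v y\<bar> + \<bar>m * (x - y)\<bar>" by (simp add: w_def algebra_simps)
        then show "norm (complex_of_real (w x) - complex_of_real (w y))
            \<le> 1 * norm (complex_of_real (v x) - complex_of_real (v y)) + \<bar>m\<bar> * \<bar>x - y\<bar>"
          by (simp add: abs_mult flip: of_real_diff)
      qed auto
      show "Low p \<inter> Upp q \<in> sets lebesgue" using setsL setsU by auto
      show "Low p \<inter> Upp q \<subseteq> {a<..<b}" by (auto simp: Low_def)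
      show "0 < q - m" using pq by (simp add: m_def)
      fix x d :: real assume x: "x \<in> Low p \<inter> Upp q" and d: "0 < d"
      then have x': "x \<in> {a<..<b}" by (auto simp: Low_def)
      then have d': "min d (min (x - a) (b - x)) > 0" using d by auto
      have "\<exists>h. h \<noteq> 0 \<and> \<bar>h\<bar> < min d (min (x - a) (b - x)) \<and> Q h x > q"
        by (rule dest[OF _ d']) (use x in \<open>auto simp: Upp_def\<close>)
      then obtain h where h: "h \<noteq> 0" "\<bar>h\<bar> < min d (min (x - a) (b - x))" "Q h x > q" by blast
      obtain s t where st: "s < t" "x \<in> {s..t}" "t - s < d" "v t - v s = Q h x * (t - s)"
        using ival[OF h(1,2)] by blast
      have "w t - w s = (Q h x - m) * (t - s)" using st(4) by (simp add: w_def algebra_simps)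
      also have "\<dots> \<ge> (q - m) * (t - s)" using h(3) st(1) by (intro mult_right_mono) auto
      finally show "\<exists>s t. s < t \<and> x \<in> {s..t} \<and> t - s < d \<and> (q - m) * (t - s) \<le> w t - w s"
        using st by blast
      have "\<exists>h. h \<noteq> 0 \<and> \<bar>h\<bar> < min d (min (x - a) (b - x)) \<and> Q h x < p"
        by (rule dest[OF _ d']) (use x in \<open>auto simp: Low_def\<close>)
      then obtain h where h: "h \<noteq> 0" "\<bar>h\<bar> < min d (min (x - a) (b - x))" "Q h x < p" by blast
      obtain s t where st: "s < t" "x \<in> {s..t}" "t - s < d" "v t - v s = Q h x * (t - s)"
        using ival[OF h(1,2)] by blast
      have "w t - w s = (Q h x - m) * (t - s)" using st(4) by (simp add: w_def algebra_simps)
      also have "\<dots> \<le> 0" using h(3) st(1) pq by (intro mult_nonpos_nonneg) (auto simp: m_def)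
      finally show "\<exists>s t. s < t \<and> x \<in> {s..t} \<and> t - s < d \<and> w t - w s \<le> 0" using st by blast
    qed
  qed
  have n2: "negligible Unb"
    unfolding locally_negligible_alt[of Unb]
  proof
    fix x0 assume x0: "x0 \<in> Unb"
    obtain d where d: "d > 0" and D0: "\<forall>D. D division_of \<Union>D \<and> \<Union>D \<subseteq> {a..b} \<and>
        (\<Sum>K\<in>D. Sup K - Inf K) < d \<longrightarrow> (\<Sum>K\<in>D. norm (complex_of_real (v (Sup K)) - complex_of_real (v (Inf K)))) < 1"
      using abs_cont_onE[OF ac zero_less_one] .
    \<comment> \<open>The radius \<open>d / 4\<close> keeps every family of nonoverlapping intervals
      inside \<open>W\<close> below the total length \<open>d\<close> for which the variation is
      less than 1; this is why negligibility is checked locally.\<close>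
    define W where "W = {a<..<b} \<inter> ball x0 (d / 4)"
    define S where "S = Unb \<inter> ball x0 (d / 4)"
    have W: "open W" "S \<subseteq> W" by (auto simp: W_def S_def Unb_def)
    have Sm: "S \<in> lmeasurable" unfolding S_def
      using setsB by (intro bounded_set_imp_lmeasurable) (auto intro: bounded_subset[OF bounded_ball])
    have "negligible S"
    proof (rule ccontr)
      assume "\<not> negligible S"
      define m where "m = measure lebesgue S"
      have m: "m > 0" using \<open>\<not> negligible S\<close> Sm negligible_iff_measure0
        unfolding m_def by (metis measure_nonneg less_le)
      obtain k :: nat where k: "k > 2 / m" using reals_Archimedean2 by blast
      have "\<exists>D. D division_of \<Union>D \<and> \<Union>D \<subseteq> W \<and> (\<forall>K\<in>D. \<exists>s t. s < t \<and> K = {s..t} \<and> \<bar>v t - v s\<bar> \<ge> real k * (t - s))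
        \<and> measure lebesgue (S - \<Union>D) < m / 2 \<and> \<Union>D \<in> lmeasurable"
      proof (rule Vitali_finite_intervals[OF Sm W, where P="\<lambda>s t. \<bar>v t - v s\<bar> \<ge> real k * (t - s)"])
        fix x e :: real assume x: "x \<in> S" and e: "e > 0"
        then have e': "min e (min (x - a) (b - x)) > 0" by (auto simp: S_def Unb_def)
        have "\<exists>h. h \<noteq> 0 \<and> \<bar>h\<bar> < min e (min (x - a) (b - x)) \<and> \<bar>Q h x\<bar> > k"
          by (rule dest[OF _ e']) (use x in \<open>auto simp: S_def Unb_def\<close>)
        then obtain h where h: "h \<noteq> 0" "\<bar>h\<bar> < min e (min (x - a) (b - x))" "\<bar>Q h x\<bar> > k" by blast
        obtain s t where st: "s < t" "x \<in> {s..t}" "t - s < e" "v t - v s = Q h x * (t - s)"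
          using ival[OF h(1,2)] by blast
        have "\<bar>v t - v s\<bar> \<ge> real k * (t - s)"
          using h(3) st(1) unfolding st(4) by (simp add: abs_mult mult_right_mono)
        then show "\<exists>u w. u < w \<and> x \<in> {u..w} \<and> w - u < e \<and> real k * (w - u) \<le> \<bar>v w - v u\<bar>"
          using st by blast
      qed (use m in auto)
      then obtain D where D: "D division_of \<Union>D" "\<Union>D \<subseteq> W"
        and DP: "\<forall>K\<in>D. \<exists>s t. s < t \<and> K = {s..t} \<and> \<bar>v t - v s\<bar> \<ge> real k * (t - s)"
        and DS: "measure lebesgue (S - \<Union>D) < m / 2" and Dm: "\<Union>D \<in> lmeasurable"
        by (elim exE conjE) (rule that, auto)
      have Dab: "\<Union>D \<subseteq> {a..b}" using D(2) by (auto simp: W_def dest: subsetD)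
      have len: "(\<Sum>K\<in>D. Sup K - Inf K) = measure lebesgue (\<Union>D)"
        by (rule sum_lengths_division[OF D(1) Dab])
      have "measure lebesgue (\<Union>D) \<le> measure lebesgue (ball x0 (d / 4))"
        using D(2) Dm by (intro measure_mono_fmeasurable) (auto simp: W_def dest: fmeasurableD)
      also have "\<dots> = d / 2" using d by (simp add: ball_eq_greaterThanLessThan)
      finally have "(\<Sum>K\<in>D. Sup K - Inf K) < d" using len d by simp
      then have "(\<Sum>K\<in>D. \<bar>v (Sup K) - v (Inf K)\<bar>) < 1"
        using D0[rule_format, of D] D(1) Dab by (simp flip: of_real_diff)
      moreover have "(\<Sum>K\<in>D. \<bar>v (Sup K) - v (Inf K)\<bar>) \<ge> (\<Sum>K\<in>D. k * (Sup K - Inf K))"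
        by (rule sum_mono) (use DP in fastforce)
      moreover have "(\<Sum>K\<in>D. k * (Sup K - Inf K)) = k * measure lebesgue (\<Union>D)"
        by (simp add: len[symmetric] sum_distrib_left)
      moreover have "measure lebesgue (\<Union>D) \<ge> m / 2"
      proof -
        have "m \<le> measure lebesgue (\<Union>D \<union> (S - \<Union>D))" unfolding m_def
          using Sm Dm by (intro measure_mono_fmeasurable fmeasurable.Un fmeasurable.Diff) (auto dest: fmeasurableD)
        also have "\<dots> \<le> measure lebesgue (\<Union>D) + measure lebesgue (S - \<Union>D)"
          using Sm Dm by (intro measure_Un_le) (auto dest: fmeasurableD)
        finally show ?thesis using DS by simp
      qed
      then have "k * measure lebesgue (\<Union>D) \<ge> k * (m / 2)" by (intro mult_left_mono) auto
      moreover have "k * (m / 2) > 1" using k m by (simp add: field_simps)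
      ultimately show False by simp
    qed
    then show "\<exists>U. openin (top_of_set Unb) U \<and> x0 \<in> U \<and> negligible U"
      using x0 d by (intro exI[of _ S]) (auto simp: S_def)
  qed
  define PQ where "PQ = {(p,q). p \<in> \<rat> \<and> q \<in> \<rat> \<and> p < (q::real)}"
  have "countable PQ"
    by (rule countable_subset[OF _ countable_SIGMA[OF countable_rat countable_rat]]) (auto simp: PQ_def)
  define N where "N = (\<Union>(p,q)\<in>PQ. Low p \<inter> Upp q) \<union> Unb"
  have "negligible N"
    unfolding N_def using \<open>countable PQ\<close> n1 n2
    by (intro negligible_Un negligible_countable_Union) (auto simp: PQ_def)
  moreover have "v differentiable at x" if x: "x \<in> {a<..<b} - N" for x
  proof -
    let ?f = "\<lambda>h. ereal (Q h x)"
    have fr: "\<exists>h\<in>A n. P h" if "\<exists>\<^sub>F h in at 0. P h" for P n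
      using that unfolding frequently_at by (auto simp: A_def dest!: spec[of _ "1 / real (Suc n)"])
    have "x \<notin> Unb" using x by (auto simp: N_def)
    then obtain k n where kn: "\<And>h. h \<in> A n \<Longrightarrow> \<bar>Q h x\<bar> \<le> real (k::nat)"
      using x by (auto simp: Unb_def not_less)
    have ev: "\<forall>\<^sub>F h in at 0. \<bar>Q h x\<bar> \<le> k"
      unfolding eventually_at using kn by (intro exI[of _ "1 / real (Suc n)"]) (auto simp: A_def)
    have 1: "\<not> Liminf (at 0) ?f < Limsup (at 0) ?f"
    proof
      assume less: "Liminf (at 0) ?f < Limsup (at 0) ?f"
      obtain p' where p': "Liminf (at 0) ?f < ereal p'" "ereal p' < Limsup (at 0) ?f"
        using ereal_dense2[OF less] by blast
      obtain q' where q': "ereal p' < ereal q'" "ereal q' < Limsup (at 0) ?f"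
        using ereal_dense2[OF p'(2)] by blast
      have "p' < q'" using q' by simp
      then obtain p where p: "p \<in> \<rat>" "p' < p" "p < q'" using Rats_dense_in_real by blast
      obtain q where q: "q \<in> \<rat>" "p < q" "q < q'" using Rats_dense_in_real[OF p(3)] by blast
      have "\<exists>\<^sub>F h in at 0. Q h x < p"
      proof (rule ccontr)
        assume "\<not> ?thesis"
        then have "\<forall>\<^sub>F h in at 0. ereal p \<le> ?f h" by (simp add: not_frequently not_less)
        then have "ereal p \<le> Liminf (at 0) ?f" by (rule Liminf_bounded)
        then have "ereal p < ereal p'" using p'(1) by (rule le_less_trans)
        then show False using p by simp
      qed
      then have "x \<in> Low p" using x fr by (auto simp: Low_def)
      moreover have "\<exists>\<^sub>F h in at 0. Q h x > q"
      proof (rule ccontr)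
        assume "\<not> ?thesis"
        then have "\<forall>\<^sub>F h in at 0. ?f h \<le> ereal q" by (simp add: not_frequently not_less)
        then have "Limsup (at 0) ?f \<le> ereal q" by (rule Limsup_bounded)
        then have "ereal q' < ereal q" using q'(2) by (metis less_le_trans)
        then show False using q by simp
      qed
      then have "x \<in> Upp q" using x fr by (auto simp: Upp_def)
      ultimately show False using x p q by (auto simp: N_def PQ_def)
    qed
    have nt: "at (0::real) \<noteq> bot" by simp
    have eq: "Liminf (at 0) ?f = Limsup (at 0) ?f"
      using 1 Liminf_le_Limsup[OF nt, of ?f] by (simp add: order.order_iff_strict)
    have "ereal (- real k) \<le> Liminf (at 0) ?f"
      using ev by (intro Liminf_bounded) (auto elim!: eventually_mono)
    moreover have "Limsup (at 0) ?f \<le> ereal (real k)"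
      using ev by (intro Limsup_bounded) (auto elim!: eventually_mono)
    ultimately obtain l where l: "Liminf (at 0) ?f = ereal l"
      unfolding eq by (cases "Limsup (at 0) ?f") auto
    then have "(?f \<longlongrightarrow> ereal l) (at 0)"
      using eq by (intro tendsto_iff_Liminf_eq_Limsup[OF nt, THEN iffD2]) auto
    then have "((\<lambda>h. Q h x) \<longlongrightarrow> l) (at 0)" by simp
    moreover have "\<forall>\<^sub>F h in at 0. Q h x = (v (x + h) - v x) / h"
      unfolding eventually_at
      by (intro exI[of _ "min (x - a) (b - x)"]) (use x in \<open>auto simp: Q_def c_def min_def max_def dist_real_def\<close>)
    ultimately have "((\<lambda>h. (v (x + h) - v x) / h) \<longlongrightarrow> l) (at 0)"
      by (rule Lim_transform_eventually)
    then have "(v has_field_derivative l) (at x)" by (simp add: DERIV_def)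
    then show ?thesis using real_differentiable_def by blast
  qed
  ultimately show ?thesis by blast
qed

lemma abs_cont_on_differentiable:
  assumes ac: "abs_cont_on a b u"
  shows "\<exists>N. negligible N \<and> (\<forall>x\<in>{a<..<b} - N. u differentiable at x)"
proof -
  have "abs_cont_on a b (\<lambda>x. complex_of_real (Re (u x)))" "abs_cont_on a b (\<lambda>x. complex_of_real (Im (u x)))"
    by (rule abs_cont_on_comparison[OF ac, of 1 0];
        simp flip: of_real_diff minus_complex.sel add: abs_Re_le_cmod abs_Im_le_cmod)+
  then obtain N1 N2 where N: "negligible N1" "\<And>x. x \<in> {a<..<b} - N1 \<Longrightarrow> (\<lambda>x. Re (u x)) differentiable at x"
    "negligible N2" "\<And>x. x \<in> {a<..<b} - N2 \<Longrightarrow> (\<lambda>x. Im (u x)) differentiable at x"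
    by (metis abs_cont_on_differentiable_real)
  have "u differentiable at x" if x: "x \<in> {a<..<b} - (N1 \<union> N2)" for x
  proof -
    obtain r i where "((\<lambda>x. Re (u x)) has_vector_derivative r) (at x)" "((\<lambda>x. Im (u x)) has_vector_derivative i) (at x)"
      using N(2,4) x by (metis DiffD1 DiffD2 DiffI UnCI vector_derivative_works)
    then have "((\<lambda>x. complex_of_real (Re (u x)) + \<i> * complex_of_real (Im (u x))) has_vector_derivative
        (complex_of_real r + \<i> * complex_of_real i)) (at x)"
      by (intro has_vector_derivative_add has_vector_derivative_mult_right has_vector_derivative_of_real)
        (simp_all add: has_real_derivative_iff_has_vector_derivative)
    then show ?thesis
      by (simp flip: complex_eq add: differentiableI_vector)
  qed
  then show ?thesis using N(1,3) by (intro exI[of _ "N1 \<union> N2"]) auto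
qed

subsection \<open>Change of variables in the plane\<close>

text \<open>Both orders of the coordinates are recorded because absolute continuity is available on
  almost all horizontal and on almost all vertical lines, and null sets are found by Fubini in
  either direction.\<close>

lemma lborel_complex_distr:
  "(lborel :: complex measure) = distr lborel borel (\<lambda>(x, y). Complex x y)"
  "(lborel :: complex measure) = distr lborel borel (\<lambda>(y, x). Complex x y)"
proof -
  have m1: "(\<lambda>(x, y). Complex x y) \<in> borel_measurable borel"
    and m2: "(\<lambda>(y, x). Complex x y) \<in> borel_measurable borel"
    unfolding Complex_eq case_prod_beta by (intro borel_measurable_continuous_onI continuous_intros)+
  have box: "box l u = {z. Re l < Re z \<and> Re z < Re u \<and> Im l < Im z \<and> Im z < Im u}" for l u :: complex
    by (auto simp: in_box_complex_iff)
  have em: "emeasure lborel (box (Re l) (Re u) \<times> box (Im l) (Im u)) = ennreal ((Re u - Re l) * (Im u - Im l))"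
    "emeasure lborel (box (Im l) (Im u) \<times> box (Re l) (Re u)) = ennreal ((Re u - Re l) * (Im u - Im l))"
    if "Re l \<le> Re u" "Im l \<le> Im u" for l u
    using that by (simp_all add: lborel_prod[symmetric] lborel.emeasure_pair_measure_Times ennreal_mult mult.commute)
  show "(lborel :: complex measure) = distr lborel borel (\<lambda>(x, y). Complex x y)"
  proof (rule lborel_eqI)
    fix l u :: complex assume le: "\<And>b. b \<in> Basis \<Longrightarrow> l \<bullet> b \<le> u \<bullet> b"
    have lu: "Re l \<le> Re u" "Im l \<le> Im u"
      using le[of 1] le[of \<i>] by (auto simp: Basis_complex_def)
    have "(\<lambda>(x, y). Complex x y) -` box l u = box (Re l) (Re u) \<times> box (Im l) (Im u)"
      by (auto simp: box)
    then show "emeasure (distr lborel borel (\<lambda>(x, y). Complex x y)) (box l u) = ennreal (\<Prod>b\<in>Basis. (u - l) \<bullet> b)"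
      using lu em(1)[of l u] m1 by (simp add: emeasure_distr Basis_complex_def)
  qed simp
  show "(lborel :: complex measure) = distr lborel borel (\<lambda>(y, x). Complex x y)"
  proof (rule lborel_eqI)
    fix l u :: complex assume le: "\<And>b. b \<in> Basis \<Longrightarrow> l \<bullet> b \<le> u \<bullet> b"
    have lu: "Re l \<le> Re u" "Im l \<le> Im u"
      using le[of 1] le[of \<i>] by (auto simp: Basis_complex_def)
    have "(\<lambda>(y, x). Complex x y) -` box l u = box (Im l) (Im u) \<times> box (Re l) (Re u)"
      by (auto simp: box)
    then show "emeasure (distr lborel borel (\<lambda>(y, x). Complex x y)) (box l u) = ennreal (\<Prod>b\<in>Basis. (u - l) \<bullet> b)"
      using lu em(2)[of l u] m2 by (simp add: emeasure_distr Basis_complex_def)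
  qed simp
qed

lemma measurable_Complex_pair [measurable]:
  "(\<lambda>(x, y). Complex x y) \<in> borel_measurable (lborel :: (real \<times> real) measure)"
  "(\<lambda>(y, x). Complex x y) \<in> borel_measurable (lborel :: (real \<times> real) measure)"
  by (auto intro!: borel_measurable_continuous_onI continuous_intros simp: Complex_eq case_prod_beta)

lemma nn_integral_complex_iterated:
  fixes f :: "complex \<Rightarrow> ennreal"
  assumes f: "f \<in> borel_measurable borel"
  shows "(\<integral>\<^sup>+z. f z \<partial>lborel) = (\<integral>\<^sup>+x. \<integral>\<^sup>+y. f (Complex x y) \<partial>lborel \<partial>lborel)"
    and "(\<integral>\<^sup>+z. f z \<partial>lborel) = (\<integral>\<^sup>+y. \<integral>\<^sup>+x. f (Complex x y) \<partial>lborel \<partial>lborel)"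
proof -
  have 1: "(\<integral>\<^sup>+z. f z \<partial>lborel) = (\<integral>\<^sup>+p. f (case p of (x, y) \<Rightarrow> Complex x y) \<partial>lborel)"
    using f by (subst lborel_complex_distr(1)) (simp add: nn_integral_distr)
  have "(\<lambda>p. f (case p of (x, y) \<Rightarrow> Complex x y)) \<in> borel_measurable (lborel \<Otimes>\<^sub>M lborel)"
    using measurable_compose[OF measurable_Complex_pair(1) f] by (simp add: lborel_prod)
  from lborel.nn_integral_fst[OF this] 1
  show "(\<integral>\<^sup>+z. f z \<partial>lborel) = (\<integral>\<^sup>+x. \<integral>\<^sup>+y. f (Complex x y) \<partial>lborel \<partial>lborel)"
    by (simp add: lborel_prod)
  have 2: "(\<integral>\<^sup>+z. f z \<partial>lborel) = (\<integral>\<^sup>+p. f (case p of (y, x) \<Rightarrow> Complex x y) \<partial>lborel)"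
    using f by (subst lborel_complex_distr(2)) (simp add: nn_integral_distr)
  have "(\<lambda>p. f (case p of (y, x) \<Rightarrow> Complex x y)) \<in> borel_measurable (lborel \<Otimes>\<^sub>M lborel)"
    using measurable_compose[OF measurable_Complex_pair(2) f] by (simp add: lborel_prod)
  from lborel.nn_integral_fst[OF this] 2
  show "(\<integral>\<^sup>+z. f z \<partial>lborel) = (\<integral>\<^sup>+y. \<integral>\<^sup>+x. f (Complex x y) \<partial>lborel \<partial>lborel)"
    by (simp add: lborel_prod)
qed

lemma emeasure_complex_eq_0I:
  assumes N: "N \<in> sets borel"
    and "(AE x in lborel. AE y in lborel. Complex x y \<notin> N) \<or> (AE y in lborel. AE x in lborel. Complex x y \<notin> N)"
  shows "emeasure lborel N = 0"
proof -
  have mN: "(indicator N :: complex \<Rightarrow> ennreal) \<in> borel_measurable borel" using N by simp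
  have z: "AE x in M. (\<integral>\<^sup>+y. indicator N (g x y) \<partial>(lborel::real measure)) = (0::ennreal)" if "AE x in M. AE y in lborel. g x y \<notin> N"
    for M :: "real measure" and g :: "real \<Rightarrow> real \<Rightarrow> complex"
    using that
  proof (rule eventually_mono)
    fix x assume "AE y in lborel. g x y \<notin> N"
    then have "(\<integral>\<^sup>+y. indicator N (g x y) \<partial>(lborel::real measure)) = (\<integral>\<^sup>+y. (0::ennreal) \<partial>(lborel::real measure))"
      by (intro nn_integral_cong_AE) (auto elim!: eventually_mono)
    then show "(\<integral>\<^sup>+y. indicator N (g x y) \<partial>(lborel::real measure)) = (0::ennreal)" by simp
  qed
  have "(\<integral>\<^sup>+z. indicator N z \<partial>lborel) = (0::ennreal)"
    using assms(2)
  proof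
    assume "AE x in lborel. AE y in lborel. Complex x y \<notin> N"
    from z[OF this] show ?thesis
      unfolding nn_integral_complex_iterated(1)[OF mN] by (subst nn_integral_cong_AE[of _ "\<lambda>_. 0"]) auto
  next
    assume "AE y in lborel. AE x in lborel. Complex x y \<notin> N"
    from z[OF this] show ?thesis
      unfolding nn_integral_complex_iterated(2)[OF mN] by (subst nn_integral_cong_AE[of _ "\<lambda>_. 0"]) auto
  qed
  then show ?thesis using N by simp
qed

lemma integral_complex_iterated:
  fixes f :: "complex \<Rightarrow> real"
  assumes f: "integrable lborel f"
  shows "AE x in lborel. integrable lborel (\<lambda>y. f (Complex x y))"
    "(\<integral>z. f z \<partial>lborel) = (\<integral>x. \<integral>y. f (Complex x y) \<partial>lborel \<partial>lborel)"
    "AE y in lborel. integrable lborel (\<lambda>x. f (Complex x y))"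
    "(\<integral>z. f z \<partial>lborel) = (\<integral>y. \<integral>x. f (Complex x y) \<partial>lborel \<partial>lborel)"
proof -
  have fm: "f \<in> borel_measurable borel" using f borel_measurable_integrable by fastforce
  have i1: "integrable (lborel \<Otimes>\<^sub>M lborel) (\<lambda>p. f (case p of (x, y) \<Rightarrow> Complex x y))"
    using f by (subst (asm) lborel_complex_distr(1)) (simp add: integrable_distr_eq fm lborel_prod)
  have i2: "integrable (lborel \<Otimes>\<^sub>M lborel) (\<lambda>p. f (case p of (y, x) \<Rightarrow> Complex x y))"
    using f by (subst (asm) lborel_complex_distr(2)) (simp add: integrable_distr_eq fm lborel_prod)
  show "AE x in lborel. integrable lborel (\<lambda>y. f (Complex x y))"
    using lborel_pair.AE_integrable_fst'[OF i1] by simp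
  show "AE y in lborel. integrable lborel (\<lambda>x. f (Complex x y))"
    using lborel_pair.AE_integrable_fst'[OF i2] by simp
  have "(\<integral>z. f z \<partial>lborel) = (\<integral>p. f (case p of (x, y) \<Rightarrow> Complex x y) \<partial>lborel)"
    by (subst lborel_complex_distr(1)) (simp add: integral_distr fm)
  then show "(\<integral>z. f z \<partial>lborel) = (\<integral>x. \<integral>y. f (Complex x y) \<partial>lborel \<partial>lborel)"
    using lborel_pair.integral_fst'[OF i1] by (simp add: lborel_prod)
  have "(\<integral>z. f z \<partial>lborel) = (\<integral>p. f (case p of (y, x) \<Rightarrow> Complex x y) \<partial>lborel)"
    by (subst lborel_complex_distr(2)) (simp add: integral_distr fm)
  then show "(\<integral>z. f z \<partial>lborel) = (\<integral>y. \<integral>x. f (Complex x y) \<partial>lborel \<partial>lborel)"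
    using lborel_pair.integral_fst'[OF i2] by (simp add: lborel_prod)
qed

text \<open>Meant for the identification of \<open>complex\<close> with \<open>real^2\<close>: the
  change of variables formula is formulated with determinants of matrices, so integrals over the
  complex plane are carried to \<open>real^2\<close> and back. The hypotheses record that such a map
  preserves boxes, their contents and norms.\<close>

lemma has_integral_isometry:
  fixes f :: "'b::euclidean_space \<Rightarrow> 'c::banach" and g :: "'a::euclidean_space \<Rightarrow> 'b"
  assumes hg: "\<And>x. h (g x) = x" and gh: "\<And>x. g (h x) = x"
    and contg: "\<And>x. continuous (at x) g" and iso: "\<And>x. norm (h x) = norm x"
    and g: "\<And>u v. \<exists>w z. g ` cbox u v = cbox w z" and h: "\<And>u v. \<exists>w z. h ` cbox u v = cbox w z"
    and c: "\<And>u v. measure lborel (g ` cbox u v) = measure lborel (cbox u v)"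
    and f: "(f has_integral i) S"
  shows "((\<lambda>x. f (g x)) has_integral i) (h ` S)"
proof -
  define F where "F = (\<lambda>x. if x \<in> S then f x else 0)"
  have eq: "(\<lambda>x. if x \<in> h ` S then f (g x) else 0) = (\<lambda>x. F (g x))"
    using hg gh by (force simp: F_def fun_eq_iff image_iff)
  have box: "((\<lambda>x. F (g x)) has_integral j) (cbox a b)" if "(F has_integral j) (g ` cbox a b)" for a b j
  proof -
    obtain u v where uv: "g ` cbox a b = cbox u v" using g by blast
    have "h ` cbox u v = cbox a b" using hg by (force simp: uv[symmetric] image_image)
    then show ?thesis
      using has_integral_twiddle[of 1 h g, OF _ hg gh contg g h, of F j u v] c that uv by simp
  qed
  have Fi: "F integrable_on g ` cbox a b" for a b
    using f g[of a b] unfolding has_integral_alt'[of f] F_def by auto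
  show ?thesis
    unfolding has_integral_alt' eq
  proof (intro conjI allI impI)
    show "(\<lambda>x. F (g x)) integrable_on cbox a b" for a b
      using box Fi by (meson integrable_on_def)
    fix e :: real assume "e > 0"
    then obtain B where B: "B > 0" "\<And>a b. ball 0 B \<subseteq> cbox a b \<Longrightarrow> norm (integral (cbox a b) F - i) < e"
      using f unfolding has_integral_alt'[of f] F_def by blast
    have "norm (integral (cbox a b) (\<lambda>x. F (g x)) - i) < e" if ab: "ball 0 B \<subseteq> cbox a b" for a b
    proof -
      obtain u v where uv: "g ` cbox a b = cbox u v" using g by blast
      have "ball 0 B \<subseteq> cbox u v"
      proof
        fix y assume "y \<in> ball (0::'b) B"
        then have "h y \<in> cbox a b" using ab iso[of y] by (auto simp: subset_iff)
        then show "y \<in> cbox u v" using gh uv by (metis imageI)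
      qed
      then have "norm (integral (cbox u v) F - i) < e" by (rule B)
      moreover have "integral (cbox a b) (\<lambda>x. F (g x)) = integral (cbox u v) F"
        using box[OF integrable_integral[OF Fi]] uv by (metis integral_unique)
      ultimately show ?thesis by simp
    qed
    then show "\<exists>B>0. \<forall>a b. ball 0 B \<subseteq> cbox a b \<longrightarrow> norm (integral (cbox a b) (\<lambda>x. F (g x)) - i) < e"
      using B(1) by blast
  qed
qed

definition cvec :: "complex \<Rightarrow> real^2" where "cvec z = (\<chi> i. if i = 1 then Re z else Im z)"
definition vecc :: "real^2 \<Rightarrow> complex" where "vecc x = Complex (x $ 1) (x $ 2)"

lemma cvec_vecc [simp]: "cvec (vecc x) = x" "vecc (cvec z) = z"
  by (auto simp: cvec_def vecc_def vec_eq_iff) (metis exhaust_2)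

lemma cvec_components [simp]: "cvec z $ 1 = Re z" "cvec z $ 2 = Im z"
  by (auto simp: cvec_def)

lemma linear_cvec: "linear cvec" and linear_vecc: "linear vecc"
  by (auto intro!: linearI simp: cvec_def vecc_def vec_eq_iff complex_eq_iff)

lemma cbox_cvec: "cvec ` cbox u v = cbox (cvec u) (cvec v)" "vecc ` cbox x y = cbox (vecc x) (vecc y)"
proof -
  have 1: "cvec z \<in> cbox (cvec u) (cvec v) \<longleftrightarrow> z \<in> cbox u v" for z u v
    by (auto simp: mem_box_cart in_cbox_complex_iff forall_2)
  show "cvec ` cbox u v = cbox (cvec u) (cvec v)"
  proof (rule set_eqI)
    fix x
    have "x \<in> cvec ` cbox u v \<longleftrightarrow> vecc x \<in> cbox u v" by (metis cvec_vecc imageE imageI)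
    then show "x \<in> cvec ` cbox u v \<longleftrightarrow> x \<in> cbox (cvec u) (cvec v)" using 1[of "vecc x" u v] by simp
  qed
  show "vecc ` cbox x y = cbox (vecc x) (vecc y)"
  proof (rule set_eqI)
    fix z
    have "z \<in> vecc ` cbox x y \<longleftrightarrow> cvec z \<in> cbox x y" by (metis cvec_vecc imageE imageI)
    then show "z \<in> vecc ` cbox x y \<longleftrightarrow> z \<in> cbox (vecc x) (vecc y)" using 1[of z "vecc x" "vecc y"] by simp
  qed
qed

lemma norm_cvec: "norm (cvec z) = norm z" "norm (vecc x) = norm x"
  by (simp_all add: norm_vec_def L2_set_def sum_2 cmod_def vecc_def cvec_def)

lemma content_cvec: "measure lborel (cvec ` cbox u v) = measure lborel (cbox u v)"
proof (cases "cbox u v = {}")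
  case False
  moreover from this have "cbox (cvec u) (cvec v) \<noteq> {}" by (metis cbox_cvec(1) image_is_empty)
  ultimately show ?thesis
    unfolding cbox_cvec by (simp add: content_cbox_cart UNIV_2 content_cbox' Basis_complex_def)
qed simp

lemma content_vecc: "measure lborel (vecc ` cbox x y) = measure lborel (cbox x y)"
  using content_cvec[of "vecc x" "vecc y"] by (simp add: cbox_cvec)

lemma has_integral_vecc:
  fixes f :: "complex \<Rightarrow> 'c::banach"
  shows "(f has_integral i) S \<longleftrightarrow> ((\<lambda>x. f (vecc x)) has_integral i) (cvec ` S)"
proof
  assume "(f has_integral i) S"
  then show "((\<lambda>x. f (vecc x)) has_integral i) (cvec ` S)"
    by (rule has_integral_isometry[rotated -1])
      (auto simp: norm_cvec cbox_cvec content_vecc content_vecc[unfolded cbox_cvec] linear_continuous_at linear_conv_bounded_linear[THEN iffD1, OF linear_vecc])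
next
  assume "((\<lambda>x. f (vecc x)) has_integral i) (cvec ` S)"
  then have "((\<lambda>z. f (vecc (cvec z))) has_integral i) (vecc ` cvec ` S)"
    by (rule has_integral_isometry[rotated -1])
      (auto simp: norm_cvec cbox_cvec content_cvec content_cvec[unfolded cbox_cvec] linear_continuous_at linear_conv_bounded_linear[THEN iffD1, OF linear_cvec])
  then show "(f has_integral i) S" by (simp add: image_image)
qed

lemma absolutely_integrable_vecc:
  fixes f :: "complex \<Rightarrow> real"
  shows "f absolutely_integrable_on S \<longleftrightarrow> (\<lambda>x. f (vecc x)) absolutely_integrable_on (cvec ` S)"
    and "integral S f = integral (cvec ` S) (\<lambda>x. f (vecc x))"
proof -
  have "f integrable_on S \<longleftrightarrow> (\<lambda>x. f (vecc x)) integrable_on (cvec ` S)" for f :: "complex \<Rightarrow> real"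
    unfolding integrable_on_def using has_integral_vecc by blast
  from this[of f] this[of "\<lambda>x. norm (f x)"]
  show "f absolutely_integrable_on S \<longleftrightarrow> (\<lambda>x. f (vecc x)) absolutely_integrable_on (cvec ` S)"
    by (simp add: absolutely_integrable_on_def)
  show "integral S f = integral (cvec ` S) (\<lambda>x. f (vecc x))"
    unfolding integral_def integrable_on_def using has_integral_vecc[of f _ S] by simp
qed

text \<open>\<open>J\<close> is the determinant of the real-linear map \<open>g' z\<close>, whose
  columns are the images of 1 and \<i>. Stated as an equivalence, the formula transfers
  integrability together with the value of the integral.\<close>

theorem complex_change_of_variables:
  fixes f :: "complex \<Rightarrow> real" and g :: "complex \<Rightarrow> complex"
  assumes S: "S \<in> sets borel"
    and der: "\<And>z. z \<in> S \<Longrightarrow> (g has_derivative g' z) (at z within S)"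
    and inj: "inj_on g S"
    and J: "\<And>z. z \<in> S \<Longrightarrow> J z = Re (g' z 1) * Im (g' z \<i>) - Im (g' z 1) * Re (g' z \<i>)"
  shows "(\<lambda>z. \<bar>J z\<bar> * f (g z)) absolutely_integrable_on S \<and> integral S (\<lambda>z. \<bar>J z\<bar> * f (g z)) = b
    \<longleftrightarrow> f absolutely_integrable_on g ` S \<and> integral (g ` S) f = b"
proof -
  define G where "G = (\<lambda>x. cvec (g (vecc x)))"
  define G' where "G' = (\<lambda>x w. cvec (g' (vecc x) (vecc w)))"
  define T where "T = cvec ` S"
  \<comment> \<open>Real values are wrapped as vectors of \<open>real^1\<close>, the form of
    integrand to which the change of variables theorem for \<open>real^2\<close> is applied.\<close>
  define F where "F = (\<lambda>x. vec (f (vecc x)) :: real^1)"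
  have bl: "bounded_linear cvec" "bounded_linear vecc"
    using linear_cvec linear_vecc linear_conv_bounded_linear by blast+
  have T_eq: "T = vecc -` S" unfolding T_def by (auto simp: image_iff) (metis cvec_vecc(1))
  have "vecc \<in> borel_measurable borel"
    by (intro borel_measurable_continuous_onI linear_continuous_on bl)
  then have Tb: "T \<in> sets borel" unfolding T_eq using measurable_sets[of vecc borel borel S] S by simp
  have d: "(G has_derivative G' x) (at x within T)" if "x \<in> T" for x
  proof -
    have "vecc x \<in> S" using that T_eq by blast
    have im: "vecc ` T = S" by (simp add: T_def image_image)
    have "((\<lambda>x. g (vecc x)) has_derivative (\<lambda>w. g' (vecc x) (vecc w))) (at x within T)"
      using has_derivative_in_compose[OF bounded_linear_imp_has_derivative[OF bl(2)], of g "g' (vecc x)" x T]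
        der[OF \<open>vecc x \<in> S\<close>] unfolding im .
    then show ?thesis unfolding G_def G'_def by (rule bounded_linear.has_derivative[OF bl(1)])
  qed
  have det: "det (matrix (G' x)) = J (vecc x)" if "x \<in> T" for x
  proof -
    have "vecc (axis 1 1) = 1" "vecc (axis 2 1) = \<i>" by (auto simp: vecc_def axis_def complex_eq_iff)
    then show ?thesis using J[of "vecc x"] that T_eq by (simp add: det_2 matrix_def G'_def)
  qed
  have injG: "inj_on G T" using inj unfolding inj_on_def G_def T_def by (metis cvec_vecc(2) imageE)
  have GT: "G ` T = cvec ` (g ` S)" by (simp add: G_def T_def image_image)
  have vi: "(\<lambda>x. vec (k x) :: real^1) absolutely_integrable_on A \<longleftrightarrow> k absolutely_integrable_on A"
    for k :: "real^2 \<Rightarrow> real" and A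
    by (simp add: absolutely_integrable_componentwise_iff[where f="\<lambda>x. vec (k x) :: real^1"] Basis_vec_def inner_axis)
  have vint: "integral A (\<lambda>x. vec (k x) :: real^1) = vec (integral A k)" if "k absolutely_integrable_on A"
    for k :: "real^2 \<Rightarrow> real" and A
  proof -
    have "linear (vec :: real \<Rightarrow> real^1)" by (auto intro!: linearI simp: vec_eq_iff)
    then have "bounded_linear (vec :: real \<Rightarrow> real^1)" using linear_conv_bounded_linear by blast
    from integral_linear[OF set_lebesgue_integral_eq_integral(1)[OF that] this] show ?thesis by (simp add: o_def)
  qed
  have main: "(\<lambda>x. \<bar>det (matrix (G' x))\<bar> *\<^sub>R F (G x)) absolutely_integrable_on T \<and>
      integral T (\<lambda>x. \<bar>det (matrix (G' x))\<bar> *\<^sub>R F (G x)) = vec b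
      \<longleftrightarrow> F absolutely_integrable_on G ` T \<and> integral (G ` T) F = vec b"
    using Tb by (intro has_absolute_integral_change_of_variables d injG) auto
  have e1: "\<bar>det (matrix (G' x))\<bar> *\<^sub>R F (G x) = vec (\<bar>J (vecc x)\<bar> * f (g (vecc x)))" if "x \<in> T" for x
    using det[OF that] by (simp add: F_def G_def vec_eq_iff)
  have e2: "(\<lambda>x. \<bar>det (matrix (G' x))\<bar> *\<^sub>R F (G x)) absolutely_integrable_on T
      \<longleftrightarrow> (\<lambda>x. vec (\<bar>J (vecc x)\<bar> * f (g (vecc x))) :: real^1) absolutely_integrable_on T"
    by (rule set_integrable_cong[OF refl refl e1])
  have e3: "integral T (\<lambda>x. \<bar>det (matrix (G' x))\<bar> *\<^sub>R F (G x)) = integral T (\<lambda>x. vec (\<bar>J (vecc x)\<bar> * f (g (vecc x))))"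
    by (rule integral_cong[OF e1])
  have veq: "(\<lambda>x. vec (k x) :: real^1) absolutely_integrable_on A \<and> integral A (\<lambda>x. vec (k x) :: real^1) = vec b
      \<longleftrightarrow> k absolutely_integrable_on A \<and> integral A k = b" for k :: "real^2 \<Rightarrow> real" and A
    by (cases "k absolutely_integrable_on A") (simp_all add: vi vint vec_eq_iff)
  define L where "L = (\<lambda>z. \<bar>J z\<bar> * f (g z))"
  have m2: "(\<lambda>x. L (vecc x)) absolutely_integrable_on T \<and> integral T (\<lambda>x. L (vecc x)) = b
      \<longleftrightarrow> (\<lambda>x. f (vecc x)) absolutely_integrable_on cvec ` (g ` S) \<and> integral (cvec ` (g ` S)) (\<lambda>x. f (vecc x)) = b"
    using main[unfolded e2 e3, unfolded F_def veq GT] unfolding L_def .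
  have "L absolutely_integrable_on S \<and> integral S L = b
      \<longleftrightarrow> (\<lambda>x. L (vecc x)) absolutely_integrable_on T \<and> integral T (\<lambda>x. L (vecc x)) = b"
    using absolutely_integrable_vecc(1)[of S L] absolutely_integrable_vecc(2)[of S L] unfolding T_def by simp
  also note m2
  also have "(\<lambda>x. f (vecc x)) absolutely_integrable_on cvec ` (g ` S) \<and> integral (cvec ` (g ` S)) (\<lambda>x. f (vecc x)) = b
      \<longleftrightarrow> f absolutely_integrable_on g ` S \<and> integral (g ` S) f = b"
    using absolutely_integrable_vecc(1)[of "g ` S" f] absolutely_integrable_vecc(2)[of "g ` S" f] by simp
  finally show ?thesis unfolding L_def .
qed

subsection \<open>Differentiability and energy of quasiconformal maps\<close>

definition diffquot :: "(complex \<Rightarrow> complex) \<Rightarrow> complex \<Rightarrow> real \<Rightarrow> complex \<Rightarrow> complex" where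
  "diffquot h v s z = (h (z + of_real s * v) - h z) / of_real s"

lemma has_vector_derivative_iff_diffquot:
  "((\<lambda>t. h (z + of_real t * v)) has_vector_derivative l) (at 0) \<longleftrightarrow> ((\<lambda>s. diffquot h v s z) \<longlongrightarrow> l) (at 0)"
proof -
  have "((\<lambda>t. h (z + of_real t * v)) has_vector_derivative l) (at 0) \<longleftrightarrow>
      ((\<lambda>s. norm (h (z + of_real s * v) - h z - s *\<^sub>R l) / norm s) \<longlongrightarrow> 0) (at 0)"
    unfolding has_vector_derivative_def has_derivative_at by (simp add: bounded_linear_scaleR_left)
  also have "\<dots> \<longleftrightarrow> ((\<lambda>s. norm (diffquot h v s z - l)) \<longlongrightarrow> 0) (at 0)"
  proof (rule filterlim_cong[OF refl refl], unfold eventually_at, intro exI[of _ 1] conjI ballI impI)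
    fix s :: real assume "s \<noteq> 0 \<and> dist s 0 < 1"
    then have "diffquot h v s z - l = (h (z + of_real s * v) - h z - s *\<^sub>R l) / of_real s"
      by (simp add: diffquot_def scaleR_conv_of_real field_simps)
    then show "norm (h (z + of_real s * v) - h z - s *\<^sub>R l) / norm s = norm (diffquot h v s z - l)"
      by (simp add: norm_divide)
  qed simp
  also have "\<dots> \<longleftrightarrow> ((\<lambda>s. diffquot h v s z) \<longlongrightarrow> l) (at 0)"
    by (simp add: tendsto_norm_zero_iff LIM_zero_iff)
  finally show ?thesis .
qed

locale continuous_box_map =
  fixes h :: "complex \<Rightarrow> complex" and a b c e :: real
  assumes ab: "a < b" and ce: "c < e"
    and cont: "continuous_on (cbox (Complex a c) (Complex b e)) h"
begin

definition Q where "Q = cbox (Complex a c) (Complex b e)"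

definition inner_box :: "nat \<Rightarrow> complex set" where
  "inner_box m = cbox (Complex (a + 1 / Suc m) (c + 1 / Suc m)) (Complex (b - 1 / Suc m) (e - 1 / Suc m))"

text \<open>Existence of the directional derivative as a Cauchy condition on difference quotients.
  Each single condition is closed by continuity of \<open>h\<close>, which gives measurability at
  once, and the inner box keeps the shifted points inside \<open>Q\<close>.\<close>

definition Osc :: "complex \<Rightarrow> nat \<Rightarrow> nat \<Rightarrow> complex set" where
  "Osc v k m = {z \<in> inner_box m. \<forall>s t. s \<noteq> 0 \<and> \<bar>s\<bar> < 1 / Suc m \<and> t \<noteq> 0 \<and> \<bar>t\<bar> < 1 / Suc m \<longrightarrow>
     norm (diffquot h v s z - diffquot h v t z) \<le> 1 / Suc k}"

definition Good :: "complex \<Rightarrow> complex set" where "Good v = (\<Inter>k. \<Union>m. Osc v k m)"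

definition Dq :: "complex \<Rightarrow> complex \<Rightarrow> complex" where "Dq v z = Lim (at 0) (\<lambda>s. diffquot h v s z)"

lemma inner_box_shift:
  assumes "z \<in> inner_box m" "\<bar>s\<bar> < 1 / Suc m" "v \<in> {1, \<i>}"
  shows "z + of_real s * v \<in> Q"
  using assms by (auto simp: inner_box_def Q_def in_cbox_complex_iff abs_less_iff)

lemma inner_box_subset: "inner_box m \<subseteq> box (Complex a c) (Complex b e)"
proof
  fix z assume z: "z \<in> inner_box m"
  have "1 / real (Suc m) > 0" by simp
  then show "z \<in> box (Complex a c) (Complex b e)"
    using z unfolding inner_box_def in_cbox_complex_iff in_box_complex_iff complex.sel atLeastAtMost_iff greaterThanLessThan_iff by linarith
qed

lemma box_subset_Q: "box (Complex a c) (Complex b e) \<subseteq> Q"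
  unfolding Q_def by (rule box_subset_cbox)

lemma inner_box_mono: "m \<le> m' \<Longrightarrow> inner_box m \<subseteq> inner_box m'"
proof
  fix z assume m: "m \<le> m'" and z: "z \<in> inner_box m"
  have "1 / real (Suc m') \<le> 1 / real (Suc m)" using m by (simp add: frac_le)
  then show "z \<in> inner_box m'"
    using z unfolding inner_box_def in_cbox_complex_iff complex.sel atLeastAtMost_iff by linarith
qed

lemma continuous_on_diffquot:
  assumes "\<bar>s\<bar> < 1 / Suc m" "v \<in> {1, \<i>}"
  shows "continuous_on (inner_box m) (diffquot h v s)"
proof -
  have "continuous_on (inner_box m) (\<lambda>z. h (z + of_real s * v))"
    by (rule continuous_on_compose2[OF cont])
      (use inner_box_shift assms in \<open>auto simp: Q_def intro!: continuous_intros\<close>)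
  moreover have "continuous_on (inner_box m) h"
    by (rule continuous_on_subset[OF cont]) (use inner_box_subset box_subset_Q in \<open>auto simp: Q_def\<close>)
  ultimately show ?thesis
    unfolding diffquot_def[abs_def] divide_inverse by (intro continuous_intros)
qed

lemma closed_Osc:
  assumes v: "v \<in> {1, \<i>}"
  shows "closed (Osc v k m)"
proof -
  have ib: "closed (inner_box m)" unfolding inner_box_def by (rule closed_cbox)
  define A where "A = {(s, t). s \<noteq> 0 \<and> \<bar>s\<bar> < 1 / Suc m \<and> t \<noteq> 0 \<and> \<bar>t\<bar> < 1 / Suc m}"
  have "Osc v k m = inner_box m \<inter> (\<Inter>(s,t)\<in>A. {z \<in> inner_box m. norm (diffquot h v s z - diffquot h v t z) \<le> 1 / Suc k})"
    by (auto simp: Osc_def A_def)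
  moreover have "closed {z \<in> inner_box m. norm (diffquot h v s z - diffquot h v t z) \<le> 1 / Suc k}" if "(s,t) \<in> A" for s t
    using that v by (intro continuous_on_closed_Collect_le continuous_intros continuous_on_diffquot)
      (auto simp: A_def ib)
  ultimately show ?thesis using ib by (auto intro!: closed_Int closed_INT)
qed

lemma Osc_mono: "m \<le> m' \<Longrightarrow> Osc v k m \<subseteq> Osc v k m'"
proof
  fix z assume m: "m \<le> m'" and z: "z \<in> Osc v k m"
  have "1 / real (Suc m') \<le> 1 / real (Suc m)" using m by (simp add: frac_le)
  then show "z \<in> Osc v k m'"
    using z inner_box_mono[OF m] unfolding Osc_def by (auto intro: less_le_trans)
qed

lemma Good_subset: "Good v \<subseteq> box (Complex a c) (Complex b e)"
proof
  fix z assume "z \<in> Good v"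
  then obtain m where "z \<in> Osc v 0 m" unfolding Good_def by blast
  then show "z \<in> box (Complex a c) (Complex b e)" using inner_box_subset unfolding Osc_def by blast
qed

lemma sets_Good: "v \<in> {1, \<i>} \<Longrightarrow> Good v \<in> sets borel"
  unfolding Good_def by (intro sets.countable_INT'' sets.countable_UN'' borel_closed closed_Osc) auto

lemma GoodI:
  assumes z: "z \<in> box (Complex a c) (Complex b e)"
    and l: "((\<lambda>s. diffquot h v s z) \<longlongrightarrow> l) (at 0)"
  shows "z \<in> Good v"
  unfolding Good_def
proof (intro INT_I UN_iff[THEN iffD2])
  fix k :: nat
  have "1 / (2 * real (Suc k)) > 0" by simp
  then obtain d where d: "d > 0" "\<And>s. s \<noteq> 0 \<Longrightarrow> \<bar>s\<bar> < d \<Longrightarrow> norm (diffquot h v s z - l) < 1 / (2 * real (Suc k))"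
    using l unfolding LIM_def by (metis dist_0_norm dist_norm dist_commute real_norm_def)
  define r where "r = Min {d, Re z - a, b - Re z, Im z - c, e - Im z}"
  have "r > 0" using d z by (auto simp: r_def in_box_complex_iff)
  then obtain m where m: "1 / real (Suc m) < r" by (meson nat_approx_posE)
  have le: "1 / real (Suc m) \<le> d" "1 / real (Suc m) \<le> Re z - a" "1 / real (Suc m) \<le> b - Re z"
    "1 / real (Suc m) \<le> Im z - c" "1 / real (Suc m) \<le> e - Im z"
    using m by (auto simp: r_def)
  have "z \<in> Osc v k m" unfolding Osc_def
  proof (intro CollectI conjI allI impI)
    show "z \<in> inner_box m" using le by (auto simp: inner_box_def in_cbox_complex_iff)
    fix s t :: real
    assume st: "s \<noteq> 0 \<and> \<bar>s\<bar> < 1 / real (Suc m) \<and> t \<noteq> 0 \<and> \<bar>t\<bar> < 1 / real (Suc m)"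
    have "norm (diffquot h v s z - l) < 1 / (2 * real (Suc k))" "norm (diffquot h v t z - l) < 1 / (2 * real (Suc k))"
      using d(2)[of s] d(2)[of t] st le(1) by auto
    moreover have "1 / (2 * real (Suc k)) + 1 / (2 * real (Suc k)) = 1 / real (Suc k)" by (simp add: field_simps)
    ultimately show "norm (diffquot h v s z - diffquot h v t z) \<le> 1 / real (Suc k)"
      using norm_triangle_ineq4[of "diffquot h v s z - l" "diffquot h v t z - l"] by simp
  qed
  then show "\<exists>m\<in>UNIV. z \<in> Osc v k m" by blast
qed

lemma
  assumes z: "z \<in> Good v"
  shows Good_Lim: "((\<lambda>s. diffquot h v s z) \<longlongrightarrow> Dq v z) (at 0)"
    and Osc_Dq: "z \<in> Osc v k m \<Longrightarrow> s \<noteq> 0 \<Longrightarrow> \<bar>s\<bar> < 1 / Suc m \<Longrightarrow> norm (diffquot h v s z - Dq v z) \<le> 1 / Suc k"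
proof -
  define q where "q = (\<lambda>n. diffquot h v (1 / real (Suc n)) z)"
  have osc: "norm (diffquot h v s z - diffquot h v t z) \<le> 1 / Suc k"
    if "z \<in> Osc v k m" "s \<noteq> 0" "\<bar>s\<bar> < 1 / Suc m" "t \<noteq> 0" "\<bar>t\<bar> < 1 / Suc m" for k m s t
    using that by (auto simp: Osc_def)
  have ex: "\<exists>m. z \<in> Osc v k m" for k using z by (auto simp: Good_def)
  have "Cauchy q"
  proof (rule metric_CauchyI)
    fix r :: real assume "r > 0"
    then obtain k where k: "1 / real (Suc k) < r" by (meson nat_approx_posE)
    obtain m where m: "z \<in> Osc v k m" using ex by blast
    have "dist (q i) (q j) < r" if "i \<ge> Suc m" "j \<ge> Suc m" for i j
      unfolding q_def dist_norm using that k
      by (intro le_less_trans[OF osc[OF m]]) (auto simp: frac_less2)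
    then show "\<exists>M. \<forall>i\<ge>M. \<forall>j\<ge>M. dist (q i) (q j) < r" by blast
  qed
  then obtain l where l: "q \<longlonglongrightarrow> l" using Cauchy_convergent convergent_def by blast
  have bound: "norm (diffquot h v s z - l) \<le> 1 / Suc k"
    if "z \<in> Osc v k m" "s \<noteq> 0" "\<bar>s\<bar> < 1 / Suc m" for k m s
  proof (rule LIMSEQ_le_const2)
    show "(\<lambda>n. norm (diffquot h v s z - q n)) \<longlonglongrightarrow> norm (diffquot h v s z - l)"
      by (intro tendsto_intros l)
    show "\<exists>N. \<forall>n\<ge>N. norm (diffquot h v s z - q n) \<le> 1 / Suc k"
      unfolding q_def by (intro exI[of _ "Suc m"] allI impI osc[OF that]) (auto simp: frac_less2)
  qed
  have lim: "((\<lambda>s. diffquot h v s z) \<longlongrightarrow> l) (at 0)"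
  proof (rule LIM_I)
    fix r :: real assume "r > 0"
    then obtain k where k: "1 / real (Suc k) < r" by (meson nat_approx_posE)
    obtain m where m: "z \<in> Osc v k m" using ex by blast
    have "norm (diffquot h v s z - l) < r" if "s \<noteq> 0 \<and> norm (s - 0) < 1 / real (Suc m)" for s
      using bound[OF m, of s] that k by simp
    then show "\<exists>s>0. \<forall>x. x \<noteq> 0 \<and> norm (x - 0) < s \<longrightarrow> norm (diffquot h v x z - l) < r"
      by (intro exI[of _ "1 / real (Suc m)"]) auto
  qed
  then have Dl: "Dq v z = l" unfolding Dq_def by (intro tendsto_Lim) auto
  show "((\<lambda>s. diffquot h v s z) \<longlongrightarrow> Dq v z) (at 0)" using lim Dl by simp
  show "z \<in> Osc v k m \<Longrightarrow> s \<noteq> 0 \<Longrightarrow> \<bar>s\<bar> < 1 / Suc m \<Longrightarrow> norm (diffquot h v s z - Dq v z) \<le> 1 / Suc k"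
    using bound Dl by simp
qed

text \<open>Egorov: outside a set of small measure the difference quotients converge uniformly. On such
  a set the partial derivatives are continuous and \<open>h\<close> is differentiable within it, because a corner
  of the rectangle spanned by two of its points may be reached from either of them.\<close>

lemma differentiable_within_Osc:
  assumes E: "E \<subseteq> Good 1 \<inter> Good \<i>" and m: "\<And>k. E \<subseteq> Osc 1 k (m1 k)" "\<And>k. E \<subseteq> Osc \<i> k (m2 k)"
    and z0: "z0 \<in> E"
  shows "(h has_derivative (\<lambda>w. of_real (Re w) * Dq 1 z0 + of_real (Im w) * Dq \<i> z0)) (at z0 within E)"
  unfolding has_derivative_within_alt
proof (intro conjI allI impI)
  show "bounded_linear (\<lambda>w. of_real (Re w) * Dq 1 z0 + of_real (Im w) * Dq \<i> z0)"
    by (intro bounded_linear_add bounded_linear_mult_const bounded_linear_compose[OF bounded_linear_of_real]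
        bounded_linear_Re bounded_linear_Im)
  fix r :: real assume r: "r > 0"
  \<comment> \<open>The error is at most \<open>\<kappa>\<close> for each of the two legs and
    \<open>3 * \<kappa>\<close> for replacing \<open>Dq 1 z\<close> by \<open>Dq 1 z0\<close>, hence
    the factor 5.\<close>
  then obtain k where k: "1 / real (Suc k) < r / 5" by (metis nat_approx_posE divide_pos_pos zero_less_numeral)
  define \<kappa> where "\<kappa> = 1 / real (Suc k)"
  have \<kappa>: "\<kappa> > 0" "5 * \<kappa> < r" using k by (auto simp: \<kappa>_def)
  \<comment> \<open>One fixed step: the quotient with step \<open>s0\<close> is continuous in the
    point and within \<open>\<kappa>\<close> of \<open>Dq 1\<close> on \<open>E\<close>, which
    bounds the variation of \<open>Dq 1\<close> near \<open>z0\<close>.\<close>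
  define s0 where "s0 = 1 / real (Suc (Suc (m1 k)))"
  have s0: "s0 \<noteq> 0" "\<bar>s0\<bar> < 1 / Suc (m1 k)" by (auto simp: s0_def frac_less2)
  have z0b: "z0 \<in> inner_box (m1 k)" using m(1)[of k] z0 by (auto simp: Osc_def)
  obtain d0 where d0: "d0 > 0" "\<And>z. z \<in> inner_box (m1 k) \<Longrightarrow> dist z z0 < d0 \<Longrightarrow> dist (diffquot h 1 s0 z) (diffquot h 1 s0 z0) < \<kappa>"
    using continuous_on_diffquot[OF s0(2), of 1] z0b \<kappa>(1) unfolding continuous_on_iff by (metis insertI1)
  define d where "d = Min {d0, 1 / real (Suc (m1 k)), 1 / real (Suc (m2 k))}"
  have d: "d > 0" "d \<le> d0" "d \<le> 1 / real (Suc (m1 k))" "d \<le> 1 / real (Suc (m2 k))" using d0 by (auto simp: d_def)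
  have "norm (h z - h z0 - (of_real (Re (z - z0)) * Dq 1 z0 + of_real (Im (z - z0)) * Dq \<i> z0)) \<le> r * norm (z - z0)"
    if z: "z \<in> E" "norm (z - z0) < d" for z
  proof -
    define s where "s = Re (z - z0)"
    define t where "t = Im (z - z0)"
    have st: "\<bar>s\<bar> \<le> norm (z - z0)" "\<bar>t\<bar> \<le> norm (z - z0)"
      by (auto simp: s_def t_def abs_Re_le_cmod abs_Im_le_cmod simp del: minus_complex.sel)
    define w where "w = z0 + of_real t * \<i>"
    have zw: "w = z + of_real (- s) * 1" by (simp add: w_def s_def t_def complex_eq_iff)
    have 1: "norm (h z - h w - of_real s * Dq 1 z) \<le> \<kappa> * \<bar>s\<bar>"
    proof (cases "s = 0")
      case True then show ?thesis using zw by simp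
    next
      case False
      have A: "norm (diffquot h 1 (- s) z - Dq 1 z) \<le> \<kappa>" unfolding \<kappa>_def
        using z E m(1)[of k] False st d by (intro Osc_Dq[of z 1 k "m1 k"]) auto
      moreover have "h z - h w - of_real s * Dq 1 z = of_real s * (diffquot h 1 (- s) z - Dq 1 z)"
        unfolding diffquot_def zw[symmetric] using False by (simp add: field_simps)
      ultimately show ?thesis using mult_left_mono[OF A, of "\<bar>s\<bar>"] by (simp add: norm_mult mult.commute)
    qed
    have 2: "norm (h w - h z0 - of_real t * Dq \<i> z0) \<le> \<kappa> * \<bar>t\<bar>"
    proof (cases "t = 0")
      case True then show ?thesis by (simp add: w_def)
    next
      case False
      have A: "norm (diffquot h \<i> t z0 - Dq \<i> z0) \<le> \<kappa>" unfolding \<kappa>_def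
        using z z0 E m(2)[of k] False st d by (intro Osc_Dq[of z0 \<i> k "m2 k"]) auto
      moreover have "h w - h z0 - of_real t * Dq \<i> z0 = of_real t * (diffquot h \<i> t z0 - Dq \<i> z0)"
        unfolding diffquot_def w_def using False by (simp add: field_simps)
      ultimately show ?thesis using mult_left_mono[OF A, of "\<bar>t\<bar>"] by (simp add: norm_mult mult.commute)
    qed
    have 3: "norm (Dq 1 z - Dq 1 z0) \<le> 3 * \<kappa>"
    proof -
      have zb: "z \<in> inner_box (m1 k)" using m(1)[of k] z by (auto simp: Osc_def)
      have "norm (diffquot h 1 s0 z - Dq 1 z) \<le> \<kappa>" "norm (diffquot h 1 s0 z0 - Dq 1 z0) \<le> \<kappa>"
        unfolding \<kappa>_def using Osc_Dq[of z 1 k "m1 k" s0] Osc_Dq[of z0 1 k "m1 k" s0] z z0 E m(1)[of k] s0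
        by auto
      moreover have "norm (diffquot h 1 s0 z - diffquot h 1 s0 z0) \<le> \<kappa>"
        using d0(2)[OF zb] z d by (auto simp: dist_norm)
      moreover have "Dq 1 z - Dq 1 z0 = (diffquot h 1 s0 z - diffquot h 1 s0 z0) -
          (diffquot h 1 s0 z - Dq 1 z) + (diffquot h 1 s0 z0 - Dq 1 z0)" by simp
      moreover have "norm (x - y + w) \<le> norm x + norm y + norm w" for x y w :: complex
        by (intro norm_triangle_mono norm_triangle_ineq4) auto
      ultimately show ?thesis
        by (smt (verit))
    qed
    have "h z - h z0 - (of_real s * Dq 1 z0 + of_real t * Dq \<i> z0) =
        (h z - h w - of_real s * Dq 1 z) + (h w - h z0 - of_real t * Dq \<i> z0) + of_real s * (Dq 1 z - Dq 1 z0)"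
      by (simp add: algebra_simps)
    also have "norm \<dots> \<le> \<kappa> * \<bar>s\<bar> + \<kappa> * \<bar>t\<bar> + \<bar>s\<bar> * (3 * \<kappa>)"
      using 1 2 3 by (intro norm_triangle_mono) (auto simp: norm_mult intro!: mult_left_mono)
    also have "\<dots> \<le> \<kappa> * norm (z - z0) + \<kappa> * norm (z - z0) + norm (z - z0) * (3 * \<kappa>)"
      using st \<kappa> by (intro add_mono mult_left_mono mult_right_mono) auto
    also have "\<dots> = 5 * \<kappa> * norm (z - z0)" by simp
    also have "\<dots> \<le> r * norm (z - z0)" using \<kappa> by (intro mult_right_mono) auto
    finally show ?thesis by (simp add: s_def t_def)
  qed
  then show "\<exists>d>0. \<forall>y\<in>E. norm (y - z0) < d \<longrightarrow>
      norm (h y - h z0 - (of_real (Re (y - z0)) * Dq 1 z0 + of_real (Im (y - z0)) * Dq \<i> z0)) \<le> r * norm (y - z0)"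
    using d(1) by blast
qed

lemma Osc_measure_small:
  assumes v: "v \<in> {1, \<i>}" and "\<epsilon> > 0"
  shows "\<exists>m. emeasure lborel (Good v - Osc v k m) < \<epsilon>"
proof -
  have "(\<lambda>m. emeasure lborel (Good v - Osc v k m)) \<longlonglongrightarrow> emeasure lborel (\<Inter>m. Good v - Osc v k m)"
  proof (rule Lim_emeasure_decseq)
    show "range (\<lambda>m. Good v - Osc v k m) \<subseteq> sets lborel"
      using sets_Good[OF v] closed_Osc[OF v] by auto
    show "decseq (\<lambda>m. Good v - Osc v k m)"
      using Osc_mono by (fastforce simp: decseq_def)
    have "emeasure lborel (Good v - Osc v k m) \<le> emeasure lborel Q" for m
      using Good_subset box_subset_Q by (intro emeasure_mono) (auto simp: Q_def)
    moreover have "emeasure lborel Q < \<infinity>" unfolding Q_def by (rule emeasure_lborel_cbox_finite)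
    ultimately show "emeasure lborel (Good v - Osc v k m) \<noteq> \<infinity>" for m
      by (metis infinity_ennreal_def le_less_trans less_irrefl)
  qed
  moreover have "(\<Inter>m. Good v - Osc v k m) = {}" by (auto simp: Good_def)
  ultimately have "(\<lambda>m. emeasure lborel (Good v - Osc v k m)) \<longlonglongrightarrow> 0" by (simp only: emeasure_empty)
  from order_tendstoD(2)[OF this \<open>\<epsilon> > 0\<close>] show ?thesis
    unfolding eventually_sequentially by blast
qed

text \<open>Compact sets on which \<open>h\<close> is differentiable suffice for the area
  inequality. For each tolerance \<open>k\<close> and each of the two directions, \<open>E j\<close>
  discards a set of measure at most 2^(-k) / (j + 1), in total at most 4 / (j + 1).\<close>

lemma exhaustion:
  "\<exists>E :: nat \<Rightarrow> complex set. incseq E \<and> (\<forall>j. compact (E j) \<and> E j \<subseteq> Good 1 \<inter> Good \<i> \<and>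
      (\<forall>z\<in>E j. (h has_derivative (\<lambda>w. of_real (Re w) * Dq 1 z + of_real (Im w) * Dq \<i> z)) (at z within E j))) \<and>
    emeasure lborel (Good 1 \<inter> Good \<i> - (\<Union>j. E j)) = 0"
proof -
  define \<delta> where "\<delta> = (\<lambda>j k :: nat. ennreal ((1/2)^k / real (Suc j)))"
  \<comment> \<open>The least admissible \<open>m\<close> depends monotonically on \<open>j\<close>;
    this makes the sets \<open>E j\<close> increase.\<close>
  define mm where "mm = (\<lambda>v j k. LEAST m. emeasure lborel (Good v - Osc v k m) < \<delta> j k)"
  have mm: "emeasure lborel (Good v - Osc v k (mm v j k)) < \<delta> j k" if "v \<in> {1, \<i>}" for v j k
    unfolding mm_def by (rule LeastI_ex, rule Osc_measure_small[OF that]) (simp add: \<delta>_def)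
  have mm_mono: "mm v j k \<le> mm v j' k" if "v \<in> {1, \<i>}" "j \<le> j'" for v j j' k
  proof -
    have "\<delta> j' k \<le> \<delta> j k" using that(2) by (auto simp: \<delta>_def intro!: ennreal_leI frac_le)
    then have "emeasure lborel (Good v - Osc v k (mm v j' k)) < \<delta> j k" using mm[OF that(1), of k j'] by simp
    then show ?thesis unfolding mm_def[of] by (rule Least_le)
  qed
  define E where "E = (\<lambda>j. (\<Inter>k. Osc 1 k (mm 1 j k)) \<inter> (\<Inter>k. Osc \<i> k (mm \<i> j k)))"
  have Esub: "E j \<subseteq> Good 1 \<inter> Good \<i>" for j by (auto simp: E_def Good_def)
  have Ecl: "closed (E j)" for j unfolding E_def by (intro closed_Int closed_INT ballI closed_Osc) auto
  have "bounded (E j)" for j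
    using Esub Good_subset by (intro bounded_subset[OF bounded_box]) blast
  then have Ecomp: "compact (E j)" for j using Ecl compact_eq_bounded_closed by blast
  have der: "(h has_derivative (\<lambda>w. of_real (Re w) * Dq 1 z + of_real (Im w) * Dq \<i> z)) (at z within E j)"
    if "z \<in> E j" for z j
    by (rule differentiable_within_Osc[OF Esub _ _ that, of "mm 1 j" "mm \<i> j"]) (auto simp: E_def)
  have inc: "incseq E"
    unfolding incseq_def
  proof (intro allI impI subsetI)
    fix j j' :: nat and z assume "j \<le> j'" "z \<in> E j"
    moreover have "Osc v k (mm v j k) \<subseteq> Osc v k (mm v j' k)" if "v \<in> {1, \<i>}" for v k
      by (rule Osc_mono[OF mm_mono[OF that \<open>j \<le> j'\<close>]])
    note A = this[of 1, simplified] and B = this[of \<i>, simplified]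
    have "E j \<subseteq> E j'" unfolding E_def by (auto dest: subsetD[OF A] subsetD[OF B])
    ultimately show "z \<in> E j'" by blast
  qed
  let ?G = "Good 1 \<inter> Good \<i>"
  have meas: "?G - (\<Union>j. E j) \<in> sets lborel"
    using sets_Good Ecl by (intro sets.Diff sets.Int sets.countable_UN'') auto
  have small: "emeasure lborel (Good v - (\<Inter>k. Osc v k (mm v j k))) \<le> ennreal (2 / Suc j)" if v: "v \<in> {1, \<i>}" for v j
  proof -
    have "emeasure lborel (Good v - (\<Inter>k. Osc v k (mm v j k))) = emeasure lborel (\<Union>k. Good v - Osc v k (mm v j k))"
      by (rule arg_cong[where f="emeasure lborel"]) auto
    also have "\<dots> \<le> (\<Sum>k. emeasure lborel (Good v - Osc v k (mm v j k)))"
      using sets_Good[OF v] closed_Osc[OF v] by (intro emeasure_subadditive_countably) auto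
    also have "\<dots> \<le> (\<Sum>k. \<delta> j k)" using mm[OF v] by (intro suminf_le) (auto intro: less_imp_le)
    also have "\<dots> = ennreal (2 / Suc j)"
    proof -
      have "(\<lambda>k. (1/2)^k / real (Suc j)) sums (2 / real (Suc j))"
        using sums_divide[OF geometric_sums[of "1/2::real"], of "real (Suc j)"] by simp
      then show ?thesis unfolding \<delta>_def by (subst suminf_ennreal_eq) auto
    qed
    finally show ?thesis .
  qed
  have "emeasure lborel (?G - (\<Union>j. E j)) \<le> ennreal (4 / Suc j)" for j
  proof -
    have "emeasure lborel (?G - (\<Union>j. E j)) \<le>
        emeasure lborel ((Good 1 - (\<Inter>k. Osc 1 k (mm 1 j k))) \<union> (Good \<i> - (\<Inter>k. Osc \<i> k (mm \<i> j k))))"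
      using sets_Good closed_Osc by (intro emeasure_mono sets.Un sets.Diff sets.countable_INT'') (auto simp: E_def)
    also have "\<dots> \<le> emeasure lborel (Good 1 - (\<Inter>k. Osc 1 k (mm 1 j k))) + emeasure lborel (Good \<i> - (\<Inter>k. Osc \<i> k (mm \<i> j k)))"
      using sets_Good closed_Osc by (intro emeasure_subadditive sets.Diff sets.countable_INT'') auto
    also have "\<dots> \<le> ennreal (2 / Suc j) + ennreal (2 / Suc j)" by (intro add_mono small) auto
    also have "\<dots> = ennreal (4 / Suc j)" by (simp flip: ennreal_plus add: add_divide_distrib[symmetric])
    finally show ?thesis .
  qed
  moreover have "(\<lambda>j. ennreal (4 / Suc j)) \<longlonglongrightarrow> ennreal 0"
    by (intro tendsto_ennrealI LIMSEQ_Suc lim_const_over_n)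
  ultimately have "emeasure lborel (?G - (\<Union>j. E j)) \<le> 0"
    by (intro LIMSEQ_le_const[of "\<lambda>j. ennreal (4 / Suc j)"]) auto
  then show ?thesis using inc Ecomp Esub der by (intro exI[of _ E]) auto
qed

end

text \<open>For partial derivatives \<open>p\<close> and \<open>q\<close>, the numbers
  \<open>A\<close> and \<open>B\<close> are the moduli of the two complex derivatives,
  \<open>A + B\<close> is the operator norm of the real derivative and A^2 - B^2 its Jacobian. So
  \<open>B \<le> k * A\<close> bounds the squared norm by (1 + k) / (1 - k) times the
  Jacobian.\<close>

lemma dilatation_bounds:
  fixes p q :: complex
  defines "A \<equiv> norm (p - \<i> * q) / 2" and "B \<equiv> norm (p + \<i> * q) / 2"
  assumes B: "norm (p + \<i> * q) \<le> k * norm (p - \<i> * q)" and k: "0 \<le> k" "k < 1"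
  shows "(A + B)\<^sup>2 \<le> (1 + k) / (1 - k) * \<bar>Re p * Im q - Im p * Re q\<bar>"
proof -
  have J: "Re p * Im q - Im p * Re q = (A + B) * (A - B)"
  proof -
    have A2: "A\<^sup>2 = ((Re p + Im q)\<^sup>2 + (Im p - Re q)\<^sup>2) / 4" and B2: "B\<^sup>2 = ((Re p - Im q)\<^sup>2 + (Im p + Re q)\<^sup>2) / 4"
      unfolding A_def B_def by (simp_all add: power_divide cmod_power2)
    have "(A + B) * (A - B) = A\<^sup>2 - B\<^sup>2" by (simp add: power2_eq_square algebra_simps)
    then show ?thesis unfolding A2 B2 by (simp add: power2_eq_square field_simps)
  qed
  have BkA: "B \<le> k * A" using B by (simp add: A_def B_def)
  have A0: "A \<ge> 0" "B \<ge> 0" by (auto simp: A_def B_def)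
  have "(1 - k) * (A + B) \<le> (1 + k) * (A - B)" using BkA by (simp add: algebra_simps)
  then have "A + B \<le> (1 + k) / (1 - k) * (A - B)" using k by (simp add: field_simps)
  then have "(A + B) * (A + B) \<le> (A + B) * ((1 + k) / (1 - k) * (A - B))"
    using A0 by (intro mult_left_mono) auto
  also have "\<dots> = (1 + k) / (1 - k) * (Re p * Im q - Im p * Re q)" unfolding J by simp
  also have "\<dots> \<le> (1 + k) / (1 - k) * \<bar>Re p * Im q - Im p * Re q\<bar>"
    using k by (intro mult_left_mono) auto
  finally show ?thesis by (simp add: power2_eq_square)
qed

lemma norm_real_combination_le:
  fixes p q :: complex and s t :: real
  shows "norm (of_real s * p + of_real t * q) \<le> norm (Complex s t) * ((norm (p - \<i> * q) + norm (p + \<i> * q)) / 2)"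
proof -
  have "of_real s * p + of_real t * q = (p - \<i> * q) / 2 * Complex s t + (p + \<i> * q) / 2 * cnj (Complex s t)"
    by (simp add: complex_eq_iff field_simps)
  also have "norm \<dots> \<le> norm ((p - \<i> * q) / 2) * norm (Complex s t) + norm ((p + \<i> * q) / 2) * norm (Complex s t)"
    by (rule order_trans[OF norm_triangle_ineq]) (simp add: norm_mult)
  also have "\<dots> = norm (p - \<i> * q) / 2 * norm (Complex s t) + norm (p + \<i> * q) / 2 * norm (Complex s t)"
    by (simp only: norm_divide norm_numeral)
  also have "\<dots> = norm (Complex s t) * ((norm (p - \<i> * q) + norm (p + \<i> * q)) / 2)"
    by (simp only: distrib_left distrib_right add_divide_distrib mult.commute)
  finally show ?thesis .
qed

lemma has_vector_derivative_shift_0: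
  "((\<lambda>t. u (x + t)) has_vector_derivative l) (at 0) \<longleftrightarrow> (u has_vector_derivative l) (at (x::real))"
  unfolding has_vector_derivative_def has_derivative_at by simp

lemma negligible_AE_lborel:
  fixes N :: "'a::euclidean_space set"
  assumes "negligible N"
  shows "AE x in lborel. x \<notin> N"
proof -
  have "AE x in lebesgue. x \<notin> N" using assms by (intro AE_not_in) (simp add: negligible_iff_null_sets)
  then show ?thesis by (simp add: AE_completion_iff)
qed

text \<open>The Beltrami inequality is required of derivatives that exist, so no default value of
  \<open>vector_derivative\<close> enters, and the condition passes to the composition with a chart.
  The domain is a closed box, whose sides are parallel to the lines of absolute continuity.\<close>

locale qc_box_map = continuous_box_map +
  fixes k :: real
  assumes inj: "inj_on h (cbox (Complex a c) (Complex b e))"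
    and acx: "AE y in lborel. y \<in> {c..e} \<longrightarrow> abs_cont_on a b (\<lambda>x. h (Complex x y))"
    and acy: "AE x in lborel. x \<in> {a..b} \<longrightarrow> abs_cont_on c e (\<lambda>y. h (Complex x y))"
    and k: "0 \<le> k" "k < 1"
    and beltrami: "AE z in lborel. z \<in> cbox (Complex a c) (Complex b e) \<longrightarrow>
      (\<forall>hx hy. ((\<lambda>t. h (z + of_real t * 1)) has_vector_derivative hx) (at 0) \<longrightarrow>
        ((\<lambda>t. h (z + of_real t * \<i>)) has_vector_derivative hy) (at 0) \<longrightarrow>
        norm (hx + \<i> * hy) \<le> k * norm (hx - \<i> * hy))"
begin

lemma Q_closed: "closed Q" and Q_compact: "compact Q" and Q_borel: "Q \<in> sets borel"
  unfolding Q_def by auto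

lemma mem_Q: "Complex x y \<in> Q \<longleftrightarrow> x \<in> {a..b} \<and> y \<in> {c..e}"
  by (auto simp: Q_def in_cbox_complex_iff)

lemma AE_box: "AE z in lborel. z \<in> Q \<longrightarrow> z \<in> box (Complex a c) (Complex b e)"
proof -
  have "negligible (Q - box (Complex a c) (Complex b e))"
    unfolding Q_def by (rule negligible_frontier_interval)
  from negligible_AE_lborel[OF this] show ?thesis by (rule eventually_mono) auto
qed

lemma horizontal_derivative:
  assumes "((\<lambda>x. h (Complex x y)) has_vector_derivative l) (at x)" "Complex x y \<in> box (Complex a c) (Complex b e)"
  shows "Complex x y \<in> Good 1" "Dq 1 (Complex x y) = l"
proof -
  have "(\<lambda>t. h (Complex x y + of_real t * 1)) = (\<lambda>t. h (Complex (x + t) y))"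
    by (intro ext arg_cong[where f=h]) (simp add: complex_eq_iff)
  then have "((\<lambda>t. h (Complex x y + of_real t * 1)) has_vector_derivative l) (at 0)"
    using assms(1) by (simp add: has_vector_derivative_shift_0[of "\<lambda>x. h (Complex x y)"])
  then have l: "((\<lambda>s. diffquot h 1 s (Complex x y)) \<longlongrightarrow> l) (at 0)"
    unfolding has_vector_derivative_iff_diffquot .
  show "Complex x y \<in> Good 1" by (rule GoodI[OF assms(2) l])
  show "Dq 1 (Complex x y) = l" unfolding Dq_def by (rule tendsto_Lim[OF _ l]) simp
qed

lemma vertical_derivative:
  assumes "((\<lambda>y. h (Complex x y)) has_vector_derivative l) (at y)" "Complex x y \<in> box (Complex a c) (Complex b e)"
  shows "Complex x y \<in> Good \<i>" "Dq \<i> (Complex x y) = l"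
proof -
  have "(\<lambda>t. h (Complex x y + of_real t * \<i>)) = (\<lambda>t. h (Complex x (y + t)))"
    by (intro ext arg_cong[where f=h]) (simp add: complex_eq_iff)
  then have "((\<lambda>t. h (Complex x y + of_real t * \<i>)) has_vector_derivative l) (at 0)"
    using assms(1) by (simp add: has_vector_derivative_shift_0[of "\<lambda>y. h (Complex x y)"])
  then have l: "((\<lambda>s. diffquot h \<i> s (Complex x y)) \<longlongrightarrow> l) (at 0)"
    unfolding has_vector_derivative_iff_diffquot .
  show "Complex x y \<in> Good \<i>" by (rule GoodI[OF assms(2) l])
  show "Dq \<i> (Complex x y) = l" unfolding Dq_def by (rule tendsto_Lim[OF _ l]) simp
qed

lemma AE_Good: "AE z in lborel. z \<in> Q \<longrightarrow> z \<in> Good 1 \<inter> Good \<i>"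
proof -
  let ?B = "box (Complex a c) (Complex b e)"
  have e1: "emeasure lborel (?B - Good 1) = 0"
  proof (rule emeasure_complex_eq_0I[OF _ disjI2])
    show "?B - Good 1 \<in> sets borel" using sets_Good by auto
    show "AE y in lborel. AE x in lborel. Complex x y \<notin> ?B - Good 1"
      using acx
    proof (rule eventually_mono)
      fix y assume y: "y \<in> {c..e} \<longrightarrow> abs_cont_on a b (\<lambda>x. h (Complex x y))"
      show "AE x in lborel. Complex x y \<notin> ?B - Good 1"
      proof (cases "y \<in> {c<..<e}")
        case False
        then show ?thesis by (intro AE_I2) (auto simp: in_box_complex_iff)
      next
        case True
        then have "abs_cont_on a b (\<lambda>x. h (Complex x y))" using y by auto
        from abs_cont_on_differentiable[OF this] obtain N where N: "negligible N"
          "\<And>x. x \<in> {a<..<b} - N \<Longrightarrow> (\<lambda>x. h (Complex x y)) differentiable at x" by blast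
        show ?thesis
          using negligible_AE_lborel[OF N(1)]
        proof (rule eventually_mono)
          fix x assume "x \<notin> N"
          show "Complex x y \<notin> ?B - Good 1"
          proof
            assume B: "Complex x y \<in> ?B - Good 1"
            then have "x \<in> {a<..<b} - N" using \<open>x \<notin> N\<close> by (auto simp: in_box_complex_iff)
            from N(2)[OF this] show False
              using horizontal_derivative(1)[of y _ x] B by (auto simp: vector_derivative_works)
          qed
        qed
      qed
    qed
  qed
  have e2: "emeasure lborel (?B - Good \<i>) = 0"
  proof (rule emeasure_complex_eq_0I[OF _ disjI1])
    show "?B - Good \<i> \<in> sets borel" using sets_Good by auto
    show "AE x in lborel. AE y in lborel. Complex x y \<notin> ?B - Good \<i>"
      using acy
    proof (rule eventually_mono)
      fix x assume x: "x \<in> {a..b} \<longrightarrow> abs_cont_on c e (\<lambda>y. h (Complex x y))"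
      show "AE y in lborel. Complex x y \<notin> ?B - Good \<i>"
      proof (cases "x \<in> {a<..<b}")
        case False
        then show ?thesis by (intro AE_I2) (auto simp: in_box_complex_iff)
      next
        case True
        then have "abs_cont_on c e (\<lambda>y. h (Complex x y))" using x by auto
        from abs_cont_on_differentiable[OF this] obtain N where N: "negligible N"
          "\<And>y. y \<in> {c<..<e} - N \<Longrightarrow> (\<lambda>y. h (Complex x y)) differentiable at y" by blast
        show ?thesis
          using negligible_AE_lborel[OF N(1)]
        proof (rule eventually_mono)
          fix y assume "y \<notin> N"
          show "Complex x y \<notin> ?B - Good \<i>"
          proof
            assume B: "Complex x y \<in> ?B - Good \<i>"
            then have "y \<in> {c<..<e} - N" using \<open>y \<notin> N\<close> by (auto simp: in_box_complex_iff)
            from N(2)[OF this] show False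
              using vertical_derivative(1)[of x _ y] B by (auto simp: vector_derivative_works)
          qed
        qed
      qed
    qed
  qed
  have "AE z in lborel. z \<notin> ?B - Good 1"
    by (rule AE_not_in[OF null_setsI[OF e1]]) (use sets_Good in auto)
  moreover have "AE z in lborel. z \<notin> ?B - Good \<i>"
    by (rule AE_not_in[OF null_setsI[OF e2]]) (use sets_Good in auto)
  ultimately show ?thesis using AE_box by eventually_elim auto
qed

text \<open>\<open>h0\<close> and \<open>D0\<close> are extended by 0, which makes them Borel on the
  whole plane. \<open>Sq\<close> is the sum of the moduli of the two complex derivatives, the
  operator norm of the derivative of \<open>h\<close>.\<close>

definition h0 :: "complex \<Rightarrow> complex" where "h0 z = indicator Q z *\<^sub>R h z"
definition D0 :: "complex \<Rightarrow> complex \<Rightarrow> complex" where "D0 v z = indicator (Good v) z *\<^sub>R Dq v z"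
definition Sq :: "complex \<Rightarrow> real" where
  "Sq z = (norm (D0 1 z - \<i> * D0 \<i> z) + norm (D0 1 z + \<i> * D0 \<i> z)) / 2"

lemma h0_measurable [measurable]: "h0 \<in> borel_measurable borel"
  unfolding h0_def[abs_def] Q_def by (rule borel_measurable_continuous_on_indicator[OF _ cont]) simp

lemma D0_measurable:
  assumes v: "v \<in> {1, \<i>}"
  shows "D0 v \<in> borel_measurable borel"
proof -
  define r where "r = (\<lambda>n z. indicator (Good v) z *\<^sub>R ((h0 (z + of_real (1 / real (Suc n)) * v) - h0 z) / of_real (1 / real (Suc n))))"
  show ?thesis
  proof (rule borel_measurable_LIMSEQ_metric)
    show "r n \<in> borel_measurable borel" for n
    proof -
      have "(\<lambda>z. h0 (z + of_real (1 / real (Suc n)) * v)) \<in> borel_measurable borel"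
        by (intro measurable_compose[OF _ h0_measurable] borel_measurable_continuous_onI continuous_intros)
      then show ?thesis unfolding r_def using sets_Good[OF v]
        by (intro borel_measurable_scaleR borel_measurable_indicator borel_measurable_divide borel_measurable_diff) auto
    qed
    fix z :: complex
    show "(\<lambda>n. r n z) \<longlonglongrightarrow> D0 v z"
    proof (cases "z \<in> Good v")
      case False
      then show ?thesis by (simp add: r_def D0_def)
    next
      case True
      then obtain m where m: "z \<in> inner_box m" by (auto simp: Good_def Osc_def)
      have "filterlim (\<lambda>n. 1 / real (Suc n)) (at 0) sequentially"
        by (rule filterlim_atI[OF LIMSEQ_inverse_real_of_nat[unfolded inverse_eq_divide]]) simp
      from filterlim_compose[OF Good_Lim[OF True] this]
      have lim: "(\<lambda>n. diffquot h v (1 / real (Suc n)) z) \<longlonglongrightarrow> Dq v z" .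
      have "z \<in> Q" using m inner_box_subset box_subset_Q by blast
      have "\<forall>\<^sub>F n in sequentially. diffquot h v (1 / real (Suc n)) z = r n z"
        unfolding eventually_sequentially
      proof (intro exI[of _ "Suc m"] allI impI)
        fix n assume "n \<ge> Suc m"
        then have "\<bar>1 / real (Suc n)\<bar> < 1 / Suc m" by (simp add: frac_less2)
        from inner_box_shift[OF m this v] show "diffquot h v (1 / real (Suc n)) z = r n z"
          using \<open>z \<in> Q\<close> True unfolding r_def h0_def diffquot_def by simp
      qed
      from Lim_transform_eventually[OF lim this] show ?thesis using True by (simp add: D0_def)
    qed
  qed
qed

lemma D0_measurable' [measurable]: "D0 1 \<in> borel_measurable borel" "D0 \<i> \<in> borel_measurable borel"
  using D0_measurable by auto

lemma Sq_measurable [measurable]: "Sq \<in> borel_measurable borel"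
  unfolding Sq_def[abs_def] by measurable

text \<open>Energy grows under composition at most by the dilatation: the squared norm of the
  derivative is at most (1 + k) / (1 - k) times the Jacobian, and the Jacobian is removed by
  substitution. The substitution is made on the compact sets of the exhaustion, whose images are
  merely subsets of the plane, as an upper bound is wanted; monotone convergence does the
  rest.\<close>

lemma energy_bound:
  fixes G :: "complex \<Rightarrow> real"
  assumes G: "G \<in> borel_measurable borel" "integrable lborel (\<lambda>w. (G w)\<^sup>2)"
  shows "(\<integral>\<^sup>+z. ennreal (indicator Q z * (G (h0 z) * Sq z)\<^sup>2) \<partial>lborel)
     \<le> ennreal ((1 + k) / (1 - k) * (\<integral>w. (G w)\<^sup>2 \<partial>lborel))"
proof -
  define K where "K = (1 + k) / (1 - k)"
  have K: "K \<ge> 0" using k by (simp add: K_def)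
  define J where "J = (\<lambda>z. Re (Dq 1 z) * Im (Dq \<i> z) - Im (Dq 1 z) * Re (Dq \<i> z))"
  obtain E :: "nat \<Rightarrow> complex set" where E: "incseq E" "\<And>j. compact (E j)" "\<And>j. E j \<subseteq> Good 1 \<inter> Good \<i>"
    "\<And>j z. z \<in> E j \<Longrightarrow> (h has_derivative (\<lambda>w. of_real (Re w) * Dq 1 z + of_real (Im w) * Dq \<i> z)) (at z within E j)"
    "emeasure lborel (Good 1 \<inter> Good \<i> - (\<Union>j. E j)) = 0"
    using exhaustion by (elim exE conjE) (rule that, auto)
  have EQ: "E j \<subseteq> Q" for j using E(3)[of j] Good_subset box_subset_Q by blast
  have GL: "(\<lambda>w. (G w)\<^sup>2) absolutely_integrable_on UNIV"
    using G(2) by (simp add: set_integrable_def integrable_completion borel_measurable_integrable)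
  have piece: "(\<integral>\<^sup>+z. ennreal (indicator (E j) z * (G (h0 z) * Sq z)\<^sup>2) \<partial>lborel) \<le> ennreal (K * (\<integral>w. (G w)\<^sup>2 \<partial>lborel))" for j
  proof -
    have comp: "compact (h ` E j)"
      by (intro compact_continuous_image E(2) continuous_on_subset[OF cont]) (use EQ in \<open>auto simp: Q_def\<close>)
    have i1: "(\<lambda>w. (G w)\<^sup>2) absolutely_integrable_on h ` E j"
      by (rule set_integrable_subset[OF GL]) (use comp in \<open>auto intro: compact_imp_closed lmeasurable_compact fmeasurableD\<close>)
    have cv: "(\<lambda>z. \<bar>J z\<bar> * (G (h z))\<^sup>2) absolutely_integrable_on E j \<and>
        integral (E j) (\<lambda>z. \<bar>J z\<bar> * (G (h z))\<^sup>2) = integral (h ` E j) (\<lambda>w. (G w)\<^sup>2)"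
    proof (rule complex_change_of_variables[THEN iffD2])
      show "E j \<in> sets borel" using E(2) by (simp add: compact_imp_closed)
      show "inj_on h (E j)" using inj_on_subset[OF inj] EQ by (simp add: Q_def)
      show "(h has_derivative (\<lambda>w. of_real (Re w) * Dq 1 z + of_real (Im w) * Dq \<i> z)) (at z within E j)" if "z \<in> E j" for z
        using E(4) that .
    qed (use i1 in \<open>auto simp: J_def\<close>)
    have le: "integral (h ` E j) (\<lambda>w. (G w)\<^sup>2) \<le> (\<integral>w. (G w)\<^sup>2 \<partial>lborel)"
    proof -
      have "integral (h ` E j) (\<lambda>w. (G w)\<^sup>2) \<le> integral UNIV (\<lambda>w. (G w)\<^sup>2)"
        using i1 GL by (intro integral_subset_le set_lebesgue_integral_eq_integral(1)) auto
      also have "\<dots> = (\<integral>w. (G w)\<^sup>2 \<partial>lborel)"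
        using G(2) by (simp add: integral_lborel)
      finally show ?thesis .
    qed
    have i2: "integrable lebesgue (\<lambda>z. indicator (E j) z * (\<bar>J z\<bar> * (G (h z))\<^sup>2))"
      using cv by (simp add: set_integrable_def)
    have eq: "(\<integral>z. indicator (E j) z * (\<bar>J z\<bar> * (G (h z))\<^sup>2) \<partial>lebesgue) = integral (h ` E j) (\<lambda>w. (G w)\<^sup>2)"
      using cv set_lebesgue_integral_eq_integral(2)[OF conjunct1[OF cv]] by (simp add: set_lebesgue_integral_def)
    have AEb: "AE z in lborel. z \<in> E j \<longrightarrow> (Sq z)\<^sup>2 \<le> K * \<bar>J z\<bar>"
      using beltrami
    proof (rule eventually_mono, intro impI)
      fix z assume b: "z \<in> cbox (Complex a c) (Complex b e) \<longrightarrow>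
        (\<forall>hx hy. ((\<lambda>t. h (z + of_real t * 1)) has_vector_derivative hx) (at 0) \<longrightarrow>
        ((\<lambda>t. h (z + of_real t * \<i>)) has_vector_derivative hy) (at 0) \<longrightarrow>
        norm (hx + \<i> * hy) \<le> k * norm (hx - \<i> * hy))" and z: "z \<in> E j"
      have g: "z \<in> Good 1" "z \<in> Good \<i>" using E(3) z by auto
      have "norm (Dq 1 z + \<i> * Dq \<i> z) \<le> k * norm (Dq 1 z - \<i> * Dq \<i> z)"
        using b z EQ Good_Lim[OF g(1)] Good_Lim[OF g(2)]
        unfolding has_vector_derivative_iff_diffquot Q_def by blast
      from dilatation_bounds[OF this k] show "(Sq z)\<^sup>2 \<le> K * \<bar>J z\<bar>"
        using g by (simp add: Sq_def D0_def K_def J_def add_divide_distrib)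
    qed
    have "(\<integral>\<^sup>+z. ennreal (indicator (E j) z * (G (h0 z) * Sq z)\<^sup>2) \<partial>lborel)
        \<le> (\<integral>\<^sup>+z. ennreal K * ennreal (indicator (E j) z * (\<bar>J z\<bar> * (G (h z))\<^sup>2)) \<partial>lborel)"
    proof (rule nn_integral_mono_AE)
      show "AE z in lborel. ennreal (indicator (E j) z * (G (h0 z) * Sq z)\<^sup>2)
          \<le> ennreal K * ennreal (indicator (E j) z * (\<bar>J z\<bar> * (G (h z))\<^sup>2))"
        using AEb
      proof (rule eventually_mono)
        fix z assume z: "z \<in> E j \<longrightarrow> (Sq z)\<^sup>2 \<le> K * \<bar>J z\<bar>"
        show "ennreal (indicator (E j) z * (G (h0 z) * Sq z)\<^sup>2) \<le> ennreal K * ennreal (indicator (E j) z * (\<bar>J z\<bar> * (G (h z))\<^sup>2))"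
        proof (cases "z \<in> E j")
          case True
          then have "h0 z = h z" using subsetD[OF EQ] by (simp add: h0_def)
          moreover have "(G (h z))\<^sup>2 * (Sq z)\<^sup>2 \<le> (G (h z))\<^sup>2 * (K * \<bar>J z\<bar>)" using z True by (intro mult_left_mono) auto
          ultimately show ?thesis using True K by (simp add: power_mult_distrib ennreal_mult[symmetric] ac_simps)
        qed simp
      qed
    qed
    also have "\<dots> = (\<integral>\<^sup>+z. ennreal (K * (indicator (E j) z * (\<bar>J z\<bar> * (G (h z))\<^sup>2))) \<partial>lebesgue)"
      unfolding nn_integral_completion using K by (simp add: ennreal_mult)
    also have "\<dots> = ennreal (\<integral>z. K * (indicator (E j) z * (\<bar>J z\<bar> * (G (h z))\<^sup>2)) \<partial>lebesgue)"
      using i2 K by (intro nn_integral_eq_integral) auto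
    also have "\<dots> = ennreal (K * integral (h ` E j) (\<lambda>w. (G w)\<^sup>2))" using eq by simp
    also have "\<dots> \<le> ennreal (K * (\<integral>w. (G w)\<^sup>2 \<partial>lborel))" using le K by (intro ennreal_leI mult_left_mono)
    finally show ?thesis .
  qed
  have AEE: "AE z in lborel. z \<in> Q \<longrightarrow> z \<in> (\<Union>j. E j)"
  proof -
    have "Good 1 \<inter> Good \<i> - (\<Union>j. E j) \<in> sets lborel"
      using sets_Good E(2) by (intro sets.Diff sets.Int sets.countable_UN'') (auto simp: compact_imp_closed)
    from AE_not_in[OF null_setsI[OF E(5) this]] show ?thesis using AE_Good by eventually_elim auto
  qed
  have m: "(\<lambda>z. ennreal (indicator (E j) z * (G (h0 z) * Sq z)\<^sup>2)) \<in> borel_measurable lborel" for j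
    using G(1) E(2)[of j] by (auto intro!: borel_measurable_times borel_measurable_indicator compact_imp_closed borel_closed
        borel_measurable_power measurable_compose[OF h0_measurable])
  have "(\<integral>\<^sup>+z. ennreal (indicator Q z * (G (h0 z) * Sq z)\<^sup>2) \<partial>lborel)
      = (\<integral>\<^sup>+z. (SUP j. ennreal (indicator (E j) z * (G (h0 z) * Sq z)\<^sup>2)) \<partial>lborel)"
  proof (rule nn_integral_cong_AE)
    show "AE z in lborel. ennreal (indicator Q z * (G (h0 z) * Sq z)\<^sup>2) = (SUP j. ennreal (indicator (E j) z * (G (h0 z) * Sq z)\<^sup>2))"
      using AEE
    proof (rule eventually_mono)
      fix z assume z: "z \<in> Q \<longrightarrow> z \<in> (\<Union>j. E j)"
      show "ennreal (indicator Q z * (G (h0 z) * Sq z)\<^sup>2) = (SUP j. ennreal (indicator (E j) z * (G (h0 z) * Sq z)\<^sup>2))"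
      proof (cases "z \<in> Q")
        case True
        then obtain j where j: "z \<in> E j" using z by blast
        show ?thesis
        proof (rule antisym)
          show "ennreal (indicator Q z * (G (h0 z) * Sq z)\<^sup>2) \<le> (SUP j. ennreal (indicator (E j) z * (G (h0 z) * Sq z)\<^sup>2))"
            by (rule SUP_upper2[of j]) (use j True in auto)
          show "(SUP j. ennreal (indicator (E j) z * (G (h0 z) * Sq z)\<^sup>2)) \<le> ennreal (indicator Q z * (G (h0 z) * Sq z)\<^sup>2)"
            by (rule SUP_least) (use True in \<open>auto intro!: ennreal_leI simp: indicator_def\<close>)
        qed
      next
        case False
        then have "z \<notin> E j" for j using EQ by blast
        then show ?thesis using False by simp
      qed
    qed
  qed
  also have "\<dots> = (SUP j. \<integral>\<^sup>+z. ennreal (indicator (E j) z * (G (h0 z) * Sq z)\<^sup>2) \<partial>lborel)"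
  proof (rule nn_integral_monotone_convergence_SUP[OF _ m])
    show "incseq (\<lambda>j z. ennreal (indicator (E j) z * (G (h0 z) * Sq z)\<^sup>2))"
      using E(1) by (force simp: incseq_def le_fun_def indicator_def intro!: ennreal_leI dest: subsetD)
  qed
  also have "\<dots> \<le> ennreal (K * (\<integral>w. (G w)\<^sup>2 \<partial>lborel))" by (rule SUP_least) (rule piece)
  finally show ?thesis by (simp add: K_def)
qed

end

context qc_box_map
begin

text \<open>Integration by parts along one line: the integrand is almost everywhere the derivative
  of the product of \<open>X\<close> and \<open>u \<circ> H\<close>, which is absolutely continuous
  and vanishes at both ends. \<open>H'\<close> is tied to \<open>H\<close> only where
  \<open>H\<close> is differentiable, which is almost everywhere.\<close>

lemma line_integral_zero:
  fixes u :: "complex \<Rightarrow> real" and p :: "complex \<Rightarrow> complex" and X D :: "real \<Rightarrow> real" and H :: "real \<Rightarrow> complex"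
  assumes u: "\<And>w. (u has_derivative (\<lambda>v. p w \<bullet> v)) (at w)" and B: "\<And>w. norm (p w) \<le> B"
    and ac: "abs_cont_on s t H" and st: "s < t"
    and X: "\<And>x. x \<in> {s..t} \<Longrightarrow> (X has_vector_derivative D x) (at x)" "continuous_on {s..t} D"
    and X0: "X s = 0" "X t = 0"
    and H': "\<And>x l. x \<in> {s<..<t} \<Longrightarrow> (H has_vector_derivative l) (at x) \<Longrightarrow> H' x = l"
  shows "((\<lambda>x. X x * (p (H x) \<bullet> H' x) + u (H x) * D x) has_integral 0) {s..t}"
proof -
  have Lip: "\<bar>u v - u w\<bar> \<le> B * norm (v - w)" for v w
  proof -
    have "norm (u v - u w) \<le> B * norm (v - w)"
    proof (rule differentiable_bound[of UNIV u "\<lambda>w v. p w \<bullet> v"])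
      show "onorm (\<lambda>v. p x \<bullet> v) \<le> B" for x
        using B[of x] by (intro onorm_le) (metis Cauchy_Schwarz_ineq2 mult_right_mono norm_ge_zero order_trans real_norm_def)
    qed (auto intro: has_derivative_at_withinI u)
    then show ?thesis by simp
  qed
  have B0: "B \<ge> 0" using B[of 0] norm_ge_zero[of "p 0"] by linarith
  have contX: "continuous_on {s..t} X"
    using X(1) by (meson continuous_at_imp_continuous_on has_vector_derivative_continuous)
  have contu: "continuous_on UNIV u" using u by (meson has_derivative_continuous_on has_derivative_at_withinI)
  have contH: "continuous_on {s..t} H" by (rule abs_cont_on_imp_continuous_on[OF ac])
  have contuH: "continuous_on {s..t} (\<lambda>x. u (H x))" by (rule continuous_on_compose2[OF contu contH]) auto
  have bdd: "\<exists>M\<ge>0. \<forall>x\<in>{s..t}. \<bar>f x\<bar> \<le> M" if "continuous_on {s..t} f" for f :: "real \<Rightarrow> real"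
  proof -
    have "bounded (f ` {s..t})" using that compact_continuous_image compact_imp_bounded by blast
    then obtain M where "\<forall>y\<in>f ` {s..t}. norm y \<le> M" unfolding bounded_iff by blast
    then show ?thesis by (intro exI[of _ "max M 0"]) (auto simp: le_max_iff_disj)
  qed
  obtain M1 where M1: "M1 \<ge> 0" "\<And>x. x \<in> {s..t} \<Longrightarrow> \<bar>X x\<bar> \<le> M1" using bdd[OF contX] by blast
  obtain M2 where M2: "M2 \<ge> 0" "\<And>x. x \<in> {s..t} \<Longrightarrow> \<bar>u (H x)\<bar> \<le> M2" using bdd[OF contuH] by blast
  obtain M3 where M3: "M3 \<ge> 0" "\<And>x. x \<in> {s..t} \<Longrightarrow> \<bar>D x\<bar> \<le> M3" using bdd[OF X(2)] by blast
  have XLip: "\<bar>X x - X y\<bar> \<le> M3 * \<bar>x - y\<bar>" if "x \<in> {s..t}" "y \<in> {s..t}" for x y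
  proof -
    have "norm (X x - X y) \<le> M3 * norm (x - y)"
      by (rule field_differentiable_bound[of "{s..t}" X D])
        (use X(1) M3 that in \<open>auto simp: has_real_derivative_iff_has_vector_derivative intro: has_vector_derivative_at_within\<close>)
    then show ?thesis by simp
  qed
  define V where "V = (\<lambda>x. X x * u (H x))"
  have acV: "abs_cont_on s t (\<lambda>x. complex_of_real (V x))"
  proof (rule abs_cont_on_comparison[OF ac, of "M1 * B" "M2 * M3"])
    fix x y assume xy: "x \<in> {s..t}" "y \<in> {s..t}"
    have "\<bar>V x - V y\<bar> = \<bar>X x * (u (H x) - u (H y)) + u (H y) * (X x - X y)\<bar>" by (simp add: V_def algebra_simps)
    also have "\<dots> \<le> \<bar>X x\<bar> * \<bar>u (H x) - u (H y)\<bar> + \<bar>u (H y)\<bar> * \<bar>X x - X y\<bar>"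
      by (rule order_trans[OF abs_triangle_ineq]) (simp add: abs_mult)
    also have "\<dots> \<le> M1 * (B * norm (H x - H y)) + M2 * (M3 * \<bar>x - y\<bar>)"
      using xy M1 M2 B0 M3 by (intro add_mono mult_mono Lip XLip) auto
    finally show "norm (complex_of_real (V x) - complex_of_real (V y)) \<le> M1 * B * norm (H x - H y) + M2 * M3 * \<bar>x - y\<bar>"
      by (simp add: mult.assoc flip: of_real_diff)
  qed (use M1 M2 M3 B0 in auto)
  obtain N where N: "negligible N" "\<And>x. x \<in> {s<..<t} - N \<Longrightarrow> H differentiable at x"
    using abs_cont_on_differentiable[OF ac] by blast
  define V' where "V' = (\<lambda>x. X x * (p (H x) \<bullet> H' x) + u (H x) * D x)"
  have "((\<lambda>x. complex_of_real (V' x)) has_integral (complex_of_real (V t) - complex_of_real (V s))) {s..t}"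
  proof (rule abs_cont_on_has_integral[OF _ acV, of "N \<union> {s, t}"])
    show "negligible (N \<union> {s, t})" using N(1) by (simp add: negligible_Un)
    fix x assume x: "x \<in> {s..t} - (N \<union> {s, t})"
    then have x': "x \<in> {s<..<t}" "x \<in> {s..t}" by auto
    obtain l where l: "(H has_vector_derivative l) (at x)"
      using N(2)[of x] x' x by (auto simp: vector_derivative_works)
    have Hx: "H' x = l" by (rule H'[OF x'(1) l])
    have "((\<lambda>x. u (H x)) has_derivative (\<lambda>y. p (H x) \<bullet> (y *\<^sub>R l))) (at x)"
      by (rule has_derivative_compose[OF l[unfolded has_vector_derivative_def] u])
    then have "((\<lambda>x. u (H x)) has_vector_derivative (p (H x) \<bullet> l)) (at x)"
      by (simp add: has_vector_derivative_def)
    from has_vector_derivative_mult[OF X(1)[OF x'(2)] this]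
    have "(V has_vector_derivative V' x) (at x)"
      unfolding V_def V'_def Hx by (simp add: ac_simps)
    then have "((\<lambda>x. complex_of_real (V x)) has_vector_derivative complex_of_real (V' x)) (at x)"
      by (intro has_vector_derivative_of_real) (simp add: has_real_derivative_iff_has_vector_derivative)
    then show "((\<lambda>x. complex_of_real (V x)) has_vector_derivative complex_of_real (V' x)) (at x within {s..t})"
      by (rule has_vector_derivative_at_within)
  qed (use st in auto)
  then have "((\<lambda>x. Re (complex_of_real (V' x))) has_integral Re (complex_of_real (V t) - complex_of_real (V s))) {s..t}"
    by (rule has_integral_Re)
  then show ?thesis using X0 by (simp add: V'_def V_def)
qed

text \<open>The weak form of the capacity inequality: \<open>div X\<close> is tested against \<open>u \<circ> h\<close>, whose
  gradient is controlled by the change of variables. Only horizontal and vertical lines enter.\<close>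

theorem weak_capacity_inequality:
  fixes u :: "complex \<Rightarrow> real" and p :: "complex \<Rightarrow> complex" and G X1 X2 d1 d2 :: "complex \<Rightarrow> real"
  assumes u: "\<And>w. (u has_derivative (\<lambda>v. p w \<bullet> v)) (at w)" and B: "\<And>w. norm (p w) \<le> B"
    and pm: "p \<in> borel_measurable borel"
    and pG: "\<And>z. z \<in> Q \<Longrightarrow> norm (p (h z)) \<le> G (h z)"
    and G: "G \<in> borel_measurable borel" "integrable lborel (\<lambda>w. (G w)\<^sup>2)"
    and X1: "\<And>z. z \<in> Q \<Longrightarrow> ((\<lambda>t. X1 (z + of_real t)) has_vector_derivative d1 z) (at 0)" "continuous_on Q d1" "continuous_on Q X1"
      "\<And>z. z \<in> Q \<Longrightarrow> Re z \<in> {a, b} \<Longrightarrow> X1 z = 0"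
    and X2: "\<And>z. z \<in> Q \<Longrightarrow> ((\<lambda>t. X2 (z + of_real t * \<i>)) has_vector_derivative d2 z) (at 0)" "continuous_on Q d2" "continuous_on Q X2"
      "\<And>z. z \<in> Q \<Longrightarrow> Im z \<in> {c, e} \<Longrightarrow> X2 z = 0"
  shows "2 * \<bar>\<integral>z. indicator Q z * (u (h z) * (d1 z + d2 z)) \<partial>lborel\<bar>
    \<le> (\<integral>z. indicator Q z * ((X1 z)\<^sup>2 + (X2 z)\<^sup>2) \<partial>lborel) + (1 + k) / (1 - k) * (\<integral>w. (G w)\<^sup>2 \<partial>lborel)"
proof -
  have contu: "continuous_on UNIV u" using u by (meson has_derivative_continuous_on has_derivative_at_withinI)
  have conth: "continuous_on Q h" using cont by (simp add: Q_def)
  have contuh: "continuous_on Q (\<lambda>z. u (h z))" by (rule continuous_on_compose2[OF contu conth]) auto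
  have intQ: "integrable lborel (\<lambda>z. indicator Q z * f z)" if "continuous_on Q f" for f :: "complex \<Rightarrow> real"
    using borel_integrable_compact[OF Q_compact that] by simp
  have measQ: "(\<lambda>z. indicator Q z * f z) \<in> borel_measurable borel" if "continuous_on Q f" for f :: "complex \<Rightarrow> real"
    using borel_measurable_integrable[OF intQ[OF that]] by simp
  \<comment> \<open>An upper bound for the gradient of \<open>u \<circ> h\<close>, as
    \<open>G\<close> bounds \<open>p\<close> along \<open>h\<close> and \<open>Sq\<close> bounds the
    derivative of \<open>h\<close>.\<close>
  define f where "f = (\<lambda>z. indicator Q z * (G (h0 z) * Sq z))"
  have Gh: "(\<lambda>z. G (h0 z)) \<in> borel_measurable borel" using measurable_compose[OF h0_measurable G(1)] .
  have fm: "f \<in> borel_measurable borel"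
    unfolding f_def using Q_borel Gh by (intro borel_measurable_times borel_measurable_indicator Sq_measurable) auto
  have f2eq: "(f z)\<^sup>2 = indicator Q z * (G (h0 z) * Sq z)\<^sup>2" for z by (simp add: f_def power_mult_distrib indicator_def)
  have "(\<integral>\<^sup>+z. ennreal ((f z)\<^sup>2) \<partial>lborel) \<le> ennreal ((1 + k) / (1 - k) * (\<integral>w. (G w)\<^sup>2 \<partial>lborel))"
    using energy_bound[OF G] by (simp add: f2eq)
  then have f2: "integrable lborel (\<lambda>z. (f z)\<^sup>2)" and f2le: "(\<integral>z. (f z)\<^sup>2 \<partial>lborel) \<le> (1 + k) / (1 - k) * (\<integral>w. (G w)\<^sup>2 \<partial>lborel)"
  proof -
    assume le: "(\<integral>\<^sup>+z. ennreal ((f z)\<^sup>2) \<partial>lborel) \<le> ennreal ((1 + k) / (1 - k) * (\<integral>w. (G w)\<^sup>2 \<partial>lborel))"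
    show i: "integrable lborel (\<lambda>z. (f z)\<^sup>2)"
      unfolding integrable_iff_bounded using fm le by (auto intro: le_less_trans)
    show "(\<integral>z. (f z)\<^sup>2 \<partial>lborel) \<le> (1 + k) / (1 - k) * (\<integral>w. (G w)\<^sup>2 \<partial>lborel)"
    proof -
      have rhs: "0 \<le> (1 + k) / (1 - k) * (\<integral>w. (G w)\<^sup>2 \<partial>lborel)" using k by simp
      have "(\<integral>\<^sup>+z. ennreal ((f z)\<^sup>2) \<partial>lborel) = ennreal (\<integral>z. (f z)\<^sup>2 \<partial>lborel)"
        by (rule nn_integral_eq_integral[OF i]) simp
      then show ?thesis using le by (simp only: ennreal_le_iff[OF rhs])
    qed
  qed
  have intXX: "integrable lborel (\<lambda>z. indicator Q z * ((X1 z)\<^sup>2 + (X2 z)\<^sup>2))"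
    by (intro intQ continuous_intros X1 X2)
  define P1 where "P1 = (\<lambda>z. indicator Q z * X1 z * (p (h0 z) \<bullet> D0 1 z))"
  define P2 where "P2 = (\<lambda>z. indicator Q z * X2 z * (p (h0 z) \<bullet> D0 \<i> z))"
  have ph: "(\<lambda>z. p (h0 z)) \<in> borel_measurable borel" using measurable_compose[OF h0_measurable pm] .
  have P1m: "P1 \<in> borel_measurable borel" unfolding P1_def
    by (intro borel_measurable_times borel_measurable_inner ph D0_measurable' measQ X1(3))
  have P2m: "P2 \<in> borel_measurable borel" unfolding P2_def
    by (intro borel_measurable_times borel_measurable_inner ph D0_measurable' measQ X2(3))
  have comb: "\<bar>s * (p (h0 z) \<bullet> D0 1 z) + t * (p (h0 z) \<bullet> D0 \<i> z)\<bar> \<le> norm (Complex s t) * f z" if "z \<in> Q" for z s t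
  proof -
    have "\<bar>s * (p (h0 z) \<bullet> D0 1 z) + t * (p (h0 z) \<bullet> D0 \<i> z)\<bar> = \<bar>p (h0 z) \<bullet> (of_real s * D0 1 z + of_real t * D0 \<i> z)\<bar>"
      by (simp add: inner_add_right flip: scaleR_conv_of_real)
    also have "\<dots> \<le> norm (p (h0 z)) * norm (of_real s * D0 1 z + of_real t * D0 \<i> z)" by (rule Cauchy_Schwarz_ineq2)
    also have "\<dots> \<le> G (h0 z) * (norm (Complex s t) * Sq z)"
      unfolding Sq_def using pG[OF that] that
      by (intro mult_mono norm_real_combination_le) (auto simp: h0_def intro: order_trans[OF norm_ge_zero])
    finally show ?thesis using that by (simp add: f_def ac_simps)
  qed
  \<comment> \<open>The product is bounded by half the sum of squares, not by Cauchy-Schwarz after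
    integration: the additive inequality that results loses nothing when the two energies
    coincide.\<close>
  have P12: "\<bar>P1 z + P2 z\<bar> \<le> ((X1 z)\<^sup>2 + (X2 z)\<^sup>2) * indicator Q z / 2 + (f z)\<^sup>2 / 2" for z
  proof (cases "z \<in> Q")
    case True
    have "\<bar>P1 z + P2 z\<bar> \<le> norm (Complex (X1 z) (X2 z)) * f z"
      using comb[OF True, of "X1 z" "X2 z"] True by (simp add: P1_def P2_def)
    also have "\<dots> \<le> (norm (Complex (X1 z) (X2 z)))\<^sup>2 / 2 + (f z)\<^sup>2 / 2"
      using sum_squares_bound[of "norm (Complex (X1 z) (X2 z))" "f z"] by simp
    finally show ?thesis using True by (simp add: cmod_power2)
  qed (simp add: P1_def P2_def)
  have Pint: "integrable lborel P1" "integrable lborel P2"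
  proof -
    have b: "integrable lborel (\<lambda>z. indicator Q z * (Y z)\<^sup>2 + (f z)\<^sup>2)" if "continuous_on Q Y" for Y
      by (intro Bochner_Integration.integrable_add f2 intQ continuous_intros that)
    show "integrable lborel P1"
    proof (rule Bochner_Integration.integrable_bound[OF b[OF X1(3)]])
      show "P1 \<in> borel_measurable lborel" using P1m by simp
      show "AE z in lborel. norm (P1 z) \<le> norm (indicator Q z * (X1 z)\<^sup>2 + (f z)\<^sup>2)"
      proof (intro AE_I2)
        fix z show "norm (P1 z) \<le> norm (indicator Q z * (X1 z)\<^sup>2 + (f z)\<^sup>2)"
        proof (cases "z \<in> Q")
          case True
          have "\<bar>P1 z\<bar> \<le> \<bar>X1 z\<bar> * f z"
            using comb[OF True, of "X1 z" 0] True by (simp add: P1_def cmod_def)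
          also have "\<dots> \<le> (X1 z)\<^sup>2 + (f z)\<^sup>2"
          proof -
            have "2 * (\<bar>X1 z\<bar> * f z) \<le> (X1 z)\<^sup>2 + (f z)\<^sup>2"
              using sum_squares_bound[of "\<bar>X1 z\<bar>" "f z"] by (simp add: mult.assoc)
            moreover have "0 \<le> (X1 z)\<^sup>2 + (f z)\<^sup>2" by simp
            ultimately show ?thesis by linarith
          qed
          finally show ?thesis using True by simp
        qed (simp add: P1_def)
      qed
    qed
    show "integrable lborel P2"
    proof (rule Bochner_Integration.integrable_bound[OF b[OF X2(3)]])
      show "P2 \<in> borel_measurable lborel" using P2m by simp
      show "AE z in lborel. norm (P2 z) \<le> norm (indicator Q z * (X2 z)\<^sup>2 + (f z)\<^sup>2)"
      proof (intro AE_I2)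
        fix z show "norm (P2 z) \<le> norm (indicator Q z * (X2 z)\<^sup>2 + (f z)\<^sup>2)"
        proof (cases "z \<in> Q")
          case True
          have "\<bar>P2 z\<bar> \<le> \<bar>X2 z\<bar> * f z"
            using comb[OF True, of 0 "X2 z"] True by (simp add: P2_def cmod_def)
          also have "\<dots> \<le> (X2 z)\<^sup>2 + (f z)\<^sup>2"
          proof -
            have "2 * (\<bar>X2 z\<bar> * f z) \<le> (X2 z)\<^sup>2 + (f z)\<^sup>2"
              using sum_squares_bound[of "\<bar>X2 z\<bar>" "f z"] by (simp add: mult.assoc)
            moreover have "0 \<le> (X2 z)\<^sup>2 + (f z)\<^sup>2" by simp
            ultimately show ?thesis by linarith
          qed
          finally show ?thesis using True by simp
        qed (simp add: P2_def)
      qed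
    qed
  qed
  define U1 where "U1 = (\<lambda>z. indicator Q z * (u (h z) * d1 z))"
  define U2 where "U2 = (\<lambda>z. indicator Q z * (u (h z) * d2 z))"
  have Uint: "integrable lborel U1" "integrable lborel U2"
    unfolding U1_def U2_def by (intro intQ continuous_intros contuh X1 X2)+
  have zero: "(\<integral>x. F x \<partial>lborel) = 0"
    if "integrable lborel F" "\<And>x. F x = indicator {s..t} x * f' x" "(f' has_integral 0) {s..t}"
    for F f' :: "real \<Rightarrow> real" and s t
  proof -
    have F: "F = (\<lambda>x. indicator {s..t} x * f' x)" using that(2) by (rule ext)
    then have "set_integrable lborel {s..t} f'" using that(1) by (simp add: set_integrable_def)
    from set_borel_integral_eq_integral(2)[OF this] that(3) show ?thesis
      by (simp add: set_lebesgue_integral_def F integral_unique)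
  qed
  have z1: "(\<integral>z. P1 z + U1 z \<partial>lborel) = 0"
  proof -
    have i: "integrable lborel (\<lambda>z. P1 z + U1 z)" using Pint Uint by simp
    \<comment> \<open>\<open>D0 1\<close> is the partial derivative only in the open box, so the two
      lines along its horizontal sides are discarded.\<close>
    have "AE y in lborel. (\<integral>x. P1 (Complex x y) + U1 (Complex x y) \<partial>lborel) = 0"
      using integral_complex_iterated(3)[OF i] acx AE_lborel_singleton[of c] AE_lborel_singleton[of e]
    proof eventually_elim
      fix y assume int: "integrable lborel (\<lambda>x. P1 (Complex x y) + U1 (Complex x y))"
        and ac: "y \<in> {c..e} \<longrightarrow> abs_cont_on a b (\<lambda>x. h (Complex x y))"
        and ends: "y \<noteq> c" "y \<noteq> e"
      show "(\<integral>x. P1 (Complex x y) + U1 (Complex x y) \<partial>lborel) = 0"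
      proof (cases "y \<in> {c..e}")
        case False
        then have "P1 (Complex x y) + U1 (Complex x y) = 0" for x by (auto simp: P1_def U1_def mem_Q indicator_def)
        then show ?thesis by simp
      next
        case True
        then have in_box: "y \<in> {c<..<e}" using ends by auto
        have line: "((\<lambda>x. X1 (Complex x y) * (p (h (Complex x y)) \<bullet> D0 1 (Complex x y)) + u (h (Complex x y)) * d1 (Complex x y)) has_integral 0) {a..b}"
        proof (rule line_integral_zero[OF u B _ ab])
          show "abs_cont_on a b (\<lambda>x. h (Complex x y))" using ac True by blast
          have cC: "continuous_on {a..b} (\<lambda>x. Complex x y)" unfolding Complex_eq by (intro continuous_intros)
          show "continuous_on {a..b} (\<lambda>x. d1 (Complex x y))"
            by (rule continuous_on_compose2[OF X1(2) cC]) (use True in \<open>auto simp: mem_Q\<close>)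
          show "((\<lambda>x. X1 (Complex x y)) has_vector_derivative d1 (Complex x y)) (at x)" if "x \<in> {a..b}" for x
          proof -
            have "(\<lambda>t. X1 (Complex x y + of_real t)) = (\<lambda>t. X1 (Complex (x + t) y))"
              by (intro ext arg_cong[where f=X1]) (simp add: complex_eq_iff)
            then show ?thesis using X1(1)[of "Complex x y"] that True
              by (simp add: mem_Q has_vector_derivative_shift_0[of "\<lambda>x. X1 (Complex x y)"])
          qed
          show "X1 (Complex a y) = 0" "X1 (Complex b y) = 0" using X1(4) True ab by (auto simp: mem_Q)
          show "D0 1 (Complex x y) = l" if "x \<in> {a<..<b}" "((\<lambda>x. h (Complex x y)) has_vector_derivative l) (at x)" for x l
            using horizontal_derivative[OF that(2)] that(1) in_box by (simp add: D0_def in_box_complex_iff)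
        qed
        show ?thesis
          by (rule zero[OF int _ line]) (use True in \<open>auto simp: P1_def U1_def mem_Q indicator_def h0_def\<close>)
      qed
    qed
    then have "(\<integral>y. \<integral>x. P1 (Complex x y) + U1 (Complex x y) \<partial>lborel \<partial>lborel) = 0"
      by (rule integral_eq_zero_AE)
    then show ?thesis unfolding integral_complex_iterated(4)[OF i] .
  qed
  have z2: "(\<integral>z. P2 z + U2 z \<partial>lborel) = 0"
  proof -
    have i: "integrable lborel (\<lambda>z. P2 z + U2 z)" using Pint Uint by simp
    have "AE x in lborel. (\<integral>y. P2 (Complex x y) + U2 (Complex x y) \<partial>lborel) = 0"
      using integral_complex_iterated(1)[OF i] acy AE_lborel_singleton[of a] AE_lborel_singleton[of b]
    proof eventually_elim
      fix x assume int: "integrable lborel (\<lambda>y. P2 (Complex x y) + U2 (Complex x y))"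
        and ac: "x \<in> {a..b} \<longrightarrow> abs_cont_on c e (\<lambda>y. h (Complex x y))"
        and ends: "x \<noteq> a" "x \<noteq> b"
      show "(\<integral>y. P2 (Complex x y) + U2 (Complex x y) \<partial>lborel) = 0"
      proof (cases "x \<in> {a..b}")
        case False
        then have "P2 (Complex x y) + U2 (Complex x y) = 0" for y by (auto simp: P2_def U2_def mem_Q indicator_def)
        then show ?thesis by simp
      next
        case True
        then have in_box: "x \<in> {a<..<b}" using ends by auto
        have line: "((\<lambda>y. X2 (Complex x y) * (p (h (Complex x y)) \<bullet> D0 \<i> (Complex x y)) + u (h (Complex x y)) * d2 (Complex x y)) has_integral 0) {c..e}"
        proof (rule line_integral_zero[OF u B _ ce])
          show "abs_cont_on c e (\<lambda>y. h (Complex x y))" using ac True by blast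
          have cC: "continuous_on {c..e} (\<lambda>y. Complex x y)" unfolding Complex_eq by (intro continuous_intros)
          show "continuous_on {c..e} (\<lambda>y. d2 (Complex x y))"
            by (rule continuous_on_compose2[OF X2(2) cC]) (use True in \<open>auto simp: mem_Q\<close>)
          show "((\<lambda>y. X2 (Complex x y)) has_vector_derivative d2 (Complex x y)) (at y)" if "y \<in> {c..e}" for y
          proof -
            have "(\<lambda>t. X2 (Complex x y + of_real t * \<i>)) = (\<lambda>t. X2 (Complex x (y + t)))"
              by (intro ext arg_cong[where f=X2]) (simp add: complex_eq_iff)
            then show ?thesis using X2(1)[of "Complex x y"] that True
              by (simp add: mem_Q has_vector_derivative_shift_0[of "\<lambda>y. X2 (Complex x y)"])
          qed
          show "X2 (Complex x c) = 0" "X2 (Complex x e) = 0" using X2(4) True ce by (auto simp: mem_Q)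
          show "D0 \<i> (Complex x y) = l" if "y \<in> {c<..<e}" "((\<lambda>y. h (Complex x y)) has_vector_derivative l) (at y)" for y l
            using vertical_derivative[OF that(2)] that(1) in_box by (simp add: D0_def in_box_complex_iff)
        qed
        show ?thesis
          by (rule zero[OF int _ line]) (use True in \<open>auto simp: P2_def U2_def mem_Q indicator_def h0_def\<close>)
      qed
    qed
    then have "(\<integral>x. \<integral>y. P2 (Complex x y) + U2 (Complex x y) \<partial>lborel \<partial>lborel) = 0"
      by (rule integral_eq_zero_AE)
    then show ?thesis unfolding integral_complex_iterated(2)[OF i] .
  qed
  have eq: "(\<integral>z. indicator Q z * (u (h z) * (d1 z + d2 z)) \<partial>lborel) = - (\<integral>z. P1 z + P2 z \<partial>lborel)"
  proof -
    have "(\<integral>z. indicator Q z * (u (h z) * (d1 z + d2 z)) \<partial>lborel) = (\<integral>z. U1 z + U2 z \<partial>lborel)"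
      by (simp add: U1_def U2_def algebra_simps)
    then show ?thesis using z1 z2 Pint Uint by simp
  qed
  have "\<bar>\<integral>z. P1 z + P2 z \<partial>lborel\<bar> \<le> (\<integral>z. \<bar>P1 z + P2 z\<bar> \<partial>lborel)" by (rule integral_abs_bound)
  also have "\<dots> \<le> (\<integral>z. ((X1 z)\<^sup>2 + (X2 z)\<^sup>2) * indicator Q z / 2 + (f z)\<^sup>2 / 2 \<partial>lborel)"
    using Pint intXX f2 P12 by (intro integral_mono) (auto simp: mult.commute)
  also have "\<dots> = (\<integral>z. indicator Q z * ((X1 z)\<^sup>2 + (X2 z)\<^sup>2) \<partial>lborel) / 2 + (\<integral>z. (f z)\<^sup>2 \<partial>lborel) / 2"
    using intXX f2 by (simp add: mult.commute)
  finally show ?thesis unfolding eq using f2le by simp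
qed

end

subsection \<open>Cutoff functions\<close>

lemma DERIV_max_0_squared: "((\<lambda>x::real. (max 0 x)\<^sup>2) has_real_derivative 2 * max 0 x) (at x)"
proof (cases "x = 0")
  case True
  have "((\<lambda>h::real. (max 0 (0 + h))\<^sup>2 / h) \<longlongrightarrow> 0) (at 0)"
  proof (rule Lim_null_comparison)
    show "\<forall>\<^sub>F h in at 0. norm ((max 0 (0 + h))\<^sup>2 / h) \<le> \<bar>h\<bar>"
      by (intro always_eventually allI) (auto simp: max_def power2_eq_square)
    show "((\<lambda>h::real. \<bar>h\<bar>) \<longlongrightarrow> 0) (at 0)" by (auto intro!: tendsto_eq_intros)
  qed
  then show ?thesis using True by (simp add: DERIV_def)
next
  case False
  then consider "x > 0" | "x < 0" by linarith
  then show ?thesis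
  proof cases
    case 1
    have "((\<lambda>x::real. x\<^sup>2) has_real_derivative 2 * max 0 x) (at x)" using 1 by (auto intro!: derivative_eq_intros)
    then show ?thesis
      by (rule has_field_derivative_transform_within_open[of _ _ _ "{0<..}"]) (use 1 in auto)
  next
    case 2
    have "((\<lambda>x::real. 0) has_real_derivative 2 * max 0 x) (at x)" using 2 by (auto intro!: derivative_eq_intros)
    then show ?thesis
      by (rule has_field_derivative_transform_within_open[of _ _ _ "{..<0}"]) (use 2 in auto)
  qed
qed

text \<open>A \<open>C\<^sup>1\<close> step: a quadratic spline which is 0 for \<open>x \<le> 0\<close> and 1 for \<open>x \<ge> 1\<close>.\<close>

definition step :: "real \<Rightarrow> real" where
  "step x = 2 * ((max 0 x)\<^sup>2 - 2 * (max 0 (x - 1/2))\<^sup>2 + (max 0 (x - 1))\<^sup>2)"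
definition step' :: "real \<Rightarrow> real" where
  "step' x = 4 * (max 0 x - 2 * max 0 (x - 1/2) + max 0 (x - 1))"

lemma DERIV_step: "(step has_real_derivative step' x) (at x)"
proof -
  have sh: "((\<lambda>x. (max 0 (x - c))\<^sup>2) has_real_derivative 2 * max 0 (x - c)) (at x)" for c :: real
  proof -
    have "((\<lambda>x. x - c) has_real_derivative 1) (at x)" by (auto intro!: derivative_eq_intros)
    from DERIV_chain2[where f="\<lambda>x. (max 0 x)\<^sup>2" and g="\<lambda>x. x - c", OF DERIV_max_0_squared this] show ?thesis by simp
  qed
  show ?thesis unfolding step_def[abs_def] step'_def
    by (rule derivative_eq_intros sh DERIV_max_0_squared refl | simp add: algebra_simps)+
qed

lemma continuous_on_step' [continuous_intros]: "continuous_on A f \<Longrightarrow> continuous_on A (\<lambda>x. step' (f x))"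
  unfolding step'_def by (intro continuous_intros)

lemma continuous_on_step [continuous_intros]: "continuous_on A f \<Longrightarrow> continuous_on A (\<lambda>x. step (f x))"
  unfolding step_def by (intro continuous_intros)

lemma step'_bounds: "0 \<le> step' x" "step' x \<le> 2"
  by (auto simp: step'_def max_def)

lemma step'_eq_0: "x \<le> 0 \<Longrightarrow> step' x = 0" "x \<ge> 1 \<Longrightarrow> step' x = 0"
  by (auto simp: step'_def max_def)

lemma step_eq_0: "x \<le> 0 \<Longrightarrow> step x = 0" by (auto simp: step_def max_def)

lemma step_eq_1: "x \<ge> 1 \<Longrightarrow> step x = 1"
  by (auto simp: step_def max_def power2_eq_square algebra_simps)

lemma step_mono: "x \<le> y \<Longrightarrow> step x \<le> step y"
  using DERIV_step step'_bounds(1) by (intro DERIV_nonneg_imp_nondecreasing[of x y step]) blast+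

lemma step_bounds: "0 \<le> step x" "step x \<le> 1"
proof -
  show "0 \<le> step x" using step_mono[of "min x 0" x] step_eq_0[of "min x 0"] by simp
  show "step x \<le> 1" using step_mono[of x "max x 1"] step_eq_1[of "max x 1"] by simp
qed

section \<open>Polar coordinates and the angular potential\<close>

lemma
  assumes "w \<noteq> (0::complex)"
  shows has_derivative_ln_norm: "((\<lambda>w. ln (norm w)) has_derivative (\<lambda>v. Re (v / w))) (at w)"
    and has_derivative_cos_arg: "((\<lambda>w. Re w / norm w) has_derivative (\<lambda>v. - (Im w / norm w) * Im (v / w))) (at w)"
    and has_derivative_sin_arg: "((\<lambda>w. Im w / norm w) has_derivative (\<lambda>v. Re w / norm w * Im (v / w))) (at w)"
proof -
  have n: "norm w > 0" using assms by simp
  have nsq: "norm w * norm w = Re w * Re w + Im w * Im w" using cmod_power2[of w] by (simp add: power2_eq_square)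
  have dn: "(norm has_derivative (\<lambda>v. (Re v * Re w + Im v * Im w) / norm w)) (at w)"
    by (rule has_derivative_eq_rhs[OF has_derivative_norm[OF assms]])
      (simp add: fun_eq_iff sgn_div_norm inner_complex_def divide_inverse algebra_simps)
  have Rev: "Re (v / w) = (Re v * Re w + Im v * Im w) / (norm w * norm w)" for v
    unfolding nsq by (simp add: Re_divide power2_eq_square)
  have Imv: "Im (v / w) = (Im v * Re w - Re v * Im w) / (norm w * norm w)" for v
    unfolding nsq by (simp add: Im_divide power2_eq_square)
  show "((\<lambda>w. ln (norm w)) has_derivative (\<lambda>v. Re (v / w))) (at w)"
    by (rule has_derivative_eq_rhs[OF has_derivative_ln[OF n dn]]) (rule ext, unfold Rev, simp add: divide_inverse)
  have key1: "Re v * (norm w * norm w) - Re w * (Re v * Re w + Im v * Im w) = - (Im w * (Im v * Re w - Re v * Im w))" for v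
    unfolding nsq by (simp add: algebra_simps)
  have key2: "Im v * (norm w * norm w) - Im w * (Re v * Re w + Im v * Im w) = Re w * (Im v * Re w - Re v * Im w)" for v
    unfolding nsq by (simp add: algebra_simps)
  have q1: "Re v / norm w - Re w * ((Re v * Re w + Im v * Im w) / norm w) / (norm w * norm w) = - (Im w / norm w) * Im (v / w)" for v
  proof -
    have "Re v / norm w - Re w * ((Re v * Re w + Im v * Im w) / norm w) / (norm w * norm w)
        = (Re v * (norm w * norm w) - Re w * (Re v * Re w + Im v * Im w)) / (norm w * (norm w * norm w))"
      using n by (simp add: field_simps)
    then show ?thesis unfolding key1 Imv by simp
  qed
  have q2: "Im v / norm w - Im w * ((Re v * Re w + Im v * Im w) / norm w) / (norm w * norm w) = Re w / norm w * Im (v / w)" for v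
  proof -
    have "Im v / norm w - Im w * ((Re v * Re w + Im v * Im w) / norm w) / (norm w * norm w)
        = (Im v * (norm w * norm w) - Im w * (Re v * Re w + Im v * Im w)) / (norm w * (norm w * norm w))"
      using n by (simp add: field_simps)
    then show ?thesis unfolding key2 Imv by simp
  qed
  have dR: "(Re has_derivative Re) (at w)" "(Im has_derivative Im) (at w)"
    by (auto intro!: bounded_linear_imp_has_derivative bounded_linear_Re bounded_linear_Im)
  show "((\<lambda>w. Re w / norm w) has_derivative (\<lambda>v. - (Im w / norm w) * Im (v / w))) (at w)"
    by (rule has_derivative_eq_rhs[OF has_derivative_divide'[OF dR(1) dn]])
      (use n q1 in \<open>auto simp: fun_eq_iff field_simps\<close>)
  show "((\<lambda>w. Im w / norm w) has_derivative (\<lambda>v. Re w / norm w * Im (v / w))) (at w)"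
    by (rule has_derivative_eq_rhs[OF has_derivative_divide'[OF dR(2) dn]])
      (use n q2 in \<open>auto simp: fun_eq_iff field_simps\<close>)
qed

corollary holomorphic_change_of_variables:
  fixes f :: "complex \<Rightarrow> real"
  assumes S: "S \<in> sets borel" and der: "\<And>z. z \<in> S \<Longrightarrow> (g has_field_derivative g' z) (at z)" and inj: "inj_on g S"
  shows "(\<lambda>z. (norm (g' z))\<^sup>2 * f (g z)) absolutely_integrable_on S \<and> integral S (\<lambda>z. (norm (g' z))\<^sup>2 * f (g z)) = b
    \<longleftrightarrow> f absolutely_integrable_on g ` S \<and> integral (g ` S) f = b"
proof -
  have d: "(g has_derivative (*) (g' z)) (at z within S)" if "z \<in> S" for z
    using der[OF that] by (simp add: has_field_derivative_def has_derivative_at_withinI)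
  have J: "(norm (g' z))\<^sup>2 = Re (g' z * 1) * Im (g' z * \<i>) - Im (g' z * 1) * Re (g' z * \<i>)" for z
    by (simp add: cmod_power2) (simp add: power2_eq_square)
  have a: "\<bar>(norm (g' z))\<^sup>2\<bar> = (norm (g' z))\<^sup>2" for z by simp
  show ?thesis using complex_change_of_variables[OF S d inj J, where f=f and b=b, unfolded a] by blast
qed

text \<open>In polar coordinates arcsin (cos \<theta>) is pi/2 - |\<theta>|, the angular function
  with values pi/2 and -pi/2 on the two half-axes and slope of modulus 1. The factor
  \<open>sin A\<close> with A < pi/2 rounds its corners, and \<open>step\<close> removes the
  singularity at 0. The functions \<open>pot_a\<close> and \<open>pot_b\<close> are the derivatives
  in ln (norm w) and in the argument.\<close>

definition potential :: "real \<Rightarrow> real \<Rightarrow> complex \<Rightarrow> real" where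
  "potential A T w = arcsin (sin A * (Re w / norm w)) * step (ln (norm w) - T)"

definition pot_a :: "real \<Rightarrow> real \<Rightarrow> complex \<Rightarrow> real" where
  "pot_a A T w = arcsin (sin A * (Re w / norm w)) * step' (ln (norm w) - T)"

definition pot_b :: "real \<Rightarrow> real \<Rightarrow> complex \<Rightarrow> real" where
  "pot_b A T w = - (sin A * (Im w / norm w) / sqrt (1 - (sin A * (Re w / norm w))\<^sup>2)) * step (ln (norm w) - T)"

definition potential_grad :: "real \<Rightarrow> real \<Rightarrow> complex \<Rightarrow> complex" where
  "potential_grad A T w = Complex (pot_a A T w) (pot_b A T w) * w / of_real ((norm w)\<^sup>2)"

lemma sin_A_cos_bounds:
  assumes "0 < A" "A < pi / 2"
  shows "\<bar>sin A * (Re w / norm w)\<bar> < 1" "0 < sin A" "sin A < 1"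
proof -
  show s: "0 < sin A" using assms by (intro sin_gt_zero) auto
  show s1: "sin A < 1" using assms sin_monotone_2pi[of A "pi/2"] by simp
  have c: "\<bar>Re w / norm w\<bar> \<le> 1"
    by (cases "w = 0") (auto simp: abs_Re_le_cmod divide_le_eq_1)
  have "\<bar>sin A * (Re w / norm w)\<bar> \<le> sin A * 1"
    unfolding abs_mult using s c by (intro mult_mono) auto
  then show "\<bar>sin A * (Re w / norm w)\<bar> < 1" using s1 by simp
qed

text \<open>The bound 1 for the angular derivative decides the sharp constant; it comes from S^2 +
  C^2 \<le> (sin A)^2. The radial derivative lives over one unit of ln (norm w) only, where a crude
  bound is enough.\<close>

lemma pot_bounds:
  assumes "0 < A" "A < pi / 2"
  shows "\<bar>pot_a A T w\<bar> \<le> pi" "\<bar>pot_b A T w\<bar> \<le> 1"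
proof -
  note s = sin_A_cos_bounds(1)[OF assms, of w] sin_A_cos_bounds(2,3)[OF assms]
  have "\<bar>arcsin (sin A * (Re w / norm w))\<bar> \<le> pi / 2"
  proof -
    have c: "- 1 \<le> sin A * (Re w / norm w)" "sin A * (Re w / norm w) \<le> 1"
      using s(1) by linarith+
    show ?thesis using arcsin_lbound[OF c] arcsin_ubound[OF c] by linarith
  qed
  then have "\<bar>pot_a A T w\<bar> \<le> pi / 2 * 2"
    unfolding pot_a_def abs_mult using step'_bounds by (intro mult_mono) auto
  then show "\<bar>pot_a A T w\<bar> \<le> pi" by simp
  define S where "S = sin A * (Im w / norm w)"
  define C where "C = sin A * (Re w / norm w)"
  have C: "C\<^sup>2 < 1" using s(1) unfolding C_def by (simp add: abs_square_less_1)
  have "S\<^sup>2 \<le> 1 - C\<^sup>2"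
  proof -
    have "S\<^sup>2 + C\<^sup>2 = (sin A)\<^sup>2 * ((Im w / norm w)\<^sup>2 + (Re w / norm w)\<^sup>2)"
      by (simp only: S_def C_def power_mult_distrib distrib_left)
    also have "(Im w / norm w)\<^sup>2 + (Re w / norm w)\<^sup>2 \<le> 1"
      by (cases "w = 0") (auto simp: power_divide cmod_power2 add_divide_distrib[symmetric] add.commute)
    also have "(sin A)\<^sup>2 * 1 \<le> 1" using s by (simp add: abs_square_le_1)
    finally show ?thesis by (simp add: mult_left_mono)
  qed
  then have "\<bar>S\<bar> \<le> sqrt (1 - C\<^sup>2)" using real_le_rsqrt[of "\<bar>S\<bar>"] by simp
  then have "\<bar>S / sqrt (1 - C\<^sup>2)\<bar> \<le> 1" using C by (simp add: divide_le_eq_1)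
  then have "\<bar>S / sqrt (1 - C\<^sup>2)\<bar> * \<bar>step (ln (norm w) - T)\<bar> \<le> 1 * 1"
    using step_bounds by (intro mult_mono) auto
  then show "\<bar>pot_b A T w\<bar> \<le> 1" unfolding pot_b_def S_def C_def by (simp add: abs_mult)
qed

lemma pot_eq_0:
  assumes "w = 0 \<or> ln (norm w) \<le> T"
  shows "potential A T w = 0" "potential_grad A T w = 0"
  using assms step_eq_0[of "ln (norm w) - T"] step'_eq_0[of "ln (norm w) - T"]
  by (auto simp: potential_def potential_grad_def pot_a_def pot_b_def complex_eq_iff)

lemma norm_potential_grad: "norm (potential_grad A T w) = sqrt ((pot_a A T w)\<^sup>2 + (pot_b A T w)\<^sup>2) / norm w"
  by (cases "w = 0") (simp_all add: potential_grad_def norm_mult norm_divide complex_norm power2_eq_square)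

lemma potential_near_0: "w \<in> ball 0 (exp T) \<Longrightarrow> w = 0 \<or> ln (norm w) \<le> T"
  by (metis dist_0_norm ln_exp ln_le_cancel_iff exp_gt_zero less_imp_le mem_ball zero_less_norm_iff)

lemma potential_has_derivative:
  assumes A: "0 < A" "A < pi / 2"
  shows "(potential A T has_derivative (\<lambda>v. potential_grad A T w \<bullet> v)) (at w)"
proof (cases "w = 0")
  case True
  have "((\<lambda>_. 0) has_derivative (\<lambda>v. potential_grad A T w \<bullet> v)) (at w)"
    using True by (simp add: potential_grad_def)
  then show ?thesis
    by (rule has_derivative_transform_within_open[of _ _ _ UNIV "ball 0 (exp T)"])
      (use True pot_eq_0(1)[OF potential_near_0] in simp_all)
next
  case False
  define C where "C = (\<lambda>w. sin A * (Re w / norm w))"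
  note s = sin_A_cos_bounds(1)[OF A, of w]
  have dC: "(C has_derivative (\<lambda>v. sin A * (- (Im w / norm w) * Im (v / w)))) (at w)"
    unfolding C_def by (rule has_derivative_mult_right[OF has_derivative_cos_arg[OF False]])
  have das: "(arcsin has_real_derivative inverse (sqrt (1 - (C w)\<^sup>2))) (at (C w))"
    using s unfolding C_def abs_less_iff by (intro DERIV_arcsin) linarith+
  have d1: "((\<lambda>w. arcsin (C w)) has_derivative (\<lambda>v. sin A * (- (Im w / norm w) * Im (v / w)) * inverse (sqrt (1 - (C w)\<^sup>2)))) (at w)"
    using DERIV_compose_FDERIV[OF das dC] .
  have d0: "((\<lambda>w. ln (norm w) - T) has_derivative (\<lambda>v. Re (v / w))) (at w)"
    using has_derivative_diff[OF has_derivative_ln_norm[OF False] has_derivative_const[of T]] by simp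
  have d2: "((\<lambda>w. step (ln (norm w) - T)) has_derivative (\<lambda>v. Re (v / w) * step' (ln (norm w) - T))) (at w)"
    using DERIV_compose_FDERIV[OF DERIV_step d0] .
  have "(potential A T has_derivative (\<lambda>v. arcsin (C w) * (Re (v / w) * step' (ln (norm w) - T))
      + sin A * (- (Im w / norm w) * Im (v / w)) * inverse (sqrt (1 - (C w)\<^sup>2)) * step (ln (norm w) - T))) (at w)"
    using has_derivative_mult[OF d1 d2] unfolding potential_def[abs_def] C_def .
  moreover have "arcsin (C w) * (Re (v / w) * step' (ln (norm w) - T))
      + sin A * (- (Im w / norm w) * Im (v / w)) * inverse (sqrt (1 - (C w)\<^sup>2)) * step (ln (norm w) - T)
      = potential_grad A T w \<bullet> v" for v
  proof -
    have "potential_grad A T w \<bullet> v = pot_a A T w * Re (v / w) + pot_b A T w * Im (v / w)"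
      unfolding potential_grad_def inner_complex_def Re_divide_of_real Im_divide_of_real
      by (simp add: Re_divide Im_divide cmod_power2 add_divide_distrib[symmetric] diff_divide_distrib[symmetric]) (simp add: algebra_simps)
    then show ?thesis by (simp add: pot_a_def pot_b_def C_def divide_inverse)
  qed
  ultimately show ?thesis by simp
qed

lemma norm_potential_grad_le:
  assumes A: "0 < A" "A < pi / 2"
  shows "norm (potential_grad A T w) \<le> 5 * exp (- T)"
proof (cases "w = 0 \<or> ln (norm w) \<le> T")
  case True
  then show ?thesis using pot_eq_0 by simp
next
  case False
  then have w: "norm w > 0" "ln (norm w) > T" by auto
  then have "norm w \<ge> exp T" by (metis exp_ln exp_less_mono less_imp_le)
  have "sqrt ((pot_a A T w)\<^sup>2 + (pot_b A T w)\<^sup>2) \<le> \<bar>pot_a A T w\<bar> + \<bar>pot_b A T w\<bar>"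
    by (rule sqrt_sum_squares_le_sum_abs)
  also have "\<dots> \<le> 5"
  proof -
    have "pi \<le> 4" using pi_approx(2) by simp
    then show ?thesis using pot_bounds[OF A, of T w] by linarith
  qed
  finally have "norm (potential_grad A T w) \<le> 5 / norm w"
    unfolding norm_potential_grad by (rule divide_right_mono) simp
  also have "\<dots> \<le> 5 / exp T" using \<open>norm w \<ge> exp T\<close> w(1) by (intro divide_left_mono mult_pos_pos) auto
  finally show ?thesis by (simp add: exp_minus divide_inverse)
qed

lemma continuous_on_potential_grad:
  assumes A: "0 < A" "A < pi / 2"
  shows "continuous_on UNIV (potential_grad A T)"
proof -
  have "continuous_on (-{0}) (potential_grad A T)"
  proof -
    have "(sin A * (Re w / norm w))\<^sup>2 < 1" for w
      using sin_A_cos_bounds(1)[OF A, of w] by (simp add: abs_square_less_1)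
    then have sq: "sqrt (1 - (sin A * (Re w / norm w))\<^sup>2) \<noteq> 0" for w
      by (metis diff_gt_0_iff_gt less_irrefl real_sqrt_eq_zero_cancel_iff)
    have c1: "- 1 \<le> sin A * (Re w / norm w) \<and> sin A * (Re w / norm w) \<le> 1" for w
      using sin_A_cos_bounds(1)[OF A, of w] by linarith
    have cR: "continuous_on (-{0}) (\<lambda>w. sin A * (Re w / norm w))" "continuous_on (-{0}) (\<lambda>w. sin A * (Im w / norm w))"
      by (intro continuous_intros; simp)+
    have cl: "continuous_on (-{0::complex}) (\<lambda>w. ln (norm w) - T)" by (intro continuous_intros) auto
    have ca: "continuous_on (-{0}) (pot_a A T)"
      unfolding pot_a_def[abs_def] by (intro continuous_on_mult continuous_on_arcsin continuous_on_step' cR cl ballI c1)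
    have cb: "continuous_on (-{0}) (pot_b A T)"
      unfolding pot_b_def[abs_def]
      by (intro continuous_on_mult continuous_on_minus continuous_on_divide continuous_on_real_sqrt continuous_on_diff
          continuous_on_const continuous_on_power continuous_on_step cR cl ballI sq)
    show ?thesis
      unfolding potential_grad_def[abs_def] Complex_eq
      by (intro continuous_intros ca cb) auto
  qed
  moreover have "continuous_on (ball 0 (exp T)) (potential_grad A T)"
    using pot_eq_0(2)[OF potential_near_0] by (subst continuous_on_cong[OF refl, of _ _ "\<lambda>_. 0"]) auto
  moreover have "- {0} \<union> ball 0 (exp T) = (UNIV :: complex set)" by auto
  ultimately show ?thesis by (metis continuous_on_open_Un open_ball open_delete open_UNIV Compl_eq_Diff_UNIV)
qed

text \<open>The gradient of an angular function is not square integrable at infinity. The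
  restriction to the unit disc is adequate because the maps considered take their values
  there.\<close>

definition pot_energy :: "real \<Rightarrow> real \<Rightarrow> complex \<Rightarrow> real" where
  "pot_energy A T w = indicator (cball 0 1) w * norm (potential_grad A T w)"

text \<open>The strip is half-open in the imaginary direction so that \<open>exp\<close> is
  injective on it; the missing side is part of a line and hence negligible.\<close>

lemma polar_strip:
  fixes \<alpha> \<beta> :: real
  defines "S \<equiv> {\<zeta>. Re \<zeta> \<in> {\<alpha>..\<beta>} \<and> Im \<zeta> \<in> {-pi<..pi}}"
  shows "S \<in> sets borel" "inj_on exp S" "exp ` S = {w. exp \<alpha> \<le> norm w \<and> norm w \<le> exp \<beta>}"
    "S \<subseteq> cbox (Complex \<alpha> (-pi)) (Complex \<beta> pi)" "S \<in> lmeasurable"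
    "negligible (cbox (Complex \<alpha> (-pi)) (Complex \<beta> pi) - S)"
proof -
  have "S = {\<zeta>. Re \<zeta> \<ge> \<alpha>} \<inter> {\<zeta>. Re \<zeta> \<le> \<beta>} \<inter> {\<zeta>. Im \<zeta> > - pi} \<inter> {\<zeta>. Im \<zeta> \<le> pi}"
    by (auto simp: S_def)
  then show Sb: "S \<in> sets borel"
    by (auto intro!: sets.Int borel_open borel_closed closed_halfspace_Re_ge closed_halfspace_Re_le closed_halfspace_Im_le open_halfspace_Im_gt)
  show "inj_on exp S"
  proof (rule inj_onI)
    fix x y assume "x \<in> S" "y \<in> S" "exp x = exp y"
    then show "x = y" by (metis (mono_tags, lifting) Ln_exp S_def greaterThanAtMost_iff mem_Collect_eq)
  qed
  show "exp ` S = {w. exp \<alpha> \<le> norm w \<and> norm w \<le> exp \<beta>}"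
  proof (intro equalityI subsetI)
    fix w :: complex assume "w \<in> exp ` S" then show "w \<in> {w. exp \<alpha> \<le> norm w \<and> norm w \<le> exp \<beta>}" by (auto simp: S_def)
  next
    fix w :: complex assume w: "w \<in> {w. exp \<alpha> \<le> norm w \<and> norm w \<le> exp \<beta>}"
    then have w0: "w \<noteq> 0" using exp_gt_zero[of \<alpha>] by auto
    then have "norm w > 0" by simp
    have "\<alpha> \<le> ln (norm w)" "ln (norm w) \<le> \<beta>"
      using w \<open>norm w > 0\<close> ln_le_cancel_iff[of "norm w" "exp \<beta>"] by (auto simp: ln_ge_iff)
    then have "Ln w \<in> S" using w0 by (auto simp: S_def Re_Ln mpi_less_Im_Ln Im_Ln_le_pi)
    then show "w \<in> exp ` S" using w0 exp_Ln by (metis imageI)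
  qed
  show Ssub: "S \<subseteq> cbox (Complex \<alpha> (-pi)) (Complex \<beta> pi)" by (auto simp: S_def in_cbox_complex_iff)
  show "S \<in> lmeasurable"
    using Sb Ssub by (intro bounded_set_imp_lmeasurable) (auto intro: bounded_subset[OF bounded_cbox])
  have "cbox (Complex \<alpha> (-pi)) (Complex \<beta> pi) - S \<subseteq> {z. \<i> \<bullet> z = - pi}"
    by (auto simp: S_def in_cbox_complex_iff inner_complex_def)
  then show "negligible (cbox (Complex \<alpha> (-pi)) (Complex \<beta> pi) - S)"
    by (rule negligible_subset[OF negligible_hyperplane[of \<i> "-pi"], rotated]) simp
qed

lemma measure_strip:
  assumes "\<alpha> \<le> \<beta>"
  shows "measure lebesgue {\<zeta>. Re \<zeta> \<in> {\<alpha>..\<beta>} \<and> Im \<zeta> \<in> {-pi<..pi}} \<le> 2 * pi * (\<beta> - \<alpha>)"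
proof -
  have "measure lebesgue {\<zeta>. Re \<zeta> \<in> {\<alpha>..\<beta>} \<and> Im \<zeta> \<in> {-pi<..pi}} \<le> measure lebesgue (cbox (Complex \<alpha> (-pi)) (Complex \<beta> pi))"
    using polar_strip(4,5) by (intro measure_mono_fmeasurable) (auto dest: fmeasurableD)
  also have "\<dots> = 2 * pi * (\<beta> - \<alpha>)"
    using assms by (simp add: measure_lborel_cbox_eq Basis_complex_def inner_complex_def algebra_simps)
  finally show ?thesis .
qed

text \<open>In logarithmic coordinates the energy density is the sum of the squares of
  \<open>pot_a\<close> and \<open>pot_b\<close>, by conformal invariance. The angular part
  contributes at most the area -2 pi T of the strip, the radial part at most pi^2 < 10 on a strip of
  width 1, hence the term 10 - T.\<close>

lemma pot_energy_integral:
  assumes A: "0 < A" "A < pi / 2" and T: "T \<le> 0"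
  shows "pot_energy A T \<in> borel_measurable borel" "integrable lborel (\<lambda>w. (pot_energy A T w)\<^sup>2)"
    "(\<integral>w. (pot_energy A T w)\<^sup>2 \<partial>lborel) \<le> 2 * pi * (10 - T)"
proof -
  have pm: "(\<lambda>w. norm (potential_grad A T w)) \<in> borel_measurable borel"
    by (intro borel_measurable_continuous_onI continuous_intros continuous_on_potential_grad A)
  show gm: "pot_energy A T \<in> borel_measurable borel" unfolding pot_energy_def[abs_def]
    by (intro borel_measurable_times borel_measurable_indicator pm) auto
  have eq: "(pot_energy A T w)\<^sup>2 = indicator (cball 0 1) w *\<^sub>R (norm (potential_grad A T w))\<^sup>2" for w
    by (simp add: pot_energy_def power_mult_distrib indicator_def)
  show gi: "integrable lborel (\<lambda>w. (pot_energy A T w)\<^sup>2)" unfolding eq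
    by (intro borel_integrable_compact continuous_intros continuous_on_subset[OF continuous_on_potential_grad[OF A]]) auto
  define f where "f = (\<lambda>w. (pot_energy A T w)\<^sup>2)"
  have fU: "f absolutely_integrable_on UNIV" unfolding f_def
    using gi by (simp add: set_integrable_def integrable_completion borel_measurable_integrable)
  define S where "S = {\<zeta>. Re \<zeta> \<in> {T..0} \<and> Im \<zeta> \<in> {-pi<..pi}}"
  define S1 where "S1 = {\<zeta>. Re \<zeta> \<in> {T..T+1} \<and> Im \<zeta> \<in> {-pi<..pi}}"
  note ps = polar_strip[of T 0, folded S_def] and ps1 = polar_strip[of T "T+1", folded S1_def]
  have eS: "exp ` S \<in> sets lebesgue"
  proof -
    have "closed {w::complex. exp T \<le> norm w \<and> norm w \<le> exp 0}"
      by (intro closed_Collect_conj closed_Collect_le continuous_intros)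
    then show ?thesis by (simp add: ps(3))
  qed
  have expS: "f absolutely_integrable_on exp ` S"
    by (rule set_integrable_subset[OF fU eS]) simp
  have cv: "(\<lambda>z. (norm (exp z))\<^sup>2 * f (exp z)) absolutely_integrable_on S \<and>
      integral S (\<lambda>z. (norm (exp z))\<^sup>2 * f (exp z)) = integral (exp ` S) f"
    by (rule holomorphic_change_of_variables[THEN iffD2]) (use ps(1,2) expS in \<open>auto intro: DERIV_exp\<close>)
  have f0: "f w = 0" if "w \<notin> exp ` S" for w
  proof (cases "w \<in> cball 0 1 \<and> w \<noteq> 0")
    case True
    then have "norm w < exp T" using that by (auto simp: ps(3))
    then show ?thesis using pot_eq_0(2)[OF potential_near_0] by (simp add: f_def pot_energy_def)
  next
    case False
    then show ?thesis by (auto simp: f_def pot_energy_def potential_grad_def)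
  qed
  have bnd: "(norm (exp z))\<^sup>2 * f (exp z) \<le> 1 + 10 * indicator S1 z" if z: "z \<in> S" for z
  proof -
    have "(norm (exp z))\<^sup>2 * f (exp z) \<le> (pot_a A T (exp z))\<^sup>2 + (pot_b A T (exp z))\<^sup>2"
      unfolding f_def pot_energy_def norm_potential_grad
      by (simp add: power_mult_distrib power_divide indicator_def)
    also have "(pot_b A T (exp z))\<^sup>2 \<le> 1" using pot_bounds(2)[OF A] by (simp add: abs_square_le_1)
    also have "(pot_a A T (exp z))\<^sup>2 \<le> 10 * indicator S1 z"
    proof (cases "z \<in> S1")
      case True
      have "\<bar>pot_a A T (exp z)\<bar>\<^sup>2 \<le> (3.15)\<^sup>2"
        using pot_bounds(1)[OF A, of T "exp z"] pi_approx by (intro power_mono) auto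
      then show ?thesis using True by (simp add: power2_eq_square)
    next
      case False
      then have "Re z - T \<ge> 1" using z by (auto simp: S_def S1_def)
      then show ?thesis using False by (simp add: pot_a_def step'_eq_0)
    qed
    finally show ?thesis by simp
  qed
  have "(\<integral>w. f w \<partial>lborel) = integral UNIV f" using gi by (simp add: integral_lborel f_def)
  also have "\<dots> = integral (exp ` S) f"
  proof -
    have "(\<lambda>w. if w \<in> exp ` S then f w else 0) = f" using f0 by auto
    then show ?thesis by (metis integral_restrict_UNIV)
  qed
  also have "\<dots> = integral S (\<lambda>z. (norm (exp z))\<^sup>2 * f (exp z))" using cv by simp
  also have "\<dots> \<le> integral S (\<lambda>z. 1 + 10 * indicator S1 z)"
  proof (rule integral_le)
    show "(\<lambda>z. (norm (exp z))\<^sup>2 * f (exp z)) integrable_on S"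
      using cv set_lebesgue_integral_eq_integral(1) by blast
    show "(\<lambda>z. 1 + 10 * indicator S1 z :: real) integrable_on S"
      using ps(5) ps1(5) by (intro integrable_add integrable_on_cmult_left)
        (auto simp: integrable_on_const integrable_on_indicator fmeasurable.Int)
  qed (rule bnd)
  also have "\<dots> = measure lebesgue S + 10 * measure lebesgue (S1 \<inter> S)"
    using ps(5) ps1(5) by (subst integral_add)
      (auto simp: integrable_on_const integrable_on_indicator lmeasure_integral integral_indicator fmeasurable.Int integrable_on_cmult_left)
  also have "\<dots> \<le> measure lebesgue S + 10 * measure lebesgue S1"
    using ps(5) ps1(5) by (intro add_left_mono mult_left_mono measure_mono_fmeasurable) (auto dest: fmeasurableD)
  also have "\<dots> \<le> 2 * pi * (0 - T) + 10 * (2 * pi * (T + 1 - T))"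
    unfolding S_def S1_def using T by (intro add_mono mult_left_mono measure_strip) auto
  also have "\<dots> = 2 * pi * (10 - T)" by (simp add: algebra_simps)
  finally show "(\<integral>w. (pot_energy A T w)\<^sup>2 \<partial>lborel) \<le> 2 * pi * (10 - T)" by (simp add: f_def)
qed

section \<open>Logarithmic charts at points of the unit circle\<close>

definition chart :: "complex \<Rightarrow> complex \<Rightarrow> complex" where "chart p z = Ln (z / p) / (2 * of_real pi * \<i>)"
definition unchart :: "complex \<Rightarrow> complex \<Rightarrow> complex" where "unchart p w = p * exp (2 * of_real pi * \<i> * w)"

lemma chart_domain:
  fixes p z :: complex
  assumes p: "norm p = 1" and z: "z \<in> ball p (1/2)"
  shows "norm (z / p - 1) < 1/2" "z \<noteq> 0" "z / p \<notin> \<real>\<^sub>\<le>\<^sub>0" "norm z > 1/2" "p \<noteq> 0"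
proof -
  show p0: "p \<noteq> 0" using p by auto
  have "z / p - 1 = (z - p) / p" using p0 diff_divide_distrib[of z p p] by auto
  then show n: "norm (z / p - 1) < 1/2" using z p by (simp add: norm_divide dist_norm norm_minus_commute)
  have "norm p \<le> norm z + norm (p - z)" by (metis add.commute diff_add_cancel norm_triangle_ineq)
  then show nz: "norm z > 1/2" using z p by (simp add: dist_norm)
  then show "z \<noteq> 0" by auto
  have "\<bar>Re (z / p - 1)\<bar> < 1/2" using n abs_Re_le_cmod[of "z / p - 1"] by linarith
  then have "Re (z / p) > 0" unfolding minus_complex.sel one_complex.sel by linarith
  then show "z / p \<notin> \<real>\<^sub>\<le>\<^sub>0" by (auto simp: complex_nonpos_Reals_iff)
qed

lemma unchart_chart: "norm p = 1 \<Longrightarrow> z \<in> ball p (1/2) \<Longrightarrow> unchart p (chart p z) = z"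
  using chart_domain[of p z] by (simp add: unchart_def chart_def)

lemma chart_unchart: "norm p = 1 \<Longrightarrow> \<bar>Re w\<bar> < 1/2 \<Longrightarrow> chart p (unchart p w) = w"
proof -
  assume p: "norm p = 1" and w: "\<bar>Re w\<bar> < 1/2"
  have "Im (2 * of_real pi * \<i> * w) = 2 * pi * Re w" by simp
  moreover have "\<bar>2 * pi * Re w\<bar> < pi" using w by (simp add: abs_mult)
  ultimately have "Ln (exp (2 * of_real pi * \<i> * w)) = 2 * of_real pi * \<i> * w"
    by (intro Ln_exp) (auto simp: abs_less_iff)
  moreover have "unchart p w / p = exp (2 * of_real pi * \<i> * w)" using p by (auto simp: unchart_def)
  ultimately show ?thesis by (simp add: chart_def)
qed

lemma norm_chart_le: "norm p = 1 \<Longrightarrow> z \<in> ball p (1/2) \<Longrightarrow> norm (chart p z) \<le> 1"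
proof -
  assume p: "norm p = 1" and z: "z \<in> ball p (1/2)"
  have "norm (Ln (1 + (z / p - 1))) \<le> 2 * norm (z / p - 1)"
    using chart_domain(1)[OF p z] by (intro norm_Ln_le) auto
  then have "norm (Ln (z / p)) \<le> 1" using chart_domain(1)[OF p z] by simp
  also have "1 \<le> 2 * pi" using pi_ge_two by simp
  finally show ?thesis by (simp add: chart_def norm_divide norm_mult divide_le_eq_1)
qed

lemma chart_has_field_derivative:
  assumes "norm p = 1" "z \<in> ball p (1/2)"
  shows "(chart p has_field_derivative 1 / (2 * of_real pi * \<i> * z)) (at z)"
  unfolding chart_def[abs_def]
  by (rule derivative_eq_intros refl | use chart_domain[OF assms] in \<open>simp add: field_simps\<close>)+

lemma chart_Lipschitz:
  assumes p: "norm p = 1" and xy: "x \<in> ball p (1/2)" "y \<in> ball p (1/2)"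
  shows "norm (chart p x - chart p y) \<le> norm (x - y)"
proof -
  have "norm (chart p x - chart p y) \<le> 1 * norm (x - y)"
  proof (rule field_differentiable_bound[OF convex_ball _ _ xy])
    fix z assume z: "z \<in> ball p (1/2)"
    show "(chart p has_field_derivative 1 / (2 * of_real pi * \<i> * z)) (at z within ball p (1/2))"
      using chart_has_field_derivative[OF p z] by (rule has_field_derivative_at_within)
    have "2 * pi * norm z \<ge> 2 * 2 * (1/2)" using chart_domain(4)[OF p z] pi_ge_two by (intro mult_mono) auto
    then show "norm (1 / (2 * of_real pi * \<i> * z)) \<le> 1" by (simp add: norm_divide norm_mult divide_le_eq_1)
  qed
  then show ?thesis by simp
qed

section \<open>A smoothed sign function and the cutoff built from it\<close>

definition psi :: "real \<Rightarrow> real" where "psi s = 2 * step ((s + 1) / 2) - 1"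
definition psi' :: "real \<Rightarrow> real" where "psi' s = step' ((s + 1) / 2)"

lemma DERIV_psi: "(psi has_real_derivative psi' s) (at s)"
proof -
  have "((\<lambda>s::real. (s + 1) / 2) has_real_derivative 1/2) (at s)" by (auto intro!: derivative_eq_intros)
  from DERIV_chain2[OF DERIV_step this] show ?thesis
    unfolding psi_def[abs_def] psi'_def by (auto intro!: derivative_eq_intros)
qed

lemma psi_simps: "s \<le> -1 \<Longrightarrow> psi s = -1" "s \<ge> 1 \<Longrightarrow> psi s = 1" "\<bar>psi s\<bar> \<le> 1" "psi' s \<ge> 0"
  "\<bar>s\<bar> \<ge> 1 \<Longrightarrow> psi' s = 0"
  using step_eq_0[of "(s+1)/2"] step_eq_1[of "(s+1)/2"] step_bounds[of "(s+1)/2"] step'_bounds[of "(s+1)/2"] step'_eq_0[of "(s+1)/2"]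
  by (auto simp: psi_def psi'_def abs_le_iff abs_if split: if_splits)

lemma continuous_on_psi: "continuous_on A f \<Longrightarrow> continuous_on A (\<lambda>x. psi (f x))"
  "continuous_on A f \<Longrightarrow> continuous_on A (\<lambda>x. psi' (f x))"
  unfolding psi_def psi'_def by (intro continuous_intros; simp)+

text \<open>The \<theta>-derivative of \<open>psi (sin \<theta> / \<delta>)\<close>, a smoothed sign
  of sin \<theta>. For small \<delta> it is a positive mass near 0 and a negative one near pi and
  -pi.\<close>

definition bump :: "real \<Rightarrow> real \<Rightarrow> real" where "bump \<delta> \<theta> = psi' (sin \<theta> / \<delta>) * (cos \<theta> / \<delta>)"

text \<open>This is the total variation of the smoothed sign once around the circle: it rises by 2
  across the right half and falls by 2 across the left half.\<close>

lemma integral_abs_bump: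
  assumes \<delta>: "0 < \<delta>" "\<delta> \<le> 1"
  shows "((\<lambda>\<theta>. \<bar>bump \<delta> \<theta>\<bar>) has_integral 4) {-pi..pi}"
proof -
  have der: "((\<lambda>\<theta>. psi (sin \<theta> / \<delta>)) has_vector_derivative bump \<delta> \<theta>) (at \<theta> within A)" for \<theta> A
  proof -
    have "((\<lambda>\<theta>. sin \<theta> / \<delta>) has_real_derivative cos \<theta> / \<delta>) (at \<theta>)" using \<delta> by (auto intro!: derivative_eq_intros)
    from DERIV_chain2[OF DERIV_psi this] show ?thesis
      unfolding bump_def by (simp add: has_real_derivative_iff_has_vector_derivative has_vector_derivative_at_within)
  qed
  have ends: "psi (sin (pi/2) / \<delta>) = 1" "psi (sin (-pi/2) / \<delta>) = -1" "psi (sin pi / \<delta>) = psi 0" "psi (sin (-pi) / \<delta>) = psi 0"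
    using \<delta> psi_simps(1)[of "-1/\<delta>"] psi_simps(2)[of "1/\<delta>"] by (auto simp: field_simps)
  have i1: "(bump \<delta> has_integral -1 - psi 0) {-pi..-pi/2}"
    using fundamental_theorem_of_calculus[OF _ der, of "-pi" "-pi/2"] ends by simp
  have i2: "(bump \<delta> has_integral 2) {-pi/2..pi/2}"
    using fundamental_theorem_of_calculus[OF _ der, of "-pi/2" "pi/2"] ends by simp
  have i3: "(bump \<delta> has_integral psi 0 - 1) {pi/2..pi}"
    using fundamental_theorem_of_calculus[OF _ der, of "pi/2" "pi"] ends by simp
  have c1: "cos \<theta> \<le> 0" if "\<theta> \<in> {-pi..-pi/2}" for \<theta>
    using cos_ge_zero[of "\<theta> + pi"] that by auto
  have c2: "cos \<theta> \<ge> 0" if "\<theta> \<in> {-pi/2..pi/2}" for \<theta>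
    using cos_ge_zero[of \<theta>] that by auto
  have c3: "cos \<theta> \<le> 0" if "\<theta> \<in> {pi/2..pi}" for \<theta>
    using cos_ge_zero[of "\<theta> - pi"] that by auto
  have b: "cos \<theta> \<ge> 0 \<Longrightarrow> \<bar>bump \<delta> \<theta>\<bar> = bump \<delta> \<theta>" "cos \<theta> \<le> 0 \<Longrightarrow> \<bar>bump \<delta> \<theta>\<bar> = - bump \<delta> \<theta>" for \<theta>
    using \<delta> psi_simps(4)[of "sin \<theta> / \<delta>"]
    by (auto simp: bump_def mult_nonneg_nonneg mult_nonneg_nonpos divide_nonpos_pos abs_of_nonneg abs_of_nonpos)
  have j1: "((\<lambda>\<theta>. \<bar>bump \<delta> \<theta>\<bar>) has_integral -(-1 - psi 0)) {-pi..-pi/2}"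
    by (rule has_integral_eq[OF _ has_integral_neg[OF i1]]) (simp add: b(2)[OF c1])
  have j2: "((\<lambda>\<theta>. \<bar>bump \<delta> \<theta>\<bar>) has_integral 2) {-pi/2..pi/2}"
    by (rule has_integral_eq[OF _ i2]) (simp add: b(1)[OF c2])
  have j3: "((\<lambda>\<theta>. \<bar>bump \<delta> \<theta>\<bar>) has_integral -(psi 0 - 1)) {pi/2..pi}"
    by (rule has_integral_eq[OF _ has_integral_neg[OF i3]]) (simp add: b(2)[OF c3])
  have "((\<lambda>\<theta>. \<bar>bump \<delta> \<theta>\<bar>) has_integral (-(-1 - psi 0) + 2) + -(psi 0 - 1)) {-pi..pi}"
    by (rule has_integral_combine[OF _ _ has_integral_combine[OF _ _ j1 j2] j3]) auto
  then show ?thesis by simp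
qed

lemma continuous_on_bump:
  fixes f :: "'a::t2_space \<Rightarrow> real"
  shows "\<delta> \<noteq> 0 \<Longrightarrow> continuous_on A f \<Longrightarrow> continuous_on A (\<lambda>x. bump \<delta> (f x))"
  unfolding bump_def by (intro continuous_intros continuous_on_psi) auto

lemma sin_small_imp:
  assumes \<eta>: "0 < \<eta>" "\<eta> \<le> pi / 2" and s: "\<bar>sin \<theta>\<bar> < sin \<eta>" and \<theta>: "\<bar>\<theta>\<bar> \<le> pi"
  shows "cos \<theta> \<ge> 0 \<and> \<bar>\<theta>\<bar> < \<eta> \<or> cos \<theta> \<le> 0 \<and> (\<bar>\<theta> - pi\<bar> < \<eta> \<or> \<bar>\<theta> + pi\<bar> < \<eta>)"
proof -
  have key: "\<bar>x\<bar> < \<eta>" if "\<bar>x\<bar> \<le> pi / 2" "\<bar>sin x\<bar> < sin \<eta>" for x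
  proof (rule ccontr)
    assume "\<not> \<bar>x\<bar> < \<eta>"
    then have "sin \<eta> \<le> sin \<bar>x\<bar>" using \<eta> that(1) by (intro sin_monotone_2pi_le) auto
    moreover have "sin \<bar>x\<bar> \<le> \<bar>sin x\<bar>" by (cases "x \<ge> 0") auto
    ultimately show False using that(2) by simp
  qed
  consider "\<bar>\<theta>\<bar> \<le> pi / 2" | "\<theta> > pi / 2" | "\<theta> < - pi / 2" by linarith
  then show ?thesis
  proof cases
    case 1
    then show ?thesis using key[OF 1 s] cos_ge_zero[of \<theta>] by auto
  next
    case 2
    then show ?thesis using key[of "\<theta> - pi"] s \<theta> cos_ge_zero[of "\<theta> - pi"] by auto
  next
    case 3
    then show ?thesis using key[of "\<theta> + pi"] s \<theta> cos_ge_zero[of "\<theta> + pi"] by auto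
  qed
qed

text \<open>The cutoff \<open>s\<close> in polar coordinates: a plateau in \<open>ln (norm w)\<close> times an approximation of the
  sign of \<open>Im w\<close>. The field \<open>s \<nabla>\<theta>\<close> then runs from the positive to the negative half-axis on both sides,
  and its divergence is concentrated near the real axis.\<close>

definition plateau :: "real \<Rightarrow> real \<Rightarrow> real \<Rightarrow> real" where
  "plateau \<alpha> \<beta> t = step (t - \<alpha>) * step (\<beta> - t)"
definition plateau' :: "real \<Rightarrow> real \<Rightarrow> real \<Rightarrow> real" where
  "plateau' \<alpha> \<beta> t = step' (t - \<alpha>) * step (\<beta> - t) - step (t - \<alpha>) * step' (\<beta> - t)"

lemma DERIV_plateau: "(plateau \<alpha> \<beta> has_real_derivative plateau' \<alpha> \<beta> t) (at t)"
proof -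
  have "((\<lambda>t. step (t - \<alpha>)) has_real_derivative step' (t - \<alpha>) * 1) (at t)"
    by (rule DERIV_chain2[OF DERIV_step]) (auto intro!: derivative_eq_intros)
  moreover have "((\<lambda>t. step (\<beta> - t)) has_real_derivative step' (\<beta> - t) * (-1)) (at t)"
    by (rule DERIV_chain2[OF DERIV_step]) (auto intro!: derivative_eq_intros)
  ultimately show ?thesis unfolding plateau_def[abs_def] plateau'_def
    by (auto intro!: derivative_eq_intros simp: algebra_simps)
qed

lemma continuous_on_plateau: "continuous_on A f \<Longrightarrow> continuous_on A (\<lambda>x. plateau \<alpha> \<beta> (f x))"
  "continuous_on A f \<Longrightarrow> continuous_on A (\<lambda>x. plateau' \<alpha> \<beta> (f x))"
  unfolding plateau_def plateau'_def by (intro continuous_intros; simp)+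

lemma plateau_bounds: "0 \<le> plateau \<alpha> \<beta> t" "plateau \<alpha> \<beta> t \<le> 1"
  using step_bounds by (auto simp: plateau_def intro: mult_le_one)

lemma plateau_eq_0:
  assumes "t \<le> \<alpha> \<or> \<beta> \<le> t"
  shows "plateau \<alpha> \<beta> t = 0" "plateau' \<alpha> \<beta> t = 0"
  using assms step_eq_0[of "t - \<alpha>"] step_eq_0[of "\<beta> - t"] step'_eq_0[of "t - \<alpha>"] step'_eq_0[of "\<beta> - t"]
  by (auto simp: plateau_def plateau'_def)

lemma integral_plateau:
  assumes "\<alpha> + 2 \<le> \<beta>"
  shows "(\<integral>t. indicator {\<alpha>..\<beta>} t * plateau \<alpha> \<beta> t \<partial>lborel) \<ge> \<beta> - \<alpha> - 2"
proof -
  have i: "integrable lborel (\<lambda>t. indicator {\<alpha>..\<beta>} t * plateau \<alpha> \<beta> t)"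
    using borel_integrable_compact[of "{\<alpha>..\<beta>}" "plateau \<alpha> \<beta>"] continuous_on_plateau(1)[of "{\<alpha>..\<beta>}" "\<lambda>x. x"] by simp
  have "\<beta> - \<alpha> - 2 = (\<integral>t. indicator {\<alpha>+1..\<beta>-1} t \<partial>lborel)" using assms by simp
  also have "\<dots> \<le> (\<integral>t. indicator {\<alpha>..\<beta>} t * plateau \<alpha> \<beta> t \<partial>lborel)"
  proof (rule integral_mono[OF _ i])
    fix t show "indicator {\<alpha>+1..\<beta>-1} t \<le> indicator {\<alpha>..\<beta>} t * plateau \<alpha> \<beta> t"
      using plateau_bounds[of \<alpha> \<beta> t] step_eq_1[of "t - \<alpha>"] step_eq_1[of "\<beta> - t"]
      by (auto simp: indicator_def plateau_def)
  qed (intro integrable_real_indicator; simp add: emeasure_lborel_Icc_eq)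
  finally show ?thesis .
qed

definition cut :: "real \<Rightarrow> real \<Rightarrow> real \<Rightarrow> complex \<Rightarrow> real" where
  "cut \<alpha> \<beta> \<delta> w = plateau \<alpha> \<beta> (ln (norm w)) * psi (Im w / norm w / \<delta>)"
text \<open>\<open>cut_r\<close> and \<open>cut_t\<close> are the derivatives of \<open>cut\<close>
  in ln (norm w) and in the argument.\<close>

definition cut_r :: "real \<Rightarrow> real \<Rightarrow> real \<Rightarrow> complex \<Rightarrow> real" where
  "cut_r \<alpha> \<beta> \<delta> w = plateau' \<alpha> \<beta> (ln (norm w)) * psi (Im w / norm w / \<delta>)"
definition cut_t :: "real \<Rightarrow> real \<Rightarrow> real \<Rightarrow> complex \<Rightarrow> real" where
  "cut_t \<alpha> \<beta> \<delta> w = plateau \<alpha> \<beta> (ln (norm w)) * (psi' (Im w / norm w / \<delta>) * (Re w / norm w / \<delta>))"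

lemma cut_has_derivative:
  assumes "w \<noteq> 0" "\<delta> \<noteq> 0"
  shows "(cut \<alpha> \<beta> \<delta> has_derivative (\<lambda>v. cut_r \<alpha> \<beta> \<delta> w * Re (v / w) + cut_t \<alpha> \<beta> \<delta> w * Im (v / w))) (at w)"
proof -
  have d1: "((\<lambda>w. plateau \<alpha> \<beta> (ln (norm w))) has_derivative (\<lambda>v. Re (v / w) * plateau' \<alpha> \<beta> (ln (norm w)))) (at w)"
    by (rule DERIV_compose_FDERIV[OF DERIV_plateau has_derivative_ln_norm[OF assms(1)]])
  have d0: "((\<lambda>w. Im w / norm w / \<delta>) has_derivative (\<lambda>v. Re w / norm w * Im (v / w) / \<delta>)) (at w)"
    using has_derivative_mult_left[OF has_derivative_sin_arg[OF assms(1)], of "inverse \<delta>"] by (simp add: divide_inverse)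
  have d2: "((\<lambda>w. psi (Im w / norm w / \<delta>)) has_derivative (\<lambda>v. (Re w / norm w * Im (v / w) / \<delta>) * psi' (Im w / norm w / \<delta>))) (at w)"
    by (rule DERIV_compose_FDERIV[OF DERIV_psi d0])
  show ?thesis
    unfolding cut_def[abs_def]
    by (rule has_derivative_eq_rhs[OF has_derivative_mult[OF d1 d2]])
      (simp add: fun_eq_iff cut_r_def cut_t_def algebra_simps)
qed

lemma cut_eq_0:
  assumes "\<beta> \<le> 0" and "w = 0 \<or> ln (norm w) \<le> \<alpha> \<or> \<beta> \<le> ln (norm w)"
  shows "cut \<alpha> \<beta> \<delta> w = 0" "cut_r \<alpha> \<beta> \<delta> w = 0" "cut_t \<alpha> \<beta> \<delta> w = 0"
  using assms plateau_eq_0[of "ln (norm w)" \<alpha> \<beta>] by (auto simp: cut_def cut_r_def cut_t_def)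

lemma abs_cut_le_1: "\<bar>cut \<alpha> \<beta> \<delta> w\<bar> \<le> 1"
  unfolding cut_def abs_mult using plateau_bounds psi_simps(3) by (intro mult_le_one) auto

lemma continuous_on_cut:
  assumes "\<delta> \<noteq> 0"
  shows "continuous_on (-{0}) (cut \<alpha> \<beta> \<delta>)" "continuous_on (-{0}) (cut_r \<alpha> \<beta> \<delta>)" "continuous_on (-{0}) (cut_t \<alpha> \<beta> \<delta>)"
  unfolding cut_def[abs_def] cut_r_def[abs_def] cut_t_def[abs_def]
  by (intro continuous_intros continuous_on_plateau continuous_on_psi; use assms in simp)+

lemma cut_t_exp: "cut_t \<alpha> \<beta> \<delta> (exp \<zeta>) = plateau \<alpha> \<beta> (Re \<zeta>) * bump \<delta> (Im \<zeta>)"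
  by (simp add: cut_t_def bump_def Re_exp Im_exp)

subsection \<open>Pointwise Hoelder estimate on the boundary\<close>

lemma frechet_line:
  assumes g: "(g has_derivative g') (at (m z))" and m: "((\<lambda>t. m (z + of_real t * v)) has_vector_derivative l) (at 0)"
  shows "((\<lambda>t. g (m (z + of_real t * v))) has_vector_derivative g' l) (at (0::real))"
proof -
  have "((\<lambda>t. g (m (z + of_real t * v))) has_derivative (\<lambda>t. g' (t *\<^sub>R l))) (at (0::real))"
    by (rule has_derivative_compose[of "\<lambda>t. m (z + of_real t * v)" _ 0 UNIV g g'])
      (use g m in \<open>simp_all add: has_vector_derivative_def\<close>)
  moreover have "g' (t *\<^sub>R l) = t *\<^sub>R g' l" for t
    using has_derivative_bounded_linear[OF g] by (simp add: linear_simps)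
  ultimately show ?thesis by (simp add: has_vector_derivative_def)
qed

lemma field_derivative_line:
  assumes "(f has_field_derivative f') (at z)"
  shows "((\<lambda>t. f (z + of_real t * v)) has_vector_derivative f' * v) (at (0::real))"
proof -
  have "((\<lambda>t. z + of_real t * v) has_vector_derivative v) (at (0::real))"
    by (auto intro!: derivative_eq_intros simp: has_vector_derivative_def scaleR_conv_of_real)
  from field_vector_diff_chain_at[OF this, of f f'] assms show ?thesis by (simp add: o_def mult.commute)
qed

text \<open>\<open>h\<close> is already expressed in a chart at the image point, so that near the
  boundary point \<open>p\<close> it becomes on the circle the increasing function \<open>f\<close>.
  The bound \<open>R < 1/4\<close> keeps the disc of radius \<open>R\<close> well inside the region
  where \<open>chart\<close> inverts \<open>unchart\<close>.\<close>

locale capacity_setting = qc_box_map +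
  fixes p :: complex and R :: real and f :: "real \<Rightarrow> real"
  assumes p: "norm p = 1" and Qp: "cbox (Complex a c) (Complex b e) \<subseteq> ball p (1/2)"
    and R: "0 < R" "R < 1/4" and Rbox: "unchart p ` cball 0 R \<subseteq> box (Complex a c) (Complex b e)"
    and h1: "h ` cbox (Complex a c) (Complex b e) \<subseteq> cball 0 1"
    and f: "strict_mono f" "f 0 = 0" "\<And>t. \<bar>t\<bar> \<le> R \<Longrightarrow> h (unchart p (of_real t)) = of_real (f t)"
begin

definition M where "M = chart p"
text \<open>\<open>mder\<close> is the logarithmic derivative of the chart \<open>M\<close>, that is
  the derivative of ln M, and \<open>polar\<close> inverts ln M: these are polar coordinates around
  \<open>p\<close> in logarithmic form.\<close>

definition mder :: "complex \<Rightarrow> complex" where "mder z = 1 / (z * Ln (z / p))"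
definition mder' :: "complex \<Rightarrow> complex" where "mder' z = - (Ln (z / p) + 1) / (z * Ln (z / p))\<^sup>2"
definition polar :: "complex \<Rightarrow> complex" where "polar \<zeta> = unchart p (exp \<zeta>)"

lemma Q_ball: "z \<in> Q \<Longrightarrow> z \<in> ball p (1/2)" using Qp by (auto simp: Q_def)

lemma polar_in:
  assumes "Re \<zeta> \<le> ln R"
  shows "polar \<zeta> \<in> box (Complex a c) (Complex b e)" "polar \<zeta> \<in> Q" "M (polar \<zeta>) = exp \<zeta>"
proof -
  have "exp (Re \<zeta>) \<le> R" using assms R by (metis exp_le_cancel_iff exp_ln)
  then have n: "norm (exp \<zeta>) \<le> R" by simp
  then show "polar \<zeta> \<in> box (Complex a c) (Complex b e)" using Rbox by (force simp: polar_def)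
  then show "polar \<zeta> \<in> Q" using box_subset_Q by blast
  have "\<bar>Re (exp \<zeta>)\<bar> < 1/2" using n R abs_Re_le_cmod[of "exp \<zeta>"] by linarith
  then show "M (polar \<zeta>) = exp \<zeta>" unfolding M_def polar_def by (rule chart_unchart[OF p])
qed

lemma polar_has_field_derivative: "(polar has_field_derivative 2 * of_real pi * \<i> * exp \<zeta> * polar \<zeta>) (at \<zeta>)"
  unfolding polar_def unchart_def by (auto intro!: derivative_eq_intros simp: algebra_simps)

lemma mder_polar:
  assumes "Re \<zeta> \<le> ln R"
  shows "mder (polar \<zeta>) * (2 * of_real pi * \<i> * exp \<zeta> * polar \<zeta>) = 1"
proof -
  have "polar \<zeta> \<noteq> 0" using chart_domain(2)[OF p Q_ball[OF polar_in(2)[OF assms]]] .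
  moreover have "Ln (polar \<zeta> / p) = 2 * of_real pi * \<i> * exp \<zeta>"
    using polar_in(3)[OF assms] by (simp add: M_def chart_def field_simps)
  ultimately show ?thesis by (simp add: mder_def)
qed

lemma M_cont: "continuous_on (ball p (1/2)) M"
  unfolding M_def by (meson chart_has_field_derivative[OF p] DERIV_continuous continuous_at_imp_continuous_on)

lemma boundary_far: "z \<in> Q \<Longrightarrow> z \<notin> box (Complex a c) (Complex b e) \<Longrightarrow> norm (M z) > R"
proof (rule ccontr)
  assume z: "z \<in> Q" "z \<notin> box (Complex a c) (Complex b e)" and "\<not> norm (M z) > R"
  then have "unchart p (M z) \<in> box (Complex a c) (Complex b e)" using Rbox by force
  then show False using z unchart_chart[OF p Q_ball[OF z(1)]] by (simp add: M_def)
qed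

text \<open>Substitution z = \<open>polar\<close> \<zeta>, with Jacobian the inverse square of the
  modulus of the logarithmic derivative. The integrand vanishes off the annulus, so the shape of the
  box leaves no trace in the result.\<close>

lemma annulus_integral:
  fixes F :: "complex \<Rightarrow> real"
  assumes r: "0 < r" "r < R" and F: "continuous_on Q F"
    and F0: "\<And>z. z \<in> Q \<Longrightarrow> M z = 0 \<or> ln (norm (M z)) \<le> ln r \<or> ln R \<le> ln (norm (M z)) \<Longrightarrow> F z = 0"
  defines "S \<equiv> {\<zeta>. Re \<zeta> \<in> {ln r..ln R} \<and> Im \<zeta> \<in> {-pi<..pi}}"
  shows "(\<lambda>\<zeta>. F (polar \<zeta>) / (norm (mder (polar \<zeta>)))\<^sup>2) absolutely_integrable_on S"
    "(\<integral>z. indicator Q z * F z \<partial>lborel) = integral S (\<lambda>\<zeta>. F (polar \<zeta>) / (norm (mder (polar \<zeta>)))\<^sup>2)"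
proof -
  note ps = polar_strip[of "ln r" "ln R", folded S_def]
  have SR: "Re \<zeta> \<le> ln R" if "\<zeta> \<in> S" for \<zeta> using that by (simp add: S_def)
  have img: "polar ` S = {z \<in> Q. r \<le> norm (M z) \<and> norm (M z) \<le> R}"
  proof (intro equalityI subsetI)
    fix z assume "z \<in> polar ` S"
    then obtain \<zeta> where \<zeta>: "\<zeta> \<in> S" "z = polar \<zeta>" by blast
    have "exp \<zeta> \<in> exp ` S" using \<zeta> by blast
    then show "z \<in> {z \<in> Q. r \<le> norm (M z) \<and> norm (M z) \<le> R}"
      using \<zeta> polar_in[OF SR[OF \<zeta>(1)]] r R by (simp add: ps(3) del: norm_exp_eq_Re)
  next
    fix z assume z: "z \<in> {z \<in> Q. r \<le> norm (M z) \<and> norm (M z) \<le> R}"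
    then have "M z \<in> exp ` S" using r R by (simp add: ps(3))
    then obtain \<zeta> where "\<zeta> \<in> S" "M z = exp \<zeta>" by blast
    then show "z \<in> polar ` S"
      using z unchart_chart[OF p Q_ball, of z] by (force simp: polar_def M_def)
  qed
  have MQ: "continuous_on Q M" by (rule continuous_on_subset[OF M_cont]) (use Q_ball in auto)
  have c1: "closed {z \<in> Q. r \<le> norm (M z)}"
    by (intro continuous_on_closed_Collect_le continuous_intros MQ Q_closed)
  have MQ': "continuous_on {z \<in> Q. r \<le> norm (M z)} M" by (rule continuous_on_subset[OF MQ]) auto
  have "closed {z \<in> {z \<in> Q. r \<le> norm (M z)}. norm (M z) \<le> R}"
    by (intro continuous_on_closed_Collect_le continuous_intros MQ' c1)
  then have cl: "closed (polar ` S)" by (simp add: img conj_ac)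
  have inj: "inj_on polar S"
  proof (rule inj_onI)
    fix x y assume xy: "x \<in> S" "y \<in> S" "polar x = polar y"
    then have "exp x = exp y" using polar_in(3)[OF SR[OF xy(1)]] polar_in(3)[OF SR[OF xy(2)]] by simp
    then show "x = y" using inj_onD[OF ps(2)] xy by blast
  qed
  have intQ: "integrable lborel (\<lambda>z. indicator Q z * F z)"
    using borel_integrable_compact[OF Q_compact F] by simp
  have absQ: "F absolutely_integrable_on Q"
    using intQ by (simp add: set_integrable_def integrable_completion borel_measurable_integrable)
  have absI: "F absolutely_integrable_on polar ` S"
    by (rule set_integrable_subset[OF absQ]) (use cl img in auto)
  have cv: "(\<lambda>\<zeta>. (norm (2 * of_real pi * \<i> * exp \<zeta> * polar \<zeta>))\<^sup>2 * F (polar \<zeta>)) absolutely_integrable_on S \<and>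
      integral S (\<lambda>\<zeta>. (norm (2 * of_real pi * \<i> * exp \<zeta> * polar \<zeta>))\<^sup>2 * F (polar \<zeta>)) = integral (polar ` S) F"
    by (rule holomorphic_change_of_variables[THEN iffD2])
      (use ps(1) inj absI in \<open>auto intro: polar_has_field_derivative\<close>)
  have eq: "(norm (2 * of_real pi * \<i> * exp \<zeta> * polar \<zeta>))\<^sup>2 * F (polar \<zeta>) = F (polar \<zeta>) / (norm (mder (polar \<zeta>)))\<^sup>2"
    if "\<zeta> \<in> S" for \<zeta>
  proof -
    have "norm (mder (polar \<zeta>)) * norm (2 * of_real pi * \<i> * exp \<zeta> * polar \<zeta>) = 1"
      using mder_polar[OF SR[OF that]] by (metis norm_mult norm_one)
    then have "norm (2 * of_real pi * \<i> * exp \<zeta> * polar \<zeta>) = inverse (norm (mder (polar \<zeta>)))"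
      by (rule inverse_unique[symmetric])
    then show ?thesis by (simp add: divide_inverse power_inverse)
  qed
  show "(\<lambda>\<zeta>. F (polar \<zeta>) / (norm (mder (polar \<zeta>)))\<^sup>2) absolutely_integrable_on S"
    by (rule iffD1[OF set_integrable_cong[OF refl refl eq] conjunct1[OF cv]])
  have "(\<integral>z. indicator Q z * F z \<partial>lborel) = (\<integral>z. indicator Q z * F z \<partial>lebesgue)"
    using intQ by (simp add: integral_completion borel_measurable_integrable)
  also have "\<dots> = integral Q F"
    using set_lebesgue_integral_eq_integral(2)[OF absQ] by (simp add: set_lebesgue_integral_def)
  also have "\<dots> = integral (polar ` S) F"
  proof -
    have "F z = 0" if "z \<in> Q - polar ` S" for z
    proof (rule F0)
      show "z \<in> Q" using that by blast
      show "M z = 0 \<or> ln (norm (M z)) \<le> ln r \<or> ln R \<le> ln (norm (M z))"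
      proof (cases "M z = 0")
        case False
        then have "norm (M z) > 0" by simp
        then show ?thesis using that r R unfolding img by (auto simp: not_le less_imp_le)
      qed simp
    qed
    then have "(\<lambda>z. if z \<in> Q then F z else 0) = (\<lambda>z. if z \<in> polar ` S then F z else 0)" by (auto simp: fun_eq_iff img)
    then show ?thesis by (metis integral_restrict_UNIV)
  qed
  also have "\<dots> = integral S (\<lambda>\<zeta>. (norm (2 * of_real pi * \<i> * exp \<zeta> * polar \<zeta>))\<^sup>2 * F (polar \<zeta>))" using cv by simp
  also have "\<dots> = integral S (\<lambda>\<zeta>. F (polar \<zeta>) / (norm (mder (polar \<zeta>)))\<^sup>2)" by (rule integral_cong[OF eq])
  finally show "(\<integral>z. indicator Q z * F z \<partial>lborel) = integral S (\<lambda>\<zeta>. F (polar \<zeta>) / (norm (mder (polar \<zeta>)))\<^sup>2)" .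
qed

text \<open>With \<theta> the argument of \<open>M\<close>, the partial derivatives of \<theta> are
  \<open>Im (mder z)\<close> and \<open>Re (mder z)\<close>, so the field is the cutoff times the
  gradient of \<theta>. As \<theta> is harmonic, the terms with \<open>mder'\<close> cancel in the
  divergence, the sum of \<open>d1\<close> and \<open>d2\<close>, and only the angular derivative of
  the cutoff remains.\<close>

definition X1 where "X1 r \<delta> z = cut (ln r) (ln R) \<delta> (M z) * Im (mder z)"
definition X2 where "X2 r \<delta> z = cut (ln r) (ln R) \<delta> (M z) * Re (mder z)"
definition d1 where "d1 r \<delta> z = (cut_r (ln r) (ln R) \<delta> (M z) * Re (mder z) + cut_t (ln r) (ln R) \<delta> (M z) * Im (mder z)) * Im (mder z)
    + cut (ln r) (ln R) \<delta> (M z) * Im (mder' z)"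
definition d2 where "d2 r \<delta> z = (- cut_r (ln r) (ln R) \<delta> (M z) * Im (mder z) + cut_t (ln r) (ln R) \<delta> (M z) * Re (mder z)) * Re (mder z)
    - cut (ln r) (ln R) \<delta> (M z) * Im (mder' z)"

lemma divergence: "d1 r \<delta> z + d2 r \<delta> z = cut_t (ln r) (ln R) \<delta> (M z) * (norm (mder z))\<^sup>2"
  unfolding d1_def d2_def cmod_power2 by (simp add: algebra_simps power2_eq_square)

lemma field_norm: "(X1 r \<delta> z)\<^sup>2 + (X2 r \<delta> z)\<^sup>2 = (cut (ln r) (ln R) \<delta> (M z))\<^sup>2 * (norm (mder z))\<^sup>2"
  unfolding X1_def X2_def cmod_power2 by (simp add: power_mult_distrib algebra_simps)

lemma lnR: "ln R \<le> 0" using R by simp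

lemma field_zero:
  assumes "M z = 0 \<or> ln (norm (M z)) \<le> ln r \<or> ln R \<le> ln (norm (M z))"
  shows "X1 r \<delta> z = 0" "X2 r \<delta> z = 0" "d1 r \<delta> z = 0" "d2 r \<delta> z = 0"
  using cut_eq_0[OF lnR assms] by (simp_all add: X1_def X2_def d1_def d2_def)

lemma field_zero_ball:
  assumes "0 < r" "norm (M z) < r"
  shows "X1 r \<delta> z = 0" "X2 r \<delta> z = 0" "d1 r \<delta> z = 0" "d2 r \<delta> z = 0"
proof -
  have "M z = 0 \<or> ln (norm (M z)) \<le> ln r \<or> ln R \<le> ln (norm (M z))"
    using assms by (cases "M z = 0") (auto simp: less_imp_le)
  from field_zero[OF this] show "X1 r \<delta> z = 0" "X2 r \<delta> z = 0" "d1 r \<delta> z = 0" "d2 r \<delta> z = 0" .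
qed

lemma open_pieces: "open {z \<in> ball p (1/2). M z \<noteq> 0}" "open {z \<in> ball p (1/2). norm (M z) < r}"
proof -
  have "open (ball p (1/2) \<inter> M -` (-{0}))" by (rule continuous_open_preimage[OF M_cont]) auto
  moreover have "open (ball p (1/2) \<inter> M -` (ball 0 r))" by (rule continuous_open_preimage[OF M_cont]) auto
  moreover have "ball p (1/2) \<inter> M -` (-{0}) = {z \<in> ball p (1/2). M z \<noteq> 0}"
    "ball p (1/2) \<inter> M -` (ball 0 r) = {z \<in> ball p (1/2). norm (M z) < r}" by auto
  ultimately show "open {z \<in> ball p (1/2). M z \<noteq> 0}" "open {z \<in> ball p (1/2). norm (M z) < r}" by auto
qed

lemma M_nonzero: "z \<in> ball p (1/2) \<Longrightarrow> M z \<noteq> 0 \<Longrightarrow> z * Ln (z / p) \<noteq> 0"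
  using chart_domain(2)[OF p] by (auto simp: M_def chart_def)

text \<open>\<open>mder\<close> is singular at \<open>p\<close>, but the cutoff vanishes where
  \<open>norm (M z) < r\<close>; hence the two open pieces, one that avoids \<open>p\<close> and one
  where the field is 0.\<close>

lemma field_continuous:
  assumes r: "0 < r" and \<delta>: "\<delta> \<noteq> 0"
  shows "continuous_on Q (X1 r \<delta>)" "continuous_on Q (X2 r \<delta>)" "continuous_on Q (d1 r \<delta>)" "continuous_on Q (d2 r \<delta>)"
proof -
  define U where "U = {z \<in> ball p (1/2). M z \<noteq> 0}"
  define V where "V = {z \<in> ball p (1/2). norm (M z) < r}"
  have UV: "open U" "open V" "Q \<subseteq> U \<union> V" using open_pieces r Q_ball by (auto simp: U_def V_def)
  have cM: "continuous_on U M" by (rule continuous_on_subset[OF M_cont]) (auto simp: U_def)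
  have nz: "z * Ln (z / p) \<noteq> 0" if "z \<in> U" for z using that M_nonzero by (auto simp: U_def)
  have dom: "z / p \<notin> \<real>\<^sub>\<le>\<^sub>0" if "z \<in> U" for z using that chart_domain(3)[OF p] by (auto simp: U_def)
  have p0: "p \<noteq> 0" using p by auto
  have cLn: "continuous_on U (\<lambda>z. Ln (z / p))" by (intro continuous_on_Ln continuous_intros) (use dom p0 in auto)
  have cL: "continuous_on U (\<lambda>z. z * Ln (z / p))" by (intro continuous_intros cLn)
  have cm: "continuous_on U mder" unfolding mder_def[abs_def]
    by (intro continuous_on_divide continuous_on_const cL ballI nz)
  have cm': "continuous_on U mder'" unfolding mder'_def[abs_def]
    by (intro continuous_on_divide continuous_on_power continuous_on_minus continuous_on_add continuous_on_const cL cLn)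
      (use nz in auto)
  have cc: "continuous_on U (\<lambda>z. g (M z))" if "continuous_on (-{0}) g" for g :: "complex \<Rightarrow> real"
    by (rule continuous_on_compose2[OF that cM]) (auto simp: U_def)
  note cuts = cc[OF continuous_on_cut(1)[OF \<delta>]] cc[OF continuous_on_cut(2)[OF \<delta>]] cc[OF continuous_on_cut(3)[OF \<delta>]]
  have onU: "continuous_on U (X1 r \<delta>)" "continuous_on U (X2 r \<delta>)" "continuous_on U (d1 r \<delta>)" "continuous_on U (d2 r \<delta>)"
    unfolding X1_def[abs_def] X2_def[abs_def] d1_def[abs_def] d2_def[abs_def]
    by (intro continuous_intros cuts cm cm')+
  have onV: "continuous_on V (X1 r \<delta>)" "continuous_on V (X2 r \<delta>)" "continuous_on V (d1 r \<delta>)" "continuous_on V (d2 r \<delta>)"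
    using field_zero_ball[OF r] by (subst continuous_on_cong[OF refl, of _ _ "\<lambda>_. 0"]; auto simp: V_def)+
  show "continuous_on Q (X1 r \<delta>)" "continuous_on Q (X2 r \<delta>)" "continuous_on Q (d1 r \<delta>)" "continuous_on Q (d2 r \<delta>)"
    using continuous_on_open_Un[OF UV(1,2) onU(1) onV(1)] continuous_on_open_Un[OF UV(1,2) onU(2) onV(2)]
      continuous_on_open_Un[OF UV(1,2) onU(3) onV(3)] continuous_on_open_Un[OF UV(1,2) onU(4) onV(4)] UV(3)
    by (blast intro: continuous_on_subset)+
qed

lemma field_derivatives:
  assumes r: "0 < r" and \<delta>: "\<delta> \<noteq> 0" and z: "z \<in> Q"
  shows "((\<lambda>t. X1 r \<delta> (z + of_real t)) has_vector_derivative d1 r \<delta> z) (at 0)"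
    "((\<lambda>t. X2 r \<delta> (z + of_real t * \<i>)) has_vector_derivative d2 r \<delta> z) (at 0)"
proof -
  have zb: "z \<in> ball p (1/2)" by (rule Q_ball[OF z])
  have "((\<lambda>t. X1 r \<delta> (z + of_real t * 1)) has_vector_derivative d1 r \<delta> z) (at 0) \<and>
    ((\<lambda>t. X2 r \<delta> (z + of_real t * \<i>)) has_vector_derivative d2 r \<delta> z) (at 0)"
  proof (cases "M z = 0")
    case True
    define V where "V = {z \<in> ball p (1/2). norm (M z) < r}"
    have zV: "z \<in> V" using True r zb by (simp add: V_def)
    have oV: "open V" using open_pieces(2) by (simp add: V_def)
    have "((\<lambda>t. X (z + of_real t * v)) has_vector_derivative 0) (at (0::real))"
      if "\<And>z. z \<in> V \<Longrightarrow> X z = 0" for X :: "complex \<Rightarrow> real" and v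
    proof -
      have "open ((\<lambda>t. z + of_real t * v) -` V)" for v
        by (intro open_vimage oV continuous_intros)
      moreover have "((\<lambda>t. 0::real) has_vector_derivative 0) (at (0::real))" by simp
      ultimately show ?thesis
        by (rule_tac has_vector_derivative_transform_within_open[of "\<lambda>t. 0" 0 0 "(\<lambda>t. z + of_real t * v) -` V"])
          (use zV that in auto)
    qed
    from this[of "X1 r \<delta>" 1] this[of "X2 r \<delta>" \<i>] show ?thesis
      using field_zero_ball[OF r, of _ \<delta>] True r by (auto simp: V_def)
  next
    case False
    have p0: "p \<noteq> 0" using p by auto
    have nz: "z * Ln (z / p) \<noteq> 0" by (rule M_nonzero[OF zb False])
    have z0: "z \<noteq> 0" using nz by auto
    have dM: "(M has_field_derivative 1 / (2 * of_real pi * \<i> * z)) (at z)"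
      unfolding M_def by (rule chart_has_field_derivative[OF p zb])
    have dLn: "((\<lambda>z. Ln (z / p)) has_field_derivative inverse z) (at z)"
      by (rule derivative_eq_intros refl | use chart_domain(3)[OF p zb] p0 z0 in \<open>simp add: field_simps\<close>)+
    have dP: "((\<lambda>z. z * Ln (z / p)) has_field_derivative Ln (z / p) + 1) (at z)"
      using DERIV_mult[OF DERIV_ident dLn] z0 by simp
    have dm: "(mder has_field_derivative mder' z) (at z)"
      unfolding mder_def[abs_def] mder'_def using DERIV_divide[OF DERIV_const[of 1] dP nz]
      by (simp add: power2_eq_square)
    have Mv: "1 / (2 * of_real pi * \<i> * z) * v / M z = mder z * v" for v
      using z0 by (simp add: M_def chart_def mder_def)
    have cutv: "((\<lambda>t. cut (ln r) (ln R) \<delta> (M (z + of_real t * v))) has_vector_derivative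
        (cut_r (ln r) (ln R) \<delta> (M z) * Re (mder z * v) + cut_t (ln r) (ln R) \<delta> (M z) * Im (mder z * v))) (at 0)" for v
      using frechet_line[where g="cut (ln r) (ln R) \<delta>" and m=M, OF cut_has_derivative[OF False \<delta>] field_derivative_line[OF dM, of v]]
      by (simp only: Mv)
    have mv: "((\<lambda>t. mder (z + of_real t * v)) has_vector_derivative mder' z * v) (at 0)" for v
      by (rule field_derivative_line[OF dm])
    have imv: "((\<lambda>t. Im (mder (z + of_real t * v))) has_vector_derivative Im (mder' z * v)) (at 0)" for v
      by (rule bounded_linear.has_vector_derivative[OF bounded_linear_Im mv])
    have rev: "((\<lambda>t. Re (mder (z + of_real t * v))) has_vector_derivative Re (mder' z * v)) (at 0)" for v
      by (rule bounded_linear.has_vector_derivative[OF bounded_linear_Re mv])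
    show ?thesis
      using has_vector_derivative_mult[OF cutv[of 1] imv[of 1]] has_vector_derivative_mult[OF cutv[of \<i>] rev[of \<i>]]
      unfolding X1_def X2_def d1_def d2_def by (simp add: algebra_simps)
  qed
  then show "((\<lambda>t. X1 r \<delta> (z + of_real t)) has_vector_derivative d1 r \<delta> z) (at 0)"
    "((\<lambda>t. X2 r \<delta> (z + of_real t * \<i>)) has_vector_derivative d2 r \<delta> z) (at 0)" by simp_all
qed

end

lemma potential_real:
  assumes A: "0 < A" "A < pi / 2" and m: "0 < m" "m \<le> \<bar>x\<bar>"
  shows "potential A (ln m - 1) (of_real x) = (if x > 0 then A else - A)"
proof -
  have "ln m \<le> ln \<bar>x\<bar>" using m by simp
  then have "step (ln \<bar>x\<bar> - (ln m - 1)) = 1" by (intro step_eq_1) simp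
  moreover have "arcsin (sin A) = A" using A by (intro arcsin_sin) auto
  moreover have "arcsin (- sin A) = - A"
    using arcsin_sin[of "- A"] A by simp
  ultimately show ?thesis using m by (auto simp: potential_def)
qed

context capacity_setting
begin

text \<open>The left side bounds from below twice the pairing of the potential, composed with
  \<open>h\<close>, with the divergence of the field: on the two half-axes the potential is close to
  \<open>A\<close> and \<open>-A\<close>, and the divergence has mass 2 and -2 per unit of ln (norm
  (M z)). The loss of 2 comes from the ends of the plateau. On the right stand bounds for the
  energies of the field and of the potential. The minimum in \<open>m\<close> ensures that on both
  sides boundary points at distance between \<open>r\<close> and \<open>R\<close> have images at
  distance at least \<open>m\<close>.\<close>

theorem capacity_estimate:
  assumes A: "0 < A'" "A' < A" "A < pi / 2" and r: "0 < r" "r \<le> R * exp (-2)"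
  defines "m \<equiv> min (f r) (- f (- r))"
  shows "8 * A' * (ln R - ln r - 2) \<le> 2 * pi * (ln R - ln r) + (1 + k) / (1 - k) * (2 * pi * (11 - ln m))" and "m > 0"
proof -
  have A0: "0 < A" using A by simp
  have "R * exp (-2) < R * 1" using R by (intro mult_strict_left_mono) auto
  then have rR: "r < R" using r by simp
  have lnr: "ln r + 2 \<le> ln R"
  proof -
    have "ln r \<le> ln (R * exp (-2))" using r by (intro ln_mono) auto
    also have "\<dots> = ln R - 2" using R by (simp add: ln_mult)
    finally show ?thesis by simp
  qed
  have fpos: "f t > 0" if "t > 0" for t using f(1,2) that strict_monoD[of f 0 t] by simp
  have fneg: "f t < 0" if "t < 0" for t using f(1,2) that strict_monoD[of f t 0] by simp
  show m: "m > 0" using fpos[of r] fneg[of "-r"] r by (simp add: m_def)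
  have rin: "unchart p (of_real r) \<in> Q"
  proof -
    have "of_real r \<in> cball (0::complex) R" using r rR by simp
    then show ?thesis using Rbox box_subset_Q by blast
  qed
  have "norm (h (unchart p (of_real r))) \<le> 1" using h1 rin by (force simp: Q_def)
  then have "f r \<le> 1" using f(3)[of r] r rR by simp
  then have m1: "m \<le> 1" by (simp add: m_def)
  \<comment> \<open>The truncation of the potential then ends at radius \<open>m\<close>, below the
    images of all boundary points that are used.\<close>
  define T where "T = ln m - 1"
  have T: "T \<le> 0" using ln_mono[OF m1 m] by (simp add: T_def)
  define u where "u = potential A T"
  have uder: "(u has_derivative (\<lambda>v. potential_grad A T w \<bullet> v)) (at w)" for w
    unfolding u_def by (rule potential_has_derivative[OF A0 A(3)])
  have contu: "continuous_on UNIV u" using uder by (meson has_derivative_continuous_on has_derivative_at_withinI)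
  define C where "C = cbox (Complex (ln r) (-pi)) (Complex (ln R) pi)"
  define S where "S = {\<zeta>. Re \<zeta> \<in> {ln r..ln R} \<and> Im \<zeta> \<in> {-pi<..pi}}"
  note ps = polar_strip[of "ln r" "ln R", folded S_def C_def]
  have CR: "Re \<zeta> \<le> ln R" "ln r \<le> Re \<zeta>" "\<bar>Im \<zeta>\<bar> \<le> pi" if "\<zeta> \<in> C" for \<zeta>
    using that by (auto simp: C_def in_cbox_complex_iff abs_le_iff)
  define g where "g = (\<lambda>\<zeta>. u (h (polar \<zeta>)))"
  have cpol: "continuous_on A polar" for A
    unfolding polar_def unchart_def by (intro continuous_intros)
  have gcont: "continuous_on C g"
    unfolding g_def
    by (rule continuous_on_compose2[OF contu], rule continuous_on_compose2[OF cont cpol])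
      (use polar_in(2) CR in \<open>auto simp: Q_def\<close>)
  have "uniformly_continuous_on C g"
    by (rule compact_uniformly_continuous[OF gcont]) (simp add: C_def)
  \<comment> \<open>The slack between \<open>A'\<close> and \<open>A\<close> absorbs the deviation
    of the potential from its values on the half-axes; the choice
    \<open>\<delta> = sin \<eta>\<close> makes the divergence vanish outside the sectors where this
    deviation is controlled.\<close>
  then obtain \<eta>0 where \<eta>0: "\<eta>0 > 0" "\<And>x y. x \<in> C \<Longrightarrow> y \<in> C \<Longrightarrow> dist y x < \<eta>0 \<Longrightarrow> dist (g y) (g x) < A - A'"
    unfolding uniformly_continuous_on_def using A(2) by (metis diff_gt_0_iff_gt)
  define \<eta> where "\<eta> = min \<eta>0 (pi / 2)"
  have \<eta>: "0 < \<eta>" "\<eta> \<le> pi / 2" "\<eta> \<le> \<eta>0" using \<eta>0 by (auto simp: \<eta>_def)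
  define \<delta> where "\<delta> = sin \<eta>"
  have \<delta>: "0 < \<delta>" "\<delta> \<le> 1" using \<eta> by (auto simp: \<delta>_def intro: sin_gt_zero)
  \<comment> \<open>Treats the rays of argument 0, pi and -pi together; \<open>s\<close> is the sign
    of the half-axis.\<close>
  have greal: "g \<zeta>' = (if s > 0 then A else - A)" if "exp \<zeta>' = of_real (s * exp t)" "\<bar>s\<bar> = 1" "t \<in> {ln r..ln R}" for \<zeta>' s t
  proof -
    have et: "r \<le> exp t" "exp t \<le> R"
      using that(3) r R by (metis atLeastAtMost_iff exp_le_cancel_iff exp_ln)+
    have hp: "h (polar \<zeta>') = of_real (f (s * exp t))"
      unfolding polar_def that(1) using et that(2) by (intro f(3)) (simp add: abs_mult)
    have s: "s = 1 \<or> s = -1" using that(2) by linarith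
    have "f r \<le> f (exp t)" "f (- exp t) \<le> f (- r)"
      using et f(1) by (simp_all add: strict_mono_less_eq)
    then have "m \<le> \<bar>f (s * exp t)\<bar>" using s by (auto simp: m_def)
    then have "g \<zeta>' = (if f (s * exp t) > 0 then A else - A)"
      unfolding g_def u_def T_def hp by (rule potential_real[OF A0 A(3) m])
    moreover have "f (s * exp t) > 0 \<longleftrightarrow> s > 0" using s fpos[of "exp t"] fneg[of "- exp t"] by auto
    ultimately show ?thesis by simp
  qed
  have low: "A' * (plateau (ln r) (ln R) (Re \<zeta>) * \<bar>bump \<delta> (Im \<zeta>)\<bar>) \<le> g \<zeta> * cut_t (ln r) (ln R) \<delta> (exp \<zeta>)" if \<zeta>: "\<zeta> \<in> C" for \<zeta>
  proof (cases "\<bar>sin (Im \<zeta>)\<bar> < \<delta>")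
    case False
    then have "\<bar>sin (Im \<zeta>) / \<delta>\<bar> \<ge> 1" using \<delta> by (simp add: le_divide_eq)
    then have "bump \<delta> (Im \<zeta>) = 0" by (simp add: bump_def psi_simps(5))
    then show ?thesis by (simp add: cut_t_exp)
  next
    case True
    define t where "t = Re \<zeta>"
    define \<theta> where "\<theta> = Im \<zeta>"
    have t: "t \<in> {ln r..ln R}" using CR[OF \<zeta>] by (simp add: t_def)
    have near: "dist (g \<zeta>) (g (Complex t \<theta>0)) < A - A'" if "\<bar>\<theta> - \<theta>0\<bar> < \<eta>" "\<bar>\<theta>0\<bar> \<le> pi" for \<theta>0
    proof (rule \<eta>0(2))
      show "Complex t \<theta>0 \<in> C" using t that(2) by (auto simp: C_def in_cbox_complex_iff abs_le_iff)
      have "\<zeta> - Complex t \<theta>0 = \<i> * of_real (\<theta> - \<theta>0)" by (simp add: complex_eq_iff t_def \<theta>_def)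
      then have "norm (\<zeta> - Complex t \<theta>0) = \<bar>\<theta> - \<theta>0\<bar>" by (simp add: norm_mult flip: of_real_diff)
      then show "dist \<zeta> (Complex t \<theta>0) < \<eta>0" using that(1) \<eta>(3) by (simp add: dist_norm)
    qed (rule \<zeta>)
    have pl: "plateau (ln r) (ln R) t \<ge> 0" by (rule plateau_bounds)
    have bs: "cos \<theta> \<ge> 0 \<Longrightarrow> bump \<delta> \<theta> \<ge> 0" "cos \<theta> \<le> 0 \<Longrightarrow> bump \<delta> \<theta> \<le> 0"
      using \<delta> psi_simps(4)[of "sin \<theta> / \<delta>"] by (auto simp: bump_def mult_nonneg_nonneg mult_nonneg_nonpos divide_nonpos_pos)
    have "\<bar>\<theta>\<bar> \<le> pi" using CR(3)[OF \<zeta>] by (simp add: \<theta>_def)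
    from sin_small_imp[OF \<eta>(1,2) _ this] True
    consider "cos \<theta> \<ge> 0" "\<bar>\<theta>\<bar> < \<eta>" | "cos \<theta> \<le> 0" "\<bar>\<theta> - pi\<bar> < \<eta>" | "cos \<theta> \<le> 0" "\<bar>\<theta> + pi\<bar> < \<eta>"
      by (auto simp: \<delta>_def \<theta>_def)
    then have "A' * \<bar>bump \<delta> \<theta>\<bar> \<le> g \<zeta> * bump \<delta> \<theta>"
    proof cases
      case 1
      have "g (Complex t 0) = A" using greal[of "Complex t 0" 1 t] t by (simp add: complex_eq_iff Re_exp Im_exp)
      then have "g \<zeta> \<ge> A'" using near[of 0] 1 by (simp add: dist_real_def)
      then show ?thesis using bs(1)[OF 1(1)] by (simp add: mult_right_mono)
    next
      case 2
      have "g (Complex t pi) = - A" using greal[of "Complex t pi" "-1" t] t by (simp add: complex_eq_iff Re_exp Im_exp)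
      then have "g \<zeta> \<le> - A'" using near[of pi] 2 by (simp add: dist_real_def)
      then have "(- A') * bump \<delta> \<theta> \<le> g \<zeta> * bump \<delta> \<theta>" using bs(2)[OF 2(1)] by (intro mult_right_mono_neg)
      then show ?thesis using bs(2)[OF 2(1)] by simp
    next
      case 3
      have "g (Complex t (-pi)) = - A" using greal[of "Complex t (-pi)" "-1" t] t by (simp add: complex_eq_iff Re_exp Im_exp)
      then have "g \<zeta> \<le> - A'" using near[of "-pi"] 3 by (simp add: dist_real_def)
      then have "(- A') * bump \<delta> \<theta> \<le> g \<zeta> * bump \<delta> \<theta>" using bs(2)[OF 3(1)] by (intro mult_right_mono_neg)
      then show ?thesis using bs(2)[OF 3(1)] by simp
    qed
    then have "plateau (ln r) (ln R) t * (A' * \<bar>bump \<delta> \<theta>\<bar>) \<le> plateau (ln r) (ln R) t * (g \<zeta> * bump \<delta> \<theta>)"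
      by (rule mult_left_mono[OF _ pl])
    then show ?thesis by (simp add: cut_t_exp t_def \<theta>_def mult_ac)
  qed
  have \<delta>0: "\<delta> \<noteq> 0" using \<delta> by simp
  note fc = field_continuous[OF r(1) \<delta>0] and fd = field_derivatives[OF r(1) \<delta>0]
  have SC: "\<zeta> \<in> C" if "\<zeta> \<in> S" for \<zeta> using ps(4) that by blast
  have mn: "norm (mder (polar \<zeta>)) \<noteq> 0" if "\<zeta> \<in> S" for \<zeta>
    using mder_polar[OF CR(1)[OF SC[OF that]]] by auto
  have far: "X1 r \<delta> z = 0" "X2 r \<delta> z = 0" if "z \<in> Q" "z \<notin> box (Complex a c) (Complex b e)" for z
  proof -
    have "norm (M z) > R" by (rule boundary_far[OF that])
    then have "ln R \<le> ln (norm (M z))" using R by (intro ln_mono) auto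
    then show "X1 r \<delta> z = 0" "X2 r \<delta> z = 0" using field_zero by blast+
  qed
  have weak: "2 * \<bar>\<integral>z. indicator Q z * (u (h z) * (d1 r \<delta> z + d2 r \<delta> z)) \<partial>lborel\<bar>
    \<le> (\<integral>z. indicator Q z * ((X1 r \<delta> z)\<^sup>2 + (X2 r \<delta> z)\<^sup>2) \<partial>lborel) + (1 + k) / (1 - k) * (\<integral>w. (pot_energy A T w)\<^sup>2 \<partial>lborel)"
  proof (rule weak_capacity_inequality[where p="potential_grad A T" and B="5 * exp (-T)"])
    show "potential_grad A T \<in> borel_measurable borel"
      by (intro borel_measurable_continuous_onI continuous_on_potential_grad A0 A(3))
    show "norm (potential_grad A T (h z)) \<le> pot_energy A T (h z)" if "z \<in> Q" for z
      using h1 that by (auto simp: pot_energy_def Q_def indicator_def)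
    show "X1 r \<delta> z = 0" if "z \<in> Q" "Re z \<in> {a, b}" for z
      using that by (intro far) (auto simp: in_box_complex_iff)
    show "X2 r \<delta> z = 0" if "z \<in> Q" "Im z \<in> {c, e}" for z
      using that by (intro far) (auto simp: in_box_complex_iff)
  qed (use uder norm_potential_grad_le[OF A0 A(3)] pot_energy_integral(1,2)[OF A0 A(3) T] fc fd in auto)
  have uhc: "continuous_on Q (\<lambda>z. u (h z))"
    by (rule continuous_on_compose2[OF contu cont[folded Q_def]]) auto
  have I1: "(\<lambda>\<zeta>. g \<zeta> * cut_t (ln r) (ln R) \<delta> (exp \<zeta>)) integrable_on S"
    and I1eq: "(\<integral>z. indicator Q z * (u (h z) * (d1 r \<delta> z + d2 r \<delta> z)) \<partial>lborel) = integral S (\<lambda>\<zeta>. g \<zeta> * cut_t (ln r) (ln R) \<delta> (exp \<zeta>))"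
  proof -
    have F: "continuous_on Q (\<lambda>z. u (h z) * (d1 r \<delta> z + d2 r \<delta> z))" by (intro continuous_intros uhc fc)
    have eq: "u (h (polar \<zeta>)) * (d1 r \<delta> (polar \<zeta>) + d2 r \<delta> (polar \<zeta>)) / (norm (mder (polar \<zeta>)))\<^sup>2
        = g \<zeta> * cut_t (ln r) (ln R) \<delta> (exp \<zeta>)" if "\<zeta> \<in> S" for \<zeta>
      using mn[OF that] polar_in(3)[OF CR(1)[OF SC[OF that]]] by (simp add: divergence g_def)
    note ai = annulus_integral[OF r(1) rR F, folded S_def]
    have "(\<lambda>\<zeta>. u (h (polar \<zeta>)) * (d1 r \<delta> (polar \<zeta>) + d2 r \<delta> (polar \<zeta>)) / (norm (mder (polar \<zeta>)))\<^sup>2) integrable_on S"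
      by (rule set_lebesgue_integral_eq_integral(1)[OF ai(1)]) (use field_zero in auto)
    then show "(\<lambda>\<zeta>. g \<zeta> * cut_t (ln r) (ln R) \<delta> (exp \<zeta>)) integrable_on S"
      by (rule integrable_eq) (rule eq)
    have "(\<integral>z. indicator Q z * (u (h z) * (d1 r \<delta> z + d2 r \<delta> z)) \<partial>lborel)
        = integral S (\<lambda>\<zeta>. u (h (polar \<zeta>)) * (d1 r \<delta> (polar \<zeta>) + d2 r \<delta> (polar \<zeta>)) / (norm (mder (polar \<zeta>)))\<^sup>2)"
      by (rule ai(2)) (use field_zero in auto)
    also have "\<dots> = integral S (\<lambda>\<zeta>. g \<zeta> * cut_t (ln r) (ln R) \<delta> (exp \<zeta>))" by (rule integral_cong[OF eq])
    finally show "(\<integral>z. indicator Q z * (u (h z) * (d1 r \<delta> z + d2 r \<delta> z)) \<partial>lborel) = \<dots>" .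
  qed
  have I2: "(\<integral>z. indicator Q z * ((X1 r \<delta> z)\<^sup>2 + (X2 r \<delta> z)\<^sup>2) \<partial>lborel) \<le> 2 * pi * (ln R - ln r)"
  proof -
    have F: "continuous_on Q (\<lambda>z. (X1 r \<delta> z)\<^sup>2 + (X2 r \<delta> z)\<^sup>2)" by (intro continuous_intros fc)
    have eq: "((X1 r \<delta> (polar \<zeta>))\<^sup>2 + (X2 r \<delta> (polar \<zeta>))\<^sup>2) / (norm (mder (polar \<zeta>)))\<^sup>2 \<le> 1" if "\<zeta> \<in> S" for \<zeta>
      using mn[OF that] abs_cut_le_1 by (simp add: field_norm abs_square_le_1)
    note ai = annulus_integral[OF r(1) rR F, folded S_def]
    have i: "(\<lambda>\<zeta>. ((X1 r \<delta> (polar \<zeta>))\<^sup>2 + (X2 r \<delta> (polar \<zeta>))\<^sup>2) / (norm (mder (polar \<zeta>)))\<^sup>2) integrable_on S"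
      by (rule set_lebesgue_integral_eq_integral(1)[OF ai(1)]) (use field_zero in auto)
    have "(\<integral>z. indicator Q z * ((X1 r \<delta> z)\<^sup>2 + (X2 r \<delta> z)\<^sup>2) \<partial>lborel)
        = integral S (\<lambda>\<zeta>. ((X1 r \<delta> (polar \<zeta>))\<^sup>2 + (X2 r \<delta> (polar \<zeta>))\<^sup>2) / (norm (mder (polar \<zeta>)))\<^sup>2)"
      by (rule ai(2)) (use field_zero in auto)
    also have "\<dots> \<le> integral S (\<lambda>\<zeta>. 1)"
      by (rule integral_le[OF i]) (use ps(5) eq in \<open>auto simp: integrable_on_const\<close>)
    also have "\<dots> = measure lebesgue S" using ps(5) by (simp add: lmeasure_integral)
    also have "\<dots> \<le> 2 * pi * (ln R - ln r)" unfolding S_def using rR r by (intro measure_strip ln_mono) auto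
    finally show ?thesis .
  qed
  define \<phi> where "\<phi> = (\<lambda>\<zeta>. plateau (ln r) (ln R) (Re \<zeta>) * \<bar>bump \<delta> (Im \<zeta>)\<bar>)"
  have \<phi>c: "continuous_on X \<phi>" for X
    unfolding \<phi>_def by (intro continuous_intros continuous_on_plateau continuous_on_bump \<delta>0)
  have \<phi>i: "integrable lborel (\<lambda>\<zeta>. indicator C \<zeta> * \<phi> \<zeta>)"
    using borel_integrable_compact[OF _ \<phi>c, of C] by (simp add: C_def)
  have I3: "integral C \<phi> \<ge> 4 * (ln R - ln r - 2)"
  proof -
    have si: "set_integrable lborel C \<phi>" using \<phi>i by (simp add: set_integrable_def)
    have "integral C \<phi> = (\<integral>\<zeta>. indicator C \<zeta> * \<phi> \<zeta> \<partial>lborel)"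
      using set_borel_integral_eq_integral(2)[OF si] by (simp add: set_lebesgue_integral_def)
    also have "\<dots> = (\<integral>x. \<integral>y. indicator C (Complex x y) * \<phi> (Complex x y) \<partial>lborel \<partial>lborel)"
      by (rule integral_complex_iterated(2)[OF \<phi>i])
    also have "\<dots> = (\<integral>x. (indicator {ln r..ln R} x * plateau (ln r) (ln R) x) * (\<integral>y. indicator {-pi..pi} y * \<bar>bump \<delta> y\<bar> \<partial>lborel) \<partial>lborel)"
    proof (intro Bochner_Integration.integral_cong refl)
      fix x
      have "indicator C (Complex x y) * \<phi> (Complex x y)
          = (indicator {ln r..ln R} x * plateau (ln r) (ln R) x) * (indicator {-pi..pi} y * \<bar>bump \<delta> y\<bar>)" for y
        by (auto simp: C_def in_cbox_complex_iff \<phi>_def indicator_def)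
      then show "(\<integral>y. indicator C (Complex x y) * \<phi> (Complex x y) \<partial>lborel)
          = (indicator {ln r..ln R} x * plateau (ln r) (ln R) x) * (\<integral>y. indicator {-pi..pi} y * \<bar>bump \<delta> y\<bar> \<partial>lborel)"
        by simp
    qed
    also have "(\<integral>y. indicator {-pi..pi} y * \<bar>bump \<delta> y\<bar> \<partial>lborel) = 4"
    proof -
      have "integrable lborel (\<lambda>y. indicator {-pi..pi} y *\<^sub>R \<bar>bump \<delta> y\<bar>)"
        by (intro borel_integrable_compact continuous_intros continuous_on_bump \<delta>0) auto
      then have "set_integrable lborel {-pi..pi} (\<lambda>y. \<bar>bump \<delta> y\<bar>)" by (simp add: set_integrable_def)
      from set_borel_integral_eq_integral(2)[OF this] show ?thesis
        using integral_abs_bump[OF \<delta>] by (simp add: set_lebesgue_integral_def integral_unique)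
    qed
    also have "(\<integral>x. (indicator {ln r..ln R} x * plateau (ln r) (ln R) x) * 4 \<partial>lborel) = 4 * (\<integral>x. indicator {ln r..ln R} x * plateau (ln r) (ln R) x \<partial>lborel)"
      by simp
    also have "\<dots> \<ge> 4 * (ln R - ln r - 2)" using integral_plateau[OF lnr] by simp
    finally show ?thesis .
  qed
  have "A' * (4 * (ln R - ln r - 2)) \<le> A' * integral C \<phi>" using I3 A by (intro mult_left_mono) auto
  also have "\<dots> = integral S (\<lambda>\<zeta>. A' * \<phi> \<zeta>)"
    using integral_subset_negligible[OF ps(4) ps(6), of \<phi>] by simp
  also have "\<dots> \<le> integral S (\<lambda>\<zeta>. g \<zeta> * cut_t (ln r) (ln R) \<delta> (exp \<zeta>))"
  proof (rule integral_le[OF _ I1])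
    have "\<phi> integrable_on C" using integrable_continuous[OF \<phi>c] by (simp add: C_def)
    then have "\<phi> integrable_on S"
      by (rule integrable_spike_set) (use ps(4,6) in \<open>auto intro: negligible_subset\<close>)
    then show "(\<lambda>\<zeta>. A' * \<phi> \<zeta>) integrable_on S" by (rule integrable_on_mult_right)
    show "A' * \<phi> \<zeta> \<le> g \<zeta> * cut_t (ln r) (ln R) \<delta> (exp \<zeta>)" if "\<zeta> \<in> S" for \<zeta>
      using low[OF SC[OF that]] by (simp add: \<phi>_def)
  qed
  finally have "2 * (A' * (4 * (ln R - ln r - 2))) \<le> 2 * \<bar>\<integral>z. indicator Q z * (u (h z) * (d1 r \<delta> z + d2 r \<delta> z)) \<partial>lborel\<bar>"
    unfolding I1eq by linarith
  also note weak
  also have "(1 + k) / (1 - k) * (\<integral>w. (pot_energy A T w)\<^sup>2 \<partial>lborel) \<le> (1 + k) / (1 - k) * (2 * pi * (11 - ln m))"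
    using pot_energy_integral(3)[OF A0 A(3) T] k by (intro mult_left_mono) (auto simp: T_def)
  finally show "8 * A' * (ln R - ln r - 2) \<le> 2 * pi * (ln R - ln r) + (1 + k) / (1 - k) * (2 * pi * (11 - ln m))"
    using I2 by (simp add: algebra_simps)
qed

end

lemma unchart_cis: "unchart (cis (2 * pi * x)) (of_real t) = cis (2 * pi * (x + t))"
proof -
  have "exp (2 * of_real pi * \<i> * of_real t) = cis (2 * pi * t)"
    by (simp add: cis_conv_exp mult_ac)
  then show ?thesis by (simp add: unchart_def cis_mult distrib_left)
qed

text \<open>Solving the capacity estimate for ln m gives an upper bound that is linear in ln r; its
  slope is the exponent, which tends to 1 as \<open>A'\<close> tends to pi/2 and \<open>k\<close> to
  0. The estimate controls the minimum of the two one-sided increments, with constants that depend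
  on the extension and on the point.\<close>

theorem quasiconformal_Holder:
  fixes \<Phi> :: "real \<Rightarrow> real"
  assumes U: "open U" "circle \<subseteq> U" and hom: "homeomorphism U (h ` U) h hi" and acl: "ACL_on U h"
    and k: "k \<in> beltrami_bounds U h" "k < 1"
    and \<Phi>: "strict_mono \<Phi>" "continuous_on UNIV \<Phi>" "\<And>x. h (cis (2 * pi * x)) = cis (2 * pi * \<Phi> x)"
    and A: "0 < A'" "A' < A" "A < pi / 2"
  shows "\<exists>C>0. \<exists>R>0. \<forall>r. 0 < r \<and> r < R \<longrightarrow>
    min (\<Phi> (x0 + r) - \<Phi> x0) (\<Phi> x0 - \<Phi> (x0 - r)) \<le> C * r powr ((4 * A' / pi - 1) * ((1 - k) / (1 + k)))"
proof -
  define p where "p = cis (2 * pi * x0)"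
  define q where "q = cis (2 * pi * \<Phi> x0)"
  have p: "norm p = 1" and q: "norm q = 1" by (auto simp: p_def q_def)
  have k0: "0 \<le> k" and kb: "AE z in lborel. z \<in> U \<longrightarrow> norm (d_zbar h z) \<le> k * norm (d_z h z)"
    using k(1) by (auto simp: beltrami_bounds_def)
  have hc: "continuous_on U h" and hinj: "inj_on h U"
    using hom by (auto simp: homeomorphism_def inj_on_def) metis
  have hp: "h p = q" using \<Phi>(3) by (simp add: p_def q_def)
  define W where "W = ball p (1/2) \<inter> (U \<inter> h -` ball q (1/2))"
  have "open (U \<inter> h -` ball q (1/2))" by (rule continuous_open_preimage[OF hc U(1)]) simp
  then have "open W" unfolding W_def by (rule open_Int[OF open_ball])
  moreover have "p \<in> W" using U(2) p hp by (auto simp: W_def)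
  ultimately obtain la lb where box: "cbox la lb \<subseteq> W" "p \<in> box la lb"
    using open_contains_cbox[of W p] by metis
  define a where "a = Re la" define c where "c = Im la" define b where "b = Re lb" define e where "e = Im lb"
  have lab: "la = Complex a c" "lb = Complex b e" by (auto simp: a_def b_def c_def e_def)
  define Q where "Q = cbox (Complex a c) (Complex b e)"
  define B where "B = box (Complex a c) (Complex b e)"
  have QW: "Q \<subseteq> W" and pB: "p \<in> B" using box by (auto simp: Q_def B_def lab)
  have BQ: "B \<subseteq> Q" unfolding B_def Q_def by (rule box_subset_cbox)
  have QU: "Q \<subseteq> U" "Q \<subseteq> ball p (1/2)" "\<And>z. z \<in> Q \<Longrightarrow> h z \<in> ball q (1/2)" using QW by (auto simp: W_def)
  have abce: "a < b" "c < e" using pB by (auto simp: B_def in_box_complex_iff)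
  define H where "H = (\<lambda>z. chart q (h z))"
  have hH: "h z = unchart q (H z)" if "z \<in> Q" for z
    unfolding H_def using unchart_chart[OF q QU(3)[OF that]] by simp
  have contq: "continuous_on (ball q (1/2)) (chart q)"
    by (meson chart_has_field_derivative[OF q] DERIV_continuous continuous_at_imp_continuous_on)
  interpret qc: qc_box_map H a b c e k
  proof unfold_locales
    show "a < b" "c < e" by (rule abce)+
    show "continuous_on (cbox (Complex a c) (Complex b e)) H"
      unfolding H_def using QU
      by (intro continuous_on_compose2[OF contq] continuous_on_subset[OF hc]) (auto simp: Q_def)
    show "inj_on H (cbox (Complex a c) (Complex b e))"
    proof (rule inj_onI, fold Q_def)
      fix x y assume xy: "x \<in> Q" "y \<in> Q" "H x = H y"
      then have "h x = h y" using hH by metis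
      then show "x = y" using hinj xy QU(1) by (auto dest: inj_onD)
    qed
    have acl': "AE y in lborel. y \<in> {c..e} \<longrightarrow> abs_cont_on a b (\<lambda>x. h (Complex x y))"
      "AE x in lborel. x \<in> {a..b} \<longrightarrow> abs_cont_on c e (\<lambda>y. h (Complex x y))"
      using acl abce QU(1) unfolding ACL_on_def Q_def by blast+
    show "AE y in lborel. y \<in> {c..e} \<longrightarrow> abs_cont_on a b (\<lambda>x. H (Complex x y))"
      using acl'(1)
    proof (rule eventually_mono, intro impI)
      fix y assume y: "y \<in> {c..e} \<longrightarrow> abs_cont_on a b (\<lambda>x. h (Complex x y))" "y \<in> {c..e}"
      show "abs_cont_on a b (\<lambda>x. H (Complex x y))"
      proof (rule abs_cont_on_comparison[of a b "\<lambda>x. h (Complex x y)" 1 0])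
        fix x x' assume "x \<in> {a..b}" "x' \<in> {a..b}"
        then have "Complex x y \<in> Q" "Complex x' y \<in> Q" using y by (auto simp: Q_def in_cbox_complex_iff)
        then show "norm (H (Complex x y) - H (Complex x' y)) \<le> 1 * norm (h (Complex x y) - h (Complex x' y)) + 0 * \<bar>x - x'\<bar>"
          unfolding H_def using chart_Lipschitz[OF q QU(3) QU(3)] by simp
      qed (use y in auto)
    qed
    show "AE x in lborel. x \<in> {a..b} \<longrightarrow> abs_cont_on c e (\<lambda>y. H (Complex x y))"
      using acl'(2)
    proof (rule eventually_mono, intro impI)
      fix x assume x: "x \<in> {a..b} \<longrightarrow> abs_cont_on c e (\<lambda>y. h (Complex x y))" "x \<in> {a..b}"
      show "abs_cont_on c e (\<lambda>y. H (Complex x y))"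
      proof (rule abs_cont_on_comparison[of c e "\<lambda>y. h (Complex x y)" 1 0])
        fix y y' assume "y \<in> {c..e}" "y' \<in> {c..e}"
        then have "Complex x y \<in> Q" "Complex x y' \<in> Q" using x by (auto simp: Q_def in_cbox_complex_iff)
        then show "norm (H (Complex x y) - H (Complex x y')) \<le> 1 * norm (h (Complex x y) - h (Complex x y')) + 0 * \<bar>y - y'\<bar>"
          unfolding H_def using chart_Lipschitz[OF q QU(3) QU(3)] by simp
      qed (use x in auto)
    qed
    show "0 \<le> k" "k < 1" using k0 k(2) by auto
    \<comment> \<open>At points of the open box the relation between \<open>h\<close> and
      \<open>H\<close> holds nearby on each line, so derivatives of \<open>H\<close> can be
      transported to \<open>h\<close>.\<close>
    have "negligible (Q - B)" unfolding Q_def B_def by (rule negligible_frontier_interval)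
    from negligible_AE_lborel[OF this] kb
    have "AE z in lborel. z \<in> Q \<longrightarrow> z \<in> B \<and> norm (d_zbar h z) \<le> k * norm (d_z h z)"
      by eventually_elim (use QU(1) in auto)
    then show "AE z in lborel. z \<in> cbox (Complex a c) (Complex b e) \<longrightarrow>
      (\<forall>hx hy. ((\<lambda>t. H (z + of_real t * 1)) has_vector_derivative hx) (at 0) \<longrightarrow>
        ((\<lambda>t. H (z + of_real t * \<i>)) has_vector_derivative hy) (at 0) \<longrightarrow>
        norm (hx + \<i> * hy) \<le> k * norm (hx - \<i> * hy))"
      unfolding Q_def[symmetric]
    proof (rule eventually_mono, intro impI allI)
      fix z hx hy
      assume "z \<in> Q \<longrightarrow> z \<in> B \<and> norm (d_zbar h z) \<le> k * norm (d_z h z)" and zQ: "z \<in> Q"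
        and hx: "((\<lambda>t. H (z + of_real t * 1)) has_vector_derivative hx) (at (0::real))"
        and hy: "((\<lambda>t. H (z + of_real t * \<i>)) has_vector_derivative hy) (at (0::real))"
      then have zB: "z \<in> B" and bel: "norm (d_zbar h z) \<le> k * norm (d_z h z)" by auto
      define E where "E = 2 * of_real pi * \<i> * h z"
      have h0: "h z \<noteq> 0" using chart_domain(2)[OF q QU(3)[OF zQ]] .
      have part: "((\<lambda>t. h (z + of_real t * v)) has_vector_derivative E * l) (at (0::real))"
        if l: "((\<lambda>t. H (z + of_real t * v)) has_vector_derivative l) (at (0::real))" for v l
      proof -
        have "(unchart q has_field_derivative E) (at (H z))"
          unfolding E_def hH[OF zQ] unchart_def by (auto intro!: derivative_eq_intros simp: algebra_simps)
        then have "((\<lambda>t. unchart q (H (z + of_real t * v))) has_vector_derivative E * l) (at (0::real))"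
          using field_vector_diff_chain_at[OF l, of "unchart q" E] by (simp add: o_def mult.commute)
        moreover have "open ((\<lambda>t. z + of_real t * v) -` B)"
          unfolding B_def by (intro open_vimage open_box continuous_intros)
        ultimately show ?thesis
          by (rule has_vector_derivative_transform_within_open) (use zB BQ hH in auto)
      qed
      have "partial_x h z = E * hx"
        unfolding partial_x_def using part[OF hx] by (intro vector_derivative_at) simp
      moreover have "partial_y h z = E * hy"
        unfolding partial_y_def using part[OF hy] by (intro vector_derivative_at) (simp add: mult.commute)
      ultimately have "d_z h z = E / 2 * (hx - \<i> * hy)" "d_zbar h z = E / 2 * (hx + \<i> * hy)"
        by (simp_all add: d_z_def d_zbar_def algebra_simps diff_divide_distrib add_divide_distrib)
      then have "norm (E / 2) * norm (hx + \<i> * hy) \<le> norm (E / 2) * (k * norm (hx - \<i> * hy))"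
        using bel by (simp only: norm_mult mult_ac)
      moreover have "norm (E / 2) > 0" using h0 by (simp add: E_def)
      ultimately show "norm (hx + \<i> * hy) \<le> k * norm (hx - \<i> * hy)" by (simp only: mult_le_cancel_left_pos)
    qed
  qed
  define f where "f = (\<lambda>t. \<Phi> (x0 + t) - \<Phi> x0)"
  have cf: "continuous_on UNIV f" unfolding f_def
    by (intro continuous_intros continuous_on_compose2[OF \<Phi>(2)]) auto
  have "isCont f 0" using cf by (simp add: continuous_on_eq_continuous_at)
  then obtain R1 where R1: "R1 > 0" "\<And>t. \<bar>t\<bar> < R1 \<Longrightarrow> \<bar>f t\<bar> < 1/2"
    unfolding continuous_at_eps_delta by (force simp: f_def dest: spec[of _ "1/2"])
  have "isCont (unchart p) 0" unfolding unchart_def by (intro continuous_intros)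
  moreover have "unchart p 0 \<in> B" using pB by (simp add: unchart_def)
  moreover have "open B" unfolding B_def by (rule open_box)
  ultimately obtain R2 where R2: "R2 > 0" "\<And>w. norm w < R2 \<Longrightarrow> unchart p w \<in> B"
    unfolding continuous_at_open by (metis dist_0_norm open_contains_ball_eq mem_ball subsetD)
  define R where "R = Min {R1 / 2, R2 / 2, 1/5}"
  have R: "0 < R" "R < R1" "R < R2" "R < 1/4" using R1 R2 by (auto simp: R_def min_def)
  interpret cs: capacity_setting H a b c e k p R f
  proof unfold_locales
    show "norm p = 1" by (rule p)
    show "cbox (Complex a c) (Complex b e) \<subseteq> ball p (1/2)" using QU(2) by (simp add: Q_def)
    show "0 < R" "R < 1/4" using R by auto
    show "unchart p ` cball 0 R \<subseteq> box (Complex a c) (Complex b e)" using R2(2) R by (auto simp: B_def)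
    show "H ` cbox (Complex a c) (Complex b e) \<subseteq> cball 0 1"
      using norm_chart_le[OF q QU(3)] by (auto simp: H_def Q_def)
    show "strict_mono f" using \<Phi>(1) by (auto simp: f_def strict_mono_def)
    show "f 0 = 0" by (simp add: f_def)
    fix t assume t: "\<bar>t\<bar> \<le> R"
    have "h (unchart p (of_real t)) = cis (2 * pi * \<Phi> (x0 + t))" unfolding p_def unchart_cis by (rule \<Phi>(3))
    also have "\<dots> = unchart q (of_real (f t))" unfolding q_def unchart_cis by (simp add: f_def)
    finally have "H (unchart p (of_real t)) = chart q (unchart q (of_real (f t)))" by (simp add: H_def)
    also have "\<dots> = of_real (f t)" using R1(2)[of t] t R by (intro chart_unchart[OF q]) auto
    finally show "H (unchart p (of_real t)) = of_real (f t)" .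
  qed
  define s where "s = (4 * A' / pi - 1) * ((1 - k) / (1 + k))"
  \<comment> \<open>The terms without ln r in the capacity estimate, after division by 2 pi (1 + k)
    / (1 - k).\<close>
  define c0 where "c0 = 11 + 8 * A' / pi * ((1 - k) / (1 + k)) - s * ln R"
  have main: "min (f r) (- f (- r)) \<le> exp c0 * r powr s" if r: "0 < r" "r \<le> R * exp (-2)" for r
  proof -
    define m where "m = min (f r) (- f (- r))"
    note est = cs.capacity_estimate[OF A r, folded m_def]
    define \<kappa> where "\<kappa> = (1 - k) / (1 + k)"
    have \<kappa>: "\<kappa> > 0" "(1 + k) / (1 - k) * \<kappa> = 1" using k0 k(2) by (auto simp: \<kappa>_def)
    have "\<kappa> * (8 * A' * (ln R - ln r - 2)) \<le> \<kappa> * (2 * pi * (ln R - ln r) + (1 + k) / (1 - k) * (2 * pi * (11 - ln m)))"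
      using est(1) \<kappa>(1) by (intro mult_left_mono) auto
    also have "\<dots> = \<kappa> * (2 * pi * (ln R - ln r)) + ((1 + k) / (1 - k) * \<kappa>) * (2 * pi * (11 - ln m))"
      by (simp add: algebra_simps)
    finally have "2 * pi * ln m \<le> 2 * pi * (11 + \<kappa> * (ln R - ln r)) - \<kappa> * (8 * A' * (ln R - ln r - 2))"
      unfolding \<kappa>(2) by (simp add: algebra_simps)
    also have "\<dots> = 2 * pi * (c0 + s * ln r)"
      unfolding c0_def s_def \<kappa>_def[symmetric] by (simp add: field_simps)
    finally have "ln m \<le> c0 + s * ln r" by simp
    then have "m \<le> exp (c0 + s * ln r)" using est(2) by (metis exp_le_cancel_iff exp_ln)
    also have "\<dots> = exp c0 * r powr s" using r by (simp add: exp_add powr_def)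
    finally show ?thesis by (simp add: m_def)
  qed
  have "min (\<Phi> (x0 + r) - \<Phi> x0) (\<Phi> x0 - \<Phi> (x0 - r)) \<le> exp c0 * r powr s" if "0 < r \<and> r < R * exp (-2)" for r
    using main[of r] that by (simp add: f_def)
  then show ?thesis
    using R(1) unfolding s_def by (intro exI[of _ "exp c0"] exI[of _ "R * exp (-2)"] conjI) auto
qed

subsection \<open>Linearization of expanding lifts\<close>

locale expanding_lift =
  fixes d :: nat and F :: "real \<Rightarrow> real" and \<alpha> L c0 r0 :: real
  assumes d: "d \<ge> 2" and F0: "F 0 = 0" and per: "\<And>x. F (x + 1) = F x + real d"
    and diff: "\<And>x. F differentiable at x"
    and \<alpha>: "0 < \<alpha>" and holder: "\<And>x y. \<bar>deriv F x - deriv F y\<bar> \<le> L * \<bar>x - y\<bar> powr \<alpha>"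
    and c0: "c0 > 0" and r0: "r0 > 1" and expand: "\<And>n x. n \<ge> 1 \<Longrightarrow> deriv (F ^^ n) x \<ge> c0 * r0 ^ n"
begin

lemma DERIV_F: "(F has_real_derivative deriv F x) (at x)"
  using diff by (metis DERIV_imp_deriv real_differentiable_def)

lemma DERIV_iterate: "((F ^^ n) has_real_derivative deriv (F ^^ n) x) (at x)"
proof -
  have "\<exists>D. ((F ^^ n) has_real_derivative D) (at x)" for x
  proof (induction n)
    case 0
    then show ?case by (auto intro!: exI derivative_eq_intros)
  next
    case (Suc n)
    then obtain D where "((F ^^ n) has_real_derivative D) (at x)" by blast
    from DERIV_chain[OF DERIV_F this] show ?case by (auto simp: o_def)
  qed
  then show ?thesis by (metis DERIV_imp_deriv)
qed

lemma deriv_Suc: "deriv (F ^^ Suc n) x = deriv F ((F ^^ n) x) * deriv (F ^^ n) x"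
  using DERIV_chain[OF DERIV_F DERIV_iterate, of n x] by (intro DERIV_imp_deriv) simp

lemma deriv_F_pos: "deriv F x \<ge> c0 * r0" "deriv F x > 0"
proof -
  show "deriv F x \<ge> c0 * r0" using expand[of 1 x] by simp
  moreover have "c0 * r0 > 0" using c0 r0 by simp
  ultimately show "deriv F x > 0" by linarith
qed

lemma deriv_iterate_pos: "deriv (F ^^ n) x > 0"
proof (induction n)
  case 0
  have "deriv (F ^^ 0) x = 1" by (intro DERIV_imp_deriv) (simp add: id_def)
  then show ?case by simp
next
  case (Suc n)
  then show ?case by (simp add: deriv_Suc deriv_F_pos del: funpow.simps)
qed

lemma iterate_MVT:
  assumes "x < y"
  shows "\<exists>\<xi>. x < \<xi> \<and> \<xi> < y \<and> (F ^^ n) y - (F ^^ n) x = (y - x) * deriv (F ^^ n) \<xi>"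
  using MVT2[OF assms, of "F ^^ n" "deriv (F ^^ n)"] DERIV_iterate by blast

lemma strict_mono_iterate: "strict_mono (F ^^ n)"
proof (rule strict_monoI)
  fix x y :: real assume "x < y"
  from iterate_MVT[OF this, of n] obtain \<xi> where "(F ^^ n) y - (F ^^ n) x = (y - x) * deriv (F ^^ n) \<xi>" by blast
  moreover have "(y - x) * deriv (F ^^ n) \<xi> > 0" using \<open>x < y\<close> deriv_iterate_pos by simp
  ultimately show "(F ^^ n) x < (F ^^ n) y" by linarith
qed

lemma iterate_expand:
  assumes "n \<ge> 1"
  shows "\<bar>(F ^^ n) y - (F ^^ n) x\<bar> \<ge> c0 * r0 ^ n * \<bar>y - x\<bar>"
proof -
  have *: "(F ^^ n) y - (F ^^ n) x \<ge> c0 * r0 ^ n * (y - x)" if "x < y" for x y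
  proof -
    from iterate_MVT[OF that, of n] obtain \<xi> where "(F ^^ n) y - (F ^^ n) x = (y - x) * deriv (F ^^ n) \<xi>" by blast
    moreover have "(y - x) * deriv (F ^^ n) \<xi> \<ge> (y - x) * (c0 * r0 ^ n)"
      using that expand[OF assms] by (intro mult_left_mono) auto
    ultimately show ?thesis by (simp add: mult.commute)
  qed
  show ?thesis using *[of x y] *[of y x] by (cases x y rule: linorder_cases) auto
qed

lemma F_add_nat: "F (x + real m) = F x + real m * real d"
proof (induction m)
  case (Suc m)
  then show ?case using per[of "x + real m"] by (simp add: algebra_simps)
qed simp

lemma F_add_int: "F (x + of_int m) = F x + of_int m * real d"
proof (cases m rule: int_cases2)
  case (nonneg n)
  then show ?thesis using F_add_nat[of x n] by simp
next
  case (nonpos n)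
  then show ?thesis using F_add_nat[of "x - real n" n] by simp
qed

lemma iterate_add_int: "(F ^^ n) (x + of_int m) = (F ^^ n) x + of_int m * real d ^ n"
proof (induction n)
  case (Suc n)
  have "F ((F ^^ n) x + of_int m * real d ^ n) = F ((F ^^ n) x + of_int (m * int d ^ n))" by simp
  also have "\<dots> = F ((F ^^ n) x) + of_int (m * int d ^ n) * real d" by (rule F_add_int)
  finally show ?case using Suc by (simp add: algebra_simps)
qed simp

lemma iterate_0: "(F ^^ n) 0 = 0" by (induction n) (auto simp: F0)

definition \<phi> where "\<phi> x = F x - real d * x"

lemma \<phi>_per: "\<phi> (x + of_int m) = \<phi> x" by (simp add: \<phi>_def F_add_int algebra_simps)

lemma \<phi>_bound: "\<bar>\<phi> x\<bar> \<le> real d"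
proof -
  define y where "y = x - of_int \<lfloor>x\<rfloor>"
  have y: "0 \<le> y" "y \<le> 1" unfolding y_def by linarith+
  have m: "mono F" using strict_mono_iterate[of 1] strict_mono_mono by auto
  have "F 0 \<le> F y" "F y \<le> F 1" using y m by (auto dest: monoD)
  then have "0 \<le> F y" "F y \<le> real d" using F0 per[of 0] by auto
  moreover have "0 \<le> real d * y" "real d * y \<le> real d" using y by (auto intro: mult_left_le)
  ultimately have "\<bar>\<phi> y\<bar> \<le> real d" by (simp add: \<phi>_def abs_le_iff)
  moreover have "\<phi> x = \<phi> y" using \<phi>_per[of y "\<lfloor>x\<rfloor>"] by (simp add: y_def)
  ultimately show ?thesis by simp
qed

text \<open>The telescoped form of the limit of (F ^^ n) x / d^n. The series converges uniformly
  because \<open>\<phi>\<close> is bounded, and shifting it shows that \<open>G\<close> conjugates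
  \<open>F\<close> to multiplication by d; so the inverse of the lifted marking is constructed
  directly.\<close>

definition G where "G x = x + (\<Sum>n. \<phi> ((F ^^ n) x) / real d ^ Suc n)"

lemma term_bound: "norm (\<phi> ((F ^^ n) x) / real d ^ Suc n) \<le> (1 / real d) ^ n"
proof -
  have "norm (\<phi> ((F ^^ n) x) / real d ^ Suc n) \<le> real d / real d ^ Suc n"
    unfolding real_norm_def abs_divide using \<phi>_bound d by (intro frac_le) auto
  also have "\<dots> = (1 / real d) ^ n" using d by (simp add: power_divide)
  finally show ?thesis .
qed

lemma summable_geo: "summable (\<lambda>n. (1 / real d) ^ n)"
  using d by (intro summable_geometric) simp

lemma summable_term: "summable (\<lambda>n. \<phi> ((F ^^ n) x) / real d ^ Suc n)"
  by (rule summable_comparison_test'[OF summable_geo]) (rule term_bound)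

lemma continuous_iterate: "continuous_on A (F ^^ n)"
  by (meson DERIV_continuous DERIV_iterate continuous_at_imp_continuous_on)

lemma continuous_G: "continuous_on UNIV G"
proof -
  have c\<phi>: "continuous_on UNIV (\<lambda>x. \<phi> ((F ^^ n) x))" for n
    unfolding \<phi>_def using continuous_iterate[of UNIV "Suc n"] continuous_iterate[of UNIV n]
    by (intro continuous_intros) (auto simp: o_def)
  have "uniform_limit UNIV (\<lambda>N x. \<Sum>n<N. \<phi> ((F ^^ n) x) / real d ^ Suc n) (\<lambda>x. \<Sum>n. \<phi> ((F ^^ n) x) / real d ^ Suc n) sequentially"
    by (rule Weierstrass_m_test[OF _ summable_geo]) (rule term_bound)
  then have "continuous_on UNIV (\<lambda>x. \<Sum>n. \<phi> ((F ^^ n) x) / real d ^ Suc n)"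
  proof (rule uniform_limit_theorem[rotated])
    show "\<forall>\<^sub>F N in sequentially. continuous_on UNIV (\<lambda>x. \<Sum>n<N. \<phi> ((F ^^ n) x) / real d ^ Suc n)"
      using d by (intro always_eventually allI continuous_intros c\<phi>) auto
  qed simp
  then show ?thesis unfolding G_def[abs_def] by (intro continuous_intros)
qed

lemma G_near: "\<bar>G x - x\<bar> \<le> 2"
proof -
  have "\<bar>G x - x\<bar> = norm (\<Sum>n. \<phi> ((F ^^ n) x) / real d ^ Suc n)" by (simp add: G_def)
  also have "\<dots> \<le> (\<Sum>n. (1 / real d) ^ n)"
    by (rule norm_suminf_le[OF term_bound summable_geo])
  also have "\<dots> = 1 / (1 - 1 / real d)" using d by (intro suminf_geometric) simp
  also have "\<dots> \<le> 2" using d by (simp add: field_simps)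
  finally show ?thesis .
qed

lemma G_F: "G (F x) = real d * G x"
proof -
  have "(\<Sum>n. \<phi> ((F ^^ n) (F x)) / real d ^ Suc n) = (\<Sum>n. real d * (\<phi> ((F ^^ Suc n) x) / real d ^ Suc (Suc n)))"
    using d by (intro suminf_cong) (simp add: funpow_swap1)
  also have "\<dots> = real d * (\<Sum>n. \<phi> ((F ^^ Suc n) x) / real d ^ Suc (Suc n))"
    using summable_term[of x] by (intro suminf_mult) (subst summable_Suc_iff[of "\<lambda>n. \<phi> ((F ^^ n) x) / real d ^ Suc n"])
  also have "(\<Sum>n. \<phi> ((F ^^ Suc n) x) / real d ^ Suc (Suc n)) = (\<Sum>n. \<phi> ((F ^^ n) x) / real d ^ Suc n) - \<phi> x / real d"
    using suminf_split_head[OF summable_term[of x]] by simp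
  also have "real d * ((\<Sum>n. \<phi> ((F ^^ n) x) / real d ^ Suc n) - \<phi> x / real d) = real d * (\<Sum>n. \<phi> ((F ^^ n) x) / real d ^ Suc n) - \<phi> x"
    using d by (simp add: right_diff_distrib)
  finally have eq: "(\<Sum>n. \<phi> ((F ^^ n) (F x)) / real d ^ Suc n) = real d * (\<Sum>n. \<phi> ((F ^^ n) x) / real d ^ Suc n) - \<phi> x" .
  show ?thesis unfolding G_def eq distrib_left by (simp only: \<phi>_def)
qed

lemma G_iterate: "G ((F ^^ n) x) = real d ^ n * G x"
  by (induction n) (auto simp: G_F)

lemma G_add_int: "G (x + of_int m) = G x + of_int m"
proof -
  have "\<phi> ((F ^^ n) (x + of_int m)) = \<phi> ((F ^^ n) x)" for n
    using \<phi>_per[of "(F ^^ n) x" "m * int d ^ n"] by (simp add: iterate_add_int)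
  then show ?thesis by (simp add: G_def)
qed

lemma G_0: "G 0 = 0" by (simp add: G_def iterate_0 \<phi>_def F0)

text \<open>Two distinct points are separated by more than 4 under some iterate, while
  \<open>G\<close> moves every point by at most 2; \<open>G_iterate\<close> brings the strict
  inequality back.\<close>

lemma strict_mono_G: "strict_mono G"
proof (rule strict_monoI)
  fix x y :: real assume xy: "x < y"
  obtain N where N: "4 / (c0 * (y - x)) < r0 ^ N" using real_arch_pow[OF r0] by blast
  define n where "n = Suc N"
  have "r0 ^ N \<le> r0 ^ n" using r0 by (simp add: n_def)
  then have "4 / (c0 * (y - x)) < r0 ^ n" using N by simp
  then have n: "n \<ge> 1" "c0 * r0 ^ n * (y - x) > 4" using c0 xy by (auto simp: n_def field_simps)
  then have "(F ^^ n) y - (F ^^ n) x > 4"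
    using iterate_expand[OF n(1), of y x] xy strict_monoD[OF strict_mono_iterate[of n] xy] by simp
  then have "G ((F ^^ n) x) < G ((F ^^ n) y)" using G_near[of "(F ^^ n) x"] G_near[of "(F ^^ n) y"] by linarith
  then show "G x < G y" using d by (simp add: G_iterate)
qed

lemma surj_G: "\<exists>x. G x = t"
proof -
  have "G (t - 2) \<le> t" "t \<le> G (t + 2)" using G_near[of "t - 2"] G_near[of "t + 2"] by linarith+
  then show ?thesis
    using IVT'[of G "t - 2" t "t + 2"] continuous_on_subset[OF continuous_G] by auto
qed

definition H where "H = inv G"

lemma G_H [simp]: "G (H t) = t"
proof -
  obtain x where "G x = t" using surj_G by blast
  then show ?thesis unfolding H_def by (intro f_inv_into_f) auto
qed

lemma H_G [simp]: "H (G x) = x"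
  unfolding H_def using strict_mono_G by (intro inv_f_f strict_mono_imp_inj_on)

lemma H_eqI: "G x = t \<Longrightarrow> H t = x" using H_G by blast

lemma strict_mono_H: "strict_mono H"
proof (rule strict_monoI)
  fix s t :: real assume "s < t"
  then have "G (H s) < G (H t)" by simp
  then show "H s < H t" by (simp only: strict_mono_less[OF strict_mono_G])
qed

lemma H_0: "H 0 = 0" by (rule H_eqI[OF G_0])

lemma H_add_int: "H (t + of_int m) = H t + of_int m"
  by (rule H_eqI) (simp add: G_add_int)

lemma H_mult: "H (real d * t) = F (H t)" by (rule H_eqI) (simp add: G_F)

lemma H_iterate: "H (real d ^ n * t) = (F ^^ n) (H t)" by (rule H_eqI) (simp add: G_iterate)

lemma continuous_H: "continuous_on UNIV H"
proof (rule continuous_onI_mono)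
  have "range H = UNIV" by (rule surjI[of H G]) simp
  then show "open (range H)" by simp
  show "H x \<le> H y" if "x \<le> y" for x y using that strict_mono_H by (simp add: strict_mono_less_eq)
qed

subsection \<open>Distortion\<close>

text \<open>The rate at which distances to the power \<alpha> shrink under inverse branches; it is
  the ratio of the geometric series behind \<open>Kd\<close> and of all exponential estimates
  below.\<close>

definition \<tau> where "\<tau> = (1 / r0) powr \<alpha>"
definition Kd where "Kd = \<bar>L\<bar> / (c0 * r0) * (1 / c0) powr \<alpha> / (1 - \<tau>) + \<bar>L\<bar> / (c0 * r0)"

lemma \<tau>: "0 < \<tau>" "\<tau> < 1"
proof -
  show "0 < \<tau>" using r0 by (simp add: \<tau>_def)
  have "(1 / r0) powr \<alpha> < 1 powr \<alpha>" using r0 \<alpha> by (intro powr_less_mono2) auto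
  then show "\<tau> < 1" by (simp add: \<tau>_def)
qed

lemma Kd_nonneg: "Kd \<ge> 0" using \<tau> c0 r0 by (simp add: Kd_def)

lemma ln_deriv_bound: "\<bar>ln (deriv F x) - ln (deriv F y)\<bar> \<le> \<bar>L\<bar> / (c0 * r0) * \<bar>x - y\<bar> powr \<alpha>"
proof -
  have *: "ln (deriv F x) - ln (deriv F y) \<le> \<bar>L\<bar> / (c0 * r0) * \<bar>x - y\<bar> powr \<alpha>" for x y
  proof -
    have c: "c0 * r0 > 0" using c0 r0 by simp
    have "ln (deriv F x) - ln (deriv F y) \<le> (deriv F x - deriv F y) / deriv F y"
      using deriv_F_pos by (intro ln_diff_le) auto
    also have "\<dots> \<le> (\<bar>L\<bar> * \<bar>x - y\<bar> powr \<alpha>) / deriv F y"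
    proof (intro divide_right_mono)
      have "deriv F x - deriv F y \<le> L * \<bar>x - y\<bar> powr \<alpha>" using holder[of x y] by simp
      also have "\<dots> \<le> \<bar>L\<bar> * \<bar>x - y\<bar> powr \<alpha>" by (intro mult_right_mono) auto
      finally show "deriv F x - deriv F y \<le> \<bar>L\<bar> * \<bar>x - y\<bar> powr \<alpha>" .
    qed (use deriv_F_pos(2)[of y] in simp)
    also have "\<dots> \<le> (\<bar>L\<bar> * \<bar>x - y\<bar> powr \<alpha>) / (c0 * r0)"
      using deriv_F_pos(1)[of y] mult_pos_pos[OF deriv_F_pos(2)[of y] c] by (intro divide_left_mono) auto
    finally show ?thesis by simp
  qed
  show ?thesis using *[of x y] *[of y x] by (simp add: abs_le_iff abs_minus_commute)
qed

text \<open>By the chain rule the logarithm is a sum over the orbit. The distance at time i is at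
  most a constant times r0^(-(n - i)) times the distance at time n, so the sum is dominated by a
  geometric series read backwards from the final distance.\<close>

theorem distortion: "\<bar>ln (deriv (F ^^ n) x) - ln (deriv (F ^^ n) y)\<bar> \<le> Kd * \<bar>(F ^^ n) x - (F ^^ n) y\<bar> powr \<alpha>"
proof -
  define B where "B = \<bar>L\<bar> / (c0 * r0)"
  have B: "B \<ge> 0" using c0 r0 by (simp add: B_def)
  have ln0: "ln (deriv (F ^^ 0) x) = 0" for x
  proof -
    have "deriv (F ^^ 0) x = 1" by (intro DERIV_imp_deriv) (simp add: id_def)
    then show ?thesis by simp
  qed
  have lnS: "ln (deriv (F ^^ Suc n) x) = ln (deriv F ((F ^^ n) x)) + ln (deriv (F ^^ n) x)" for n x
    unfolding deriv_Suc using deriv_F_pos deriv_iterate_pos by (intro ln_mult_pos)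
  have sum: "\<bar>ln (deriv (F ^^ n) x) - ln (deriv (F ^^ n) y)\<bar> \<le> (\<Sum>i<n. B * \<bar>(F ^^ i) x - (F ^^ i) y\<bar> powr \<alpha>)"
  proof (induction n)
    case 0
    then show ?case by (simp only: ln0) simp
  next
    case (Suc n)
    have "\<bar>ln (deriv F ((F ^^ n) x)) - ln (deriv F ((F ^^ n) y))\<bar> \<le> B * \<bar>(F ^^ n) x - (F ^^ n) y\<bar> powr \<alpha>"
      unfolding B_def by (rule ln_deriv_bound)
    then show ?case using Suc unfolding lnS sum.lessThan_Suc by linarith
  qed
  have term_le: "\<bar>(F ^^ i) x - (F ^^ i) y\<bar> powr \<alpha> \<le> ((1 / c0) powr \<alpha> * \<bar>(F ^^ n) x - (F ^^ n) y\<bar> powr \<alpha>) * \<tau> ^ (n - i)"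
    if i: "i < n" for i
  proof -
    have eq: "(F ^^ n) z = (F ^^ (n - i)) ((F ^^ i) z)" for z
      using i by (metis comp_apply funpow_add le_add_diff_inverse2 less_imp_le)
    have "c0 * r0 ^ (n - i) * \<bar>(F ^^ i) x - (F ^^ i) y\<bar> \<le> \<bar>(F ^^ n) x - (F ^^ n) y\<bar>"
      unfolding eq using i by (intro iterate_expand) auto
    then have "\<bar>(F ^^ i) x - (F ^^ i) y\<bar> \<le> 1 / c0 * (\<bar>(F ^^ n) x - (F ^^ n) y\<bar> * (1 / r0) ^ (n - i))"
      using c0 r0 by (simp add: field_simps power_divide)
    then have "\<bar>(F ^^ i) x - (F ^^ i) y\<bar> powr \<alpha> \<le> (1 / c0 * (\<bar>(F ^^ n) x - (F ^^ n) y\<bar> * (1 / r0) ^ (n - i))) powr \<alpha>"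
      using \<alpha> by (intro powr_mono2) auto
    also have "\<dots> = (1 / c0) powr \<alpha> * (\<bar>(F ^^ n) x - (F ^^ n) y\<bar> powr \<alpha> * ((1 / r0) ^ (n - i)) powr \<alpha>)"
    proof -
      have "0 \<le> 1 / c0" "0 \<le> \<bar>(F ^^ n) x - (F ^^ n) y\<bar>" "0 \<le> (1 / r0) ^ (n - i)" using c0 r0 by auto
      then show ?thesis by (simp only: powr_mult mult_nonneg_nonneg)
    qed
    also have "((1 / r0) ^ (n - i)) powr \<alpha> = \<tau> ^ (n - i)"
      unfolding \<tau>_def using r0 by (simp add: powr_realpow[symmetric] powr_powr mult.commute)
    finally show ?thesis by (simp add: mult_ac)
  qed
  define V where "V = (1 / c0) powr \<alpha> * \<bar>(F ^^ n) x - (F ^^ n) y\<bar> powr \<alpha>"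
  have V: "V \<ge> 0" by (simp add: V_def)
  have "(\<Sum>i<n. B * \<bar>(F ^^ i) x - (F ^^ i) y\<bar> powr \<alpha>) \<le> (\<Sum>i<n. B * (V * \<tau> ^ (n - i)))"
    using term_le B by (intro sum_mono mult_left_mono) (auto simp: V_def)
  also have "\<dots> = B * V * (\<Sum>i<n. \<tau> ^ (n - i))" by (simp add: sum_distrib_left mult.assoc)
  also have "(\<Sum>i<n. \<tau> ^ (n - i)) \<le> 1 / (1 - \<tau>)"
  proof -
    have "(\<Sum>i<n. \<tau> ^ (n - i)) = (\<Sum>i<n. \<tau> ^ Suc i)"
    proof -
      have "(\<Sum>i<n. \<tau> ^ (n - i)) = (\<Sum>i<n. \<tau> ^ Suc (n - Suc i))" by (intro sum.cong refl) (simp add: Suc_diff_Suc del: power_Suc)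
      then show ?thesis using sum.nat_diff_reindex[of "\<lambda>i. \<tau> ^ Suc i" n] by simp
    qed
    also have "\<dots> \<le> (\<Sum>i<n. \<tau> ^ i)" using \<tau> by (intro sum_mono) (auto intro: mult_left_le_one_le)
    also have "\<dots> \<le> (\<Sum>i. \<tau> ^ i)" using \<tau> by (intro sum_le_suminf summable_geometric) auto
    also have "\<dots> = 1 / (1 - \<tau>)" using \<tau> by (intro suminf_geometric) auto
    finally show ?thesis .
  qed
  finally have "\<bar>ln (deriv (F ^^ n) x) - ln (deriv (F ^^ n) y)\<bar> \<le> B * V * (1 / (1 - \<tau>))"
    using sum B V by (meson mult_left_mono mult_nonneg_nonneg order_trans)
  also have "\<dots> \<le> Kd * \<bar>(F ^^ n) x - (F ^^ n) y\<bar> powr \<alpha>"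
    using B by (simp add: Kd_def V_def B_def[symmetric] algebra_simps)
  finally show ?thesis .
qed

end

subsection \<open>Lifts of circle maps\<close>

lemma cis_eq_iff_int: "cis (2 * pi * x) = cis (2 * pi * y) \<longleftrightarrow> (\<exists>n::int. x = y + of_int n)"
proof -
  have "cis (2 * pi * x) = cis (2 * pi * y) \<longleftrightarrow> sin (2*pi*x) = sin (2*pi*y) \<and> cos (2*pi*x) = cos (2*pi*y)"
    by (auto simp: complex_eq_iff)
  also have "\<dots> \<longleftrightarrow> (\<exists>n::int. 2*pi*x = 2*pi*y + 2*pi*n)" by (rule sin_cos_eq_iff)
  also have "\<dots> \<longleftrightarrow> (\<exists>n::int. x = y + of_int n)"
    by (simp add: distrib_left[symmetric] mult.assoc del: distrib_left)
  finally show ?thesis .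
qed

lemma cis_eq_1_iff: "cis (2 * pi * x) = 1 \<longleftrightarrow> (\<exists>n::int. x = of_int n)"
  using cis_eq_iff_int[of x 0] by simp

lemma circle_cis: "z \<in> circle \<Longrightarrow> \<exists>x. z = cis (2 * pi * x)"
proof -
  assume "z \<in> circle"
  then have "norm z = 1" by simp
  then have "z \<noteq> 0" by auto
  then have "z = cis (Arg z)" using cis_Arg[of z] \<open>norm z = 1\<close> by (simp add: sgn_div_norm)
  then show ?thesis by (intro exI[of _ "Arg z / (2 * pi)"]) simp
qed

lemma continuous_lift_unique:
  fixes H H' :: "real \<Rightarrow> real"
  assumes "continuous_on UNIV H" "continuous_on UNIV H'" and eq: "\<And>x. cis (2 * pi * H x) = cis (2 * pi * H' x)"
    and "H 0 = H' 0"
  shows "H = H'"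
proof -
  define k where "k = (\<lambda>x. H x - H' x)"
  have ck: "continuous_on UNIV k" unfolding k_def by (intro continuous_intros assms)
  have int: "\<exists>n::int. k x = of_int n" for x using eq[of x] unfolding cis_eq_iff_int k_def by (auto simp: algebra_simps)
  have "k constant_on UNIV"
  proof (rule continuous_discrete_range_constant[OF connected_UNIV ck])
    fix x :: real
    have "1 \<le> norm (k y - k x)" if "k y \<noteq> k x" for y
    proof -
      obtain m n :: int where "k y = of_int m" "k x = of_int n" using int by metis
      moreover have "m \<noteq> n" using that calculation by auto
      ultimately show ?thesis by (simp flip: of_int_diff)
    qed
    then show "\<exists>e>0. \<forall>y. y \<in> UNIV \<and> k y \<noteq> k x \<longrightarrow> e \<le> norm (k y - k x)" by (intro exI[of _ 1]) auto
  qed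
  then have "k x = k 0" for x unfolding constant_on_def by (metis UNIV_I)
  moreover have "k 0 = 0" using assms(4) by (simp add: k_def)
  ultimately show ?thesis by (auto simp: k_def fun_eq_iff)
qed

lemma circle_liftD:
  assumes "circle_lift D f F"
  shows "continuous_on UNIV F" "inj F" "F (x + 1) = F x + of_int D" "f (cis (2 * pi * x)) = cis (2 * pi * F x)"
proof -
  obtain G where G: "homeomorphism UNIV UNIV F G" using assms by (auto simp: circle_lift_def)
  then show "continuous_on UNIV F" by (rule homeomorphism_cont1)
  show "inj F" using G by (intro inj_on_inverseI[of _ G]) (auto simp: homeomorphism_def)
  show "F (x + 1) = F x + of_int D" "f (cis (2 * pi * x)) = cis (2 * pi * F x)"
    using assms by (auto simp: circle_lift_def)
qed

lemma circle_lift_shift: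
  assumes "circle_lift D f F"
  shows "circle_lift D f (\<lambda>x. F x - of_int n)"
proof -
  obtain G where G: "homeomorphism UNIV UNIV F G" using assms by (auto simp: circle_lift_def)
  have "homeomorphism UNIV UNIV (\<lambda>x. F x - of_int n) (\<lambda>y. G (y + of_int n))"
    unfolding homeomorphism_def
  proof (intro conjI ballI)
    have gF: "G (F x) = x" "F (G y) = y" for x y using G by (auto simp: homeomorphism_def)
    show "continuous_on UNIV (\<lambda>x. F x - of_int n)" using G by (auto simp: homeomorphism_def intro!: continuous_intros)
    have "continuous_on UNIV G" using G by (auto simp: homeomorphism_def)
    then show "continuous_on UNIV (\<lambda>y. G (y + of_int n))" by (rule continuous_on_compose2) (auto intro!: continuous_intros)
    show "range (\<lambda>x. F x - of_int n) = UNIV" by (rule surjI[of _ "\<lambda>y. G (y + of_int n)"]) (simp add: gF)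
    show "range (\<lambda>y. G (y + of_int n)) = UNIV" by (rule surjI[of _ "\<lambda>x. F x - of_int n"]) (simp add: gF)
  qed (use G in \<open>auto simp: homeomorphism_def\<close>)
  moreover have "cis (2 * pi * (F x - of_int n)) = cis (2 * pi * F x)" for x
    unfolding cis_eq_iff_int by (intro exI[of _ "- n"]) simp
  ultimately show ?thesis using assms unfolding circle_lift_def by auto
qed

lemma lift_of_props:
  assumes "circle_endomorphism d f"
  shows "circle_lift (int d) f (lift_of d f)" "lift_of d f 0 = 0"
proof -
  obtain F where F: "circle_lift (int d) f F" and f1: "f 1 = 1" using assms by (auto simp: circle_endomorphism_def)
  have "cis (2 * pi * F 0) = 1" using circle_liftD(4)[OF F, of 0] f1 by simp
  then obtain n :: int where n: "F 0 = of_int n" unfolding cis_eq_1_iff by blast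
  have ex: "circle_lift (int d) f (\<lambda>x. F x - of_int n) \<and> (\<lambda>x. F x - of_int n) 0 = 0"
    using circle_lift_shift[OF F] n by simp
  have "circle_lift (int d) f (lift_of d f) \<and> lift_of d f 0 = 0"
    unfolding lift_of_def
  proof (rule theI[of "\<lambda>F. circle_lift (int d) f F \<and> F 0 = 0", OF ex])
    fix F' assume F': "circle_lift (int d) f F' \<and> F' 0 = 0"
    show "F' = (\<lambda>x. F x - of_int n)"
    proof (rule continuous_lift_unique)
      show "continuous_on UNIV F'" "continuous_on UNIV (\<lambda>x. F x - of_int n)"
        using circle_liftD(1)[OF conjunct1[OF F']] circle_liftD(1)[OF conjunct1[OF ex]] by simp_all
      show "cis (2 * pi * F' x) = cis (2 * pi * (F x - of_int n))" for x
        using circle_liftD(4)[OF conjunct1[OF F'], of x] circle_liftD(4)[OF conjunct1[OF ex], of x] by simp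
      show "F' 0 = F 0 - of_int n" using F' ex by simp
    qed
  qed
  then show "circle_lift (int d) f (lift_of d f)" "lift_of d f 0 = 0" by auto
qed

text \<open>The inverse of lifting. The chosen argument is immaterial once
  \<open>H (x + 1) = H x + 1\<close>, and the restriction to the circle makes equality of maps
  extensional.\<close>

definition circle_map :: "(real \<Rightarrow> real) \<Rightarrow> complex \<Rightarrow> complex" where
  "circle_map H = (\<lambda>z\<in>circle. cis (2 * pi * H (SOME x. z = cis (2 * pi * x))))"

lemma circle_map_cis:
  assumes per: "\<And>x. H (x + 1) = H x + 1"
  shows "circle_map H (cis (2 * pi * x)) = cis (2 * pi * H x)"
proof -
  have nat: "H (x + real n) = H x + real n" for x n
  proof (induction n)
    case (Suc n)
    then show ?case using per[of "x + real n"] by (simp add: algebra_simps)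
  qed simp
  have int: "H (x + of_int n) = H x + of_int n" for x and n :: int
    using nat[of x "nat n"] nat[of "x + of_int n" "nat (- n)"] by (cases "n \<ge> 0") auto
  define y where "y = (SOME y. cis (2 * pi * x) = cis (2 * pi * y))"
  have "cis (2 * pi * x) = cis (2 * pi * y)" unfolding y_def by (rule someI[of _ x]) simp
  then obtain n :: int where "x = y + of_int n" unfolding cis_eq_iff_int by blast
  then have "H x = H y + of_int n" using int by simp
  then have "cis (2 * pi * H x) = cis (2 * pi * H y)" unfolding cis_eq_iff_int by blast
  then show ?thesis by (simp add: circle_map_def y_def)
qed

lemma continuous_circle_map:
  assumes per: "\<And>x. H (x + 1) = H x + 1" and cont: "continuous_on UNIV H"
  shows "continuous_on circle (circle_map H)"
  unfolding continuous_on_eq_continuous_within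
proof
  fix z0 :: complex assume "z0 \<in> circle"
  then obtain x0 where x0: "z0 = cis (2 * pi * x0)" using circle_cis by blast
  define p where "p = cis (2 * pi * x0)"
  have p: "norm p = 1" by (simp add: p_def)
  have eq: "circle_map H z = cis (2 * pi * H (x0 + Re (chart p z)))" if z: "z \<in> circle" "z \<in> ball p (1/2)" for z
  proof -
    have zu: "z = unchart p (chart p z)" using unchart_chart[OF p z(2)] by simp
    have "norm z = exp (- (2 * pi * Im (chart p z)))"
      using arg_cong[OF zu, of norm] p by (simp add: unchart_def norm_mult)
    then have "Im (chart p z) = 0" using z(1) by simp
    then have "chart p z = of_real (Re (chart p z))" by (simp add: complex_eq_iff)
    then have "z = cis (2 * pi * (x0 + Re (chart p z)))" using zu unchart_cis[of x0 "Re (chart p z)"] by (simp add: p_def)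
    then show ?thesis using circle_map_cis[of H, OF per] by metis
  qed
  have "continuous_on (ball p (1/2)) (\<lambda>z. cis (2 * pi * H (x0 + Re (chart p z))))"
  proof -
    have "continuous_on (ball p (1/2)) (chart p)"
      by (meson chart_has_field_derivative[OF p] DERIV_continuous continuous_at_imp_continuous_on)
    then have "continuous_on (ball p (1/2)) (\<lambda>z. H (x0 + Re (chart p z)))"
      by (intro continuous_on_compose2[OF cont] continuous_intros) auto
    then show ?thesis by (intro continuous_intros)
  qed
  then have "continuous (at z0 within circle) (\<lambda>z. cis (2 * pi * H (x0 + Re (chart p z))))"
    by (metis centre_in_ball continuous_at_imp_continuous_at_within continuous_on_eq_continuous_at half_gt_zero_iff open_ball p_def x0 zero_less_one)
  then show "continuous (at z0 within circle) (circle_map H)"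
    by (rule continuous_transform_within[of _ _ _ "1/2"])
      (use eq \<open>z0 \<in> circle\<close> in \<open>auto simp: x0 p_def dist_commute\<close>)
qed

lemma oriented_circle_map:
  assumes H: "homeomorphism UNIV UNIV H G" "\<And>x. H (x + 1) = H x + 1"
  shows "oriented_circle_homeo (circle_map H)" "circle_lift 1 (circle_map H) H"
    "homeomorphism circle circle (circle_map H) (circle_map G)"
proof -
  have HG: "G (H x) = x" "H (G x) = x" for x using H(1) by (auto simp: homeomorphism_def)
  have G1: "G (x + 1) = G x + 1" for x using HG(1)[of "G x + 1"] H(2)[of "G x"] HG(2) by simp
  have cont: "continuous_on UNIV H" "continuous_on UNIV G" using H(1) by (auto simp: homeomorphism_def)
  note cH = circle_map_cis[of H, OF H(2)] and cG = circle_map_cis[of G, OF G1]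
  have inv: "circle_map G (circle_map H z) = z" "circle_map H (circle_map G z) = z"
    "circle_map H z \<in> circle" "circle_map G z \<in> circle" if "z \<in> circle" for z
  proof -
    obtain x where "z = cis (2 * pi * x)" using circle_cis \<open>z \<in> circle\<close> by blast
    then show "circle_map G (circle_map H z) = z" "circle_map H (circle_map G z) = z"
      "circle_map H z \<in> circle" "circle_map G z \<in> circle"
      by (simp_all add: cH cG HG)
  qed
  show hom: "homeomorphism circle circle (circle_map H) (circle_map G)"
    unfolding homeomorphism_def
    using inv continuous_circle_map[of H, OF H(2) cont(1)] continuous_circle_map[of G, OF G1 cont(2)]
    by (auto simp del: mem_sphere_0 mem_sphere) (metis imageI)+
  show lift: "circle_lift 1 (circle_map H) H"
    unfolding circle_lift_def using H cH by auto
  have "circle_map H \<in> extensional circle" by (simp add: circle_map_def)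
  then show "oriented_circle_homeo (circle_map H)" using hom lift by (auto simp: oriented_circle_homeo_def)
qed

context expanding_lift
begin

lemma homeomorphism_H: "homeomorphism UNIV UNIV H G"
  unfolding homeomorphism_def using continuous_H continuous_G by (auto intro!: surjI[of H G] surjI[of G H])

lemma H_per: "H (x + 1) = H x + 1" using H_add_int[of x 1] by simp

text \<open>Existence is the conjugation by \<open>H\<close>. For uniqueness, a second conjugacy has
  a lift \<open>K\<close> with \<open>F (K x) = K (real d * x)\<close>; then \<open>J\<close>, the
  difference of \<open>G \<circ> K\<close> and the identity, is periodic, hence bounded, and is
  multiplied by d when its argument is, which forces it to be 0.\<close>

lemma marking_eq:
  assumes f: "\<And>x. f (cis (2 * pi * x)) = cis (2 * pi * F x)"
  shows "marking d f = circle_map H"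
  unfolding marking_def
proof (rule the_equality)
  note ocm = oriented_circle_map[OF homeomorphism_H H_per]
  note cm = circle_map_cis[of H, OF H_per]
  have pw: "cis (2 * pi * x) ^ d = cis (2 * pi * (real d * x))" for x
    unfolding Complex.DeMoivre by (simp add: mult_ac)
  have "circle_map H 1 = 1" using cm[of 0] by (simp add: H_0)
  moreover have "f (circle_map H z) = circle_map H (z ^ d)" if z: "z \<in> circle" for z
  proof -
    obtain x where "z = cis (2 * pi * x)" using circle_cis z by blast
    then show ?thesis by (simp only: cm f pw H_mult)
  qed
  ultimately show "oriented_circle_homeo (circle_map H) \<and> circle_map H 1 = 1 \<and> (\<forall>z\<in>circle. f (circle_map H z) = circle_map H (z ^ d))"
    using ocm(1) by blast
  fix h assume h: "oriented_circle_homeo h \<and> h 1 = 1 \<and> (\<forall>z\<in>circle. f (h z) = h (z ^ d))"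
  then obtain K0 where K0: "circle_lift 1 h K0" by (auto simp: oriented_circle_homeo_def)
  have "cis (2 * pi * K0 0) = 1" using circle_liftD(4)[OF K0, of 0] h by simp
  then obtain n :: int where n: "K0 0 = of_int n" unfolding cis_eq_1_iff by blast
  define K where "K = (\<lambda>x. K0 x - of_int n)"
  have K: "circle_lift 1 h K" "K 0 = 0" using circle_lift_shift[OF K0] n by (auto simp: K_def)
  note Kd = circle_liftD[OF K(1)]
  have FK: "F (K x) = K (real d * x)" for x
  proof -
    have "(\<lambda>x. F (K x)) = (\<lambda>x. K (real d * x))"
    proof (rule continuous_lift_unique)
      show "continuous_on UNIV (\<lambda>x. F (K x))"
        using continuous_iterate[of UNIV 1] by (intro continuous_on_compose2[OF _ Kd(1)]) auto
      show "continuous_on UNIV (\<lambda>x. K (real d * x))"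
        by (intro continuous_on_compose2[OF Kd(1)] continuous_intros) auto
      show "F (K 0) = K (real d * 0)" by (simp add: K(2) F0)
      fix x
      have "cis (2 * pi * F (K x)) = f (h (cis (2 * pi * x)))" by (simp only: Kd(4) f)
      also have "\<dots> = h (cis (2 * pi * x) ^ d)" using h by simp
      also have "\<dots> = cis (2 * pi * K (real d * x))" by (simp only: pw Kd(4))
      finally show "cis (2 * pi * F (K x)) = cis (2 * pi * K (real d * x))" .
    qed
    then show ?thesis by (rule fun_cong)
  qed
  define J where "J = (\<lambda>x. G (K x) - x)"
  have Jd: "J (real d * x) = real d * J x" for x
    unfolding J_def FK[symmetric] G_F by (simp add: algebra_simps)
  have Jdn: "J (real d ^ n * x) = real d ^ n * J x" for n x
  proof (induction n)
    case (Suc n)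
    then show ?case using Jd[of "real d ^ n * x"] by (simp add: mult.assoc)
  qed simp
  have J1: "J (x + 1) = J x" for x using Kd(3)[of x] G_add_int[of "K x" 1] by (simp add: J_def)
  have Jc: "continuous_on UNIV J" unfolding J_def
    by (intro continuous_intros continuous_on_compose2[OF continuous_G Kd(1)]) auto
  have "compact (J ` {0..1})" using Jc by (intro compact_continuous_image continuous_on_subset[OF Jc]) auto
  then obtain B where B: "\<And>x. x \<in> {0..1} \<Longrightarrow> \<bar>J x\<bar> \<le> B"
    using compact_imp_bounded bounded_iff by (metis imageI real_norm_def)
  have Jint: "J (x + real n) = J x" for x n
  proof (induction n)
    case (Suc n)
    then show ?case using J1[of "x + real n"] by (simp add: algebra_simps)
  qed simp
  have Jb: "\<bar>J x\<bar> \<le> B" for x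
  proof -
    define y where "y = x - of_int \<lfloor>x\<rfloor>"
    have y: "y \<in> {0..1}" unfolding y_def atLeastAtMost_iff by linarith
    have "J x = J y"
    proof (cases "\<lfloor>x\<rfloor> \<ge> 0")
      case True
      then have "x = y + real (nat \<lfloor>x\<rfloor>)" by (simp add: y_def)
      then show ?thesis using Jint by metis
    next
      case False
      then have "y = x + real (nat (- \<lfloor>x\<rfloor>))" by (simp add: y_def)
      then show ?thesis using Jint by metis
    qed
    then show ?thesis using B[OF y] by simp
  qed
  have "J x = 0" for x
  proof (rule ccontr)
    assume "J x \<noteq> 0"
    then obtain n where n: "B / \<bar>J x\<bar> < real d ^ n" using d real_arch_pow[of "real d" "B / \<bar>J x\<bar>"] by auto
    then have "B < real d ^ n * \<bar>J x\<bar>" using \<open>J x \<noteq> 0\<close> by (simp add: field_simps)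
    also have "\<dots> = \<bar>J (real d ^ n * x)\<bar>" by (simp add: Jdn abs_mult)
    finally show False using Jb[of "real d ^ n * x"] by simp
  qed
  then have GK: "G (K x) = x" for x by (simp add: J_def)
  have "K = H" using H_eqI[OF GK] by (auto simp: fun_eq_iff)
  show "h = circle_map H"
  proof (rule extensionalityI[of _ circle])
    show "h \<in> extensional circle" using h by (simp add: oriented_circle_homeo_def)
    show "circle_map H \<in> extensional circle" by (simp add: circle_map_def)
    fix z assume "z \<in> circle"
    then obtain x where "z = cis (2 * pi * x)" using circle_cis by blast
    then show "h z = circle_map H z" using Kd(4)[of x] \<open>K = H\<close> by (simp add: cm)
  qed
qed

end

section \<open>Lengths of word intervals and their ratios\<close>

context expanding_lift
begin

definition len :: "nat \<Rightarrow> int \<Rightarrow> real" where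
  "len n m = H (of_int (m + 1) / real d ^ n) - H (of_int m / real d ^ n)"

text \<open>\<open>m div int d\<close> is the value after deleting the last letter, so this is the
  length relative to the parent interval, the reciprocal of the quotient in the dual
  derivative.\<close>

definition ratio :: "nat \<Rightarrow> int \<Rightarrow> real" where
  "ratio n m = len n m / len (n - 1) (m div int d)"

lemma dpos: "real d ^ n > 0" "real d > 0" using d by auto

lemma len_pos: "len n m > 0"
proof -
  have "of_int m / real d ^ n < of_int (m + 1) / real d ^ n" using dpos by (intro divide_strict_right_mono) auto
  then show ?thesis using strict_monoD[OF strict_mono_H] by (simp add: len_def)
qed

lemma len_periodic: "len n (m + j * int d ^ n) = len n m"
proof -
  have e: "of_int (m + j * int d ^ n) / real d ^ n = of_int m / real d ^ n + of_int j" for m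
    using dpos(1)[of n] by (simp add: field_simps)
  have "m + j * int d ^ n + 1 = (m + 1) + j * int d ^ n" by simp
  then show ?thesis unfolding len_def by (simp only: e H_add_int)
qed

lemma iterate_H_end: "(F ^^ k) (H (t / real d ^ (n + k))) = H (t / real d ^ n)"
  using H_iterate[of k "t / real d ^ (n + k)"] dpos by (simp add: power_add field_simps)

lemma len_sum: "len n m = (\<Sum>i<d. len (Suc n) (m * int d + int i))"
proof -
  have "(\<Sum>i<d. len (Suc n) (m * int d + int i))
      = (\<Sum>i<d. H (of_int (m * int d + int (Suc i)) / real d ^ Suc n) - H (of_int (m * int d + int i) / real d ^ Suc n))"
    by (intro sum.cong refl) (simp add: len_def algebra_simps)
  also have "\<dots> = H (of_int (m * int d + int d) / real d ^ Suc n) - H (of_int (m * int d) / real d ^ Suc n)"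
    by (subst sum_lessThan_telescope[of "\<lambda>i. H (of_int (m * int d + int i) / real d ^ Suc n)"]) simp
  also have "of_int (m * int d + int d) / real d ^ Suc n = of_int (m + 1) / real d ^ n"
    using dpos by (simp add: field_simps)
  also have "of_int (m * int d) / real d ^ Suc n = of_int m / real d ^ n"
    using dpos by (simp add: field_simps)
  finally show ?thesis by (simp add: len_def)
qed

lemma len_subinterval:
  assumes "n \<ge> 1"
  shows "H (of_int (m div int d) / real d ^ (n - 1)) \<le> H (of_int m / real d ^ n)"
    "H (of_int (m + 1) / real d ^ n) \<le> H (of_int (m div int d + 1) / real d ^ (n - 1))"
proof -
  obtain k where k: "n = Suc k" using assms by (cases n) auto
  have e: "(m div int d + 1) * int d = m div int d * int d + int d" by (simp add: distrib_right)
  have "0 \<le> m mod int d" "m mod int d < int d" using d by auto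
  then have "m div int d * int d \<le> m" "m + 1 \<le> (m div int d + 1) * int d" using e div_mult_mod_eq[of m "int d"] by linarith+
  then have "real_of_int (m div int d * int d) \<le> real_of_int m" "real_of_int (m + 1) \<le> real_of_int ((m div int d + 1) * int d)"
    by linarith+
  then have "of_int (m div int d) / real d ^ k \<le> of_int m / real d ^ n" "of_int (m + 1) / real d ^ n \<le> of_int (m div int d + 1) / real d ^ k"
    using dpos dpos(1)[of k] by (simp_all add: k divide_simps mult_ac)
  then show "H (of_int (m div int d) / real d ^ (n - 1)) \<le> H (of_int m / real d ^ n)"
    "H (of_int (m + 1) / real d ^ n) \<le> H (of_int (m div int d + 1) / real d ^ (n - 1))"
    using strict_mono_H by (simp_all add: k strict_mono_less_eq)
qed

text \<open>\<open>F ^^ k\<close> maps the interval of level n + k onto that of level n with the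
  same index, which modulo d^n amounts to deleting the first k letters of the word; the mean value
  theorem supplies the factor.\<close>

lemma len_iterate:
  "\<exists>\<xi>. H (of_int m / real d ^ (n + k)) < \<xi> \<and> \<xi> < H (of_int (m + 1) / real d ^ (n + k)) \<and>
    len n m = deriv (F ^^ k) \<xi> * len (n + k) m"
proof -
  have "H (of_int m / real d ^ (n + k)) < H (of_int (m + 1) / real d ^ (n + k))"
    using len_pos[of "n + k" m] by (simp add: len_def)
  from iterate_MVT[OF this, of k] show ?thesis
    unfolding iterate_H_end by (auto simp: len_def mult.commute)
qed

lemma len_small: "len n m \<le> max 1 (1 / c0) * (1 / r0) ^ n"
proof (cases "n = 0")
  case True
  have "len 0 m = 1" using H_add_int[of "of_int m" 1] by (simp add: len_def)
  then show ?thesis using True by simp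
next
  case False
  have e: "(F ^^ n) (H (of_int (m + 1) / real d ^ n)) = H (of_int (m + 1))" "(F ^^ n) (H (of_int m / real d ^ n)) = H (of_int m)"
    using iterate_H_end[of n _ 0] by simp_all
  have "c0 * r0 ^ n * \<bar>H (of_int (m + 1) / real d ^ n) - H (of_int m / real d ^ n)\<bar> \<le> \<bar>H (of_int (m + 1)) - H (of_int m)\<bar>"
    using iterate_expand[of n] False unfolding e[symmetric] by simp
  also have "\<dots> = 1" using H_add_int[of "of_int m" 1] by simp
  finally have "len n m \<le> 1 / c0 * (1 / r0) ^ n"
    using len_pos[of n m] c0 r0 by (simp add: len_def field_simps power_divide)
  also have "\<dots> \<le> max 1 (1 / c0) * (1 / r0) ^ n" using r0 by (intro mult_right_mono) auto
  finally show ?thesis .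
qed

text \<open>Turns the distortion over a distance of at most twice the length bound of level n - 1
  into a multiple of \<open>\<tau> ^ n\<close>; two adjacent intervals account for the 2, the shift
  of level for \<open>r0\<close>.\<close>

definition Kr where "Kr = Kd * (2 * max 1 (1 / c0) * r0) powr \<alpha>"

lemma Kr_nonneg: "Kr \<ge> 0" using Kd_nonneg by (simp add: Kr_def)

lemma distance_powr: "0 \<le> x \<Longrightarrow> x \<le> 2 * max 1 (1 / c0) * (1 / r0) ^ (n - 1) \<Longrightarrow> Kd * x powr \<alpha> \<le> Kr * \<tau> ^ n"
proof -
  assume x: "0 \<le> x" "x \<le> 2 * max 1 (1 / c0) * (1 / r0) ^ (n - 1)"
  have "(1 / r0) ^ (n - 1) \<le> r0 * (1 / r0) ^ n"
    using r0 by (cases n) (auto simp: power_divide)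
  then have "x \<le> (2 * max 1 (1 / c0)) * (r0 * (1 / r0) ^ n)"
    by (intro order_trans[OF x(2)] mult_left_mono) auto
  then have "x powr \<alpha> \<le> (2 * max 1 (1 / c0) * r0 * (1 / r0) ^ n) powr \<alpha>"
    using x \<alpha> by (intro powr_mono2) (auto simp: mult.assoc)
  also have "\<dots> = (2 * max 1 (1 / c0) * r0) powr \<alpha> * ((1 / r0) ^ n) powr \<alpha>" by (rule powr_mult)
  also have "((1 / r0) ^ n) powr \<alpha> = \<tau> ^ n"
    unfolding \<tau>_def using r0 by (simp add: powr_realpow[symmetric] powr_powr mult.commute)
  finally show ?thesis using mult_left_mono[OF _ Kd_nonneg] by (simp add: Kr_def mult.assoc)
qed

lemma ratio_pos: "ratio n m > 0" using len_pos by (simp add: ratio_def)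

text \<open>\<open>F ^^ k\<close> carries an interval and its parent down from level n + k to level
  n, so the ratio changes only by the distortion, which is bounded through the size of the image of
  the parent. Together with periodicity, the last n letters determine the logarithm of a ratio up to
  \<open>Kr * \<tau> ^ n\<close>.\<close>

lemma ratio_stable:
  assumes "n \<ge> 1"
  shows "\<bar>ln (ratio (n + k) m) - ln (ratio n m)\<bar> \<le> Kr * \<tau> ^ n"
proof -
  define j where "j = m div int d"
  have nk: "n + k - 1 = (n - 1) + k" using assms by simp
  obtain \<xi> where \<xi>: "H (of_int m / real d ^ (n + k)) < \<xi>" "\<xi> < H (of_int (m + 1) / real d ^ (n + k))"
    "len n m = deriv (F ^^ k) \<xi> * len (n + k) m" using len_iterate by blast
  obtain \<xi>' where \<xi>': "H (of_int j / real d ^ (n - 1 + k)) < \<xi>'" "\<xi>' < H (of_int (j + 1) / real d ^ (n - 1 + k))"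
    "len (n - 1) j = deriv (F ^^ k) \<xi>' * len (n - 1 + k) j" using len_iterate by blast
  have l: "ln (len n m) = ln (deriv (F ^^ k) \<xi>) + ln (len (n + k) m)"
    "ln (len (n - 1) j) = ln (deriv (F ^^ k) \<xi>') + ln (len (n - 1 + k) j)"
    unfolding \<xi>(3) \<xi>'(3) using deriv_iterate_pos len_pos by (intro ln_mult_pos; simp)+
  have "ln (ratio (n + k) m) - ln (ratio n m) = ln (deriv (F ^^ k) \<xi>') - ln (deriv (F ^^ k) \<xi>)"
    unfolding ratio_def nk j_def[symmetric] using len_pos l by (simp add: ln_div less_imp_neq[symmetric])
  then have "\<bar>ln (ratio (n + k) m) - ln (ratio n m)\<bar> \<le> Kd * \<bar>(F ^^ k) \<xi>' - (F ^^ k) \<xi>\<bar> powr \<alpha>"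
    using distortion[of k \<xi>' \<xi>] by simp
  also have "\<dots> \<le> Kr * \<tau> ^ n"
  proof (rule distance_powr)
    have mono: "mono (F ^^ k)" using strict_mono_iterate strict_mono_mono by blast
    have sub: "H (of_int j / real d ^ (n - 1 + k)) \<le> H (of_int m / real d ^ (n + k))"
      "H (of_int (m + 1) / real d ^ (n + k)) \<le> H (of_int (j + 1) / real d ^ (n - 1 + k))"
      using len_subinterval[of "n + k" m] assms nk by (simp_all add: j_def)
    have "(F ^^ k) (H (of_int j / real d ^ (n - 1 + k))) \<le> (F ^^ k) x \<and> (F ^^ k) x \<le> (F ^^ k) (H (of_int (j + 1) / real d ^ (n - 1 + k)))"
      if "x = \<xi> \<or> x = \<xi>'" for x
      using that \<xi> \<xi>' sub monoD[OF mono] by fastforce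
    from this[of \<xi>] this[of \<xi>'] have "\<bar>(F ^^ k) \<xi>' - (F ^^ k) \<xi>\<bar> \<le> len (n - 1) j"
      unfolding iterate_H_end len_def by (simp add: abs_le_iff)
    also have "\<dots> \<le> max 1 (1 / c0) * (1 / r0) ^ (n - 1)" by (rule len_small)
    also have "\<dots> \<le> 2 * max 1 (1 / c0) * (1 / r0) ^ (n - 1)" using r0 by (intro mult_right_mono) auto
    finally show "\<bar>(F ^^ k) \<xi>' - (F ^^ k) \<xi>\<bar> \<le> 2 * max 1 (1 / c0) * (1 / r0) ^ (n - 1)" .
  qed simp
  finally show ?thesis .
qed

text \<open>The same argument for two adjacent intervals, which need not share a parent: their union
  is mapped onto two adjacent intervals of level n, whose total length controls the
  distortion.\<close>

lemma neighbour_stable: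
  "\<bar>(ln (len (n + k) (m + 1)) - ln (len (n + k) m)) - (ln (len n (m + 1)) - ln (len n m))\<bar> \<le> Kr * \<tau> ^ n"
proof -
  obtain \<xi> where \<xi>: "H (of_int m / real d ^ (n + k)) < \<xi>" "\<xi> < H (of_int (m + 1) / real d ^ (n + k))"
    "len n m = deriv (F ^^ k) \<xi> * len (n + k) m" using len_iterate by blast
  obtain \<xi>' where \<xi>': "H (of_int (m + 1) / real d ^ (n + k)) < \<xi>'" "\<xi>' < H (of_int (m + 1 + 1) / real d ^ (n + k))"
    "len n (m + 1) = deriv (F ^^ k) \<xi>' * len (n + k) (m + 1)" using len_iterate by blast
  have l: "ln (len n m) = ln (deriv (F ^^ k) \<xi>) + ln (len (n + k) m)"
    "ln (len n (m + 1)) = ln (deriv (F ^^ k) \<xi>') + ln (len (n + k) (m + 1))"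
    unfolding \<xi>(3) \<xi>'(3) using deriv_iterate_pos len_pos by (intro ln_mult_pos; simp)+
  have "\<bar>(ln (len (n + k) (m + 1)) - ln (len (n + k) m)) - (ln (len n (m + 1)) - ln (len n m))\<bar>
      = \<bar>ln (deriv (F ^^ k) \<xi>) - ln (deriv (F ^^ k) \<xi>')\<bar>" using l by simp
  also have "\<dots> \<le> Kd * \<bar>(F ^^ k) \<xi> - (F ^^ k) \<xi>'\<bar> powr \<alpha>" by (rule distortion)
  also have "\<dots> \<le> Kr * \<tau> ^ n"
  proof (rule distance_powr)
    have mono: "strict_mono (F ^^ k)" by (rule strict_mono_iterate)
    have i: "H (of_int m / real d ^ n) < (F ^^ k) \<xi>" "(F ^^ k) \<xi> < H (of_int (m + 1) / real d ^ n)"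
      "H (of_int (m + 1) / real d ^ n) < (F ^^ k) \<xi>'" "(F ^^ k) \<xi>' < H (of_int (m + 1 + 1) / real d ^ n)"
      using strict_monoD[OF mono \<xi>(1)] strict_monoD[OF mono \<xi>(2)] strict_monoD[OF mono \<xi>'(1)] strict_monoD[OF mono \<xi>'(2)]
      unfolding iterate_H_end by auto
    have "(1 / r0) ^ n \<le> (1 / r0) ^ (n - 1)" using r0 by (intro power_decreasing) auto
    then have s: "max 1 (1 / c0) * (1 / r0) ^ n \<le> max 1 (1 / c0) * (1 / r0) ^ (n - 1)" by (intro mult_left_mono) auto
    have "\<bar>(F ^^ k) \<xi> - (F ^^ k) \<xi>'\<bar> \<le> len n m + len n (m + 1)" using i by (simp add: len_def)
    then show "\<bar>(F ^^ k) \<xi> - (F ^^ k) \<xi>'\<bar> \<le> 2 * max 1 (1 / c0) * (1 / r0) ^ (n - 1)"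
      using len_small[of n m] len_small[of n "m + 1"] s by linarith
  qed simp
  finally show ?thesis .
qed

lemma ratio_periodic:
  assumes "n \<ge> 1"
  shows "ratio n (m + j * int d ^ n) = ratio n m"
proof -
  have "(m + j * int d ^ n) div int d = m div int d + j * int d ^ (n - 1)"
  proof -
    have eq: "m + j * int d ^ n = m + (j * int d ^ (n - 1)) * int d" using assms by (cases n) auto
    show ?thesis unfolding eq using d by (subst div_mult_self1) simp_all
  qed
  then show ?thesis by (simp add: ratio_def len_periodic)
qed

text \<open>On level 1 there are finitely many ratios by periodicity, and stability transfers their
  minimum to all levels.\<close>

lemma ratio_lower_bound: "\<exists>c>0. \<forall>n\<ge>1. \<forall>m. c \<le> ratio n m"
proof -
  define c1 where "c1 = Min (ratio 1 ` {0..<int d})"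
  have fin: "finite (ratio 1 ` {0..<int d})" "ratio 1 ` {0..<int d} \<noteq> {}" using d by auto
  have c1: "c1 > 0" unfolding c1_def using fin ratio_pos by (subst Min_gr_iff) auto
  have low1: "c1 \<le> ratio 1 m" for m
  proof -
    have "ratio 1 m = ratio 1 (m mod int d)"
      using ratio_periodic[of 1 "m mod int d" "m div int d"] by (simp add: mod_div_mult_eq)
    moreover have "m mod int d \<in> {0..<int d}" using d by simp
    ultimately show ?thesis unfolding c1_def using fin by (auto intro: Min_le)
  qed
  have "c1 * exp (- Kr * \<tau>) \<le> ratio n m" if "n \<ge> 1" for n m
  proof -
    have "ln (ratio n m) \<ge> ln (ratio 1 m) - Kr * \<tau>"
      using ratio_stable[of 1 "n - 1" m] that by simp
    moreover have "ln c1 \<le> ln (ratio 1 m)" using c1 low1 by (intro ln_mono) auto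
    ultimately have "ln c1 - Kr * \<tau> \<le> ln (ratio n m)" by simp
    then have "exp (ln c1 - Kr * \<tau>) \<le> exp (ln (ratio n m))" by simp
    then show ?thesis using c1 ratio_pos by (simp add: exp_diff exp_minus divide_inverse)
  qed
  then show ?thesis using c1 by (intro exI[of _ "c1 * exp (- Kr * \<tau>)"]) auto
qed

end

subsection \<open>Words and the dual derivative\<close>

text \<open>The value of the word j_(n-1) ... j_0. Lengthening the word to the left changes it by a
  multiple of d^n only, in accordance with the periodicity of lengths and ratios.\<close>

definition dual_value :: "nat \<Rightarrow> (nat \<Rightarrow> nat) \<Rightarrow> nat \<Rightarrow> int" where
  "dual_value d j n = (\<Sum>i<n. int (j i) * int d ^ i)"

lemma word_value_dual_word:
  assumes "m \<le> n"
  shows "length (dual_word j m n) = n - m" "int (word_value d (dual_word j m n)) = (\<Sum>i<n-m. int (j (m + i)) * int d ^ i)"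
proof -
  show l: "length (dual_word j m n) = n - m" by (simp add: dual_word_def)
  have nth: "dual_word j m n ! k = j (n - 1 - k)" if "k < n - m" for k
    using that by (simp add: dual_word_def rev_nth)
  have "int (word_value d (dual_word j m n)) = (\<Sum>k<n-m. int (j (n - 1 - k)) * int d ^ (n - m - 1 - k))"
    unfolding word_value_def l by (simp add: nth)
  also have "\<dots> = (\<Sum>k<n-m. int (j (m + (n - m - Suc k))) * int d ^ (n - m - Suc k))"
    by (intro sum.cong refl) (auto simp: Suc_diff_Suc intro!: arg_cong2[where f="(*)"] arg_cong[where f=j])
  also have "\<dots> = (\<Sum>i<n-m. int (j (m + i)) * int d ^ i)"
    by (rule sum.nat_diff_reindex)
  finally show "int (word_value d (dual_word j m n)) = (\<Sum>i<n-m. int (j (m + i)) * int d ^ i)" .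
qed

lemma dual_value_div:
  assumes "j 0 < d"
  shows "dual_value d j (Suc n) div int d = (\<Sum>i<n. int (j (Suc i)) * int d ^ i)"
proof -
  have "dual_value d j (Suc n) = int (j 0) + int d * (\<Sum>i<n. int (j (Suc i)) * int d ^ i)"
    unfolding dual_value_def sum.lessThan_Suc_shift by (simp add: sum_distrib_left mult_ac)
  then show ?thesis using assms by simp
qed

lemma dual_value_add: "dual_value d j (n + k) = dual_value d j n + int d ^ n * (\<Sum>i<k. int (j (n + i)) * int d ^ i)"
proof (induction k)
  case (Suc k)
  then show ?case by (simp add: dual_value_def power_add algebra_simps)
qed (simp add: dual_value_def)

context expanding_lift
begin

lemma measure_word_interval:
  assumes "lift_of d f = F"
  shows "measure lborel (word_interval d f w) = len (length w) (int (word_value d w))"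
proof -
  define n where "n = length w" define m where "m = int (word_value d w)"
  have e: "(F ^^ n) (H (t / real d ^ n)) = H t" for t using iterate_H_end[of n t 0] by simp
  have Hm: "H (of_int m) = of_int m" "H (of_int (m + 1)) = of_int m + 1" using H_add_int[of 0 m] H_add_int[of 0 "m+1"] H_0 by auto
  have "x \<in> word_interval d f w \<longleftrightarrow> x \<in> {H (of_int m / real d ^ n)..H (of_int (m + 1) / real d ^ n)}" for x
  proof -
    have "x \<in> word_interval d f w \<longleftrightarrow> of_int m \<le> (F ^^ n) x \<and> (F ^^ n) x \<le> of_int m + 1"
      by (simp add: word_interval_def assms n_def m_def)
    also have "\<dots> \<longleftrightarrow> (F ^^ n) (H (of_int m / real d ^ n)) \<le> (F ^^ n) x \<and> (F ^^ n) x \<le> (F ^^ n) (H (of_int (m + 1) / real d ^ n))"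
      unfolding e Hm ..
    also have "\<dots> \<longleftrightarrow> x \<in> {H (of_int m / real d ^ n)..H (of_int (m + 1) / real d ^ n)}"
      by (simp add: strict_mono_less_eq[OF strict_mono_iterate])
    finally show ?thesis .
  qed
  then have "word_interval d f w = {H (of_int m / real d ^ n)..H (of_int (m + 1) / real d ^ n)}" by blast
  then show ?thesis using len_pos[of n m] by (simp add: len_def n_def m_def)
qed

lemma dual_quotient:
  assumes "lift_of d f = F" "j \<in> dual_sequences d"
  shows "measure lborel (word_interval d f (dual_word j 1 (Suc n))) / measure lborel (word_interval d f (dual_word j 0 (Suc n)))
    = 1 / ratio (Suc n) (dual_value d j (Suc n))"
proof -
  have j0: "j 0 < d" using assms(2) by (simp add: dual_sequences_def)
  have l: "length (dual_word j 1 (Suc n)) = n" "length (dual_word j 0 (Suc n)) = Suc n"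
    using word_value_dual_word(1)[of 1 "Suc n" j] word_value_dual_word(1)[of 0 "Suc n" j] by simp_all
  have v1: "int (word_value d (dual_word j 1 (Suc n))) = dual_value d j (Suc n) div int d"
    using word_value_dual_word(2)[of 1 "Suc n" d j] dual_value_div[of j d n, OF j0] by simp
  have v0: "int (word_value d (dual_word j 0 (Suc n))) = dual_value d j (Suc n)"
    using word_value_dual_word(2)[of 0 "Suc n" d j] by (simp add: dual_value_def)
  show ?thesis unfolding measure_word_interval[OF assms(1)] l v1 v0 by (simp add: ratio_def)
qed

lemma ratio_dual_stable:
  assumes "n \<ge> 1"
  shows "\<bar>ln (ratio (n + k) (dual_value d j (n + k))) - ln (ratio n (dual_value d j n))\<bar> \<le> Kr * \<tau> ^ n"
proof -
  have "ratio n (dual_value d j (n + k)) = ratio n (dual_value d j n)"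
    unfolding dual_value_add by (subst mult.commute) (rule ratio_periodic[OF assms])
  then show ?thesis using ratio_stable[OF assms, of k "dual_value d j (n + k)"] by simp
qed

text \<open>The logarithm of the reciprocal of the dual derivative. The levels start at 1 because a
  ratio refers to a parent.\<close>

definition dual_log :: "(nat \<Rightarrow> nat) \<Rightarrow> real" where
  "dual_log j = lim (\<lambda>n. ln (ratio (Suc n) (dual_value d j (Suc n))))"

lemma dual_log_LIMSEQ: "(\<lambda>n. ln (ratio (Suc n) (dual_value d j (Suc n)))) \<longlonglongrightarrow> dual_log j"
proof -
  have "Cauchy (\<lambda>n. ln (ratio (Suc n) (dual_value d j (Suc n))))"
  proof (rule metric_CauchyI)
    fix e :: real assume "e > 0"
    have "(\<lambda>n. Kr * \<tau> ^ Suc n) \<longlonglongrightarrow> Kr * 0"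
      using \<tau> by (intro tendsto_intros LIMSEQ_Suc LIMSEQ_power_zero) auto
    then have "\<forall>\<^sub>F n in sequentially. Kr * \<tau> ^ Suc n < e / 2" using \<open>e > 0\<close> by (intro order_tendstoD(2)) auto
    then obtain N where N: "Kr * \<tau> ^ Suc N < e / 2" by (auto simp: eventually_sequentially)
    have "dist (ln (ratio (Suc m) (dual_value d j (Suc m)))) (ln (ratio (Suc N) (dual_value d j (Suc N)))) < e / 2" if "m \<ge> N" for m
      using ratio_dual_stable[of "Suc N" "m - N" j] that N by (simp add: dist_real_def)
    then show "\<exists>M. \<forall>m\<ge>M. \<forall>n\<ge>M. dist (ln (ratio (Suc m) (dual_value d j (Suc m)))) (ln (ratio (Suc n) (dual_value d j (Suc n)))) < e"
      by (metis dist_triangle_half_l)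
  qed
  then show ?thesis unfolding dual_log_def using Cauchy_convergent convergent_LIMSEQ_iff by blast
qed

lemma dual_log_approx: "n \<ge> 1 \<Longrightarrow> \<bar>dual_log j - ln (ratio n (dual_value d j n))\<bar> \<le> Kr * \<tau> ^ n"
proof -
  assume n: "n \<ge> 1"
  have "(\<lambda>k. \<bar>ln (ratio (Suc (k + n)) (dual_value d j (Suc (k + n)))) - ln (ratio n (dual_value d j n))\<bar>) \<longlonglongrightarrow> \<bar>dual_log j - ln (ratio n (dual_value d j n))\<bar>"
    by (intro tendsto_intros LIMSEQ_ignore_initial_segment[OF dual_log_LIMSEQ])
  then show ?thesis
  proof (rule LIMSEQ_le_const2)
    show "\<exists>N. \<forall>k\<ge>N. \<bar>ln (ratio (Suc (k + n)) (dual_value d j (Suc (k + n)))) - ln (ratio n (dual_value d j n))\<bar> \<le> Kr * \<tau> ^ n"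
      using ratio_dual_stable[OF n, of "Suc _" j] by (simp add: add.commute)
  qed
qed

lemma dual_derivative_eq:
  assumes "lift_of d f = F" "j \<in> dual_sequences d"
  shows "dual_derivative d f j = exp (- dual_log j)"
proof -
  have "(\<lambda>n. exp (- ln (ratio (Suc n) (dual_value d j (Suc n))))) \<longlonglongrightarrow> exp (- dual_log j)"
    by (intro tendsto_intros dual_log_LIMSEQ)
  then have "(\<lambda>n. measure lborel (word_interval d f (dual_word j 1 (Suc n))) / measure lborel (word_interval d f (dual_word j 0 (Suc n)))) \<longlonglongrightarrow> exp (- dual_log j)"
    unfolding dual_quotient[OF assms] using ratio_pos by (simp add: exp_minus inverse_eq_divide)
  from LIMSEQ_imp_Suc[OF this] show ?thesis
    unfolding dual_derivative_def using assms(2) by (simp add: limI)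
qed

end

subsection \<open>Comparison of two expanding lifts\<close>

locale lift_pair =
  f: expanding_lift d Ff \<alpha>f Lf cf rf + g: expanding_lift d Fg \<alpha>g Lg cg rg
  for d Ff \<alpha>f Lf cf rf Fg \<alpha>g Lg cg rg
begin

definition quot :: "nat \<Rightarrow> int \<Rightarrow> real" where
  "quot n m = f.len n m / g.len n m"

lemma quot_pos: "quot n m > 0"
  by (simp add: quot_def f.len_pos g.len_pos)

lemma quot_periodic: "quot n (m + j * int d ^ n) = quot n m"
  by (simp only: quot_def f.len_periodic g.len_periodic)

lemma ln_quot: "ln (quot n m) = ln (f.len n m) - ln (g.len n m)"
  unfolding quot_def by (rule ln_divide_pos[OF f.len_pos g.len_pos])

lemma ln_ratio_diff:
  "ln (f.ratio n m) - ln (g.ratio n m) = ln (quot n m) - ln (quot (n - 1) (m div int d))"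
proof -
  have "ln (f.ratio n m) = ln (f.len n m) - ln (f.len (n - 1) (m div int d))"
    "ln (g.ratio n m) = ln (g.len n m) - ln (g.len (n - 1) (m div int d))"
    unfolding f.ratio_def g.ratio_def by (rule ln_divide_pos[OF f.len_pos f.len_pos] ln_divide_pos[OF g.len_pos g.len_pos])+
  then show ?thesis by (simp add: ln_quot)
qed

lemma digit_div:
  assumes "0 \<le> v" "v < int d ^ Suc k"
  shows "0 \<le> v div int d" "v div int d < int d ^ k"
proof -
  have d: "int d > 0" using f.d by simp
  show "0 \<le> v div int d" using assms d by (simp add: pos_imp_zdiv_nonneg_iff)
  have "v div int d * int d \<le> v" using d by (metis div_mult_mod_eq le_add_same_cancel1 pos_mod_sign)
  then have "v div int d * int d < int d ^ k * int d" using assms(2) by (simp add: mult.commute)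
  then show "v div int d < int d ^ k" using d by simp
qed

text \<open>The quotient of a parent is the average of those of its children, weighted by lengths
  for \<open>g\<close>. If it is within \<epsilon> of the bound \<open>S\<close>, a child of weight
  at least \<open>c\<close> cannot fall short of \<open>S\<close> by \<epsilon> / c or more.\<close>

lemma near_bound_child:
  assumes bound: "\<And>n m. quot n m \<le> S" and near: "quot n m > S - \<epsilon>" and "\<epsilon> > 0"
    and c: "c > 0" "c \<le> g.ratio (Suc n) (m * int d + int i)" and i: "i < d"
  shows "quot (Suc n) (m * int d + int i) > S - \<epsilon> / c"
proof -
  define fl gl where "fl k = f.len (Suc n) (m * int d + int k)" and "gl k = g.len (Suc n) (m * int d + int k)" for k
  have gl: "gl k > 0" for k by (simp add: gl_def g.len_pos)
  have fg: "fl k \<le> S * gl k" for k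
    using bound[of "Suc n" "m * int d + int k"] gl[of k] by (simp add: quot_def fl_def gl_def field_simps)
  have "f.len n m = fl i + (\<Sum>k\<in>{..<d} - {i}. fl k)"
    unfolding f.len_sum[of n m] fl_def using i by (intro sum.remove) auto
  also have "\<dots> \<le> fl i + (\<Sum>k\<in>{..<d} - {i}. S * gl k)"
    by (intro add_left_mono sum_mono fg)
  also have "\<dots> = fl i + S * (g.len n m - gl i)"
  proof -
    have "g.len n m = gl i + (\<Sum>k\<in>{..<d} - {i}. gl k)"
      unfolding g.len_sum[of n m] gl_def using i by (intro sum.remove) auto
    then show ?thesis by (simp add: sum_distrib_left)
  qed
  finally have 1: "f.len n m \<le> fl i + S * (g.len n m - gl i)" .
  have 2: "f.len n m > (S - \<epsilon>) * g.len n m"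
    using near g.len_pos[of n m] by (simp add: quot_def field_simps)
  have 3: "c * g.len n m \<le> gl i"
    using c(2) g.len_pos[of n m] i by (simp add: g.ratio_def gl_def field_simps)
  have 4: "S * gl i - fl i < \<epsilon> * g.len n m" using 1 2 by (simp add: algebra_simps)
  also have "\<dots> \<le> \<epsilon> * (gl i / c)" using 3 c(1) \<open>\<epsilon> > 0\<close> by (intro mult_left_mono) (auto simp: field_simps)
  also have "S * gl i - fl i = (S - fl i / gl i) * gl i" using gl[of i] by (simp add: left_diff_distrib)
  finally have "(S - fl i / gl i) * gl i < (\<epsilon> / c) * gl i" by simp
  then have "S - fl i / gl i < \<epsilon> / c" using gl[of i] by (simp only: mult_less_cancel_right_pos)
  then show ?thesis by (simp add: quot_def fl_def gl_def)
qed

lemma near_bound_descendant: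
  assumes bound: "\<And>n m. quot n m \<le> S" and near: "quot n m > S - \<epsilon>" and "\<epsilon> > 0"
    and c: "c > 0" "\<And>n m. n \<ge> 1 \<Longrightarrow> c \<le> g.ratio n m" and v: "0 \<le> v" "v < int d ^ k"
  shows "quot (n + k) (m * int d ^ k + v) > S - \<epsilon> / c ^ k"
  using v
proof (induction k arbitrary: v)
  case 0
  then have "v = 0" by simp
  then show ?case using near by simp
next
  case (Suc k)
  have d: "int d > 0" using f.d by simp
  have IH: "quot (n + k) (m * int d ^ k + v div int d) > S - \<epsilon> / c ^ k" by (intro Suc.IH digit_div[OF Suc.prems])
  define i where "i = nat (v mod int d)"
  have i: "int i = v mod int d" "i < d" using d by (auto simp: i_def nat_less_iff)
  have "quot (Suc (n + k)) ((m * int d ^ k + v div int d) * int d + int i) > S - (\<epsilon> / c ^ k) / c"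
    by (rule near_bound_child[OF bound IH]) (use \<open>\<epsilon> > 0\<close> c i in auto)
  moreover have "(m * int d ^ k + v div int d) * int d + int i = m * int d ^ Suc k + v"
    using i by (simp add: algebra_simps)
  ultimately show ?case by (simp add: mult.commute)
qed

lemma dual_value_range:
  assumes "j \<in> dual_sequences d"
  shows "0 \<le> dual_value d j n" "dual_value d j n < int d ^ n"
proof -
  have "0 \<le> dual_value d j n \<and> dual_value d j n < int d ^ n"
  proof (induction n)
    case (Suc n)
    have "j n < d" using assms by (simp add: dual_sequences_def)
    then have "int (j n) + 1 \<le> int d" by linarith
    then have "(int (j n) + 1) * int d ^ n \<le> int d * int d ^ n" by (intro mult_right_mono) auto
    moreover have "0 \<le> int (j n) * int d ^ n" by simp
    ultimately show ?case using Suc by (simp add: dual_value_def algebra_simps)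
  qed (simp add: dual_value_def)
  then show "0 \<le> dual_value d j n" "dual_value d j n < int d ^ n" by auto
qed

text \<open>
  The quotients form a martingale on the tree of words.  If it is bounded, then all descendants of
  a word with nearly maximal quotient down to a fixed depth have nearly maximal quotients, so
  there the ratios of \<open>f\<close> and \<open>g\<close> nearly agree, whereas they depend essentially on the last letters only.
\<close>

lemma dual_log_eq_of_bounded:
  assumes bdd: "\<And>n m. quot n m \<le> M" and j: "j \<in> dual_sequences d"
  shows "f.dual_log j = g.dual_log j"
proof -
  define S where "S = Sup (range (case_prod quot))"
  have bdd': "bdd_above (range (case_prod quot))" using bdd by (auto intro!: bdd_aboveI[of _ M])
  have le: "quot n m \<le> S" for n m
    unfolding S_def by (rule cSup_upper[OF _ bdd']) (auto intro!: image_eqI[of _ _ "(n, m)"])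
  have S: "S > 0" using le[of 0 0] quot_pos[of 0 0] by linarith
  obtain c0 where c0: "c0 > 0" "\<And>n m. n \<ge> 1 \<Longrightarrow> c0 \<le> g.ratio n m" using g.ratio_lower_bound by auto
  define c where "c = min c0 1"
  have c: "c > 0" "\<And>n m. n \<ge> 1 \<Longrightarrow> c \<le> g.ratio n m" "c \<le> 1" using c0 by (auto simp: c_def intro: min.coboundedI1)
  have "\<bar>f.dual_log j - g.dual_log j\<bar> \<le> 0 + e" if "e > 0" for e
  proof -
    \<comment> \<open>Five errors occur: one between the ratios of \<open>f\<close> and
      \<open>g\<close> at the chosen word, and for each of \<open>f\<close> and \<open>g\<close> two
      in passing through level \<open>k\<close> to the limit.\<close>
    define \<eta> where "\<eta> = e / 5"
    have \<eta>: "\<eta> > 0" using that by (simp add: \<eta>_def)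
    have "(\<lambda>n. f.Kr * f.\<tau> ^ n) \<longlonglongrightarrow> f.Kr * 0" "(\<lambda>n. g.Kr * g.\<tau> ^ n) \<longlonglongrightarrow> g.Kr * 0"
      using f.\<tau> g.\<tau> by (intro tendsto_intros LIMSEQ_power_zero; simp)+
    then have "\<forall>\<^sub>F n in sequentially. f.Kr * f.\<tau> ^ n < \<eta> \<and> g.Kr * g.\<tau> ^ n < \<eta> \<and> 1 \<le> n"
      using \<eta> by (intro eventually_conj order_tendstoD(2) eventually_ge_at_top) auto
    then obtain k where k: "f.Kr * f.\<tau> ^ k < \<eta>" "g.Kr * g.\<tau> ^ k < \<eta>" "k \<ge> 1"
      by (auto simp: eventually_sequentially)
    obtain l where l: "k = Suc l" using k(3) by (cases k) auto
    \<comment> \<open>Chosen so that all descendants down to depth \<open>k\<close> have quotients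
      above \<open>S * exp (- \<eta>)\<close>; at smaller depth the bound is no worse because
      \<open>c \<le> 1\<close>.\<close>
    define \<epsilon> where "\<epsilon> = S * (1 - exp (- \<eta>)) * c ^ k"
    have \<epsilon>: "\<epsilon> > 0" using S \<eta> c by (simp add: \<epsilon>_def)
    have "S - \<epsilon> < Sup (range (case_prod quot))" using \<epsilon> by (simp add: S_def)
    from less_cSupD[OF _ this] obtain n m where nm: "quot n m > S - \<epsilon>" by auto
    \<comment> \<open>The last \<open>k\<close> letters of the given sequence are appended to the
      nearly maximal word.\<close>
    define v where "v = dual_value d j k"
    define W where "W = m * int d ^ k + v"
    have v: "0 \<le> v" "v < int d ^ k" using dual_value_range[OF j] by (auto simp: v_def)
    have dpos: "int d > 0" using f.d by simp
    have Wd: "W div int d = m * int d ^ l + v div int d"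
      using dpos div_mult_self3[of "int d" "m * int d ^ l" v] by (simp add: W_def l mult_ac)
    have vd: "0 \<le> v div int d" "v div int d < int d ^ l"
      using digit_div[OF v[unfolded l]] .
    have \<epsilon>k: "\<epsilon> / c ^ k = S * (1 - exp (- \<eta>))" using c(1) by (simp add: \<epsilon>_def)
    have q1: "quot (n + k) W > S * exp (- \<eta>)"
      using near_bound_descendant[OF le nm \<epsilon> c(1,2) v] unfolding \<epsilon>k W_def right_diff_distrib by simp
    have "\<epsilon> / c ^ l \<le> \<epsilon> / c ^ k"
      using c \<epsilon> by (intro divide_left_mono) (auto simp: l mult_le_cancel_right1)
    also note \<epsilon>k
    finally have q2: "quot (n + k - 1) (W div int d) > S * exp (- \<eta>)"
      using near_bound_descendant[OF le nm \<epsilon> c(1,2) vd] unfolding Wd by (simp add: l algebra_simps)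
    have lnq: "ln S - \<eta> \<le> ln (quot N V)" "ln (quot N V) \<le> ln S" if "quot N V > S * exp (- \<eta>)" for N V
    proof -
      have "ln (S * exp (- \<eta>)) \<le> ln (quot N V)" using that S by (intro ln_mono) auto
      then show "ln S - \<eta> \<le> ln (quot N V)" using S by (simp add: ln_mult_pos)
      show "ln (quot N V) \<le> ln S" using le quot_pos S by (intro ln_mono) auto
    qed
    have 1: "\<bar>ln (f.ratio (n + k) W) - ln (g.ratio (n + k) W)\<bar> \<le> \<eta>"
      unfolding ln_ratio_diff using lnq[OF q1] lnq[OF q2] by linarith
    have W: "W = v + m * int d ^ k" by (simp add: W_def)
    have "f.ratio k W = f.ratio k v" "g.ratio k W = g.ratio k v"
      unfolding W by (rule f.ratio_periodic g.ratio_periodic; fact k(3))+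
    then have "\<bar>ln (f.ratio (n + k) W) - ln (f.ratio k v)\<bar> \<le> f.Kr * f.\<tau> ^ k" "\<bar>ln (g.ratio (n + k) W) - ln (g.ratio k v)\<bar> \<le> g.Kr * g.\<tau> ^ k"
      using f.ratio_stable[OF k(3), of n W] g.ratio_stable[OF k(3), of n W] by (simp_all add: add.commute)
    moreover have "\<bar>f.dual_log j - ln (f.ratio k v)\<bar> \<le> f.Kr * f.\<tau> ^ k" "\<bar>g.dual_log j - ln (g.ratio k v)\<bar> \<le> g.Kr * g.\<tau> ^ k"
      unfolding v_def by (rule f.dual_log_approx g.dual_log_approx; fact k(3))+
    moreover have "e = 5 * \<eta>" by (simp add: \<eta>_def)
    ultimately show ?thesis using 1 k(1,2) by linarith
  qed
  then have "\<bar>f.dual_log j - g.dual_log j\<bar> \<le> 0" by (rule field_le_epsilon)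
  then show ?thesis by simp
qed

end

text \<open>Strict differentiability in a form that does not name the derivative: the slope
  \<open>A\<close> may change with the tolerance, and the derivative is found as a Cauchy limit.
  Control of all pairs y, z near x, not just of pairs containing x, gives continuity of the
  derivative.\<close>

lemma C1_of_strictly_differentiable:
  fixes \<Phi> :: "real \<Rightarrow> real"
  assumes close: "\<And>x e. e > 0 \<Longrightarrow> \<exists>A \<delta>. \<delta> > 0 \<and>
      (\<forall>y z. \<bar>y - x\<bar> < \<delta> \<longrightarrow> \<bar>z - x\<bar> < \<delta> \<longrightarrow> y < z \<longrightarrow> \<bar>\<Phi> z - \<Phi> y - A * (z - y)\<bar> \<le> e * (z - y))"
    and low: "\<And>y z. y < z \<Longrightarrow> lo * (z - y) \<le> \<Phi> z - \<Phi> y"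
  shows "\<exists>P. (\<forall>x. (\<Phi> has_real_derivative P x) (at x)) \<and> continuous_on UNIV P \<and> (\<forall>x. lo \<le> P x)"
proof -
  define q where "q x y = (\<Phi> y - \<Phi> x) / (y - x)" for x y
  have close': "\<exists>A \<delta>. \<delta> > 0 \<and> (\<forall>y z. \<bar>y - x\<bar> < \<delta> \<longrightarrow> \<bar>z - x\<bar> < \<delta> \<longrightarrow> y \<noteq> z \<longrightarrow> \<bar>q y z - A\<bar> \<le> e)" if "e > 0" for x e
  proof -
    from close[OF that, of x] obtain A \<delta> where \<delta>: "\<delta> > 0"
      and *: "\<And>y z. \<bar>y - x\<bar> < \<delta> \<Longrightarrow> \<bar>z - x\<bar> < \<delta> \<Longrightarrow> y < z \<Longrightarrow> \<bar>\<Phi> z - \<Phi> y - A * (z - y)\<bar> \<le> e * (z - y)" by blast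
    have less: "\<bar>q y z - A\<bar> \<le> e" if "\<bar>y - x\<bar> < \<delta>" "\<bar>z - x\<bar> < \<delta>" "y < z" for y z
    proof -
      have "q y z - A = (\<Phi> z - \<Phi> y - A * (z - y)) / (z - y)" using that by (simp add: q_def field_simps)
      then show ?thesis using *[OF that] that by (simp add: abs_div pos_divide_le_eq)
    qed
    have sym: "q y z = q z y" for y z
      using minus_divide_divide[of "\<Phi> z - \<Phi> y" "z - y"] by (simp add: q_def)
    have "\<bar>q y z - A\<bar> \<le> e" if "\<bar>y - x\<bar> < \<delta>" "\<bar>z - x\<bar> < \<delta>" "y \<noteq> z" for y z
      using less[of y z] less[of z y] sym[of y z] that by (cases "y < z") auto
    then show ?thesis using \<delta> by blast
  qed
  have near: "eventually (\<lambda>y. \<bar>y - x\<bar> < \<delta> \<and> y \<noteq> x') (at x')" if "\<bar>x' - x\<bar> < \<delta>" for x x' \<delta> :: real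
  proof -
    have "eventually (\<lambda>y. y \<in> {x - \<delta><..<x + \<delta>}) (at x')"
      using that by (intro eventually_at_in_open') auto
    then show ?thesis using eventually_neq_at_within[of x' x'] by eventually_elim auto
  qed
  have "\<exists>D. (\<Phi> has_real_derivative D) (at x)" for x
  proof -
    define u where "u n = q x (x + 1 / real (Suc n))" for n
    have u0: "(\<lambda>n. 1 / real (Suc n)) \<longlonglongrightarrow> 0" using LIMSEQ_inverse_real_of_nat by (simp add: inverse_eq_divide)
    have u: "\<exists>A \<delta> N. \<delta> > 0 \<and> (\<forall>n\<ge>N. \<bar>u n - A\<bar> \<le> e) \<and> (\<forall>y. \<bar>y - x\<bar> < \<delta> \<longrightarrow> y \<noteq> x \<longrightarrow> \<bar>q x y - A\<bar> \<le> e)" if "e > 0" for e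
    proof -
      from close'[OF that, of x] obtain A \<delta> where \<delta>: "\<delta> > 0"
        and *: "\<And>y z. \<bar>y - x\<bar> < \<delta> \<Longrightarrow> \<bar>z - x\<bar> < \<delta> \<Longrightarrow> y \<noteq> z \<Longrightarrow> \<bar>q y z - A\<bar> \<le> e" by blast
      obtain N where N: "\<And>n. n \<ge> N \<Longrightarrow> 1 / real (Suc n) < \<delta>"
        using order_tendstoD(2)[OF u0 \<delta>] by (auto simp: eventually_sequentially)
      have "\<bar>u n - A\<bar> \<le> e" if "n \<ge> N" for n
        unfolding u_def using N[OF that] \<delta> by (intro *) auto
      moreover have "\<bar>q x y - A\<bar> \<le> e" if "\<bar>y - x\<bar> < \<delta>" "y \<noteq> x" for y using *[of x y] \<delta> that by auto
      ultimately show ?thesis using \<delta> by blast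
    qed
    have "Cauchy u"
    proof (rule metric_CauchyI)
      fix e :: real assume "e > 0"
      then obtain A N where N: "\<And>n. n \<ge> N \<Longrightarrow> \<bar>u n - A\<bar> \<le> e / 3" using u[of "e / 3"] by fastforce
      have "dist (u m) (u n) < e" if "m \<ge> N" "n \<ge> N" for m n
        using N[OF that(1)] N[OF that(2)] \<open>e > 0\<close> unfolding dist_real_def by linarith
      then show "\<exists>M. \<forall>m\<ge>M. \<forall>n\<ge>M. dist (u m) (u n) < e" by blast
    qed
    then obtain D where D: "u \<longlonglongrightarrow> D" using Cauchy_convergent convergent_def by blast
    have "(q x \<longlongrightarrow> D) (at x)"
    proof (rule tendstoI)
      fix e :: real assume "e > 0"
      then obtain A \<delta> N where \<delta>: "\<delta> > 0" and N: "\<And>n. n \<ge> N \<Longrightarrow> \<bar>u n - A\<bar> \<le> e / 3"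
        and q: "\<And>y. \<bar>y - x\<bar> < \<delta> \<Longrightarrow> y \<noteq> x \<Longrightarrow> \<bar>q x y - A\<bar> \<le> e / 3" using u[of "e / 3"] by fastforce
      have "(\<lambda>n. \<bar>u n - A\<bar>) \<longlonglongrightarrow> \<bar>D - A\<bar>" by (intro tendsto_intros D)
      then have DA: "\<bar>D - A\<bar> \<le> e / 3" by (rule LIMSEQ_le_const2) (use N in blast)
      have "eventually (\<lambda>y. \<bar>y - x\<bar> < \<delta> \<and> y \<noteq> x) (at x)" using \<delta> by (intro near) simp
      then show "eventually (\<lambda>y. dist (q x y) D < e) (at x)"
      proof eventually_elim
        case (elim y)
        then show ?case using q[of y] DA \<open>e > 0\<close> unfolding dist_real_def by linarith
      qed
    qed
    then show ?thesis by (auto simp: has_field_derivative_iff q_def[abs_def])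
  qed
  then obtain P where P: "\<And>x. (\<Phi> has_real_derivative P x) (at x)" by metis
  have lim: "(q x \<longlongrightarrow> P x) (at x)" for x using P[of x] by (simp add: has_field_derivative_iff q_def[abs_def])
  have "lo \<le> q x y" if "y \<noteq> x" for x y
  proof (cases "x < y")
    case True
    then show ?thesis using low[OF True] by (simp add: q_def pos_le_divide_eq)
  next
    case False
    then have "y < x" using that by simp
    moreover have "q x y = (\<Phi> x - \<Phi> y) / (x - y)" using minus_divide_divide[of "\<Phi> x - \<Phi> y" "x - y"] by (simp add: q_def)
    ultimately show ?thesis using low[of y x] by (simp add: pos_le_divide_eq)
  qed
  then have "lo \<le> P x" for x
    by (intro tendsto_lowerbound[OF lim]) (auto simp: eventually_at_filter)
  moreover have "continuous_on UNIV P"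
    unfolding continuous_on_iff
  proof (intro ballI allI impI)
    fix x e :: real assume "e > 0"
    then have "e / 3 > 0" by simp
    from close'[OF this, of x] obtain A \<delta> where \<delta>: "\<delta> > 0"
      and *: "\<And>y z. \<bar>y - x\<bar> < \<delta> \<Longrightarrow> \<bar>z - x\<bar> < \<delta> \<Longrightarrow> y \<noteq> z \<Longrightarrow> \<bar>q y z - A\<bar> \<le> e / 3" by blast
    have PA: "\<bar>P y - A\<bar> \<le> e / 3" if y: "\<bar>y - x\<bar> < \<delta>" for y
    proof (rule tendsto_upperbound)
      show "((\<lambda>z. \<bar>q y z - A\<bar>) \<longlongrightarrow> \<bar>P y - A\<bar>) (at y)" by (intro tendsto_intros lim)
      show "eventually (\<lambda>z. \<bar>q y z - A\<bar> \<le> e / 3) (at y)"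
        using near[OF y] by eventually_elim (use * y in auto)
    qed simp
    have "dist (P y) (P x) < e" if "dist y x < \<delta>" for y
    proof -
      have "\<bar>P y - A\<bar> \<le> e / 3" "\<bar>P x - A\<bar> \<le> e / 3" using PA[of y] PA[of x] that \<delta> by (auto simp: dist_real_def)
      then show ?thesis using \<open>e > 0\<close> unfolding dist_real_def by linarith
    qed
    then show "\<exists>\<delta>>0. \<forall>y\<in>UNIV. dist y x < \<delta> \<longrightarrow> dist (P y) (P x) < e" using \<delta> by blast
  qed
  ultimately show ?thesis using P by blast
qed

text \<open>Monotonicity along the points m / d^(n + k) extends by continuity, both arguments being
  approximated by their floors on finer and finer grids. It converts statements about word intervals
  into statements about arbitrary increments.\<close>

lemma adic_mono:
  fixes D :: "real \<Rightarrow> real"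
  assumes cont: "continuous_on UNIV D" and d: "d \<ge> (2::nat)"
    and step: "\<And>k m. a * int d ^ k \<le> m \<Longrightarrow> m < b * int d ^ k \<Longrightarrow>
        D (of_int m / real d ^ (n + k)) \<le> D (of_int (m + 1) / real d ^ (n + k))"
    and rs: "of_int a / real d ^ n \<le> r" "r \<le> s" "s \<le> of_int b / real d ^ n"
  shows "D r \<le> D s"
proof -
  define fl where "fl t k = of_int \<lfloor>t * real d ^ (n + k)\<rfloor> / real d ^ (n + k)" for t :: real and k
  have dp: "real d ^ k > 0" for k using d by simp
  have lim: "(\<lambda>k. D (fl t k)) \<longlonglongrightarrow> D t" for t
  proof -
    have "(\<lambda>k. fl t k - t) \<longlonglongrightarrow> 0"
    proof (rule Lim_null_comparison)
      show "(\<lambda>k. (1 / real d) ^ (k + n)) \<longlonglongrightarrow> 0"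
        using d by (intro LIMSEQ_ignore_initial_segment LIMSEQ_power_zero) simp
      have "\<bar>fl t k - t\<bar> \<le> (1 / real d) ^ (k + n)" for k
      proof -
        have "fl t k - t = (of_int \<lfloor>t * real d ^ (n + k)\<rfloor> - t * real d ^ (n + k)) / real d ^ (n + k)"
          using dp[of "n + k"] by (simp add: fl_def field_simps)
        moreover have "\<bar>of_int \<lfloor>t * real d ^ (n + k)\<rfloor> - t * real d ^ (n + k)\<bar> \<le> 1" by linarith
        ultimately have "\<bar>fl t k - t\<bar> \<le> 1 / real d ^ (n + k)"
          using dp[of "n + k"] by (simp add: abs_div divide_right_mono)
        then show ?thesis by (simp add: power_one_over add.commute)
      qed
      then show "\<forall>\<^sub>F k in sequentially. norm (fl t k - t) \<le> (1 / real d) ^ (k + n)" by simp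
    qed
    then have "(\<lambda>k. fl t k) \<longlonglongrightarrow> t" by (simp add: LIM_zero_iff)
    then show ?thesis by (rule continuous_on_tendsto_compose[OF cont]) auto
  qed
  have "D (fl r k) \<le> D (fl s k)" for k
  proof -
    define p where "p = \<lfloor>r * real d ^ (n + k)\<rfloor>"
    have "of_int (a * int d ^ k) \<le> r * real d ^ (n + k)"
      using mult_right_mono[OF rs(1), of "real d ^ (n + k)"] dp[of n] d by (simp add: power_add)
    then have a: "a * int d ^ k \<le> p" unfolding p_def le_floor_iff .
    have b: "\<lfloor>s * real d ^ (n + k)\<rfloor> \<le> b * int d ^ k"
    proof -
      have "s * real d ^ (n + k) \<le> of_int (b * int d ^ k)"
        using mult_right_mono[OF rs(3), of "real d ^ (n + k)"] dp[of n] d by (simp add: power_add)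
      then have "\<lfloor>s * real d ^ (n + k)\<rfloor> \<le> \<lfloor>of_int (b * int d ^ k) :: real\<rfloor>" by (rule floor_mono)
      then show ?thesis by (simp only: floor_of_int)
    qed
    have "D (of_int p / real d ^ (n + k)) \<le> D (of_int m / real d ^ (n + k))" if "p \<le> m" "m \<le> b * int d ^ k" for m
      using that
    proof (induction m rule: int_ge_induct)
      case (step i)
      then show ?case using assms(3)[of k i] a by force
    qed simp
    moreover have "p \<le> \<lfloor>s * real d ^ (n + k)\<rfloor>" unfolding p_def using rs(2) d by (intro floor_mono mult_right_mono) auto
    ultimately show ?thesis using b by (simp add: fl_def p_def)
  qed
  then show ?thesis by (intro LIMSEQ_le[OF lim lim]) auto
qed

section \<open>Regularity of the transition map\<close>

context lift_pair
begin

text \<open>On the intervals of level n + k inside the window, the bounds on quotients mean that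
  \<open>f.H - lo * g.H\<close> and \<open>hi * g.H - f.H\<close> do not decrease from one endpoint
  to the next.\<close>

lemma increment_bounds:
  assumes q: "\<And>k m. a * int d ^ k \<le> m \<Longrightarrow> m < b * int d ^ k \<Longrightarrow> lo \<le> quot (n + k) m \<and> quot (n + k) m \<le> hi"
    and rs: "of_int a / real d ^ n \<le> r" "r \<le> s" "s \<le> of_int b / real d ^ n"
  shows "lo * (g.H s - g.H r) \<le> f.H s - f.H r" "f.H s - f.H r \<le> hi * (g.H s - g.H r)"
proof -
  have eq: "f.len N m = quot N m * g.len N m" for N m using g.len_pos[of N m] by (simp add: quot_def)
  have le: "lo * g.len (n + k) m \<le> f.len (n + k) m" "f.len (n + k) m \<le> hi * g.len (n + k) m"
    if "a * int d ^ k \<le> m" "m < b * int d ^ k" for k m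
    unfolding eq using q[OF that] g.len_pos[of "n + k" m] by (auto intro: mult_right_mono)
  have c: "continuous_on UNIV (\<lambda>t. f.H t - lo * g.H t)" "continuous_on UNIV (\<lambda>t. hi * g.H t - f.H t)"
    by (intro continuous_intros f.continuous_H g.continuous_H)+
  have "f.H r - lo * g.H r \<le> f.H s - lo * g.H s"
    by (rule adic_mono[OF c(1) f.d _ rs]) (use le(1) in \<open>simp add: f.len_def g.len_def algebra_simps\<close>)
  then show "lo * (g.H s - g.H r) \<le> f.H s - f.H r" by (simp add: algebra_simps)
  have "hi * g.H r - f.H r \<le> hi * g.H s - f.H s"
    by (rule adic_mono[OF c(2) f.d _ rs]) (use le(2) in \<open>simp add: f.len_def g.len_def algebra_simps\<close>)
  then show "f.H s - f.H r \<le> hi * (g.H s - g.H r)" by (simp add: algebra_simps)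
qed

definition Krs :: real where "Krs = f.Kr + g.Kr"
definition \<tau> :: real where "\<tau> = max f.\<tau> g.\<tau>"

lemma \<tau>: "0 < \<tau>" "\<tau> < 1" using f.\<tau> g.\<tau> by (auto simp: \<tau>_def)

lemma Krs_nonneg: "Krs \<ge> 0" using f.Kr_nonneg g.Kr_nonneg by (simp add: Krs_def)

lemma Krs_power: "f.Kr * f.\<tau> ^ n + g.Kr * g.\<tau> ^ n \<le> Krs * \<tau> ^ n"
proof -
  have "f.\<tau> ^ n \<le> \<tau> ^ n" "g.\<tau> ^ n \<le> \<tau> ^ n" using f.\<tau> g.\<tau> by (auto intro!: power_mono simp: \<tau>_def)
  then have "f.Kr * f.\<tau> ^ n \<le> f.Kr * \<tau> ^ n" "g.Kr * g.\<tau> ^ n \<le> g.Kr * \<tau> ^ n"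
    using f.Kr_nonneg g.Kr_nonneg by (auto intro: mult_left_mono)
  then show ?thesis by (simp add: Krs_def distrib_right)
qed

lemma quot_0: "quot 0 m = 1"
proof -
  have "f.H (of_int k) = of_int k" "g.H (of_int k) = of_int k" for k
    using f.H_add_int[of 0 k] g.H_add_int[of 0 k] f.H_0 g.H_0 by auto
  then have "f.len 0 m = 1" "g.len 0 m = 1" unfolding f.len_def g.len_def by (simp_all del: of_int_add)
  then show ?thesis by (simp add: quot_def)
qed

context
  assumes dual_eq: "\<And>j. j \<in> dual_sequences d \<Longrightarrow> f.dual_log j = g.dual_log j"
begin

text \<open>The base d digits of \<open>m\<close>, lowest first, form a dual sequence whose first n
  digits determine both ratios by periodicity; each ratio is then compared with the common
  limit.\<close>

lemma ratio_close:
  assumes n: "n \<ge> 1"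
  shows "\<bar>ln (f.ratio n m) - ln (g.ratio n m)\<bar> \<le> Krs * \<tau> ^ n"
proof -
  define j where "j i = nat (m div int d ^ i mod int d)" for i
  have dpos: "int d > 0" using f.d by simp
  have j: "j \<in> dual_sequences d" using dpos by (simp add: dual_sequences_def j_def nat_less_iff)
  have "dual_value d j k = m mod int d ^ k" for k
  proof (induction k)
    case (Suc k)
    have "m mod (int d ^ k * int d) = int d ^ k * (m div int d ^ k mod int d) + m mod int d ^ k"
      by (rule zmod_zmult2_eq) simp
    moreover have "int (j k) = m div int d ^ k mod int d" using dpos by (simp add: j_def)
    moreover have "dual_value d j (Suc k) = dual_value d j k + int (j k) * int d ^ k" by (simp add: dual_value_def)
    ultimately show ?case using Suc by (simp add: mult.commute)
  qed (simp add: dual_value_def)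
  then have m: "m = dual_value d j n + (m div int d ^ n) * int d ^ n" by (simp add: mod_div_mult_eq)
  have r: "f.ratio n m = f.ratio n (dual_value d j n)" "g.ratio n m = g.ratio n (dual_value d j n)"
    by (subst m, rule f.ratio_periodic g.ratio_periodic, rule n)+
  show ?thesis
    unfolding r using f.dual_log_approx[OF n, of j] g.dual_log_approx[OF n, of j] dual_eq[OF j] Krs_power[of n] by linarith
qed

text \<open>The single steps add up to a geometric sum, whose bound is written as a difference of
  powers so that the induction telescopes.\<close>

lemma ancestor_close:
  "\<bar>ln (quot (n + j) m) - ln (quot n (m div int d ^ j))\<bar> \<le> Krs / (1 - \<tau>) * (\<tau> ^ n - \<tau> ^ (n + j))"
proof (induction j arbitrary: m)
  case (Suc j)
  have e: "m div int d div int d ^ j = m div int d ^ Suc j"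
    using zdiv_zmult2_eq[of "int d ^ j" m "int d"] by simp
  have "\<bar>ln (quot (n + j) (m div int d)) - ln (quot n (m div int d ^ Suc j))\<bar> \<le> Krs / (1 - \<tau>) * (\<tau> ^ n - \<tau> ^ (n + j))"
    using Suc.IH[of "m div int d"] unfolding e .
  moreover have "\<bar>ln (quot (n + Suc j) m) - ln (quot (n + j) (m div int d))\<bar> \<le> Krs * \<tau> ^ (n + Suc j)"
    using ratio_close[of "n + Suc j" m] unfolding ln_ratio_diff by simp
  moreover have "Krs * \<tau> ^ (n + Suc j) \<le> Krs / (1 - \<tau>) * (\<tau> ^ (n + j) - \<tau> ^ (n + Suc j))"
  proof -
    have "\<tau> ^ (n + j) - \<tau> ^ (n + Suc j) = (1 - \<tau>) * \<tau> ^ (n + j)" by (simp add: algebra_simps)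
    then have "Krs / (1 - \<tau>) * (\<tau> ^ (n + j) - \<tau> ^ (n + Suc j)) = Krs * \<tau> ^ (n + j)" using \<tau> by simp
    moreover have "\<tau> ^ (n + Suc j) \<le> \<tau> ^ (n + j)" using \<tau> by (intro power_decreasing) auto
    ultimately show ?thesis using Krs_nonneg by (simp only: mult_left_mono)
  qed
  ultimately have "\<bar>ln (quot (n + Suc j) m) - ln (quot n (m div int d ^ Suc j))\<bar>
      \<le> Krs / (1 - \<tau>) * (\<tau> ^ n - \<tau> ^ (n + j)) + Krs / (1 - \<tau>) * (\<tau> ^ (n + j) - \<tau> ^ (n + Suc j))" by linarith
  also have "\<dots> = Krs / (1 - \<tau>) * (\<tau> ^ n - \<tau> ^ (n + Suc j))" unfolding distrib_left[symmetric] by simp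
  finally show ?case .
qed simp

lemma ancestor_close':
  "\<bar>ln (quot (n + j) m) - ln (quot n (m div int d ^ j))\<bar> \<le> Krs / (1 - \<tau>) * \<tau> ^ n"
proof -
  have "Krs / (1 - \<tau>) * (\<tau> ^ n - \<tau> ^ (n + j)) \<le> Krs / (1 - \<tau>) * \<tau> ^ n"
    using Krs_nonneg \<tau> by (intro mult_left_mono) auto
  then show ?thesis using ancestor_close[of n j m] by linarith
qed

lemma ln_quot_bound: "\<bar>ln (quot n m)\<bar> \<le> Krs / (1 - \<tau>)"
  using ancestor_close'[of 0 n m] by (simp add: quot_0)

lemma quot_bounds: "exp (- (Krs / (1 - \<tau>))) \<le> quot n m" "quot n m \<le> exp (Krs / (1 - \<tau>))"
proof -
  have "exp (- (Krs / (1 - \<tau>))) \<le> exp (ln (quot n m))" "exp (ln (quot n m)) \<le> exp (Krs / (1 - \<tau>))"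
    using ln_quot_bound[of n m] by auto
  then show "exp (- (Krs / (1 - \<tau>))) \<le> quot n m" "quot n m \<le> exp (Krs / (1 - \<tau>))" using quot_pos by simp_all
qed

text \<open>
  Adjacent intervals have \<open>0\<close> as a common ancestor, so the quotients over their translates to deep
  levels nearly agree, and passing to a deep level hardly changes the quotient of neighbours.
\<close>

lemma neighbour_close: "\<bar>ln (quot n (m + 1)) - ln (quot n m)\<bar> \<le> Krs * \<tau> ^ n"
proof -
  have pos: "\<bar>ln (quot n (m + 1)) - ln (quot n m)\<bar> \<le> Krs * \<tau> ^ n" if m: "m \<ge> 0" for m
  proof -
    \<comment> \<open>\<open>J\<close> levels above any level, both \<open>m\<close> and
      \<open>m + 1\<close> have the ancestor of index 0, as d^J exceeds m + 1.\<close>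
    define J where "J = nat (m + 1)"
    have "J < d ^ J" using less_exp[of J] power_mono[of 2 d J] f.d by linarith
    then have J: "m + 1 < int d ^ J" using m by (simp add: J_def flip: of_nat_power)
    then have z: "m div int d ^ J = 0" "(m + 1) div int d ^ J = 0" using m by auto
    have st: "\<bar>(ln (quot (n + k) (m + 1)) - ln (quot (n + k) m)) - (ln (quot n (m + 1)) - ln (quot n m))\<bar> \<le> Krs * \<tau> ^ n" for k
      unfolding ln_quot using f.neighbour_stable[of n k m] g.neighbour_stable[of n k m] Krs_power[of n] by linarith
    have "\<bar>ln (quot n (m + 1)) - ln (quot n m)\<bar> \<le> Krs * \<tau> ^ n + 2 * (Krs / (1 - \<tau>)) * \<tau> ^ (i + n)" for i
      using st[of "i + J"] ancestor_close'[of "n + i" J m] ancestor_close'[of "n + i" J "m + 1"]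
      unfolding z by (simp add: add_ac)
    moreover have "(\<lambda>i. Krs * \<tau> ^ n + 2 * (Krs / (1 - \<tau>)) * \<tau> ^ (i + n)) \<longlonglongrightarrow> Krs * \<tau> ^ n + 2 * (Krs / (1 - \<tau>)) * 0"
      using \<tau> by (intro tendsto_intros LIMSEQ_ignore_initial_segment LIMSEQ_power_zero) simp
    ultimately show ?thesis using LIMSEQ_le_const[of _ "Krs * \<tau> ^ n"] by auto
  qed
  \<comment> \<open>Arbitrary indices are reduced modulo d^n, where the nonnegative case
    applies.\<close>
  have m: "m = m mod int d ^ n + (m div int d ^ n) * int d ^ n" by (simp add: mod_div_mult_eq)
  have m1: "m + 1 = (m mod int d ^ n + 1) + (m div int d ^ n) * int d ^ n" using m by linarith
  have "quot n m = quot n (m mod int d ^ n)" by (subst m) (rule quot_periodic)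
  moreover have "quot n (m + 1) = quot n (m mod int d ^ n + 1)" by (subst m1) (rule quot_periodic)
  moreover have "m mod int d ^ n \<ge> 0" using f.d by simp
  ultimately show ?thesis using pos by simp
qed

text \<open>Two adjacent intervals are taken because an endpoint of an interval of level n is
  interior to no single interval of that level or of any deeper one.\<close>

lemma window_close:
  assumes "m0 * int d ^ k \<le> m" "m < (m0 + 2) * int d ^ k"
  shows "\<bar>ln (quot (n + k) m) - ln (quot n m0)\<bar> \<le> (Krs / (1 - \<tau>) + Krs) * \<tau> ^ n"
proof -
  have dk: "int d ^ k > 0" using f.d by simp
  define v where "v = m div int d ^ k"
  have "m = v * int d ^ k + m mod int d ^ k" by (simp only: v_def div_mult_mod_eq)
  moreover have "0 \<le> m mod int d ^ k" "m mod int d ^ k < int d ^ k" using dk by auto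
  ultimately have "m0 * int d ^ k < (v + 1) * int d ^ k" "v * int d ^ k < (m0 + 2) * int d ^ k"
    using assms unfolding distrib_right by linarith+
  then have "m0 < v + 1" "v < m0 + 2" using dk by (simp_all only: mult_less_cancel_right_pos)
  then have "v = m0 \<or> v = m0 + 1" by linarith
  moreover have "0 \<le> Krs * \<tau> ^ n" using Krs_nonneg \<tau> by simp
  ultimately have "\<bar>ln (quot n v) - ln (quot n m0)\<bar> \<le> Krs * \<tau> ^ n" using neighbour_close[of n m0] by auto
  then show ?thesis using ancestor_close'[of n k m] unfolding distrib_right v_def by linarith
qed

text \<open>On a window of level n around \<open>g.G x\<close> all quotients agree up to factors
  between exp (- \<epsilon> n) and exp (\<epsilon> n), so there the increments of the transition map
  are nearly proportional to those of the argument. The global bounds on quotients keep the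
  derivative away from 0.\<close>

lemma transition_C1:
  "\<exists>P. (\<forall>x. ((\<lambda>x. f.H (g.G x)) has_real_derivative P x) (at x)) \<and> continuous_on UNIV P \<and> (\<forall>x. P x > 0)"
proof -
  define C where "C = Krs / (1 - \<tau>)"
  define \<Phi> where "\<Phi> x = f.H (g.G x)" for x
  have dp: "real d ^ n > 0" for n using f.d by simp
  have G_mono: "g.G y \<le> g.G z" if "y \<le> z" for y z using that g.strict_mono_G by (simp add: strict_mono_less_eq)
  have "\<exists>P. (\<forall>x. (\<Phi> has_real_derivative P x) (at x)) \<and> continuous_on UNIV P \<and> (\<forall>x. exp (- C) \<le> P x)"
  proof (rule C1_of_strictly_differentiable)
    fix y z :: real assume "y < z"
    have b: "exp (- C) \<le> quot (0 + k) m \<and> quot (0 + k) m \<le> exp C" for k m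
      using quot_bounds[of k m] by (simp add: C_def)

    have "exp (- C) * (g.H (g.G z) - g.H (g.G y)) \<le> f.H (g.G z) - f.H (g.G y)"
      by (rule increment_bounds(1)[where n=0 and a="\<lfloor>g.G y\<rfloor>" and b="\<lceil>g.G z\<rceil>"]) (use b G_mono[of y z] \<open>y < z\<close> in auto)
    then show "exp (- C) * (z - y) \<le> \<Phi> z - \<Phi> y" by (simp add: \<Phi>_def)
  next
    fix x e :: real assume "e > 0"
    define \<epsilon> where "\<epsilon> n = (C + Krs) * \<tau> ^ n" for n
    have "(\<lambda>n. exp C * (exp (\<epsilon> n) - exp (- \<epsilon> n))) \<longlonglongrightarrow> exp C * (exp ((C + Krs) * 0) - exp (- ((C + Krs) * 0)))"
      unfolding \<epsilon>_def using \<tau> by (intro tendsto_intros LIMSEQ_power_zero) simp_all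
    then have "\<forall>\<^sub>F n in sequentially. exp C * (exp (\<epsilon> n) - exp (- \<epsilon> n)) < e" using \<open>e > 0\<close> by (intro order_tendstoD(2)) auto
    then obtain n where n: "exp C * (exp (\<epsilon> n) - exp (- \<epsilon> n)) < e" by (auto simp: eventually_sequentially)
    define t where "t = g.G x"
    \<comment> \<open>With the ceiling minus 1 and width 2, \<open>t * real d ^ n\<close> lies
      strictly inside the window even when it is an integer; the floor would put it on the
      edge.\<close>
    define m0 where "m0 = \<lceil>t * real d ^ n\<rceil> - 1"
    define A where "A = quot n m0"
    have A: "A > 0" "A \<le> exp C" using quot_pos[of n m0] quot_bounds[of n m0] by (auto simp: A_def C_def)
    have \<epsilon>0: "\<epsilon> n \<ge> 0" using \<tau> Krs_nonneg by (auto simp: \<epsilon>_def C_def)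
    have "of_int m0 < t * real d ^ n" "t * real d ^ n < of_int (m0 + 2)" unfolding m0_def by linarith+
    then have t: "of_int m0 / real d ^ n < t" "t < of_int (m0 + 2) / real d ^ n"
      using dp[of n] by (simp_all add: pos_divide_less_eq pos_less_divide_eq)
    have "isCont g.G x" using g.continuous_G by (simp add: continuous_on_eq_continuous_at)
    then have "(g.G \<longlongrightarrow> t) (at x)" by (simp add: isCont_def t_def)
    then have "\<forall>\<^sub>F y in at x. of_int m0 / real d ^ n < g.G y \<and> g.G y < of_int (m0 + 2) / real d ^ n"
      using t by (intro eventually_conj order_tendstoD)
    then obtain \<delta> where \<delta>: "\<delta> > 0" "\<And>y. y \<noteq> x \<Longrightarrow> \<bar>y - x\<bar> < \<delta> \<Longrightarrow> of_int m0 / real d ^ n < g.G y \<and> g.G y < of_int (m0 + 2) / real d ^ n"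
      by (auto simp: eventually_at dist_real_def)
    have in_window: "of_int m0 / real d ^ n \<le> g.G y" "g.G y \<le> of_int (m0 + 2) / real d ^ n" if "\<bar>y - x\<bar> < \<delta>" for y
      using \<delta>(2)[of y] t that by (cases "y = x"; force simp: t_def)+
    have q: "A * exp (- \<epsilon> n) \<le> quot (n + k) m \<and> quot (n + k) m \<le> A * exp (\<epsilon> n)"
      if "m0 * int d ^ k \<le> m" "m < (m0 + 2) * int d ^ k" for k m
    proof -
      have "\<bar>ln (quot (n + k) m) - ln A\<bar> \<le> \<epsilon> n" using window_close[OF that] by (simp add: A_def \<epsilon>_def C_def)
      then have "exp (ln A - \<epsilon> n) \<le> exp (ln (quot (n + k) m))" "exp (ln (quot (n + k) m)) \<le> exp (ln A + \<epsilon> n)" by simp_all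
      then show ?thesis using A(1) quot_pos by (simp add: exp_add exp_diff exp_minus divide_inverse)
    qed
    have "\<bar>\<Phi> z - \<Phi> y - A * (z - y)\<bar> \<le> e * (z - y)" if yz: "\<bar>y - x\<bar> < \<delta>" "\<bar>z - x\<bar> < \<delta>" "y < z" for y z
    proof -
      have "A * exp (- \<epsilon> n) * (g.H (g.G z) - g.H (g.G y)) \<le> f.H (g.G z) - f.H (g.G y)"
        "f.H (g.G z) - f.H (g.G y) \<le> A * exp (\<epsilon> n) * (g.H (g.G z) - g.H (g.G y))"
        by (rule increment_bounds[where a=m0 and b="m0 + 2" and n=n, OF q]; use in_window yz G_mono[of y z] in auto)+
      then have 1: "A * exp (- \<epsilon> n) * (z - y) \<le> \<Phi> z - \<Phi> y" "\<Phi> z - \<Phi> y \<le> A * exp (\<epsilon> n) * (z - y)"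
        by (simp_all add: \<Phi>_def)
      have "exp (- \<epsilon> n) \<le> 1" "1 \<le> exp (\<epsilon> n)" using \<epsilon>0 by auto
      then have "A * exp (- \<epsilon> n) \<le> A" "A \<le> A * exp (\<epsilon> n)" using A(1) by (auto simp: mult_le_cancel_left1 mult_le_cancel_left2)
      moreover have "A * exp (\<epsilon> n) - A * exp (- \<epsilon> n) \<le> e"
      proof -
        have "A * (exp (\<epsilon> n) - exp (- \<epsilon> n)) \<le> exp C * (exp (\<epsilon> n) - exp (- \<epsilon> n))"
          using A \<epsilon>0 by (intro mult_right_mono) auto
        then show ?thesis using n by (simp add: right_diff_distrib)
      qed
      ultimately have "(A - e) * (z - y) \<le> A * exp (- \<epsilon> n) * (z - y)" "A * exp (\<epsilon> n) * (z - y) \<le> (A + e) * (z - y)"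
        using yz(3) by (intro mult_right_mono; simp)+
      then show ?thesis using 1 unfolding distrib_right left_diff_distrib by linarith
    qed
    then show "\<exists>A \<delta>. \<delta> > 0 \<and> (\<forall>y z. \<bar>y - x\<bar> < \<delta> \<longrightarrow> \<bar>z - x\<bar> < \<delta> \<longrightarrow> y < z \<longrightarrow> \<bar>\<Phi> z - \<Phi> y - A * (z - y)\<bar> \<le> e * (z - y))"
      using \<delta>(1) by blast
  qed
  then show ?thesis unfolding \<Phi>_def by (meson exp_gt_zero less_le_trans)
qed

end

end

section \<open>Multipliers of periodic points\<close>

context expanding_lift
begin

text \<open>An interval whose image has length at most 1 is stretched uniformly up to the factor exp
  Kd, which is independent of n; the derivative at any of its points may therefore stand for the
  ratio of lengths.\<close>

lemma iterate_scale:
  assumes uv: "u < v" "u \<le> w" "w \<le> v" and small: "(F ^^ n) v - (F ^^ n) u \<le> 1"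
  shows "\<bar>ln ((F ^^ n) v - (F ^^ n) u) - ln (v - u) - ln (deriv (F ^^ n) w)\<bar> \<le> Kd"
proof -
  have mono: "(F ^^ n) a \<le> (F ^^ n) b" if "a \<le> b" for a b
    using that strict_mono_iterate[of n] by (simp add: strict_mono_less_eq)
  from iterate_MVT[OF uv(1), of n] obtain \<xi> where \<xi>: "u < \<xi>" "\<xi> < v" "(F ^^ n) v - (F ^^ n) u = (v - u) * deriv (F ^^ n) \<xi>" by blast
  have "ln ((F ^^ n) v - (F ^^ n) u) = ln (v - u) + ln (deriv (F ^^ n) \<xi>)"
    unfolding \<xi>(3) using uv(1) deriv_iterate_pos by (intro ln_mult_pos) auto
  moreover have "\<bar>ln (deriv (F ^^ n) \<xi>) - ln (deriv (F ^^ n) w)\<bar> \<le> Kd * \<bar>(F ^^ n) \<xi> - (F ^^ n) w\<bar> powr \<alpha>" by (rule distortion)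
  moreover have "\<bar>(F ^^ n) \<xi> - (F ^^ n) w\<bar> \<le> 1"
    using mono[of u \<xi>] mono[of \<xi> v] mono[OF uv(2)] mono[OF uv(3)] \<xi> small by linarith
  then have "\<bar>(F ^^ n) \<xi> - (F ^^ n) w\<bar> powr \<alpha> \<le> 1" using \<alpha> by (intro powr_le1) auto
  then have "Kd * \<bar>(F ^^ n) \<xi> - (F ^^ n) w\<bar> powr \<alpha> \<le> Kd * 1" using Kd_nonneg by (rule mult_left_mono)
  ultimately show ?thesis by linarith
qed

lemma deriv_iterate_add_int: "deriv (F ^^ n) (x + of_int m) = deriv (F ^^ n) x"
proof (rule DERIV_unique)
  show "((\<lambda>u. (F ^^ n) (u + of_int m)) has_real_derivative deriv (F ^^ n) (x + of_int m)) (at x)"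
    using DERIV_iterate[of n "x + of_int m"] by (simp add: DERIV_shift)
  have "((\<lambda>u. (F ^^ n) u + of_int m * real d ^ n) has_real_derivative deriv (F ^^ n) x + 0) (at x)"
    by (intro derivative_intros DERIV_iterate)
  then show "((\<lambda>u. (F ^^ n) (u + of_int m)) has_real_derivative deriv (F ^^ n) x) (at x)"
    by (simp add: iterate_add_int)
qed

lemma periodic_iterate:
  assumes y: "real d ^ n * y = y + of_int m"
  shows "deriv (F ^^ (n * j)) (H y) = deriv (F ^^ n) (H y) ^ j \<and> (\<exists>i::int. real d ^ (n * j) * y = y + of_int i)"
proof (induction j)
  case 0
  have "deriv (F ^^ 0) x = 1" for x by (intro DERIV_imp_deriv) (simp add: id_def)
  then show ?case by (auto intro!: exI[of _ 0])
next
  case (Suc j)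
  then obtain i :: int where i: "real d ^ (n * j) * y = y + of_int i" by blast
  have e: "F ^^ (n * Suc j) = F ^^ n \<circ> F ^^ (n * j)" by (simp add: funpow_add)
  have z: "(F ^^ (n * j)) (H y) = H y + of_int i" using H_iterate[of "n * j" y] i H_add_int[of y i] by simp
  have "deriv (F ^^ (n * Suc j)) (H y) = deriv (F ^^ n) ((F ^^ (n * j)) (H y)) * deriv (F ^^ (n * j)) (H y)"
    unfolding e by (intro DERIV_imp_deriv DERIV_chain DERIV_iterate)
  then have "deriv (F ^^ (n * Suc j)) (H y) = deriv (F ^^ n) (H y) ^ Suc j"
    using Suc by (simp add: z deriv_iterate_add_int)
  moreover have "real d ^ (n * Suc j) * y = real d ^ n * (real d ^ (n * j) * y)" by (simp add: power_add)
  then have "real d ^ (n * Suc j) * y = y + of_int (m + i * int d ^ n)" unfolding i distrib_left y by simp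
  ultimately show ?case by blast
qed

text \<open>The iterate of order n j maps the intervals between y and its translates by d^(-nj),
  seen through \<open>H\<close>, to intervals of length 1, and its derivative at \<open>H y\<close>
  is the j-th power of the multiplier. The error does not grow with j.\<close>

lemma periodic_scale:
  assumes y: "real d ^ n * y = y + of_int m"
  shows "\<bar>ln (H (y + 1 / real d ^ (n * j)) - H y) + real j * ln (deriv (F ^^ n) (H y))\<bar> \<le> Kd"
    "\<bar>ln (H y - H (y - 1 / real d ^ (n * j))) + real j * ln (deriv (F ^^ n) (H y))\<bar> \<le> Kd"
proof -
  define D where "D = real d ^ (n * j)"
  have D: "D > 0" using dpos by (simp add: D_def)
  have ln: "ln (deriv (F ^^ (n * j)) (H y)) = real j * ln (deriv (F ^^ n) (H y))"
    using periodic_iterate[OF y, of j] deriv_iterate_pos by (simp add: ln_realpow)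
  have it: "(F ^^ (n * j)) (H (y + s / D)) = (F ^^ (n * j)) (H y) + s" if "s = of_int i" for s i
    using H_iterate[of "n * j" "y + s / D"] H_iterate[of "n * j" y] H_add_int[of "D * y" i] D that
    by (simp add: D_def[symmetric] distrib_left)
  have mono: "H (y - 1 / D) < H y" "H y < H (y + 1 / D)" using strict_mono_H D by (simp_all add: strict_mono_less)
  have "\<bar>ln ((F ^^ (n * j)) (H (y + 1 / D)) - (F ^^ (n * j)) (H y)) - ln (H (y + 1 / D) - H y) - ln (deriv (F ^^ (n * j)) (H y))\<bar> \<le> Kd"
    by (rule iterate_scale) (use mono it[of 1 1] in auto)
  then show "\<bar>ln (H (y + 1 / real d ^ (n * j)) - H y) + real j * ln (deriv (F ^^ n) (H y))\<bar> \<le> Kd"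
    using it[of 1 1] unfolding ln D_def by simp
  have "\<bar>ln ((F ^^ (n * j)) (H y) - (F ^^ (n * j)) (H (y - 1 / D))) - ln (H y - H (y - 1 / D)) - ln (deriv (F ^^ (n * j)) (H y))\<bar> \<le> Kd"
    by (rule iterate_scale) (use mono it[of "-1" "-1"] in auto)
  then show "\<bar>ln (H y - H (y - 1 / real d ^ (n * j))) + real j * ln (deriv (F ^^ n) (H y))\<bar> \<le> Kd"
    using it[of "-1" "-1"] unfolding ln D_def by simp
qed

text \<open>Up to the factor exp Kd the interval has the inverse of the multiplier as its length. A
  comparison of multipliers thus becomes a comparison of lengths that is uniform in n.\<close>

lemma periodic_len:
  assumes y: "real d ^ n * y = y + of_int m" and m: "of_int m \<le> real d ^ n * y" "real d ^ n * y \<le> of_int m + 1"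
  shows "\<bar>ln (len n m) + ln (deriv (F ^^ n) (H y))\<bar> \<le> Kd"
proof -
  have yin: "of_int m / real d ^ n \<le> y" "y \<le> of_int (m + 1) / real d ^ n"
    using m dpos(1)[of n] by (simp_all add: pos_divide_le_eq pos_le_divide_eq mult.commute)
  have e: "(F ^^ n) (H (t / real d ^ n)) = H t" for t using iterate_H_end[of n t 0] by simp
  have one: "(F ^^ n) (H (of_int (m + 1) / real d ^ n)) - (F ^^ n) (H (of_int m / real d ^ n)) = 1"
    unfolding e using H_add_int[of 0 m] H_add_int[of 0 "m + 1"] H_0 by simp
  have mono: "H a \<le> H b" if "a \<le> b" for a b using that strict_mono_H by (simp add: strict_mono_less_eq)
  have "\<bar>ln ((F ^^ n) (H (of_int (m + 1) / real d ^ n)) - (F ^^ n) (H (of_int m / real d ^ n))) - ln (len n m) - ln (deriv (F ^^ n) (H y))\<bar> \<le> Kd"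
    unfolding len_def
    by (rule iterate_scale) (use len_pos[of n m] one mono yin in \<open>simp_all add: len_def\<close>)
  then show ?thesis unfolding one by simp
qed

end

text \<open>At the scale d^(-nj) the estimate reads j (s \<mu>g - \<mu>f) \<le> constant, where the
  constant does not depend on j; this is impossible for large j if the factor is positive.\<close>

lemma (in lift_pair) deriv_le_of_Holder:
  fixes m :: int
  assumes y: "real d ^ n * y = y + of_int m" and n: "n \<ge> 1" and s: "0 < s"
    and holder: "\<exists>C>0. \<exists>R>0. \<forall>r. 0 < r \<and> r < R \<longrightarrow>
        min (f.H (g.G (g.H y + r)) - f.H (g.G (g.H y))) (f.H (g.G (g.H y)) - f.H (g.G (g.H y - r))) \<le> C * r powr s"
  shows "s * ln (deriv (Fg ^^ n) (g.H y)) \<le> ln (deriv (Ff ^^ n) (f.H y))"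
proof (rule ccontr)
  define \<mu>f \<mu>g where "\<mu>f = ln (deriv (Ff ^^ n) (f.H y))" and "\<mu>g = ln (deriv (Fg ^^ n) (g.H y))"
  assume "\<not> ?thesis"
  then have pos: "s * \<mu>g - \<mu>f > 0" by (simp add: \<mu>f_def \<mu>g_def)
  obtain C R where C: "C > 0" "R > 0"
    and CR: "\<And>r. 0 < r \<Longrightarrow> r < R \<Longrightarrow> min (f.H (g.G (g.H y + r)) - f.H (g.G (g.H y))) (f.H (g.G (g.H y)) - f.H (g.G (g.H y - r))) \<le> C * r powr s"
    using holder by auto
  define e where "e j = 1 / real d ^ (n * j)" for j
  \<comment> \<open>The larger of the two lengths for \<open>g\<close>: over this distance both
    one-sided increments of the transition map cover the corresponding intervals for
    \<open>f\<close>, so their minimum is bounded below.\<close>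
  define r where "r j = max (g.H (y + e j) - g.H y) (g.H y - g.H (y - e j))" for j
  have e: "e j > 0" for j using f.d by (simp add: e_def)
  have gm: "g.H y < g.H (y + e j)" "g.H (y - e j) < g.H y" for j using e[of j] g.strict_mono_H by (simp_all add: strict_mono_less)
  have fm: "f.H y < f.H (y + e j)" "f.H (y - e j) < f.H y" for j using e[of j] f.strict_mono_H by (simp_all add: strict_mono_less)
  have rpos: "r j > 0" for j using gm[of j] by (simp add: r_def less_max_iff_disj)
  have bound: "real j * (s * \<mu>g - \<mu>f) \<le> ln C + s * g.Kd + f.Kd" if small: "r j < R" for j
  proof -
    have \<Phi>_mono: "f.H (g.G a) \<le> f.H (g.G b)" if "a \<le> b" for a b
      using that g.strict_mono_G f.strict_mono_H by (simp add: strict_mono_less_eq)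
    have lnr: "ln (r j) \<le> g.Kd - real j * \<mu>g"
      using g.periodic_scale[OF y, of j] by (auto simp: r_def \<mu>g_def e_def max_def)
    have "exp (- f.Kd - real j * \<mu>f) \<le> f.H (y + e j) - f.H y"
    proof -
      have "exp (- f.Kd - real j * \<mu>f) \<le> exp (ln (f.H (y + e j) - f.H y))"
        using f.periodic_scale(1)[OF y, of j] by (simp add: \<mu>f_def e_def)
      then show ?thesis using fm[of j] by simp
    qed
    also have "\<dots> \<le> f.H (g.G (g.H y + r j)) - f.H (g.G (g.H y))"
      using \<Phi>_mono[of "g.H (y + e j)" "g.H y + r j"] by (simp add: r_def)
    finally have 1: "exp (- f.Kd - real j * \<mu>f) \<le> f.H (g.G (g.H y + r j)) - f.H (g.G (g.H y))" .
    have "exp (- f.Kd - real j * \<mu>f) \<le> f.H y - f.H (y - e j)"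
    proof -
      have "exp (- f.Kd - real j * \<mu>f) \<le> exp (ln (f.H y - f.H (y - e j)))"
        using f.periodic_scale(2)[OF y, of j] by (simp add: \<mu>f_def e_def)
      then show ?thesis using fm[of j] by simp
    qed
    also have "\<dots> \<le> f.H (g.G (g.H y)) - f.H (g.G (g.H y - r j))"
      using \<Phi>_mono[of "g.H y - r j" "g.H (y - e j)"] by (simp add: r_def)
    finally have "exp (- f.Kd - real j * \<mu>f) \<le> C * r j powr s" using 1 CR[OF rpos small] by linarith
    then have "ln (exp (- f.Kd - real j * \<mu>f)) \<le> ln (C * r j powr s)" by (intro ln_mono) auto
    also have "\<dots> = ln C + s * ln (r j)" using C(1) rpos[of j] by (simp add: ln_mult_pos ln_powr)
    also have "s * ln (r j) \<le> s * (g.Kd - real j * \<mu>g)" using lnr s by (intro mult_left_mono) auto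
    finally show ?thesis by (simp add: algebra_simps)
  qed
  have dn: "real d ^ n > 1" using n f.d by (intro one_less_power) auto
  have "(\<lambda>j. (1 / real d ^ n) ^ j) \<longlonglongrightarrow> 0" using dn f.d by (intro LIMSEQ_power_zero) simp
  then have e0: "e \<longlonglongrightarrow> 0" by (simp add: e_def[abs_def] power_mult power_one_over)
  have c: "(\<lambda>j. g.H (u j)) \<longlonglongrightarrow> g.H z" if "u \<longlonglongrightarrow> z" for u z
    by (rule continuous_on_tendsto_compose[OF g.continuous_H that]) auto
  have "r \<longlonglongrightarrow> max (g.H (y + 0) - g.H y) (g.H y - g.H (y - 0))"
    unfolding r_def by (intro tendsto_intros c e0)
  then have "\<forall>\<^sub>F j in sequentially. r j < R" using C(2) by (intro order_tendstoD(2)) auto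
  then obtain N where N: "\<And>j. j \<ge> N \<Longrightarrow> r j < R" by (auto simp: eventually_sequentially)
  obtain j where j: "real j * (s * \<mu>g - \<mu>f) > ln C + s * g.Kd + f.Kd" using reals_Archimedean3[OF pos] by blast
  have "real j * (s * \<mu>g - \<mu>f) \<le> real (max j N) * (s * \<mu>g - \<mu>f)" using pos by (intro mult_right_mono) auto
  then show False using bound[OF N, of "max j N"] j by linarith
qed

lemma (in lift_pair) quot_bounded_of_Holder:
  assumes holder: "\<And>x s. 0 < s \<Longrightarrow> s < 1 \<Longrightarrow> \<exists>C>0. \<exists>R>0. \<forall>r. 0 < r \<and> r < R \<longrightarrow>
        min (f.H (g.G (x + r)) - f.H (g.G x)) (f.H (g.G x) - f.H (g.G (x - r))) \<le> C * r powr s"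
  shows "quot n m \<le> exp (f.Kd + g.Kd)"
proof (cases "n = 0")
  case True
  then show ?thesis using f.Kd_nonneg g.Kd_nonneg by (simp add: quot_0)
next
  case False
  define v where "v = m mod int d ^ n"
  have dn: "real d ^ n > 1" using False f.d by (intro one_less_power) auto
  have v: "0 \<le> v" "v < int d ^ n" using f.d by (auto simp: v_def)
  then have "v + 1 \<le> int d ^ n" by simp
  then have "real_of_int (v + 1) \<le> real_of_int (int d ^ n)" unfolding of_int_le_iff .
  then have vr: "0 \<le> real_of_int v" "real_of_int v + 1 \<le> real d ^ n" using v by simp_all
  \<comment> \<open>The fixed point of t \<mapsto> d^n t - v; it lies in the closed interval from v
    / d^n to (v + 1) / d^n.\<close>
  define y where "y = of_int v / (real d ^ n - 1)"
  have y: "real d ^ n * y = y + of_int v" using dn by (simp add: y_def field_simps)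
  have "0 \<le> y" "y \<le> 1" using vr dn by (simp_all add: y_def)
  then have in_range: "of_int v \<le> real d ^ n * y" "real d ^ n * y \<le> of_int v + 1" unfolding y by simp_all
  have "ln (deriv (Fg ^^ n) (g.H y)) \<le> ln (deriv (Ff ^^ n) (f.H y))"
    by (rule field_le_mult_one_interval, rule deriv_le_of_Holder[OF y _ _ holder]) (use False in auto)
  then have "ln (f.len n v) \<le> ln (g.len n v) + (f.Kd + g.Kd)"
    using f.periodic_len[OF y in_range] g.periodic_len[OF y in_range] by linarith
  then have "exp (ln (quot n v)) \<le> exp (f.Kd + g.Kd)" by (simp add: ln_quot)
  moreover have "quot n m = quot n v"
    using quot_periodic[of n v "m div int d ^ n"] by (simp add: v_def mod_div_mult_eq)
  ultimately show ?thesis using quot_pos[of n v] by simp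
qed

lemma Holder_of_small_dilatation:
  assumes small: "\<And>e. e > 0 \<Longrightarrow> \<exists>U h hi k. open U \<and> circle \<subseteq> U \<and> homeomorphism U (h ` U) h hi \<and> ACL_on U h \<and>
        k \<in> beltrami_bounds U h \<and> k < e \<and> (\<forall>x. h (cis (2 * pi * x)) = cis (2 * pi * \<Phi> x))"
    and \<Phi>: "strict_mono \<Phi>" "continuous_on UNIV \<Phi>" and s: "0 < s" "s < 1"
  shows "\<exists>C>0. \<exists>R>0. \<forall>r. 0 < r \<and> r < R \<longrightarrow> min (\<Phi> (x + r) - \<Phi> x) (\<Phi> x - \<Phi> (x - r)) \<le> C * r powr s"
proof -
  \<comment> \<open>With \<open>A'\<close> as chosen below, the first factor of the exponent is 1 -
    2 \<eta> and the second at least 1 - 2 k, where k < \<eta>; the product is at least 1 - 4 \<eta>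
    = s.\<close>
  define \<eta> where "\<eta> = (1 - s) / 4"
  have \<eta>: "0 < \<eta>" "\<eta> < 1 / 4" "s = 1 - 4 * \<eta>" using s unfolding \<eta>_def by (simp_all add: field_simps)
  obtain U h hi k where h: "open U" "circle \<subseteq> U" "homeomorphism U (h ` U) h hi" "ACL_on U h" "k \<in> beltrami_bounds U h"
    "k < \<eta>" "\<And>x. h (cis (2 * pi * x)) = cis (2 * pi * \<Phi> x)" using small[OF \<eta>(1)] by blast
  have k: "0 \<le> k" "k < 1" using h(5,6) \<eta> by (auto simp: beltrami_bounds_def)
  define A' A where "A' = pi / 2 - \<eta> * pi / 2" and "A = pi / 2 - \<eta> * pi / 4"
  have A: "0 < A'" "A' < A" "A < pi / 2" using \<eta> by (auto simp: A'_def A_def)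
  define t where "t = (4 * A' / pi - 1) * ((1 - k) / (1 + k))"
  have "t \<ge> s"
  proof -
    have "4 * A' / pi - 1 = 1 - 2 * \<eta>" by (simp add: A'_def field_simps)
    moreover have "(1 - 2 * k) * (1 + k) \<le> 1 - k" using k by (simp add: algebra_simps)
    then have "(1 - k) / (1 + k) \<ge> 1 - 2 * k" using k by (subst pos_le_divide_eq) auto
    then have "(1 - 2 * \<eta>) * (1 - 2 * k) \<le> (1 - 2 * \<eta>) * ((1 - k) / (1 + k))" using \<eta> by (intro mult_left_mono) auto
    ultimately have "t \<ge> (1 - 2 * \<eta>) * (1 - 2 * k)" unfolding t_def by simp
    moreover have "(1 - 2 * \<eta>) * (1 - 2 * k) = 1 - 2 * \<eta> - 2 * k + 4 * (\<eta> * k)" by (simp add: algebra_simps)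
    moreover have "\<eta> * k \<ge> 0" using \<eta> k by simp
    ultimately show ?thesis using h(6) \<eta> by linarith
  qed
  obtain C R where C: "C > 0" "R > 0"
    and CR: "\<And>r. 0 < r \<Longrightarrow> r < R \<Longrightarrow> min (\<Phi> (x + r) - \<Phi> x) (\<Phi> x - \<Phi> (x - r)) \<le> C * r powr t"
    using quasiconformal_Holder[OF h(1-5) k(2) \<Phi> h(7) A, of x] unfolding t_def by auto
  have "min (\<Phi> (x + r) - \<Phi> x) (\<Phi> x - \<Phi> (x - r)) \<le> C * r powr s" if r: "0 < r" "r < min R 1" for r
  proof -
    have "r powr t \<le> r powr s" using r \<open>t \<ge> s\<close> by (intro powr_mono') auto
    then have "C * r powr t \<le> C * r powr s" using C by simp
    then show ?thesis using CR[of r] r by simp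
  qed
  then show ?thesis using C by (intro exI[of _ C] conjI exI[of _ "min R 1"]) auto
qed

subsection \<open>Asymptotically conformal extension of \<open>C\<^sup>1\<close>-diffeomorphisms\<close>

text \<open>In the coordinates x + y and x - y this is \<Phi> acting on each coordinate. So the
  inverse is the same construction applied to the inverse of \<Phi>, differentiability is inherited
  from \<Phi>, and the real line is mapped by \<Phi> itself.\<close>

definition diag_map :: "(real \<Rightarrow> real) \<Rightarrow> complex \<Rightarrow> complex" where
  "diag_map \<Phi> w = of_real ((\<Phi> (Re w + Im w) + \<Phi> (Re w - Im w)) / 2) + \<i> * of_real ((\<Phi> (Re w + Im w) - \<Phi> (Re w - Im w)) / 2)"

text \<open>The branch cut of \<open>Ln\<close> does no harm for lifts of degree 1, because
  \<open>diag_map\<close> then commutes with integer translations.\<close>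

definition annulus_map :: "(real \<Rightarrow> real) \<Rightarrow> complex \<Rightarrow> complex" where
  "annulus_map \<Phi> z = exp (2 * of_real pi * \<i> * diag_map \<Phi> (Ln z / (2 * of_real pi * \<i>)))"

lemma diag_map_add_int:
  assumes per: "\<And>x n. \<Phi> (x + of_int n) = \<Phi> x + of_int n"
  shows "diag_map \<Phi> (w + of_int n) = diag_map \<Phi> w + of_int n"
proof -
  have "Re w + of_int n + Im w = (Re w + Im w) + of_int n" "Re w + of_int n - Im w = (Re w - Im w) + of_int n" by simp_all
  then show ?thesis unfolding diag_map_def by (simp only: plus_complex.sel complex_Re_of_int complex_Im_of_int per add_0_right)
    (simp add: complex_eq_iff field_simps)
qed

lemma diag_map_inverse:
  assumes "\<And>x. \<Psi> (\<Phi> x) = x"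
  shows "diag_map \<Psi> (diag_map \<Phi> w) = w"
proof -
  have e: "a / 2 + b / 2 + (a / 2 - b / 2) = a" "a / 2 + b / 2 - (a / 2 - b / 2) = b" for a b :: real by auto
  show ?thesis by (simp add: diag_map_def add_divide_distrib diff_divide_distrib e assms complex_eq_iff)
qed

lemma annulus_map_exp:
  assumes per: "\<And>x n. \<Phi> (x + of_int n) = \<Phi> x + of_int n"
  shows "annulus_map \<Phi> (exp (2 * of_real pi * \<i> * w)) = exp (2 * of_real pi * \<i> * diag_map \<Phi> w)"
proof -
  have "exp (Ln (exp (2 * of_real pi * \<i> * w))) = exp (2 * of_real pi * \<i> * w)" by simp
  then obtain n :: int where n: "Ln (exp (2 * of_real pi * \<i> * w)) = 2 * of_real pi * \<i> * w + (of_int (2 * n) * pi) * \<i>"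
    unfolding exp_eq by blast
  have "Ln (exp (2 * of_real pi * \<i> * w)) / (2 * of_real pi * \<i>) = w + of_int n" unfolding n by (simp add: field_simps)
  then have "annulus_map \<Phi> (exp (2 * of_real pi * \<i> * w)) = exp (2 * of_real pi * \<i> * (diag_map \<Phi> w + of_int n))"
    by (simp only: annulus_map_def diag_map_add_int[OF per])
  also have "\<dots> = exp (2 * of_real pi * \<i> * diag_map \<Phi> w)"
    unfolding exp_eq by (rule exI[of _ n]) (simp add: algebra_simps)
  finally show ?thesis .
qed

lemma exp_Ln_scaled: "z \<noteq> 0 \<Longrightarrow> exp (2 * of_real pi * \<i> * (Ln z / (2 * of_real pi * \<i>))) = z"
  by simp

lemma annulus_map_inverse:
  assumes per: "\<And>x n. \<Phi> (x + of_int n) = \<Phi> x + of_int n" "\<And>x n. \<Psi> (x + of_int n) = \<Psi> x + of_int n"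
    and inv: "\<And>x. \<Psi> (\<Phi> x) = x" and "z \<noteq> 0"
  shows "annulus_map \<Psi> (annulus_map \<Phi> z) = z"
  unfolding annulus_map_def[of \<Phi>] annulus_map_exp[OF per(2)] diag_map_inverse[of \<Psi> \<Phi>, OF inv]
  using \<open>z \<noteq> 0\<close> by (rule exp_Ln_scaled)

text \<open>A multiple of a logarithm that is holomorphic around \<open>z0\<close> even if
  \<open>z0\<close> lies on the branch cut of \<open>Ln\<close>.\<close>

definition branch :: "complex \<Rightarrow> complex \<Rightarrow> complex" where
  "branch z0 z = (Ln z0 + Ln (z / z0)) / (2 * of_real pi * \<i>)"

lemma
  assumes z0: "z0 \<noteq> 0" and z: "z \<in> ball z0 (norm z0)"
  shows annulus_map_branch: "(\<And>x n. \<Phi> (x + of_int n) = \<Phi> x + of_int n) \<Longrightarrow>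
      annulus_map \<Phi> z = exp (2 * of_real pi * \<i> * diag_map \<Phi> (branch z0 z))"
    and branch_nonpos: "z / z0 \<notin> \<real>\<^sub>\<le>\<^sub>0"
proof -
  have "norm (z / z0 - 1) = norm (z - z0) / norm z0" using z0 by (simp add: norm_divide[symmetric] diff_divide_distrib)
  then have "norm (z / z0 - 1) < 1" using z z0 by (simp add: dist_norm norm_minus_commute pos_divide_less_eq)
  then have "\<bar>Re (z / z0 - 1)\<bar> < 1" using abs_Re_le_cmod[of "z / z0 - 1"] by linarith
  then have "Re (z / z0) > 0" unfolding minus_complex.sel one_complex.sel by linarith
  then show np: "z / z0 \<notin> \<real>\<^sub>\<le>\<^sub>0" by (auto simp: complex_nonpos_Reals_iff)
  have "z \<noteq> 0" using np by auto
  then have "exp (2 * of_real pi * \<i> * branch z0 z) = z" using z0 by (simp add: branch_def exp_add)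
  then show "annulus_map \<Phi> z = exp (2 * of_real pi * \<i> * diag_map \<Phi> (branch z0 z))"
    if "\<And>x n. \<Phi> (x + of_int n) = \<Phi> x + of_int n" using annulus_map_exp[OF that, of "branch z0 z"] by simp
qed

lemma continuous_annulus_map:
  assumes per: "\<And>x n. \<Phi> (x + of_int n) = \<Phi> x + of_int n" and cont: "continuous_on UNIV \<Phi>"
  shows "continuous_on (- {0}) (annulus_map \<Phi>)"
proof (rule continuous_at_imp_continuous_on, rule ballI)
  fix z0 :: complex assume "z0 \<in> - {0}"
  then have z0: "z0 \<noteq> 0" by simp
  have "continuous_on (ball z0 (norm z0)) (branch z0)"
    unfolding branch_def by (intro continuous_intros) (use branch_nonpos[OF z0] z0 in auto)
  moreover have "continuous_on UNIV (diag_map \<Phi>)"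
    unfolding diag_map_def by (intro continuous_intros continuous_on_compose2[OF cont]) auto
  ultimately have "continuous_on (ball z0 (norm z0)) (\<lambda>z. diag_map \<Phi> (branch z0 z))"
    using continuous_on_compose2 by blast
  then have "continuous_on (ball z0 (norm z0)) (\<lambda>z. exp (2 * of_real pi * \<i> * diag_map \<Phi> (branch z0 z)))"
    by (intro continuous_intros)
  then have "continuous_on (ball z0 (norm z0)) (annulus_map \<Phi>)"
    by (rule continuous_on_eq) (simp only: annulus_map_branch[OF z0 _ per])
  then show "isCont (annulus_map \<Phi>) z0" using z0 by (simp add: continuous_on_eq_continuous_at)
qed

text \<open>The coefficients of \<zeta> and of its conjugate are the two complex derivatives. For
  positive \<open>a\<close> and \<open>b\<close> the modulus of their quotient is |a - b| / (a + b),
  which is small when \<open>P\<close> nearly agrees at Re w + Im w and Re w - Im w.\<close>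

lemma diag_map_has_derivative:
  fixes \<Phi> P w
  assumes deriv: "\<And>x. (\<Phi> has_real_derivative P x) (at x)"
  defines "a \<equiv> P (Re w + Im w)" and "b \<equiv> P (Re w - Im w)"
  shows "(diag_map \<Phi> has_derivative (\<lambda>\<zeta>. of_real ((a + b) / 2) * \<zeta> + \<i> * of_real ((a - b) / 2) * cnj \<zeta>)) (at w)"
proof -
  have 1: "((\<lambda>w. \<Phi> (Re w + Im w)) has_derivative (\<lambda>\<zeta>. (Re \<zeta> + Im \<zeta>) * a)) (at w)"
    "((\<lambda>w. \<Phi> (Re w - Im w)) has_derivative (\<lambda>\<zeta>. (Re \<zeta> - Im \<zeta>) * b)) (at w)"
    unfolding a_def b_def by (rule DERIV_compose_FDERIV[OF deriv], intro derivative_intros)+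
  have "(diag_map \<Phi> has_derivative (\<lambda>\<zeta>. of_real (((Re \<zeta> + Im \<zeta>) * a + (Re \<zeta> - Im \<zeta>) * b) / 2)
      + \<i> * of_real (((Re \<zeta> + Im \<zeta>) * a - (Re \<zeta> - Im \<zeta>) * b) / 2))) (at w)"
    unfolding diag_map_def
    using has_derivative_mult_left[OF has_derivative_add[OF 1], of "1/2"] has_derivative_mult_left[OF has_derivative_diff[OF 1], of "1/2"]
    by (intro derivative_intros) simp_all
  moreover have "of_real (((Re \<zeta> + Im \<zeta>) * a + (Re \<zeta> - Im \<zeta>) * b) / 2) + \<i> * of_real (((Re \<zeta> + Im \<zeta>) * a - (Re \<zeta> - Im \<zeta>) * b) / 2)
      = of_real ((a + b) / 2) * \<zeta> + \<i> * of_real ((a - b) / 2) * cnj \<zeta>" for \<zeta>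
    by (simp add: complex_eq_iff field_simps)
  ultimately show ?thesis by simp
qed

lemma annulus_map_has_derivative:
  fixes \<Phi> P z0
  assumes deriv: "\<And>x. (\<Phi> has_real_derivative P x) (at x)" and per: "\<And>x n. \<Phi> (x + of_int n) = \<Phi> x + of_int n"
    and z0: "z0 \<noteq> 0"
  defines "w \<equiv> Ln z0 / (2 * of_real pi * \<i>)"
  defines "a \<equiv> P (Re w + Im w)" and "b \<equiv> P (Re w - Im w)"
  shows "(annulus_map \<Phi> has_derivative (\<lambda>\<zeta>. annulus_map \<Phi> z0 *
    (of_real ((a + b) / 2) * (\<zeta> / z0) - \<i> * of_real ((a - b) / 2) * cnj (\<zeta> / z0)))) (at z0)"
proof (rule has_derivative_transform_within_open[OF _ open_ball[of z0 "norm z0"]])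
  have w: "branch z0 z0 = w" using z0 by (simp add: branch_def w_def)
  have "(branch z0 has_field_derivative 1 / (2 * of_real pi * \<i> * z0)) (at z0)"
    unfolding branch_def by (rule derivative_eq_intros refl | use z0 in \<open>simp add: field_simps\<close>)+
  then have br: "(branch z0 has_derivative (\<lambda>\<zeta>. \<zeta> / (2 * of_real pi * \<i> * z0))) (at z0)"
    unfolding has_field_derivative_def by (rule has_derivative_eq_rhs) (simp add: fun_eq_iff)
  have dm: "(diag_map \<Phi> has_derivative (\<lambda>\<zeta>. of_real ((a + b) / 2) * \<zeta> + \<i> * of_real ((a - b) / 2) * cnj \<zeta>)) (at (branch z0 z0))"
    unfolding w a_def b_def by (rule diag_map_has_derivative[OF deriv])
  have ex: "((\<lambda>v. exp (2 * of_real pi * \<i> * v)) has_derivative (\<lambda>\<zeta>. annulus_map \<Phi> z0 * (2 * of_real pi * \<i>) * \<zeta>)) (at (diag_map \<Phi> (branch z0 z0)))"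
    unfolding has_field_derivative_def[symmetric] w
    by (rule derivative_eq_intros refl | simp add: annulus_map_def w_def)+
  from diff_chain_at[OF diff_chain_at[OF br dm, unfolded o_def] ex]
  have "((\<lambda>z. exp (2 * of_real pi * \<i> * diag_map \<Phi> (branch z0 z))) has_derivative
    (\<lambda>\<zeta>. annulus_map \<Phi> z0 * (2 * of_real pi * \<i>) * (of_real ((a + b) / 2) * (\<zeta> / (2 * of_real pi * \<i> * z0))
      + \<i> * of_real ((a - b) / 2) * cnj (\<zeta> / (2 * of_real pi * \<i> * z0))))) (at z0)"
    by (simp add: o_def)
  moreover have "annulus_map \<Phi> z0 * (2 * of_real pi * \<i>) * (of_real ((a + b) / 2) * (\<zeta> / (2 * of_real pi * \<i> * z0))
      + \<i> * of_real ((a - b) / 2) * cnj (\<zeta> / (2 * of_real pi * \<i> * z0)))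
    = annulus_map \<Phi> z0 * (of_real ((a + b) / 2) * (\<zeta> / z0) - \<i> * of_real ((a - b) / 2) * cnj (\<zeta> / z0))" for \<zeta>
    using z0 by (simp add: field_simps)
  ultimately show "((\<lambda>z. exp (2 * of_real pi * \<i> * diag_map \<Phi> (branch z0 z))) has_derivative (\<lambda>\<zeta>. annulus_map \<Phi> z0 *
    (of_real ((a + b) / 2) * (\<zeta> / z0) - \<i> * of_real ((a - b) / 2) * cnj (\<zeta> / z0)))) (at z0)" by (simp only:)
qed (use z0 annulus_map_branch[OF z0 _ per] in auto)

lemma partials_of_has_derivative:
  assumes "(h has_derivative D) (at z)"
  shows "partial_x h z = D 1" "partial_y h z = D \<i>"
proof -
  have "((\<lambda>t. h (z + c * of_real t)) has_vector_derivative D c) (at 0)" for c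
  proof -
    have "((\<lambda>t::real. z + c * of_real t) has_derivative (\<lambda>t. c * of_real t)) (at 0)"
      by (rule derivative_eq_intros refl | simp)+
    moreover have "(h has_derivative D) (at (z + c * of_real 0))" using assms by simp
    ultimately have "(h \<circ> (\<lambda>t. z + c * of_real t) has_derivative D \<circ> (\<lambda>t. c * of_real t)) (at 0)" by (rule diff_chain_at)
    moreover have "D (c * of_real t) = t *\<^sub>R D c" for t
      using linear_scale[OF has_derivative_linear[OF assms], of t c] by (simp add: scaleR_conv_of_real mult.commute)
    ultimately show ?thesis by (simp add: has_vector_derivative_def o_def)
  qed
  from this[of 1] this[of \<i>] show "partial_x h z = D 1" "partial_y h z = D \<i>"
    unfolding partial_x_def partial_y_def by (auto intro: vector_derivative_at)
qed

text \<open>Near the circle the imaginary part in the logarithmic coordinate is small, so uniform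
  continuity of the periodic function \<open>P\<close> and its positive minimum make the Beltrami
  coefficient at most \<open>e\<close>. On boxes the derivative is bounded, so the map is Lipschitz
  there and absolutely continuous on lines.\<close>

lemma quasiconformal_annulus_map:
  assumes hom: "homeomorphism UNIV UNIV \<Phi> \<Psi>"
    and deriv: "\<And>x. (\<Phi> has_real_derivative P x) (at x)" and cont: "continuous_on UNIV P" and pos: "\<And>x. P x > 0"
    and per: "\<And>x n. \<Phi> (x + of_int n) = \<Phi> x + of_int n" and e: "0 < e" "e < 1"
  shows "\<exists>U. open U \<and> circle \<subseteq> U \<and> quasiconformal_on U (annulus_map \<Phi>) \<and> e \<in> beltrami_bounds U (annulus_map \<Phi>)"
proof -
  have inv: "\<Psi> (\<Phi> x) = x" "\<Phi> (\<Psi> x) = x" for x using hom by (auto simp: homeomorphism_def)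
  have per': "\<Psi> (x + of_int n) = \<Psi> x + of_int n" for x n
    using inv(1)[of "\<Psi> x + of_int n"] by (simp add: per inv(2))
  have Pper: "P (x + of_int n) = P x" for x n
  proof (rule DERIV_unique)
    show "((\<lambda>u. \<Phi> (u + of_int n)) has_real_derivative P (x + of_int n)) (at x)"
      using deriv[of "x + of_int n"] by (simp add: DERIV_shift)
    have "((\<lambda>u. \<Phi> u + of_int n) has_real_derivative P x + 0) (at x)" by (intro derivative_intros deriv)
    then show "((\<lambda>u. \<Phi> (u + of_int n)) has_real_derivative P x) (at x)" by (simp add: per)
  qed
  have Pfrac: "P x = P (frac x)" for x using Pper[of "frac x" "\<lfloor>x\<rfloor>"] by (simp add: frac_def)
  have cP: "continuous_on S P" for S using cont continuous_on_subset by blast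
  have "\<exists>x0\<in>{0..1}. \<forall>y\<in>{0..1}. P x0 \<le> P y" by (rule continuous_attains_inf[OF _ _ cP]) auto
  then obtain x0 where "\<forall>y\<in>{0..1}. P x0 \<le> P y" by blast
  then have m: "P x0 \<le> P y" for y using Pfrac[of y] frac_ge_0[of y] frac_lt_1[of y] by auto
  have "\<exists>x1\<in>{0..1}. \<forall>y\<in>{0..1}. P y \<le> P x1" by (rule continuous_attains_sup[OF _ _ cP]) auto
  then obtain x1 where "\<forall>y\<in>{0..1}. P y \<le> P x1" by blast
  then have M: "P y \<le> P x1" for y using Pfrac[of y] frac_ge_0[of y] frac_lt_1[of y] by auto
  have "uniformly_continuous_on {-1..2} P" by (rule compact_uniformly_continuous[OF cP]) simp
  moreover have "e * P x0 > 0" using e pos by simp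
  ultimately obtain \<delta>0 where \<delta>0: "\<delta>0 > 0"
    "\<And>x y. x \<in> {-1..2} \<Longrightarrow> y \<in> {-1..2} \<Longrightarrow> dist y x < \<delta>0 \<Longrightarrow> dist (P y) (P x) < e * P x0"
    unfolding uniformly_continuous_on_def by metis
  \<comment> \<open>The arguments x + y and x - y differ by 2 y, hence the half; the bound 1 keeps
    \<open>frac x + y\<close> and \<open>frac x - y\<close> within \<open>{-1..2}\<close>.\<close>
  define \<delta> where "\<delta> = min (\<delta>0 / 2) 1"
  have \<delta>: "\<delta> > 0" "\<delta> \<le> 1" "2 * \<delta> \<le> \<delta>0" using \<delta>0(1) by (auto simp: \<delta>_def)
  have osc: "\<bar>P (x + y) - P (x - y)\<bar> \<le> e * (P (x + y) + P (x - y))" if y: "\<bar>y\<bar> < \<delta>" for x y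
  proof -
    have "P (x + y) = P (frac x + y)" "P (x - y) = P (frac x - y)"
      using Pper[of "frac x + y" "\<lfloor>x\<rfloor>"] Pper[of "frac x - y" "\<lfloor>x\<rfloor>"] by (simp_all add: frac_def algebra_simps)
    moreover have "dist (P (frac x + y)) (P (frac x - y)) < e * P x0"
    proof (rule \<delta>0(2))
      show "frac x - y \<in> {-1..2}" "frac x + y \<in> {-1..2}" "dist (frac x + y) (frac x - y) < \<delta>0"
        using y \<delta> frac_ge_0[of x] frac_lt_1[of x] unfolding atLeastAtMost_iff dist_real_def by (linarith | rule conjI)+
    qed
    ultimately have "\<bar>P (x + y) - P (x - y)\<bar> < e * P x0" by (simp add: dist_real_def)
    moreover have "e * P x0 \<le> e * (P (x + y) + P (x - y))"
      using m[of "x + y"] pos[of "x - y"] e by (intro mult_left_mono) auto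
    ultimately show ?thesis by linarith
  qed
  define U where "U = {z::complex. exp (- (2 * pi * \<delta>)) < norm z \<and> norm z < exp (2 * pi * \<delta>)}"
  have U: "open U" unfolding U_def by (intro open_Collect_conj open_Collect_less continuous_intros)
  have circ: "circle \<subseteq> U" using \<delta> by (auto simp: U_def)
  have U0: "U \<subseteq> - {0}" using exp_gt_zero[of "- (2 * pi * \<delta>)"] by (auto simp: U_def simp del: exp_gt_zero)
  have Im_Ln: "\<bar>Im (Ln z / (2 * of_real pi * \<i>))\<bar> < \<delta>" if "z \<in> U" for z
  proof -
    have z: "z \<noteq> 0" using that U0 by auto
    have "Im (Ln z / (2 * of_real pi * \<i>)) = - ln (norm z) / (2 * pi)"
      using z by (simp add: Im_divide power2_eq_square field_simps)
    moreover have "ln (exp (- (2 * pi * \<delta>))) < ln (norm z)" "ln (norm z) < ln (exp (2 * pi * \<delta>))"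
      using that z by (subst ln_less_cancel_iff; auto simp: U_def)+
    then have "\<bar>ln (norm z)\<bar> < \<delta> * (2 * pi)" by (simp add: abs_less_iff mult.commute)
    ultimately show ?thesis by (simp add: pos_divide_less_eq)
  qed
  define h where "h = annulus_map \<Phi>"
  define \<alpha> \<beta> where "\<alpha> z = (P (Re (Ln z / (2 * of_real pi * \<i>)) + Im (Ln z / (2 * of_real pi * \<i>)))
      + P (Re (Ln z / (2 * of_real pi * \<i>)) - Im (Ln z / (2 * of_real pi * \<i>)))) / 2"
    and "\<beta> z = (P (Re (Ln z / (2 * of_real pi * \<i>)) + Im (Ln z / (2 * of_real pi * \<i>)))
      - P (Re (Ln z / (2 * of_real pi * \<i>)) - Im (Ln z / (2 * of_real pi * \<i>)))) / 2" for z
  define A B where "A z = h z / z * of_real (\<alpha> z)" and "B z = - (\<i> * h z / cnj z * of_real (\<beta> z))" for z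
  have D: "(h has_derivative (\<lambda>\<zeta>. A z * \<zeta> + B z * cnj \<zeta>)) (at z)" if "z \<noteq> 0" for z
  proof -
    have "h z * (of_real (\<alpha> z) * (\<zeta> / z) - \<i> * of_real (\<beta> z) * cnj (\<zeta> / z)) = A z * \<zeta> + B z * cnj \<zeta>" for \<zeta>
      by (simp add: A_def B_def right_diff_distrib mult_ac)
    then show ?thesis
      using annulus_map_has_derivative[OF deriv per that] unfolding \<alpha>_def[symmetric] \<beta>_def[symmetric] h_def[symmetric] by simp
  qed
  have \<beta>\<alpha>: "\<bar>\<beta> z\<bar> \<le> e * \<alpha> z" if "z \<in> U" for z
    using osc[OF Im_Ln[OF that], of "Re (Ln z / (2 * of_real pi * \<i>))"] by (simp add: \<alpha>_def \<beta>_def)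
  have \<alpha>: "0 < \<alpha> z" "\<alpha> z \<le> P x1" for z
    using pos M by (auto simp: \<alpha>_def intro!: divide_pos_pos add_pos_pos) (smt (verit) M field_sum_of_halves)
  have AB: "norm (B z) \<le> e * norm (A z)" if "z \<in> U" for z
  proof -
    have "norm (B z) = norm (h z) / norm z * \<bar>\<beta> z\<bar>" "norm (A z) = norm (h z) / norm z * \<alpha> z"
      using \<alpha>(1)[of z] by (simp_all add: A_def B_def norm_mult norm_divide)
    moreover have "norm (h z) / norm z * \<bar>\<beta> z\<bar> \<le> norm (h z) / norm z * (e * \<alpha> z)"
      by (intro mult_left_mono \<beta>\<alpha>[OF that]) simp
    ultimately show ?thesis by (simp add: mult_ac)
  qed
  have dz: "d_z h z = A z" "d_zbar h z = B z" if "z \<in> U" for z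
  proof -
    have "z \<noteq> 0" using that U0 by auto
    from partials_of_has_derivative[OF D[OF this]] have p: "partial_x h z = A z + B z" "partial_y h z = A z * \<i> - B z * \<i>"
      by simp_all
    show "d_z h z = A z" "d_zbar h z = B z" unfolding d_z_def d_zbar_def p by (simp_all add: complex_eq_iff)
  qed
  have bel: "e \<in> beltrami_bounds U h" using AB dz e by (auto simp: beltrami_bounds_def)
  have ch: "continuous_on U h"
    unfolding h_def by (rule continuous_on_subset[OF continuous_annulus_map[OF per] U0]) (use hom in \<open>auto simp: homeomorphism_def\<close>)
  have hU: "h ` U \<subseteq> - {0}" by (auto simp: h_def annulus_map_def)
  have I: "annulus_map \<Psi> (h z) = z" if "z \<in> U" for z
    using annulus_map_inverse[of \<Phi> \<Psi>, OF per per' inv(1)] that U0 unfolding h_def by (cases "z = 0") auto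
  have "continuous_on UNIV \<Psi>" using hom by (simp add: homeomorphism_def)
  then have "continuous_on (h ` U) (annulus_map \<Psi>)"
    by (rule continuous_on_subset[OF continuous_annulus_map[OF per'] hU])
  then have "homeomorphism U (h ` U) h (annulus_map \<Psi>)" using ch by (intro homeomorphismI) (auto simp: I)
  moreover have "ACL_on U h"
    unfolding ACL_on_def
  proof (intro allI impI)
    fix a b c f assume R: "a < b \<and> c < f \<and> cbox (Complex a c) (Complex b f) \<subseteq> U"
    define Q where "Q = cbox (Complex a c) (Complex b f)"
    have QU: "Q \<subseteq> U" using R by (simp add: Q_def)
    have "continuous_on Q (\<lambda>z. h z / z)"
      by (intro continuous_intros continuous_on_subset[OF ch QU]) (use QU U0 in auto)
    then have "bounded ((\<lambda>z. h z / z) ` Q)" by (intro compact_imp_bounded compact_continuous_image) (simp_all add: Q_def)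
    then obtain N where N: "N > 0" "\<And>z. z \<in> Q \<Longrightarrow> norm (h z / z) \<le> N" unfolding bounded_pos by auto
    define K where "K = 2 * (N * P x1)"
    have K: "K \<ge> 0" using N(1) pos by (simp add: K_def less_imp_le)
    have lip: "norm (h z - h z') \<le> K * norm (z - z')" if "z \<in> Q" "z' \<in> Q" for z z'
    proof (rule differentiable_bound[OF _ _ _ that])
      show "convex Q" by (simp add: Q_def)
      fix z assume z: "z \<in> Q"
      then have zU: "z \<in> U" "z \<noteq> 0" using QU U0 by auto
      show "(h has_derivative (\<lambda>\<zeta>. A z * \<zeta> + B z * cnj \<zeta>)) (at z within Q)" using D[OF zU(2)] by (rule has_derivative_at_withinI)
      have "norm (A z) = norm (h z / z) * \<alpha> z" using \<alpha>(1)[of z] by (simp add: A_def norm_mult norm_divide)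
      also have "\<dots> \<le> N * P x1" using N(2)[OF z] N(1) \<alpha>[of z] by (intro mult_mono) auto
      finally have A: "norm (A z) \<le> N * P x1" .
      have "e * norm (A z) \<le> norm (A z)" using e by (simp add: mult_left_le_one_le)
      then have B: "norm (B z) \<le> N * P x1" using AB[OF zU(1)] A by linarith
      show "onorm (\<lambda>\<zeta>. A z * \<zeta> + B z * cnj \<zeta>) \<le> K"
      proof (rule onorm_le)
        fix \<zeta>
        have "norm (A z * \<zeta> + B z * cnj \<zeta>) \<le> norm (A z) * norm \<zeta> + norm (B z) * norm \<zeta>"
          using norm_triangle_ineq[of "A z * \<zeta>" "B z * cnj \<zeta>"] by (simp add: norm_mult)
        also have "\<dots> \<le> N * P x1 * norm \<zeta> + N * P x1 * norm \<zeta>" using A B by (intro add_mono mult_right_mono) auto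
        finally show "norm (A z * \<zeta> + B z * cnj \<zeta>) \<le> K * norm \<zeta>" by (simp add: K_def)
      qed
    qed
    have inQ: "Complex x y \<in> Q \<longleftrightarrow> x \<in> {a..b} \<and> y \<in> {c..f}" for x y by (auto simp: Q_def in_cbox_complex_iff)
    have n: "norm (Complex x y - Complex x' y) = \<bar>x - x'\<bar>" "norm (Complex x y - Complex x y') = \<bar>y - y'\<bar>" for x x' y y'
      by (simp_all add: cmod_def)
    have "abs_cont_on a b (\<lambda>x. h (Complex x y))" if "y \<in> {c..f}" for y
      by (rule Lipschitz_imp_abs_cont_on[OF K]) (use lip[of "Complex _ y" "Complex _ y"] that in \<open>simp only: inQ n; blast\<close>)
    moreover have "abs_cont_on c f (\<lambda>y. h (Complex x y))" if "x \<in> {a..b}" for x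
      by (rule Lipschitz_imp_abs_cont_on[OF K]) (use lip[of "Complex x _" "Complex x _"] that in \<open>simp only: inQ n; blast\<close>)
    ultimately show "(AE y in lborel. y \<in> {c..f} \<longrightarrow> abs_cont_on a b (\<lambda>x. h (Complex x y))) \<and>
        (AE x in lborel. x \<in> {a..b} \<longrightarrow> abs_cont_on c f (\<lambda>y. h (Complex x y)))" by auto
  qed
  ultimately have "quasiconformal_on U h" unfolding quasiconformal_on_def using bel e by blast
  then show ?thesis using U circ bel unfolding h_def by blast
qed

lemma annulus_map_circle:
  assumes per: "\<And>x n. \<Phi> (x + of_int n) = \<Phi> x + of_int n"
  shows "annulus_map \<Phi> (cis (2 * pi * x)) = cis (2 * pi * \<Phi> x)"
proof -
  have c: "cis (2 * pi * t) = exp (2 * of_real pi * \<i> * of_real t)" for t by (simp add: cis_conv_exp mult_ac)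
  have "diag_map \<Phi> (of_real x) = of_real (\<Phi> x)" by (simp add: diag_map_def)
  then show ?thesis unfolding c annulus_map_exp[OF per] by simp
qed

lemma beltrami_norm_bounds:
  assumes "k \<in> beltrami_bounds U h"
  shows "0 \<le> beltrami_norm U h" "beltrami_norm U h \<le> k"
proof -
  have "bdd_below (beltrami_bounds U h)" by (rule bdd_belowI[of _ 0]) (simp add: beltrami_bounds_def)
  then show "beltrami_norm U h \<le> k" unfolding beltrami_norm_def using assms by (rule cInf_lower[rotated])
  show "0 \<le> beltrami_norm U h" unfolding beltrami_norm_def
    by (rule cInf_greatest) (use assms in \<open>auto simp: beltrami_bounds_def\<close>)
qed

lemma dilatation_mono_iff:
  fixes k e :: real
  assumes "k < 1" "e < 1"
  shows "(1 + k) / (1 - k) \<le> (1 + e) / (1 - e) \<longleftrightarrow> k \<le> e" "(1 + k) / (1 - k) < (1 + e) / (1 - e) \<longleftrightarrow> k < e"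
  using assms by (simp_all add: divide_simps algebra_simps)

lemma boundary_dilatation_ge_1: "1 \<le> boundary_dilatation h"
  unfolding boundary_dilatation_def
proof (rule Inf_greatest)
  fix B assume "B \<in> {ereal ((1 + k) / (1 - k)) | U h' k. open U \<and> circle \<subseteq> U \<and> quasiconformal_on U h' \<and> (\<forall>z\<in>circle. h' z = h z) \<and> k = beltrami_norm U h'}"
  then obtain U h' where B: "B = ereal ((1 + beltrami_norm U h') / (1 - beltrami_norm U h'))" "quasiconformal_on U h'" by blast
  then obtain k where "k \<in> beltrami_bounds U h'" "k < 1" unfolding quasiconformal_on_def by blast
  with beltrami_norm_bounds[of k U h'] have "0 \<le> beltrami_norm U h'" "beltrami_norm U h' < 1" by auto
  then show "1 \<le> B" unfolding B(1) one_ereal_def by (simp add: divide_simps)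
qed

lemma boundary_dilatation_C1:
  assumes hom: "homeomorphism UNIV UNIV \<Phi> \<Psi>"
    and deriv: "\<And>x. (\<Phi> has_real_derivative P x) (at x)" and cont: "continuous_on UNIV P" and pos: "\<And>x. P x > 0"
    and per: "\<And>x n. \<Phi> (x + of_int n) = \<Phi> x + of_int n"
    and h: "\<And>x. h (cis (2 * pi * x)) = cis (2 * pi * \<Phi> x)"
  shows "boundary_dilatation h = 1"
proof (rule antisym)
  have "boundary_dilatation h \<le> 1 + ereal \<epsilon>" if "\<epsilon> > 0" for \<epsilon>
  proof -
    define e where "e = \<epsilon> / (2 + \<epsilon>)"
    have e: "0 < e" "e < 1" using that by (auto simp: e_def)
    have e1: "(1 + e) / (1 - e) = 1 + \<epsilon>" using that by (simp add: e_def divide_simps)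
    obtain U where U: "open U" "circle \<subseteq> U" "quasiconformal_on U (annulus_map \<Phi>)" "e \<in> beltrami_bounds U (annulus_map \<Phi>)"
      using quasiconformal_annulus_map[OF hom deriv cont pos per e] by blast
    have h': "\<forall>z\<in>circle. annulus_map \<Phi> z = h z"
    proof
      fix z :: complex assume "z \<in> circle"
      then obtain x where "z = cis (2 * pi * x)" using circle_cis by blast
      then show "annulus_map \<Phi> z = h z" by (simp only: annulus_map_circle[OF per] h)
    qed
    have "boundary_dilatation h \<le> ereal ((1 + beltrami_norm U (annulus_map \<Phi>)) / (1 - beltrami_norm U (annulus_map \<Phi>)))"
      unfolding boundary_dilatation_def
      by (intro Inf_lower CollectI exI[of _ U] exI[of _ "annulus_map \<Phi>"] exI[of _ "beltrami_norm U (annulus_map \<Phi>)"] conjI refl U(1,2,3) h')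
    also have "\<dots> \<le> ereal ((1 + e) / (1 - e))"
      using beltrami_norm_bounds[OF U(4)] e by (simp add: dilatation_mono_iff)
    finally show ?thesis unfolding e1 by (simp add: one_ereal_def)
  qed
  then show "boundary_dilatation h \<le> 1" by (rule ereal_le_epsilon2)
qed (rule boundary_dilatation_ge_1)

text \<open>Two infima are unwound, one over extensions and one over essential bounds; the second
  provides an admissible bound \<open>k\<close> in place of the norm.\<close>

lemma extension_of_boundary_dilatation_1:
  assumes "boundary_dilatation h = 1" and "e > 0"
  shows "\<exists>U h' hi k. open U \<and> circle \<subseteq> U \<and> homeomorphism U (h' ` U) h' hi \<and> ACL_on U h' \<and>
    k \<in> beltrami_bounds U h' \<and> k < e \<and> (\<forall>z\<in>circle. h' z = h z)"
proof -
  define e' where "e' = min e (1 / 2)"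
  have e': "0 < e'" "e' < 1" "e' \<le> e" using assms(2) by (auto simp: e'_def)
  have "(1 + e') / (1 - e') > 1" using e' by (simp add: divide_simps)
  then have "boundary_dilatation h < ereal ((1 + e') / (1 - e'))" unfolding assms(1) by (simp add: one_ereal_def)
  then obtain U h' where U: "open U" "circle \<subseteq> U" "quasiconformal_on U h'" "\<forall>z\<in>circle. h' z = h z"
    and B: "(1 + beltrami_norm U h') / (1 - beltrami_norm U h') < (1 + e') / (1 - e')"
    unfolding boundary_dilatation_def Inf_less_iff by auto
  obtain hi k where q: "homeomorphism U (h' ` U) h' hi" "ACL_on U h'" "k \<in> beltrami_bounds U h'" "k < 1"
    using U(3) unfolding quasiconformal_on_def by blast
  have "beltrami_norm U h' < e'"
    using B beltrami_norm_bounds[OF q(3)] q(4) e' by (simp add: dilatation_mono_iff)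
  then obtain k' where "k' \<in> beltrami_bounds U h'" "k' < e'"
    unfolding beltrami_norm_def using cInf_lessD[of "beltrami_bounds U h'" e'] q(3) by blast
  then show ?thesis using U q e' by (intro exI[of _ U] exI[of _ h'] exI[of _ hi] exI[of _ k']) auto
qed

subsection \<open>Comparison of markings\<close>

text \<open>A chord is compared with its arc, which lets Lipschitz bounds pass from a circle map to
  its lift. The restriction on \<open>a - b\<close> excludes points that are close on the circle but
  far apart on the line.\<close>

lemma norm_cis_diff_ge:
  assumes "\<bar>a - b\<bar> \<le> 1 / 2"
  shows "\<bar>a - b\<bar> \<le> norm (cis (2 * pi * a) - cis (2 * pi * b))"
proof -
  define s where "s = pi * \<bar>a - b\<bar> / 2"
  have "pi * \<bar>a - b\<bar> \<le> pi * (1 / 2)" using assms by (intro mult_left_mono) auto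
  then have s: "0 \<le> s" "s \<le> pi / 4" by (auto simp: s_def)
  have c: "cos t \<ge> 1 / 2" if "0 \<le> t" "t \<le> s" for t
  proof -
    have "cos (pi / 3) \<le> cos t" using that s pi_gt_zero by (intro cos_monotone_0_pi_le) linarith+
    then show ?thesis by (simp add: cos_60)
  qed
  have "s / 2 \<le> sin s"
  proof (cases "s = 0")
    case False
    then have "0 < s" using s by simp
    from MVT2[OF this, of sin cos] obtain t where "0 < t" "t < s" "sin s - sin 0 = (s - 0) * cos t" by auto
    then show ?thesis using c[of t] \<open>0 < s\<close> by simp
  qed simp
  then have "s / 2 * (1 / 2) \<le> sin s * cos s" using s c[of s] by (intro mult_mono) auto
  then have "s / 2 \<le> sin (2 * s)" by (simp add: sin_double)
  also have "2 * s = pi * \<bar>a - b\<bar>" by (simp add: s_def)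
  also have "sin (pi * \<bar>a - b\<bar>) \<le> \<bar>sin (2 * pi * (a - b) / 2)\<bar>"
  proof (cases "0 \<le> a - b")
    case False
    then have "pi * \<bar>a - b\<bar> = - (pi * (a - b))" by (simp add: right_diff_distrib)
    then show ?thesis by (simp only: sin_minus) simp
  qed simp
  finally have "s / 2 \<le> \<bar>sin (2 * pi * (a - b) / 2)\<bar>" .
  moreover have "norm (cis (2 * pi * a) - cis (2 * pi * b)) = 2 * \<bar>sin (2 * pi * (a - b) / 2)\<bar>"
  proof -
    have "cis (2 * pi * a) - cis (2 * pi * b) = cis (2 * pi * b) * (cis (2 * pi * (a - b)) - 1)"
      by (simp add: right_diff_distrib cis_mult)
    then show ?thesis using dist_exp_i_1[of "2 * pi * (a - b)"] by (simp add: norm_mult cis_conv_exp)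
  qed
  ultimately have le: "pi / 2 * \<bar>a - b\<bar> \<le> norm (cis (2 * pi * a) - cis (2 * pi * b))" by (simp add: s_def)
  have "1 * \<bar>a - b\<bar> \<le> pi / 2 * \<bar>a - b\<bar>" using pi_ge_two by (intro mult_right_mono) auto
  then have "\<bar>a - b\<bar> \<le> pi / 2 * \<bar>a - b\<bar>" by simp
  then show ?thesis using le by (rule order_trans)
qed

lemma inv_into_circle_map:
  assumes "homeomorphism UNIV UNIV H G" "\<And>x. H (x + 1) = H x + 1"
  shows "inv_into circle (circle_map H) (cis (2 * pi * x)) = cis (2 * pi * G x)"
proof -
  have inv: "H (G x) = x" for x using assms(1) by (simp add: homeomorphism_def)
  have "inj_on (circle_map H) circle"
    using oriented_circle_map(3)[OF assms] by (meson homeomorphism_def inj_on_inverseI)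
  moreover have "circle_map H (cis (2 * pi * G x)) = cis (2 * pi * x)" by (simp only: circle_map_cis[of H, OF assms(2)] inv)
  ultimately show ?thesis by (intro inv_into_f_eq) auto
qed

lemma C1_circle_mapI:
  assumes \<phi>: "\<And>x. \<phi> (cis (2 * pi * x)) = cis (2 * pi * \<Phi> x)"
    and P: "\<And>x. (\<Phi> has_real_derivative P x) (at x)" "continuous_on UNIV P"
  shows "C1_circle_map \<phi>"
proof -
  have c\<Phi>: "continuous_on UNIV \<Phi>" using P(1) by (meson DERIV_isCont continuous_at_imp_continuous_on)
  have "\<phi> ` circle \<subseteq> circle"
  proof
    fix z assume "z \<in> \<phi> ` circle"
    then obtain x where "z = \<phi> (cis (2 * pi * x))" using circle_cis by blast
    then show "z \<in> circle" by (simp add: \<phi>)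
  qed
  moreover have "((\<lambda>x. cis (2 * pi * \<Phi> x)) has_vector_derivative of_real (2 * pi * P x) * (\<i> * cis (2 * pi * \<Phi> x))) (at x)" for x
  proof -
    have "((\<lambda>z. exp (\<i> * z)) has_field_derivative \<i> * exp (\<i> * of_real (2 * pi * \<Phi> x))) (at (of_real (2 * pi * \<Phi> x)))"
      by (rule derivative_eq_intros refl | simp)+
    moreover have "((\<lambda>x. complex_of_real (2 * pi * \<Phi> x)) has_vector_derivative of_real (2 * pi * P x)) (at x)"
      by (intro has_vector_derivative_of_real) (auto intro!: derivative_eq_intros P simp flip: has_real_derivative_iff_has_vector_derivative)
    ultimately show ?thesis using field_vector_diff_chain_at[of "\<lambda>x. complex_of_real (2 * pi * \<Phi> x)"]
      by (simp add: cis_conv_exp o_def)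
  qed
  moreover have "continuous_on UNIV (\<lambda>x. of_real (2 * pi * P x) * (\<i> * cis (2 * pi * \<Phi> x)))"
    by (intro continuous_intros P(2) c\<Phi>)
  ultimately show ?thesis unfolding C1_circle_map_def C1_differentiable_on_def \<phi>
    by (intro conjI exI[of _ "\<lambda>x. of_real (2 * pi * P x) * (\<i> * cis (2 * pi * \<Phi> x))"] ballI)
qed

lemma circle_map_ext:
  assumes "\<phi> \<in> extensional circle" "\<And>x. \<phi> (cis (2 * pi * x)) = cis (2 * pi * \<Phi> x)"
    and per: "\<And>x. \<Phi> (x + 1) = \<Phi> x + 1"
  shows "\<phi> = circle_map \<Phi>"
proof (rule extensionalityI[OF assms(1)])
  show "circle_map \<Phi> \<in> extensional circle" by (simp add: circle_map_def)
  fix z assume "z \<in> circle"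
  then obtain x where "z = cis (2 * pi * x)" using circle_cis by blast
  then show "\<phi> z = circle_map \<Phi> z" by (simp only: assms(2) circle_map_cis[of \<Phi>, OF per])
qed

context lift_pair
begin

lemma transition_homeomorphism: "homeomorphism UNIV UNIV (\<lambda>x. f.H (g.G x)) (\<lambda>x. g.H (f.G x))"
  using homeomorphism_compose[OF homeomorphism_symD[OF g.homeomorphism_H] f.homeomorphism_H] by (simp add: o_def)

lemma transition_add_int: "f.H (g.G (x + of_int n)) = f.H (g.G x) + of_int n"
  by (simp only: g.G_add_int f.H_add_int)

lemma transition_per: "f.H (g.G (x + 1)) = f.H (g.G x) + 1"
  using transition_add_int[of x 1] by simp

text \<open>A C^1 circle map is Lipschitz, and so is its lift. As the lift takes the word intervals
  of \<open>g\<close> to those of \<open>f\<close>, the Lipschitz constant bounds the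
  quotients.\<close>

lemma quot_bounded_of_C1:
  assumes "C1_circle_map (circle_map (\<lambda>x. f.H (g.G x)))"
  shows "\<exists>M. \<forall>n m. quot n m \<le> M"
proof -
  define \<Phi> where "\<Phi> x = f.H (g.G x)" for x
  have per: "\<Phi> (x + 1) = \<Phi> x + 1" for x unfolding \<Phi>_def by (rule transition_per)
  have "(\<lambda>x. cis (2 * pi * \<Phi> x)) C1_differentiable_on UNIV"
    using assms unfolding C1_circle_map_def \<Phi>_def[symmetric] circle_map_cis[of \<Phi>, OF per] by blast
  then obtain D where D: "\<And>x. ((\<lambda>x. cis (2 * pi * \<Phi> x)) has_vector_derivative D x) (at x)" "continuous_on UNIV D"
    unfolding C1_differentiable_on_def by blast
  have "bounded (D ` {0..1})"
    by (intro compact_imp_bounded compact_continuous_image continuous_on_subset[OF D(2)]) auto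
  then obtain B where B: "B > 0" "\<And>x. x \<in> {0..1} \<Longrightarrow> norm (D x) \<le> B" unfolding bounded_pos by auto
  have lip: "norm (cis (2 * pi * \<Phi> s) - cis (2 * pi * \<Phi> r)) \<le> B * norm (s - r)" if "r \<in> {0..1}" "s \<in> {0..1}" for r s
  proof (rule differentiable_bound[where S="{0..1}" and f'="\<lambda>x t. t *\<^sub>R D x"])
    show "((\<lambda>x. cis (2 * pi * \<Phi> x)) has_derivative (\<lambda>t. t *\<^sub>R D x)) (at x within {0..1})" for x
      using D(1)[of x] unfolding has_vector_derivative_def by (rule has_derivative_at_withinI)
    show "onorm (\<lambda>t. t *\<^sub>R D x) \<le> B" if "x \<in> {0..1}" for x
      by (rule onorm_le) (use mult_left_mono[OF B(2)[OF that] abs_ge_zero] in \<open>simp add: mult.commute\<close>)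
  qed (use that in auto)
  have mono: "\<Phi> r \<le> \<Phi> s" if "r \<le> s" for r s
    using that g.strict_mono_G f.strict_mono_H by (simp add: \<Phi>_def strict_mono_less_eq)
  have \<Phi>01: "\<Phi> 0 = 0" "\<Phi> 1 = 1" using per[of 0] by (simp_all add: \<Phi>_def g.G_0 f.H_0)
  have grow: "\<Phi> s - \<Phi> r \<le> B * (s - r)" if rs: "0 \<le> r" "r \<le> s" "s \<le> 1" for r s
  proof -
    \<comment> \<open>The point whose image bisects the image interval: each half then has length at
      most 1/2, as the comparison of chord and arc requires.\<close>
    define t where "t = g.H (f.G ((\<Phi> r + \<Phi> s) / 2))"
    have t: "\<Phi> t = (\<Phi> r + \<Phi> s) / 2" by (simp add: t_def \<Phi>_def)
    have rt: "r \<le> t" "t \<le> s"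
    proof -
      have "r = g.H (f.G (\<Phi> r))" "s = g.H (f.G (\<Phi> s))" by (simp_all add: \<Phi>_def)
      moreover have "g.H (f.G a) \<le> g.H (f.G b)" if "a \<le> b" for a b
        using that f.strict_mono_G g.strict_mono_H by (simp add: strict_mono_less_eq)
      ultimately show "r \<le> t" "t \<le> s" using mono[OF rs(2)] unfolding t_def by (metis field_sum_of_halves add_mono divide_right_mono add_divide_distrib order_refl zero_le_numeral)+
    qed
    have h: "\<bar>\<Phi> t - \<Phi> r\<bar> \<le> 1 / 2" "\<bar>\<Phi> s - \<Phi> t\<bar> \<le> 1 / 2"
      using mono[OF rs(1)] mono[OF rs(2)] mono[OF rs(3)] \<Phi>01 unfolding t by (auto simp: abs_le_iff field_simps)
    have "\<bar>\<Phi> t - \<Phi> r\<bar> \<le> B * norm (t - r)" "\<bar>\<Phi> s - \<Phi> t\<bar> \<le> B * norm (s - t)"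
      using norm_cis_diff_ge[OF h(1)] norm_cis_diff_ge[OF h(2)] lip[of r t] lip[of t s] rt rs by auto
    then show ?thesis using rt by (simp add: right_diff_distrib)
  qed
  have "quot n m \<le> B" for n m
  proof -
    define v where "v = m mod int d ^ n"
    have dp: "real d ^ n > 0" using f.d by simp
    have v: "0 \<le> v" "v < int d ^ n" using f.d by (auto simp: v_def)
    then have "v + 1 \<le> int d ^ n" by simp
    then have "real_of_int (v + 1) \<le> real_of_int (int d ^ n)" unfolding of_int_le_iff .
    then have r: "0 \<le> of_int v / real d ^ n" "of_int (v + 1) / real d ^ n \<le> 1" using v dp by simp_all
    have le: "of_int v / real d ^ n \<le> of_int (v + 1) / real d ^ n" using dp by (intro divide_right_mono) auto
    have gm: "g.H a \<le> g.H b" if "a \<le> b" for a b using that g.strict_mono_H by (simp add: strict_mono_less_eq)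
    have H1: "g.H 1 = 1" using g.H_per[of 0] g.H_0 by simp
    have "\<Phi> (g.H (of_int (v + 1) / real d ^ n)) - \<Phi> (g.H (of_int v / real d ^ n)) \<le> B * (g.H (of_int (v + 1) / real d ^ n) - g.H (of_int v / real d ^ n))"
      by (rule grow) (use gm[OF r(1)] gm[OF r(2)] gm[OF le] g.H_0 H1 in auto)
    then have "f.len n v \<le> B * g.len n v" by (simp add: \<Phi>_def f.len_def g.len_def)
    then have "quot n v \<le> B" using g.len_pos[of n v] by (simp add: quot_def pos_divide_le_eq)
    then show ?thesis using quot_periodic[of n v "m div int d ^ n"] by (simp add: v_def mod_div_mult_eq)
  qed
  then show ?thesis by blast
qed

lemma dual_log_eq_of_dilatation:
  assumes "boundary_dilatation (circle_map (\<lambda>x. f.H (g.G x))) = 1" and j: "j \<in> dual_sequences d"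
  shows "f.dual_log j = g.dual_log j"
proof (rule dual_log_eq_of_bounded[OF _ j], rule quot_bounded_of_Holder, rule Holder_of_small_dilatation)
  show "\<exists>U h hi k. open U \<and> circle \<subseteq> U \<and> homeomorphism U (h ` U) h hi \<and> ACL_on U h \<and>
        k \<in> beltrami_bounds U h \<and> k < e \<and> (\<forall>x. h (cis (2 * pi * x)) = cis (2 * pi * f.H (g.G x)))" if "e > 0" for e
  proof -
    from extension_of_boundary_dilatation_1[OF assms(1) that] obtain U h hi k where U: "open U" "circle \<subseteq> U" "homeomorphism U (h ` U) h hi" "ACL_on U h"
      "k \<in> beltrami_bounds U h" "k < e" and h: "\<forall>z\<in>circle. h z = circle_map (\<lambda>x. f.H (g.G x)) z" by blast
    have "h (cis (2 * pi * x)) = cis (2 * pi * f.H (g.G x))" for x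
      using h circle_map_cis[of "\<lambda>x. f.H (g.G x)", OF transition_per] by simp
    then show ?thesis using U by blast
  qed
  show "strict_mono (\<lambda>x. f.H (g.G x))"
    using strict_monoD[OF f.strict_mono_H] strict_monoD[OF g.strict_mono_G] by (intro strict_monoI) blast
  show "continuous_on UNIV (\<lambda>x. f.H (g.G x))" using transition_homeomorphism by (simp add: homeomorphism_def)
qed auto

end

lemma C1plus_expanding_lift:
  assumes "d \<ge> 2" "f \<in> C1plus d"
  shows "\<exists>\<alpha> L c r. expanding_lift d (lift_of d f) \<alpha> L c r" "f (cis (2 * pi * x)) = cis (2 * pi * lift_of d f x)"
proof -
  have ce: "circle_endomorphism d f" using assms by (simp add: C1plus_def)
  show "f (cis (2 * pi * x)) = cis (2 * pi * lift_of d f x)" by (rule circle_liftD(4)[OF lift_of_props(1)[OF ce]])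
  obtain \<alpha> L where \<alpha>: "0 < \<alpha>" "\<And>x. lift_of d f differentiable at x"
    "\<And>x y. \<bar>deriv (lift_of d f) x - deriv (lift_of d f) y\<bar> \<le> L * \<bar>x - y\<bar> powr \<alpha>"
    using assms(2) unfolding C1plus_def C1_Holder_def by blast
  obtain c r where c: "c > 0" "r > 1" "\<And>n x. n \<ge> 1 \<Longrightarrow> deriv (lift_of d f ^^ n) x \<ge> c * r ^ n"
    using assms(2) unfolding C1plus_def expanding_def by blast
  have "expanding_lift d (lift_of d f) \<alpha> L c r"
    using assms(1) lift_of_props(2)[OF ce] circle_liftD(3)[OF lift_of_props(1)[OF ce]] \<alpha> c
    by unfold_locales auto
  then show "\<exists>\<alpha> L c r. expanding_lift d (lift_of d f) \<alpha> L c r" by blast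
qed

text \<open>A C^1 transition map and boundary dilatation 1 both yield bounded quotients and hence
  equal dual derivatives; equal dual derivatives give back both properties through a C^1 transition
  map with positive derivative.\<close>

lemma teich_equiv_iff:
  assumes d: "d \<ge> 2" and fg: "f \<in> C1plus d" "g \<in> C1plus d"
  shows "teich_equiv (f, marking d f) (g, marking d g) \<longleftrightarrow> dual_derivative d f = dual_derivative d g" (is "?T \<longleftrightarrow> ?D")
    "boundary_dilatation (transition (f, marking d f) (g, marking d g)) = 1 \<longleftrightarrow> dual_derivative d f = dual_derivative d g"
      (is "?B \<longleftrightarrow> ?D")
proof -
  obtain \<alpha>f Lf cf rf where Ff: "expanding_lift d (lift_of d f) \<alpha>f Lf cf rf" using C1plus_expanding_lift(1)[OF d fg(1)] by blast
  obtain \<alpha>g Lg cg rg where Fg: "expanding_lift d (lift_of d g) \<alpha>g Lg cg rg" using C1plus_expanding_lift(1)[OF d fg(2)] by blast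
  interpret p: lift_pair d "lift_of d f" \<alpha>f Lf cf rf "lift_of d g" \<alpha>g Lg cg rg
    using Ff Fg by (rule lift_pair.intro)
  \<comment> \<open>The pair in reverse order serves for the inverse of the transition map, which
    has to be C^1 as well.\<close>
  interpret q: lift_pair d "lift_of d g" \<alpha>g Lg cg rg "lift_of d f" \<alpha>f Lf cf rf
    using Fg Ff by (rule lift_pair.intro)
  define \<Phi> where "\<Phi> x = p.f.H (p.g.G x)" for x
  define \<Psi> where "\<Psi> x = p.g.H (p.f.G x)" for x
  have mf: "marking d f = circle_map p.f.H" by (rule p.f.marking_eq[OF C1plus_expanding_lift(2)[OF d fg(1)]])
  have mg: "marking d g = circle_map p.g.H" by (rule p.g.marking_eq[OF C1plus_expanding_lift(2)[OF d fg(2)]])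
  have tr: "transition (f, marking d f) (g, marking d g) = circle_map \<Phi>"
  proof (rule circle_map_ext)
    show "transition (f, marking d f) (g, marking d g) \<in> extensional circle"
      unfolding transition_def by (rule compose_extensional)
    show "transition (f, marking d f) (g, marking d g) (cis (2 * pi * x)) = cis (2 * pi * \<Phi> x)" for x
      using circle_map_cis[of p.f.H, OF p.f.H_per, of "p.g.G x"]
      by (simp add: transition_def compose_def mf mg inv_into_circle_map[OF p.g.homeomorphism_H p.g.H_per] \<Phi>_def)
    show "\<Phi> (x + 1) = \<Phi> x + 1" for x unfolding \<Phi>_def by (rule p.transition_per)
  qed
  have hom: "homeomorphism UNIV UNIV \<Phi> \<Psi>" unfolding \<Phi>_def \<Psi>_def by (rule p.transition_homeomorphism)
  have per: "\<Phi> (x + 1) = \<Phi> x + 1" for x unfolding \<Phi>_def by (rule p.transition_per)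
  have D: "?D \<longleftrightarrow> (\<forall>j\<in>dual_sequences d. p.f.dual_log j = p.g.dual_log j)"
  proof
    assume ?D
    then show "\<forall>j\<in>dual_sequences d. p.f.dual_log j = p.g.dual_log j"
      using p.f.dual_derivative_eq[OF refl] p.g.dual_derivative_eq[OF refl] by (metis exp_inj_iff neg_equal_iff_equal)
  next
    assume *: "\<forall>j\<in>dual_sequences d. p.f.dual_log j = p.g.dual_log j"
    show ?D
    proof (rule extensionalityI[where A="dual_sequences d"])
      show "dual_derivative d f \<in> extensional (dual_sequences d)" "dual_derivative d g \<in> extensional (dual_sequences d)"
        by (simp_all add: dual_derivative_def)
      fix j assume "j \<in> dual_sequences d"
      then show "dual_derivative d f j = dual_derivative d g j"
        using * p.f.dual_derivative_eq[OF refl] p.g.dual_derivative_eq[OF refl] by simp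
    qed
  qed
  show "?T \<longleftrightarrow> ?D"
  proof
    assume ?T
    then have "C1_circle_map (circle_map \<Phi>)" by (simp add: teich_equiv_def C1_circle_diffeo_def tr)
    then obtain M where "\<And>n m. p.quot n m \<le> M" using p.quot_bounded_of_C1 unfolding \<Phi>_def by blast
    then show ?D unfolding D using p.dual_log_eq_of_bounded by blast
  next
    assume ?D
    then have eq: "\<And>j. j \<in> dual_sequences d \<Longrightarrow> p.f.dual_log j = p.g.dual_log j" unfolding D by blast
    obtain P where P: "\<And>x. (\<Phi> has_real_derivative P x) (at x)" "continuous_on UNIV P"
      using p.transition_C1[OF eq] unfolding \<Phi>_def by blast
    obtain Q where Q: "\<And>x. (\<Psi> has_real_derivative Q x) (at x)" "continuous_on UNIV Q"
      using q.transition_C1[OF eq[symmetric]] unfolding \<Psi>_def by blast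
    have "bij_betw (circle_map \<Phi>) circle circle"
      using oriented_circle_map(3)[OF hom per] unfolding homeomorphism_def
      by (elim conjE, intro bij_betw_byWitness[where f'="circle_map \<Psi>"]) (assumption | simp only: order_refl)+
    moreover have "C1_circle_map (circle_map \<Phi>)" by (rule C1_circle_mapI[OF circle_map_cis[of \<Phi>, OF per] P])
    moreover have "C1_circle_map (inv_into circle (circle_map \<Phi>))" by (rule C1_circle_mapI[OF inv_into_circle_map[OF hom per] Q])
    ultimately show ?T by (simp add: teich_equiv_def C1_circle_diffeo_def tr)
  qed
  show "?B \<longleftrightarrow> ?D"
  proof
    assume ?B
    then show ?D unfolding D tr using p.dual_log_eq_of_dilatation unfolding \<Phi>_def[symmetric] by blast
  next
    assume ?D
    then have eq: "\<And>j. j \<in> dual_sequences d \<Longrightarrow> p.f.dual_log j = p.g.dual_log j" unfolding D by blast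
    obtain P where P: "\<And>x. (\<Phi> has_real_derivative P x) (at x)" "continuous_on UNIV P" "\<And>x. P x > 0"
      using p.transition_C1[OF eq] unfolding \<Phi>_def by blast
    show ?B unfolding tr
      by (rule boundary_dilatation_C1[OF hom P _ circle_map_cis[of \<Phi>, OF per]]) (simp only: \<Phi>_def p.transition_add_int)
  qed
qed

lemma half_log_eq_0:
  assumes "1 \<le> B"
  shows "half_log B = 0 \<longleftrightarrow> B = 1"
proof (cases B)
  case (real r)
  then have "r \<ge> 1" using assms by simp
  then show ?thesis using real by (simp add: half_log_def one_ereal_def zero_ereal_def)
qed (use assms in \<open>auto simp: half_log_def one_ereal_def\<close>)

theorem theorem6:
  fixes d :: nat
  assumes "d \<ge> 2"
  shows "(\<forall>f\<in>C1plus d. \<forall>g\<in>C1plus d.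
            teich_equiv (f, marking d f) (g, marking d g) \<longleftrightarrow>
            dual_derivative d f = dual_derivative d g) \<and>
         (\<forall>P\<in>TC1plus d. \<forall>Q\<in>TC1plus d. teich_dist P Q = 0 \<longleftrightarrow> P = Q)"
proof (intro conjI ballI)
  fix f g assume "f \<in> C1plus d" "g \<in> C1plus d"
  then show "teich_equiv (f, marking d f) (g, marking d g) \<longleftrightarrow> dual_derivative d f = dual_derivative d g"
    by (rule teich_equiv_iff(1)[OF assms])
next
  fix P Q assume PQ: "P \<in> TC1plus d" "Q \<in> TC1plus d"
  define R where "R = {(p, q). p \<in> marked_maps d \<and> q \<in> marked_maps d \<and> teich_equiv p q}"
  \<comment> \<open>Described by equality of dual derivatives, the relation is visibly an
    equivalence.\<close>
  have R: "(p, q) \<in> R \<longleftrightarrow> p \<in> marked_maps d \<and> q \<in> marked_maps d \<and> dual_derivative d (fst p) = dual_derivative d (fst q)" for p q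
    using teich_equiv_iff(1)[OF assms] by (fastforce simp: R_def marked_maps_def)
  then have eqv: "equiv (marked_maps d) R"
    by (intro equivI refl_onI symI transI) auto
  have PQ': "P \<in> marked_maps d // R" "Q \<in> marked_maps d // R" using PQ by (simp_all add: TC1plus_def R_def)
  \<comment> \<open>The representatives at which the distance is evaluated. All members of a class
    have the same dual derivative, so the choice does not affect whether the distance is 0.\<close>
  define p q where "p = (SOME p. p \<in> P)" and "q = (SOME q. q \<in> Q)"
  have pq: "p \<in> P" "q \<in> Q"
    using in_quotient_imp_non_empty[OF eqv PQ'(1)] in_quotient_imp_non_empty[OF eqv PQ'(2)]
    by (auto simp: p_def q_def some_in_eq)
  have pqm: "p \<in> marked_maps d" "q \<in> marked_maps d"
    using in_quotient_imp_subset[OF eqv PQ'(1)] in_quotient_imp_subset[OF eqv PQ'(2)] pq by auto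
  then obtain f g where fg: "p = (f, marking d f)" "q = (g, marking d g)" "f \<in> C1plus d" "g \<in> C1plus d"
    by (auto simp: marked_maps_def)
  have "teich_dist P Q = 0 \<longleftrightarrow> boundary_dilatation (transition p q) = 1"
    unfolding teich_dist_def p_def[symmetric] q_def[symmetric] by (rule half_log_eq_0[OF boundary_dilatation_ge_1])
  also have "\<dots> \<longleftrightarrow> dual_derivative d f = dual_derivative d g"
    unfolding fg by (rule teich_equiv_iff(2)[OF assms fg(3,4)])
  also have "\<dots> \<longleftrightarrow> (p, q) \<in> R" using R[of p q] pqm by (simp add: fg)
  also have "\<dots> \<longleftrightarrow> P = Q" by (rule quotient_eq_iff[OF eqv PQ' pq, symmetric])
  finally show "teich_dist P Q = 0 \<longleftrightarrow> P = Q" .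
qed

end
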